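(* Work in the setting of the context (in particular $R_0=\infty$, and $X$, $\widehat X$ are conservative). Let $z_0\in\mathfrak X$ and suppose that, in addition to (A), (B), (C), the assumptions (V1), (V2), ($\Phi$), (B2-a), (B2-b), (C2), (D2) listed in the context hold for $z_0$ and some $r_0>0$. Then for any $a\in(1,2)$ there exists $C_1=C_1(z_0,a)>1$ such that for any $r\ge r_0$, any open set $D\subset \overline{B}(z_0,r)^c$ and any non-negative function $u$ on $\mathfrak X$ which is regular harmonic with respect to $X$ in $D$ and vanishes on $\overline{B}(z_0,r)^c\cap\left(\overline{D}^c\cup D^{\mathrm{reg}}\right)$, it holds that $$C_1^{-1}P_{D}(x,z_0) \int_{B(z_0,2ar)}u(z)\, m(dz) \le u(x) \le C_1 P_{D}(x,z_0) \int_{B(z_0, 2ar)}u(z)\, m(dz)$$ for all $x\in D\cap \overline{B}(z_0,8r)^c$.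
   Context: **Space.** $(\mathfrak X,d)$ is a metric space in which all bounded closed sets are compact; $m$ is a $\sigma$-finite measure on $\mathfrak X$ with full support. The localization radius $R_0\in(0,\infty]$ is such that $\mathfrak X\setminus B(x,2r)\ne\emptyset$ for all $x\in\mathfrak X$ and $r<R_0$. $B(x,r)$ is the open ball and $\overline B(x,r)$ its closure; $A(x,r,R)=\{y: r<d(x,y)<R\}$ and $\overline A(x,r,R)$ is its closure; complements are in $\mathfrak X$. $C_0(\mathfrak X)$ is the space of bounded continuous functions vanishing at infinity. **Process.** $X=(X_t,\mathbb P_x)$ is a Markov process on $\mathfrak X$ with semigroup $(P_t)$, cemetery $\partial$, lifetime $\zeta$; conventions $X_\zeta=\partial$ and $u(\partial)=0$ for every function $u$. For open $D$, $\tau_D=\inf\{t>0: X_t\notin D\}$. Objects for the dual process carry a hat. (A) $X$ is a Hunt process admitting a strong dual $\widehat X$ with respect to $m$, and $\widehat X$ is also a Hunt process. The semigroups $(P_t)$, $(\widehat P_t)$ are both Feller and strongly Feller. Every semi-polar set of $X$ is polar. Under (A), for open $D$ the process $X$ killed on exiting $D$ has a unique (possibly infinite) Green function $G_D(x,y)$ with $\mathbb E_x\int_0^{\tau_D}f(X_t)dt=\int_D f(y)G_D(x,y)m(dy)$ for non-negative Borel $f$, and $G_D(x,y)=\widehat G_D(y,x)$. $D$ is Greenian if $G_D(x,y)<\infty$ for all $x,y\in D$, $x\ne y$. $\mathcal A$, $\widehat{\mathcal A}$ are the generators of $(P_t)$, $(\widehat P_t)$ in $C_0(\mathfrak X)$.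 (B) There is a linear subspace $\mathcal D$ of $\mathcal D(\mathcal A)\cap\mathcal D(\widehat{\mathcal A})$ such that for any compact $K$ and open $D$ with $K\subset D\subset\mathfrak X$, the collection $\mathcal D(K,D)$ of all $f\in\mathcal D$ with $f=1$ on $K$, $f=0$ on $\mathfrak X\setminus D$, $0\le f\le1$ on $\mathfrak X$, and $m(\partial\{f>0\})=0$, is nonempty. Under (B) the jumps of $X$ are described by a Lévy kernel $J$ (with $J(x,\{x\})=0$) satisfying $\int f(y)J(x,dy)=\lim_{t\downarrow0}\mathbb E_xf(X_t)/t$ for bounded continuous $f$ and $x\notin\mathrm{supp} f$; $\widehat J$ is defined similarly. (C) The Lévy kernels of $X$ and $\widehat X$ are $j(x,y)m(dy)$ and $\widehat j(x,y)m(dy)$, with $j(x,y)=\widehat j(y,x)>0$ for all $x\ne y$. **Poisson kernel.** For open $D$: $P_D(x,z)=\int_D G_D(x,y)j(y,z)\,m(dy)$, $x\in D$, $z\in D^c$. **Harmonicity.** A non-negative $u$ is regular harmonic in open $D$ with respect to $X$ if $u(x)=\mathbb E_x(u(X_{\tau_D}))$ for all $x\in D$. $D^{\mathrm{reg}}$ is the set of $x\in\partial D$ with $\mathbb P_x(\tau_D=0)=1$. **Standing assumptions at infinity.** $R_0=\infty$; $X$ and $\widehat X$ are conservative: $P_t1=\widehat P_t1=1$ for all $t\ge0$. $C_\infty(\mathfrak X)$ is the Banach space of continuous functions on $\mathfrak X$ having a limit at infinity; $\mathcal A,\widehat{\mathcal A}$ also denote the generators in $C_\infty(\mathfrak X)$.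 Put $V(r)=m(B(z_0,r))$. (V1) There is $c>1$ with $V(2r)\le cV(r)$ for all $r>0$. (V2) There are $c>1$ and $n_0\in\mathbb N$, $n_0\ge2$, with $V(n_0r)\ge cV(r)$ for all $r\ge r_0$. ($\Phi$) There is a non-decreasing function $\Phi:[0,\infty)\to[0,\infty)$ and $c>1$ with $\Phi(2r)\le c\,\Phi(r)$ for all $r>0$. (B2-a) For any $a\in(1,2]$ there is $c=c(z_0,a)$ such that for any $r\ge r_0$, $\inf_{f\in\mathcal D(\overline B(z_0,r),B(z_0,ar))}\sup_{x\in\mathfrak X}\max(\mathcal A(1-f)(x),\widehat{\mathcal A}(1-f)(x))\le c/\Phi(r)$. (B2-b) For any $a\in(1,2]$ there is $c=c(z_0,a)$ such that for any $r\ge r_0$ and any $f\in\mathcal D(\overline B(z_0,r),B(z_0,ar))$, $\max(\mathcal Af(x),\widehat{\mathcal A}f(x))\le cV(r)j(x,z_0)$ for $x\in\overline A(z_0,r,(a+1)r)$. (C2) For any $a\in(1,2]$ there are $c\geq 1$, $c'>0$ depending on $z_0,a$ such that for $r\ge r_0$, $x\in B(z_0,r)$, $y\in\mathfrak X\setminus B(z_0,ar)$: $c^{-1}j(z_0,y)\le j(x,y)\le c\,j(z_0,y)$, $c^{-1}\widehat j(z_0,y)\le\widehat j(x,y)\le c\,\widehat j(z_0,y)$, and $\inf_{y\in\overline A(z_0,r,ar)}\min(j(z_0,y),\widehat j(z_0,y))\ge \frac{c'}{V(r)\Phi(r)}$. (D2) $\overline B(z_0,r_0)^c$ is Greenian,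 and for every $a\in(1,2)$ there is $c=c(z_0,a)$ such that for all $r\ge r_0$, $\sup_{x\in\overline B(z_0,ar)}\sup_{y\in\overline A(z_0,2r,4r)}\max(G_{\overline B(z_0,r)^c}(x,y),\widehat G_{\overline B(z_0,r)^c}(x,y))\le c\,\Phi(r)/V(r)$. *)

theory Defs
  imports "HOL-Probability.Probability"
begin

section \<open>State space with cemetery\<close>

text \<open>The state space is the whole type \<open>'a :: heine_borel\<close> (metric spaces in which bounded closed
  sets are compact). The cemetery is \<^const>\<open>None\<close>; it is the point at infinity if the space is not
  compact and an isolated point otherwise.\<close>

abbreviation cemetery_topology :: "'a::metric_space option topology" where
  "cemetery_topology \<equiv> Alexandroff_compactification euclidean"

definition cemetery_borel :: "'a::metric_space option measure" where
  "cemetery_borel = sigma UNIV {U. openin cemetery_topology U}"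

text \<open>The convention \<open>u(\<partial>) = 0\<close>.\<close>

definition ext0 :: "('a \<Rightarrow> 'b::zero) \<Rightarrow> 'a option \<Rightarrow> 'b" where
  "ext0 u = case_option 0 u"

text \<open>Both balls and annuli are closed by taking topological closures; in a general metric space
  \<open>closure (ball x r)\<close> may be strictly smaller than \<open>cball x r\<close>.\<close>

abbreviation closed_ball :: "'a::metric_space \<Rightarrow> real \<Rightarrow> 'a set" where
  "closed_ball x r \<equiv> closure (ball x r)"

definition annulus :: "'a::metric_space \<Rightarrow> real \<Rightarrow> real \<Rightarrow> 'a set" where
  "annulus x r R = {y. r < dist x y \<and> dist x y < R}"

abbreviation closed_annulus :: "'a::metric_space \<Rightarrow> real \<Rightarrow> real \<Rightarrow> 'a set" where
  "closed_annulus x r R \<equiv> closure (annulus x r R)"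

definition full_support :: "'a::topological_space measure \<Rightarrow> bool" where
  "full_support m \<longleftrightarrow> (\<forall>U. open U \<and> U \<noteq> {} \<longrightarrow> emeasure m U > 0)"

definition limit_at_infinity :: "('a::topological_space \<Rightarrow> real) \<Rightarrow> real \<Rightarrow> bool" where
  "limit_at_infinity f l \<longleftrightarrow> (\<forall>e>0. \<exists>K. compact K \<and> (\<forall>x. x \<notin> K \<longrightarrow> \<bar>f x - l\<bar> < e))"

definition C_zero :: "('a::topological_space \<Rightarrow> real) set" where
  "C_zero = {f. continuous_on UNIV f \<and> bounded (range f) \<and> limit_at_infinity f 0}"

definition C_infinity :: "('a::topological_space \<Rightarrow> real) set" where
  "C_infinity = {f. continuous_on UNIV f \<and> (\<exists>l. limit_at_infinity f l)}"


section \<open>Hunt processes\<close>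

text \<open>Time runs through \<open>[0,\<infinity>]\<close>, with \<open>X\<^sub>\<infinity> = \<partial>\<close>. There is one law for each starting point,
  including the cemetery.\<close>

record ('w, 'a) process =
  Om :: "'w set"
  path :: "ennreal \<Rightarrow> 'w \<Rightarrow> 'a option"
  shift :: "ennreal \<Rightarrow> 'w \<Rightarrow> 'w"
  law :: "'a option \<Rightarrow> 'w measure"

definition natural_filtration :: "('w, 'a::metric_space) process \<Rightarrow> ennreal \<Rightarrow> 'w measure" where
  "natural_filtration X t =
     sigma (Om X) {path X s -` B \<inter> Om X | s B. s \<le> t \<and> B \<in> sets cemetery_borel}"

text \<open>The right-continuous filtration \<open>\<F>\<^sub>t\<^sub>+\<close>. The index \<open>\<infinity>\<close> is added to the intersection so that
  the value at time \<open>\<infinity>\<close> is the natural \<open>\<sigma>\<close>-algebra at \<open>\<infinity>\<close>. It is the smallest right-continuous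
  filtration to which the process is adapted; a process that is strong Markov and quasi-left
  continuous for some such filtration is so for this one.\<close>

definition right_filtration :: "('w, 'a::metric_space) process \<Rightarrow> ennreal \<Rightarrow> 'w measure" where
  "right_filtration X t =
     sigma (Om X) (\<Inter>s\<in>insert \<infinity> {t<..}. sets (natural_filtration X s))"

definition lifetime :: "('w, 'a) process \<Rightarrow> 'w \<Rightarrow> ennreal" where
  "lifetime X \<omega> = Inf {t. path X t \<omega> = None}"

definition markov_laws :: "('w, 'a::metric_space) process \<Rightarrow> bool" where
  "markov_laws X \<longleftrightarrow>
     (\<forall>x. prob_space (law X x) \<and> space (law X x) = Om X \<and>
          sets (law X x) = sets (natural_filtration X \<infinity>)) \<and>
     (\<forall>t. \<forall>B\<in>sets cemetery_borel.
        (\<lambda>x. emeasure (law X x) {\<omega>\<in>Om X. path X t \<omega> \<in> B}) \<in> borel_measurable cemetery_borel) \<and>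
     (\<forall>x. AE \<omega> in law X x. path X 0 \<omega> = x)"

definition hunt_paths :: "('w, 'a::metric_space) process \<Rightarrow> bool" where
  "hunt_paths X \<longleftrightarrow> (\<forall>\<omega>\<in>Om X.
     path X \<infinity> \<omega> = None \<and>
     (\<forall>t\<ge>lifetime X \<omega>. path X t \<omega> = None) \<and>
     (\<forall>t<\<infinity>. shift X t \<omega> \<in> Om X \<and> (\<forall>s. path X s (shift X t \<omega>) = path X (t + s) \<omega>)) \<and>
     (\<forall>t<\<infinity>. limitin cemetery_topology (\<lambda>s. path X s \<omega>) (path X t \<omega>) (at_right t)) \<and>
     (\<forall>t. 0 < t \<and> t < \<infinity> \<longrightarrow>
        (\<exists>l. limitin cemetery_topology (\<lambda>s. path X s \<omega>) l (at_left t))))"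

text \<open>\<open>P\<^sub>x(X\<^sub>\<sigma>\<^sub>+\<^sub>t \<in> B | \<F>\<^sub>\<sigma>) = P\<^bsub>X(\<sigma>)\<^esub>(X\<^sub>t \<in> B)\<close> almost surely on \<open>{\<sigma> < \<infinity>}\<close>, written out by means of
  the defining property of conditional probabilities.\<close>

definition strong_markov :: "('w, 'a::metric_space) process \<Rightarrow> bool" where
  "strong_markov X \<longleftrightarrow> (\<forall>\<sigma>. stopping_time (right_filtration X) \<sigma> \<longrightarrow>
     (\<forall>x. \<forall>t<\<infinity>. \<forall>B\<in>sets cemetery_borel.
      \<forall>\<Lambda>\<in>sets (filtration.pre_sigma (Om X) (right_filtration X) \<sigma>).
        emeasure (law X x) {\<omega>\<in>\<Lambda>. \<sigma> \<omega> < \<infinity> \<and> path X (\<sigma> \<omega> + t) \<omega> \<in> B} =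
        (\<integral>\<^sup>+\<omega>\<in>{\<omega>\<in>\<Lambda>. \<sigma> \<omega> < \<infinity>}.
           emeasure (law X (path X (\<sigma> \<omega>) \<omega>)) {\<omega>'\<in>Om X. path X t \<omega>' \<in> B} \<partial>law X x)))"

definition quasi_left_continuous :: "('w, 'a::metric_space) process \<Rightarrow> bool" where
  "quasi_left_continuous X \<longleftrightarrow> (\<forall>\<sigma> :: nat \<Rightarrow> 'w \<Rightarrow> ennreal.
     (\<forall>n. stopping_time (right_filtration X) (\<sigma> n)) \<and> (\<forall>\<omega>\<in>Om X. incseq (\<lambda>n. \<sigma> n \<omega>)) \<longrightarrow>
     (\<forall>x. AE \<omega> in law X x. (SUP n. \<sigma> n \<omega>) < \<infinity> \<longrightarrow>
        limitin cemetery_topology (\<lambda>n. path X (\<sigma> n \<omega>) \<omega>) (path X (SUP n. \<sigma> n \<omega>) \<omega>) sequentially))"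

definition hunt_process :: "('w, 'a::metric_space) process \<Rightarrow> bool" where
  "hunt_process X \<longleftrightarrow>
     markov_laws X \<and> hunt_paths X \<and> strong_markov X \<and> quasi_left_continuous X"


section \<open>Semigroup, generator, hitting times\<close>

text \<open>The operators \<open>P\<^sub>t\<close> on real functions, and on \<open>[0,\<infinity>]\<close>-valued functions.\<close>

definition semigroup_op :: "('w, 'a) process \<Rightarrow> real \<Rightarrow> ('a \<Rightarrow> real) \<Rightarrow> 'a \<Rightarrow> real" where
  "semigroup_op X t f x = (\<integral>\<omega>. ext0 f (path X (ennreal t) \<omega>) \<partial>law X (Some x))"

definition nn_semigroup_op :: "('w, 'a) process \<Rightarrow> real \<Rightarrow> ('a \<Rightarrow> ennreal) \<Rightarrow> 'a \<Rightarrow> ennreal" where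
  "nn_semigroup_op X t f x = (\<integral>\<^sup>+\<omega>. ext0 f (path X (ennreal t) \<omega>) \<partial>law X (Some x))"

definition resolvent :: "('w, 'a) process \<Rightarrow> real \<Rightarrow> ('a \<Rightarrow> ennreal) \<Rightarrow> 'a \<Rightarrow> ennreal" where
  "resolvent X \<alpha> f x = (\<integral>\<^sup>+t\<in>{0..}. ennreal (exp (- \<alpha> * t)) * nn_semigroup_op X t f x \<partial>lborel)"

definition feller :: "('w, 'a::metric_space) process \<Rightarrow> bool" where
  "feller X \<longleftrightarrow>
     (\<forall>t\<ge>0. \<forall>f\<in>C_zero. semigroup_op X t f \<in> C_zero) \<and>
     (\<forall>f\<in>C_zero. uniform_limit UNIV (\<lambda>t. semigroup_op X t f) f (at_right 0))"

definition strong_feller :: "('w, 'a::metric_space) process \<Rightarrow> bool" where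
  "strong_feller X \<longleftrightarrow>
     (\<forall>t>0. \<forall>f. f \<in> borel_measurable borel \<and> bounded (range f) \<longrightarrow>
        continuous_on UNIV (semigroup_op X t f))"

definition conservative :: "('w, 'a) process \<Rightarrow> bool" where
  "conservative X \<longleftrightarrow> (\<forall>t\<ge>0. \<forall>x. semigroup_op X t (\<lambda>_. 1) x = 1)"

text \<open>The generator of the semigroup on a space \<open>C\<close> of functions with the supremum norm; \<open>C\<close> is
  \<^const>\<open>C_zero\<close> or \<^const>\<open>C_infinity\<close> below.\<close>

definition generates ::
    "('a \<Rightarrow> real) set \<Rightarrow> ('w, 'a) process \<Rightarrow> ('a \<Rightarrow> real) \<Rightarrow> ('a \<Rightarrow> real) \<Rightarrow> bool" where
  "generates C X f g \<longleftrightarrow> f \<in> C \<and> g \<in> C \<and>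
     uniform_limit UNIV (\<lambda>t x. (semigroup_op X t f x - f x) / t) g (at_right 0)"

definition generator_domain :: "('a \<Rightarrow> real) set \<Rightarrow> ('w, 'a) process \<Rightarrow> ('a \<Rightarrow> real) set" where
  "generator_domain C X = {f. \<exists>g. generates C X f g}"

definition generator ::
    "('a \<Rightarrow> real) set \<Rightarrow> ('w, 'a) process \<Rightarrow> ('a \<Rightarrow> real) \<Rightarrow> 'a \<Rightarrow> real" where
  "generator C X f = (THE g. generates C X f g)"

definition hitting_time :: "('w, 'a) process \<Rightarrow> 'a set \<Rightarrow> 'w \<Rightarrow> ennreal" where
  "hitting_time X B \<omega> = Inf {t. 0 < t \<and> path X t \<omega> \<in> Some ` B}"

definition exit_time :: "('w, 'a) process \<Rightarrow> 'a set \<Rightarrow> 'w \<Rightarrow> ennreal" where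
  "exit_time X D \<omega> = Inf {t. 0 < t \<and> path X t \<omega> \<notin> Some ` D}"

text \<open>Nearly Borel, polar, thin and semi-polar sets in the sense of Blumenthal and Getoor.
  Hitting and exit times are in general measurable only with respect to the completed laws;
  \<open>AE\<close> and the nonnegative integral do not change when a measure is completed.\<close>

definition nearly_borel :: "('w, 'a::metric_space) process \<Rightarrow> 'a set \<Rightarrow> bool" where
  "nearly_borel X A \<longleftrightarrow> (\<forall>\<mu>. prob_space \<mu> \<and> sets \<mu> = sets cemetery_borel \<longrightarrow>
     (\<exists>B\<in>sets borel. \<exists>B'\<in>sets borel. B \<subseteq> A \<and> A \<subseteq> B' \<and>
        (AE \<omega> in \<mu> \<bind> law X. \<forall>t. path X t \<omega> \<notin> Some ` (B' - B))))"

definition polar :: "('w, 'a::metric_space) process \<Rightarrow> 'a set \<Rightarrow> bool" where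
  "polar X A \<longleftrightarrow> (\<exists>B. nearly_borel X B \<and> A \<subseteq> B \<and>
     (\<forall>x. AE \<omega> in law X (Some x). hitting_time X B \<omega> = \<infinity>))"

definition thin :: "('w, 'a::metric_space) process \<Rightarrow> 'a set \<Rightarrow> bool" where
  "thin X A \<longleftrightarrow> (\<exists>B. nearly_borel X B \<and> A \<subseteq> B \<and>
     (\<forall>x. AE \<omega> in law X (Some x). hitting_time X B \<omega> > 0))"

definition semipolar :: "('w, 'a::metric_space) process \<Rightarrow> 'a set \<Rightarrow> bool" where
  "semipolar X A \<longleftrightarrow> (\<exists>T :: nat \<Rightarrow> 'a set. (\<forall>n. thin X (T n)) \<and> A \<subseteq> (\<Union>n. T n))"


section \<open>Assumptions A, B, C\<close>

text \<open>Strong duality: the resolvents are in duality and their kernels are absolutely continuous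
  with respect to the duality measure.\<close>

definition strong_dual ::
    "'a::metric_space measure \<Rightarrow> ('w, 'a) process \<Rightarrow> ('v, 'a) process \<Rightarrow> bool" where
  "strong_dual m X X' \<longleftrightarrow>
     (\<forall>\<alpha>>0. \<forall>f\<in>borel_measurable borel. \<forall>g\<in>borel_measurable borel.
        (\<integral>\<^sup>+x. g x * resolvent X \<alpha> f x \<partial>m) = (\<integral>\<^sup>+x. f x * resolvent X' \<alpha> g x \<partial>m)) \<and>
     (\<forall>\<alpha>>0. \<forall>x. \<forall>B\<in>null_sets m.
        resolvent X \<alpha> (indicator B) x = 0 \<and> resolvent X' \<alpha> (indicator B) x = 0)"

definition assumption_A ::
    "'a::metric_space measure \<Rightarrow> ('w, 'a) process \<Rightarrow> ('v, 'a) process \<Rightarrow> bool" where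
  "assumption_A m X X' \<longleftrightarrow>
     hunt_process X \<and> hunt_process X' \<and> strong_dual m X X' \<and>
     feller X \<and> feller X' \<and> strong_feller X \<and> strong_feller X' \<and>
     (\<forall>A. semipolar X A \<longrightarrow> polar X A)"

definition test_functions ::
    "'a::metric_space measure \<Rightarrow> ('a \<Rightarrow> real) set \<Rightarrow> 'a set \<Rightarrow> 'a set \<Rightarrow> ('a \<Rightarrow> real) set" where
  "test_functions m \<D> K D = {f\<in>\<D>. (\<forall>x\<in>K. f x = 1) \<and> (\<forall>x\<in>- D. f x = 0) \<and>
     (\<forall>x. 0 \<le> f x \<and> f x \<le> 1) \<and> emeasure m (frontier {x. f x > 0}) = 0}"

definition function_subspace :: "('a \<Rightarrow> real) set \<Rightarrow> bool" where
  "function_subspace \<D> \<longleftrightarrow> (\<lambda>_. 0) \<in> \<D> \<and> (\<forall>f\<in>\<D>. \<forall>g\<in>\<D>. (\<lambda>x. f x + g x) \<in> \<D>) \<and>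
     (\<forall>c. \<forall>f\<in>\<D>. (\<lambda>x. c * f x) \<in> \<D>)"

definition assumption_B ::
    "'a::metric_space measure \<Rightarrow> ('w, 'a) process \<Rightarrow> ('v, 'a) process \<Rightarrow> ('a \<Rightarrow> real) set \<Rightarrow> bool" where
  "assumption_B m X X' \<D> \<longleftrightarrow>
     function_subspace \<D> \<and>
     \<D> \<subseteq> generator_domain C_zero X \<inter> generator_domain C_zero X' \<and>
     (\<forall>K D. compact K \<and> open D \<and> K \<subseteq> D \<longrightarrow> test_functions m \<D> K D \<noteq> {})"

definition levy_kernel :: "('w, 'a::metric_space) process \<Rightarrow> ('a \<Rightarrow> 'a measure) \<Rightarrow> bool" where
  "levy_kernel X J \<longleftrightarrow>
     (\<forall>x. sets (J x) = sets borel \<and> emeasure (J x) {x} = 0) \<and>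
     (\<forall>B\<in>sets borel. (\<lambda>x. emeasure (J x) B) \<in> borel_measurable borel) \<and>
     (\<forall>f x. continuous_on UNIV f \<and> bounded (range f) \<and> x \<notin> closure {y. f y \<noteq> 0} \<longrightarrow>
        integrable (J x) f \<and>
        ((\<lambda>t. semigroup_op X t f x / t) \<longlongrightarrow> (\<integral>y. f y \<partial>J x)) (at_right 0))"

definition assumption_C ::
    "'a::metric_space measure \<Rightarrow> ('w, 'a) process \<Rightarrow> ('v, 'a) process
     \<Rightarrow> ('a \<Rightarrow> 'a \<Rightarrow> real) \<Rightarrow> ('a \<Rightarrow> 'a \<Rightarrow> real) \<Rightarrow> bool" where
  "assumption_C m X X' j j' \<longleftrightarrow>
     case_prod j \<in> borel_measurable (borel \<Otimes>\<^sub>M borel) \<and>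
     case_prod j' \<in> borel_measurable (borel \<Otimes>\<^sub>M borel) \<and>
     (\<forall>x y. 0 \<le> j x y \<and> 0 \<le> j' x y) \<and>
     levy_kernel X (\<lambda>x. density m (\<lambda>y. ennreal (j x y))) \<and>
     levy_kernel X' (\<lambda>x. density m (\<lambda>y. ennreal (j' x y))) \<and>
     (\<forall>x y. x \<noteq> y \<longrightarrow> j x y = j' y x \<and> j x y > 0)"


section \<open>Green functions, Poisson kernel, harmonic functions\<close>

definition killed_semigroup_op ::
    "('w, 'a) process \<Rightarrow> 'a set \<Rightarrow> real \<Rightarrow> ('a \<Rightarrow> ennreal) \<Rightarrow> 'a \<Rightarrow> ennreal" where
  "killed_semigroup_op X D t f x =
     (\<integral>\<^sup>+\<omega>. (if ennreal t < exit_time X D \<omega> then ext0 f (path X (ennreal t) \<omega>) else 0)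
        \<partial>law X (Some x))"

definition excessive_on :: "('w, 'a) process \<Rightarrow> 'a set \<Rightarrow> ('a \<Rightarrow> ennreal) \<Rightarrow> bool" where
  "excessive_on X D h \<longleftrightarrow> (\<forall>x\<in>D. (\<forall>t\<ge>0. killed_semigroup_op X D t h x \<le> h x) \<and>
     ((\<lambda>t. killed_semigroup_op X D t h x) \<longlongrightarrow> h x) (at_right 0))"

definition green_kernel ::
    "'a::metric_space measure \<Rightarrow> ('w, 'a) process \<Rightarrow> 'a set \<Rightarrow> ('a \<Rightarrow> 'a \<Rightarrow> ennreal) \<Rightarrow> bool" where
  "green_kernel m X D g \<longleftrightarrow>
     case_prod g \<in> borel_measurable (borel \<Otimes>\<^sub>M borel) \<and>
     (\<forall>x y. x \<notin> D \<or> y \<notin> D \<longrightarrow> g x y = 0) \<and>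
     (\<forall>x\<in>D. \<forall>f\<in>borel_measurable borel.
        (\<integral>\<^sup>+\<omega>. (\<integral>\<^sup>+t\<in>{t. 0 \<le> t \<and> ennreal t < exit_time X D \<omega>}.
                   ext0 f (path X (ennreal t) \<omega>) \<partial>lborel) \<partial>law X (Some x)) =
        (\<integral>\<^sup>+y\<in>D. f y * g x y \<partial>m))"

text \<open>The integral identity determines a Green function only up to \<open>m\<close>-null sets. The version
  meant is the one that is excessive in the first variable for the killed process and excessive
  in the second variable for the killed dual process; this version is unique on \<open>D \<times> D\<close>, and it
  is extended by \<open>0\<close>.\<close>

definition green_functions ::
    "'a::metric_space measure \<Rightarrow> ('w, 'a) process \<Rightarrow> ('v, 'a) process
     \<Rightarrow> ('a set \<Rightarrow> 'a \<Rightarrow> 'a \<Rightarrow> ennreal) \<Rightarrow> ('a set \<Rightarrow> 'a \<Rightarrow> 'a \<Rightarrow> ennreal) \<Rightarrow> bool" where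
  "green_functions m X X' G G' \<longleftrightarrow> (\<forall>D. open D \<longrightarrow>
     green_kernel m X D (G D) \<and> green_kernel m X' D (G' D) \<and>
     (\<forall>x y. G D x y = G' D y x) \<and>
     (\<forall>y\<in>D. excessive_on X D (\<lambda>x. G D x y)) \<and>
     (\<forall>x\<in>D. excessive_on X' D (\<lambda>y. G' D y x)))"

definition greenian :: "('a set \<Rightarrow> 'a \<Rightarrow> 'a \<Rightarrow> ennreal) \<Rightarrow> 'a set \<Rightarrow> bool" where
  "greenian G D \<longleftrightarrow> (\<forall>x\<in>D. \<forall>y\<in>D. x \<noteq> y \<longrightarrow> G D x y < \<infinity>)"

definition poisson_kernel ::
    "'a measure \<Rightarrow> ('a set \<Rightarrow> 'a \<Rightarrow> 'a \<Rightarrow> ennreal) \<Rightarrow> ('a \<Rightarrow> 'a \<Rightarrow> real)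
     \<Rightarrow> 'a set \<Rightarrow> 'a \<Rightarrow> 'a \<Rightarrow> ennreal" where
  "poisson_kernel m G j D x z = (\<integral>\<^sup>+y\<in>D. G D x y * ennreal (j y z) \<partial>m)"

text \<open>Since \<open>X\<^sub>\<infinity> = \<partial>\<close> and \<open>u(\<partial>) = 0\<close>, paths that never leave \<open>D\<close> do not contribute.\<close>

definition regular_harmonic :: "('w, 'a) process \<Rightarrow> ('a \<Rightarrow> real) \<Rightarrow> 'a set \<Rightarrow> bool" where
  "regular_harmonic X u D \<longleftrightarrow> (\<forall>x\<in>D.
     ennreal (u x) =
       (\<integral>\<^sup>+\<omega>. ext0 (\<lambda>z. ennreal (u z)) (path X (exit_time X D \<omega>) \<omega>) \<partial>law X (Some x)))"

definition regular_boundary :: "('w, 'a::metric_space) process \<Rightarrow> 'a set \<Rightarrow> 'a set" where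
  "regular_boundary X D = {x\<in>frontier D. AE \<omega> in law X (Some x). exit_time X D \<omega> = 0}"


section \<open>Assumptions at infinity\<close>

definition vol :: "'a::metric_space measure \<Rightarrow> 'a \<Rightarrow> real \<Rightarrow> ennreal" where
  "vol m z0 r = emeasure m (ball z0 r)"

definition assumption_V1 :: "'a::metric_space measure \<Rightarrow> 'a \<Rightarrow> bool" where
  "assumption_V1 m z0 \<longleftrightarrow> (\<exists>c>1. \<forall>r>0. vol m z0 (2 * r) \<le> ennreal c * vol m z0 r)"

definition assumption_V2 :: "'a::metric_space measure \<Rightarrow> 'a \<Rightarrow> real \<Rightarrow> bool" where
  "assumption_V2 m z0 r0 \<longleftrightarrow>
     (\<exists>c>1. \<exists>n0::nat. n0 \<ge> 2 \<and> (\<forall>r\<ge>r0. vol m z0 (real n0 * r) \<ge> ennreal c * vol m z0 r))"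

definition assumption_Phi :: "(real \<Rightarrow> real) \<Rightarrow> bool" where
  "assumption_Phi \<Phi> \<longleftrightarrow> (\<forall>r\<ge>0. \<Phi> r \<ge> 0) \<and> mono_on {0..} \<Phi> \<and>
     (\<exists>c>1. \<forall>r>0. \<Phi> (2 * r) \<le> c * \<Phi> r)"

text \<open>The inequalities below are stated in \<^typ>\<open>ennreal\<close> or \<^typ>\<open>ereal\<close>, so that infima, suprema and
  quotients have their usual extended values.\<close>

definition assumption_B2a ::
    "'a::metric_space measure \<Rightarrow> ('w, 'a) process \<Rightarrow> ('v, 'a) process \<Rightarrow> ('a \<Rightarrow> real) set
     \<Rightarrow> (real \<Rightarrow> real) \<Rightarrow> 'a \<Rightarrow> real \<Rightarrow> bool" where
  "assumption_B2a m X X' \<D> \<Phi> z0 r0 \<longleftrightarrow> (\<forall>a. 1 < a \<and> a \<le> 2 \<longrightarrow> (\<exists>c>0. \<forall>r\<ge>r0.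
     (INF f\<in>test_functions m \<D> (closed_ball z0 r) (ball z0 (a * r)).
        SUP x. ereal (max (generator C_infinity X (\<lambda>z. 1 - f z) x)
                          (generator C_infinity X' (\<lambda>z. 1 - f z) x)))
     \<le> ereal c / ereal (\<Phi> r)))"

text \<open>Negative reals are mapped to \<open>0\<close> by \<^const>\<open>ennreal\<close>; as the right-hand side is nonnegative, this
  does not affect the inequality.\<close>

definition assumption_B2b ::
    "'a::metric_space measure \<Rightarrow> ('w, 'a) process \<Rightarrow> ('v, 'a) process \<Rightarrow> ('a \<Rightarrow> real) set
     \<Rightarrow> ('a \<Rightarrow> 'a \<Rightarrow> real) \<Rightarrow> 'a \<Rightarrow> real \<Rightarrow> bool" where
  "assumption_B2b m X X' \<D> j z0 r0 \<longleftrightarrow> (\<forall>a. 1 < a \<and> a \<le> 2 \<longrightarrow> (\<exists>c>0. \<forall>r\<ge>r0.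
     \<forall>f\<in>test_functions m \<D> (closed_ball z0 r) (ball z0 (a * r)).
     \<forall>x\<in>closed_annulus z0 r ((a + 1) * r).
       ennreal (max (generator C_infinity X f x) (generator C_infinity X' f x))
       \<le> ennreal c * vol m z0 r * ennreal (j x z0)))"

definition assumption_C2 ::
    "'a::metric_space measure \<Rightarrow> ('a \<Rightarrow> 'a \<Rightarrow> real) \<Rightarrow> ('a \<Rightarrow> 'a \<Rightarrow> real)
     \<Rightarrow> (real \<Rightarrow> real) \<Rightarrow> 'a \<Rightarrow> real \<Rightarrow> bool" where
  "assumption_C2 m j j' \<Phi> z0 r0 \<longleftrightarrow> (\<forall>a. 1 < a \<and> a \<le> 2 \<longrightarrow> (\<exists>c\<ge>1. \<exists>c'>0. \<forall>r\<ge>r0.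
     (\<forall>x\<in>ball z0 r. \<forall>y\<in>- ball z0 (a * r).
        inverse c * j z0 y \<le> j x y \<and> j x y \<le> c * j z0 y \<and>
        inverse c * j' z0 y \<le> j' x y \<and> j' x y \<le> c * j' z0 y) \<and>
     (INF y\<in>closed_annulus z0 r (a * r). ennreal (min (j z0 y) (j' z0 y)))
       \<ge> ennreal c' / (vol m z0 r * ennreal (\<Phi> r))))"

definition assumption_D2 ::
    "'a::metric_space measure \<Rightarrow> ('a set \<Rightarrow> 'a \<Rightarrow> 'a \<Rightarrow> ennreal) \<Rightarrow> ('a set \<Rightarrow> 'a \<Rightarrow> 'a \<Rightarrow> ennreal)
     \<Rightarrow> (real \<Rightarrow> real) \<Rightarrow> 'a \<Rightarrow> real \<Rightarrow> bool" where
  "assumption_D2 m G G' \<Phi> z0 r0 \<longleftrightarrow>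
     greenian G (- closed_ball z0 r0) \<and>
     (\<forall>a. 1 < a \<and> a < 2 \<longrightarrow> (\<exists>c>0. \<forall>r\<ge>r0.
        (SUP x\<in>closed_ball z0 (a * r). SUP y\<in>closed_annulus z0 (2 * r) (4 * r).
           max (G (- closed_ball z0 r) x y) (G' (- closed_ball z0 r) x y))
        \<le> ennreal c * ennreal (\<Phi> r) / vol m z0 r))"

end

theory Submission
  imports Defs
begin

text \<open>
  Write \<open>|z|\<close> for the distance of \<open>z\<close> from \<open>z\<^sub>0\<close>. A process outside a ball around \<open>z\<^sub>0\<close> enters a smaller
  concentric ball only by a jump. Since \<open>j(y,z)\<close> is comparable with \<open>j(y,z\<^sub>0)\<close> for such a jump, the Levy
  system shows that the exit distribution of \<open>D\<close> started from \<open>x\<close> has in the smaller ball a density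
  comparable with the Poisson kernel \<open>P\<^sub>D(x,z\<^sub>0)\<close>. As exit distributions have mass at most one, this
  also bounds \<open>P\<^sub>D(w,z\<^sub>0)\<close> by \<open>c/V(r)\<close> for \<open>2r < |w| < 4r\<close>.

  Both inequalities follow by stopping the process at its exit from the part of \<open>D\<close> outside a larger ball
  (of radius \<open>3r\<close> for the upper and \<open>(a+2)r\<close> for the lower bound). The exit position is either
  well inside this ball, where the Levy system applies, or close to its boundary. Test functions bound
  the probability of the second case by \<open>c V(r) P\<^sub>D(x,z\<^sub>0)\<close>, and there \<open>u\<close> satisfies
  \<open>u(w) \<le> (c/V(r)) \<integral>\<^bsub>B(z\<^sub>0,2r)\<^esub> u dm\<close>.

  This last inequality is the main point. Let \<open>\<phi>\<close> be a test function that is \<open>1\<close> on \<open>B(z\<^sub>0,5r/4)\<close> and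
  \<open>0\<close> off \<open>B(z\<^sub>0,3r/2)\<close>, with \<open>-A'\<phi> \<le> \<delta> = c/\<Phi>(r)\<close> for the dual generator \<open>A'\<close>, and kill both processes at
  rate \<open>\<psi> = 2\<delta>/(1 - \<phi> + \<epsilon>)\<close> in \<open>B(z\<^sub>0,3r/2)\<close>. The function \<open>1 - \<phi> + \<epsilon>\<close> is a strict supersolution for
  the killed dual process, so the potential \<open>K'p\<close> of a density \<open>p\<close> on \<open>2r < |w| < 4r\<close> is at most
  \<open>c (\<Phi>(r)/V(r)) (1 - \<phi> + \<epsilon>) \<integral>p\<close>. By duality the contribution \<open>\<integral>p K(\<psi>u) = \<integral>\<psi>u K'p\<close> of the killed paths to
  \<open>\<integral>p u\<close> is at most \<open>(c/V(r)) \<integral>p \<integral>\<^bsub>B(z\<^sub>0,2r)\<^esub> u\<close>. As \<open>\<epsilon> \<rightarrow> 0\<close> the killing becomes instantaneous in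
  \<open>B(z\<^sub>0,5r/4)\<close>, so the surviving paths enter \<open>B(z\<^sub>0,r)\<close> by a jump from outside \<open>B(z\<^sub>0,6r/5)\<close>.
\<close>

text \<open>An exit distribution need not have a density with respect to m near the boundary of the
  domain, so duality cannot be applied to it. Killing at rate \<psi> replaces the part that enters
  the small ball by the measure \<psi> u dm, to which it can. The factor 2 in \<psi> splits: one
  \<delta> absorbs -A'\<phi>, the other pays for exits of the dual process to distances that (D2)
  does not reach. Duality tests only against densities, so the inequality for u comes out almost
  everywhere; it is upgraded because a harmonic function is approximated by multiples of its own
  \<alpha>-potentials. Irregular boundary points, where u is not assumed to vanish, form a
  semi-polar and hence polar set, so exit positions avoid them almost surely. Exit times are handled
  without completed \<sigma>-algebras: \<open>exit_at\<close> is a supremum of stopping times and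
  equals the true exit time off a null set by quasi-left continuity. All quantities live in
  [0,\<infinity>]; identities with signs are written with positive and negative parts on opposite
  sides, and finiteness is proved for every term that is cancelled.\<close>

section \<open>Borel sets of the state space with cemetery\<close>

lemma sets_cemetery_borel:
  "sets (cemetery_borel :: 'a::heine_borel option measure) = sigma_sets UNIV {Some ` U |U. open U}"
proof -
  have "sigma_sets UNIV {U :: 'a option set. openin cemetery_topology U} = sigma_sets UNIV {Some ` U |U. open U}"
  proof (rule sigma_sets_eqI)
    fix A :: "'a option set" assume "A \<in> {U. openin cemetery_topology U}"
    then consider (1) U where "open U" "A = Some ` U" | (2) C where "closed C" "A = insert None (Some ` (- C))"
      by (auto simp: openin_Alexandroff_compactification Compl_eq_Diff_UNIV)
    then show "A \<in> sigma_sets UNIV {Some ` U |U. open U}"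
    proof cases
      case 1 then show ?thesis by auto
    next
      case 2
      have "A = UNIV - (Some ` UNIV - Some ` (- C))"
        using 2 by (auto simp: image_iff)
      moreover have "Some ` UNIV - Some ` (- C) \<in> sigma_sets UNIV {Some ` U |U. open U}"
      proof -
        have "Some ` UNIV - Some ` (- C) = UNIV - ((UNIV - Some ` UNIV) \<union> Some ` (- C))" by auto
        moreover have "(UNIV - Some ` UNIV) \<union> Some ` (- C) \<in> sigma_sets UNIV {Some ` U |U. open U}"
          using 2 by (intro sigma_sets_Un sigma_sets.Compl sigma_sets.Basic) (auto intro!: open_UNIV)
        ultimately show ?thesis by (simp add: sigma_sets.Compl)
      qed
      ultimately show ?thesis by (simp add: sigma_sets.Compl)
    qed
  next
    fix A :: "'a option set" assume "A \<in> {Some ` U |U. open U}"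
    then show "A \<in> sigma_sets UNIV {U. openin cemetery_topology U}" by auto
  qed
  then show ?thesis by (simp add: cemetery_borel_def)
qed

lemma space_cemetery_borel [simp]: "space cemetery_borel = UNIV"
  by (simp add: cemetery_borel_def)

text \<open>A neighbourhood of the cemetery is the complement of the image of a live closed set, so
  live open sets already generate the \<sigma>-algebra and one test class is enough.\<close>

lemma measurable_cemeteryI:
  assumes "\<And>U. open U \<Longrightarrow> {x\<in>space M. f x \<in> Some ` U} \<in> sets M"
  shows "f \<in> M \<rightarrow>\<^sub>M (cemetery_borel :: 'a::heine_borel option measure)"
proof (rule measurable_sigma_sets[where A="{Some ` U |U. open U}" and \<Omega>=UNIV])
  show "f -` y \<inter> space M \<in> sets M" if "y \<in> {Some ` U |U. open U}" for y
    using that assms by (auto simp: vimage_def Int_def conj_commute)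
qed (auto simp: sets_cemetery_borel)

lemma Some_image_sets: "B \<in> sets borel \<Longrightarrow> Some ` B \<in> sets (cemetery_borel :: 'a::heine_borel option measure)"
proof -
  assume "B \<in> sets borel"
  then have "B \<in> sigma_sets UNIV {S. open S}" by (simp add: borel_def)
  then show "Some ` B \<in> sets cemetery_borel"
  proof induction
    case (Basic a) then show ?case by (auto simp: sets_cemetery_borel)
  next
    case (Compl a)
    have U: "(Some ` UNIV :: 'a option set) \<in> sets cemetery_borel"
      by (auto simp: sets_cemetery_borel intro!: sigma_sets.Basic open_UNIV)
    have "Some ` (UNIV - a) = Some ` UNIV - Some ` a" by auto
    then show ?case using Compl U by auto
  next
    case (Union a) then show ?case by (simp add: image_UN)
  qed auto
qed

lemma None_sets [measurable]: "{None} \<in> sets (cemetery_borel :: 'a::heine_borel option measure)"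
proof -
  have "{None :: 'a option} = space cemetery_borel - Some ` UNIV" by (auto simp: image_iff)
  then show ?thesis using Some_image_sets[of "UNIV :: 'a set"] by (metis sets.compl_sets sets.top space_borel)
qed

lemma measurable_Some [measurable]: "Some \<in> borel \<rightarrow>\<^sub>M (cemetery_borel :: 'a::heine_borel option measure)"
  by (rule measurable_cemeteryI) (auto simp: image_iff)

lemma measurable_ext0:
  fixes g :: "'a::heine_borel \<Rightarrow> 'b::{topological_space,zero}"
  assumes g: "g \<in> borel_measurable borel"
  shows "ext0 g \<in> borel_measurable cemetery_borel"
proof (rule measurableI)
  fix B :: "'b set" assume "B \<in> sets borel"
  then have "Some ` (g -` B) \<in> sets (cemetery_borel :: 'a option measure)"
    using g by (intro Some_image_sets) (auto simp: measurable_def)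
  moreover have "ext0 g -` B \<inter> space cemetery_borel = Some ` (g -` B) \<union> (if 0 \<in> B then {None} else {})"
    by (auto simp: ext0_def split: option.splits)
  ultimately show "ext0 g -` B \<inter> space cemetery_borel \<in> sets cemetery_borel"
    using None_sets by (auto simp del: Un_insert_right)
qed simp

lemma ext0_simps [simp]: "ext0 g None = 0" "ext0 g (Some x) = g x"
  by (auto simp: ext0_def)

section \<open>Dyadic times from the right and the distance to a complement\<close>

text \<open>Floor plus one instead of the ceiling makes the value strictly larger than
  \<open>t\<close> even when \<open>t\<close> is dyadic; a limit along \<open>at_right\<close>
  ignores the point itself.\<close>

definition next_dyadic :: "nat \<Rightarrow> real \<Rightarrow> real" where
  "next_dyadic k t = (of_int \<lfloor>t * 2 ^ k\<rfloor> + 1) / 2 ^ k"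

lemma next_dyadic_gt: "t < next_dyadic k t"
proof -
  have "t * 2 ^ k < of_int \<lfloor>t * 2 ^ k\<rfloor> + 1" by linarith
  then show ?thesis by (simp add: next_dyadic_def field_simps)
qed

lemma next_dyadic_le: "next_dyadic k t \<le> t + 1 / 2 ^ k"
proof -
  have "of_int \<lfloor>t * 2 ^ k\<rfloor> \<le> t * 2 ^ k" by linarith
  then show ?thesis by (simp add: next_dyadic_def field_simps)
qed

lemma next_dyadic_tendsto: "(\<lambda>k. next_dyadic k t) \<longlonglongrightarrow> t"
proof (rule tendsto_sandwich[of "\<lambda>_. t" _ _ "\<lambda>k. t + 1 / 2 ^ k"])
  have "(\<lambda>k. t + (1/2) ^ k) \<longlonglongrightarrow> t + 0"
    by (intro tendsto_add tendsto_const LIMSEQ_power_zero) auto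
  then show "(\<lambda>k. t + 1 / 2 ^ k) \<longlonglongrightarrow> t" by (simp add: power_one_over)
qed (auto intro!: always_eventually less_imp_le next_dyadic_gt next_dyadic_le)

text \<open>A continuous function that is positive exactly on an open \<open>D\<close>. The whole
  space is a separate case because \<open>infdist\<close> to the empty set is 0; any positive
  constant would serve there.\<close>

definition dist_compl :: "'a::metric_space set \<Rightarrow> 'a \<Rightarrow> real" where
  "dist_compl D x = (if D = UNIV then 1 else infdist x (- D))"

lemma dist_compl_pos_iff: "open D \<Longrightarrow> 0 < dist_compl D x \<longleftrightarrow> x \<in> D"
  using in_closed_iff_infdist_zero[of "- D" x] infdist_nonneg[of x "- D"]
  by (cases "D = UNIV") (auto simp: dist_compl_def less_le)

lemma continuous_dist_compl: "continuous_on UNIV (dist_compl D)"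
  by (cases "D = UNIV") (auto simp: dist_compl_def cong: continuous_on_cong intro!: continuous_intros)

lemma dist_compl_measurable [measurable]: "dist_compl D \<in> borel_measurable borel"
  by (intro borel_measurable_continuous_onI continuous_dist_compl)

lemma ennreal_add_le_iff_le_diff:
  fixes a s t :: ennreal
  assumes "s \<le> t" "t \<noteq> top" shows "a + s \<le> t \<longleftrightarrow> a \<le> t - s"
proof (cases a)
  case top then show ?thesis using assms by (simp add: top_unique ennreal_minus_eq_top)
next
  case (real x)
  obtain y z where "s = ennreal y" "0 \<le> y" "t = ennreal z" "0 \<le> z"
    using assms by (cases s; cases t) (auto simp: top_unique)
  then show ?thesis using real assms by (simp add: ennreal_minus ennreal_plus[symmetric] ennreal_le_iff del: ennreal_plus) auto
qed

section \<open>Hunt processes: measurability and the strong Markov property\<close>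

locale hunt =
  fixes X :: "('w, 'a::heine_borel) process"
  assumes hunt_process: "hunt_process X"
begin

abbreviation "N \<equiv> natural_filtration X"
abbreviation "F \<equiv> right_filtration X"

lemma space_N [simp]: "space (N t) = Om X"
  unfolding natural_filtration_def by (intro space_measure_of) auto

lemma sets_N: "sets (N t) = sigma_sets (Om X) {path X s -` B \<inter> Om X | s B. s \<le> t \<and> B \<in> sets cemetery_borel}"
  unfolding natural_filtration_def by (intro sets_measure_of) auto

lemma sets_N_mono: "s \<le> t \<Longrightarrow> sets (N s) \<subseteq> sets (N t)"
  unfolding sets_N by (intro sigma_sets_subseteq) (blast intro: order_trans)

lemma path_measurable: "s \<le> t \<Longrightarrow> path X s \<in> N t \<rightarrow>\<^sub>M cemetery_borel"
  by (rule measurableI) (auto simp: sets_N)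

lemma space_law [simp]: "space (law X y) = Om X"
  and sets_law: "sets (law X y) = sets (N top)"
  and prob_law: "prob_space (law X y)"
  using hunt_process by (auto simp: hunt_process_def markov_laws_def)

lemma measurable_law_eq [simp]: "measurable (law X y) M = measurable (N top) M"
  by (rule measurable_cong_sets) (auto simp: sets_law)

lemma path0: "AE w in law X y. path X 0 w = y"
  using hunt_process by (auto simp: hunt_process_def markov_laws_def)

lemma hunt_pathsD:
  assumes "w \<in> Om X"
  shows path_infty: "path X top w = None"
    and path_None: "lifetime X w \<le> t \<Longrightarrow> path X t w = None"
    and shift_Om: "t < top \<Longrightarrow> shift X t w \<in> Om X"
    and path_shift: "t < top \<Longrightarrow> path X s (shift X t w) = path X (t + s) w"
    and path_right: "t < top \<Longrightarrow> limitin cemetery_topology (\<lambda>s. path X s w) (path X t w) (at_right t)"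
  using hunt_process assms by (auto simp: hunt_process_def hunt_paths_def)

lemma path_None_mono: "w \<in> Om X \<Longrightarrow> path X s w = None \<Longrightarrow> s \<le> t \<Longrightarrow> path X t w = None"
  by (rule path_None) (auto simp: lifetime_def intro: Inf_lower2)

lemma limitin_ext0:
  fixes h :: "'a \<Rightarrow> real"
  assumes h: "continuous_on UNIV h" and l: "limitin cemetery_topology f (Some x) G"
  shows "((\<lambda>s. ext0 h (f s)) \<longlongrightarrow> h x) G"
proof (rule topological_tendstoI)
  fix S assume S: "open S" "h x \<in> S"
  then have "open (h -` S)" using h by (simp add: open_vimage continuous_on_eq_continuous_at)
  then have "openin cemetery_topology (Some ` (h -` S))" by simp
  then have "\<forall>\<^sub>F s in G. f s \<in> Some ` (h -` S)" using l S by (auto simp: limitin_def)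
  then show "\<forall>\<^sub>F s in G. ext0 h (f s) \<in> S" by eventually_elim auto
qed

text \<open>\<open>h\<close> may be nonzero at infinity, so \<open>ext0 h\<close> can be
  discontinuous at the cemetery. The right limit exists nevertheless: a dead path stays dead, and at
  a live time the limit is a live point, near which \<open>h\<close> is continuous.\<close>

lemma path_right_ext0:
  fixes h :: "'a \<Rightarrow> real"
  assumes w: "w \<in> Om X" and t: "t < top" and h: "continuous_on UNIV h"
  shows "((\<lambda>s. ext0 h (path X s w)) \<longlongrightarrow> ext0 h (path X t w)) (at_right t)"
proof (cases "path X t w")
  case None
  have "\<forall>\<^sub>F s in at_right t. ext0 h (path X s w) = ext0 h (path X t w)"
    unfolding eventually_at_topological
  proof (intro exI[of _ UNIV] conjI ballI impI)
    fix s assume "s \<in> {t<..}"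
    then have "path X s w = None" by (intro path_None_mono[OF w None]) auto
    then show "ext0 h (path X s w) = ext0 h (path X t w)" using None by simp
  qed auto
  then show ?thesis by (rule tendsto_eventually)
next
  case (Some x)
  then show ?thesis using limitin_ext0[OF h, of "\<lambda>s. path X s w" x "at_right t"] path_right[OF w t] by simp
qed

text \<open>The path at time t is the limit of its values at dyadic times strictly after t. These
  look slightly beyond \<open>s\<close>, which is why the \<sigma>-algebra is that of some later
  \<open>s'\<close>, at which the dyadic times are cut off; the loss disappears in the
  right-continuous filtration.\<close>

lemma progressive_measurable:
  assumes s: "s < s' \<or> s' = top"
  shows "(\<lambda>(t::real, w). path X (min (ennreal t) s) w) \<in> borel \<Otimes>\<^sub>M N s' \<rightarrow>\<^sub>M cemetery_borel"
  unfolding case_prod_beta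
proof (rule measurable_cemeteryI)
  fix U :: "'a set" assume U: "open U"
  define h where "h = dist_compl U"
  define v where "v t = enn2real (min (ennreal t) s)" for t :: real
  have v: "ennreal (v t) = min (ennreal t) s" for t
    unfolding v_def by (intro ennreal_enn2real) (simp add: min.strict_coboundedI1)
  have [measurable]: "v \<in> borel_measurable borel" unfolding v_def by measurable
  have v0: "0 \<le> v t" for t by (simp add: v_def)
  define g where "g k p = ext0 h (path X (min (ennreal (next_dyadic k (v (fst p)))) s') (snd p))" for k and p :: "real \<times> 'w"
  have [measurable]: "ext0 h \<in> borel_measurable cemetery_borel"
    unfolding h_def by (intro measurable_ext0) simp
  have gm: "g k \<in> borel_measurable (borel \<Otimes>\<^sub>M N s')" for k
  proof -
    have "(\<lambda>p. (\<lambda>i q. ext0 h (path X (min (ennreal ((of_int i + 1) / 2 ^ k)) s') (snd q))) (\<lfloor>v (fst p) * 2 ^ k\<rfloor>) p)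
       \<in> borel_measurable (borel \<Otimes>\<^sub>M N s')"
    proof (rule measurable_compose_countable[where f="\<lambda>i q. ext0 h (path X (min (ennreal ((of_int i + 1) / 2 ^ k)) s') (snd q))"
          and g="\<lambda>p. \<lfloor>v (fst p) * 2 ^ k\<rfloor>"])
      show "(\<lambda>q. ext0 h (path X (min (ennreal ((of_int i + 1) / 2 ^ k)) s') (snd q))) \<in> borel_measurable (borel \<Otimes>\<^sub>M N s')" for i :: int
        using path_measurable[of "min (ennreal ((of_int i + 1) / 2 ^ k)) s'" s'] by measurable
      show "(\<lambda>p. \<lfloor>v (fst p) * 2 ^ k\<rfloor>) \<in> borel \<Otimes>\<^sub>M N s' \<rightarrow>\<^sub>M count_space UNIV" by measurable
    qed
    then show ?thesis by (simp add: g_def[abs_def] next_dyadic_def)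
  qed
  have lim: "(\<lambda>k. g k p) \<longlonglongrightarrow> ext0 h (path X (min (ennreal (fst p)) s) (snd p))" if "p \<in> space (borel \<Otimes>\<^sub>M N s')" for p
  proof -
    have w: "snd p \<in> Om X" using that by (auto simp: space_pair_measure)
    let ?u = "min (ennreal (fst p)) s"
    have u: "?u < top" by (simp add: min.strict_coboundedI1)
    have us': "?u < s'" using s u by (auto simp: min_less_iff_disj)
    have "filterlim (\<lambda>k. min (ennreal (next_dyadic k (v (fst p)))) s') (at_right ?u) sequentially"
    proof (rule tendsto_imp_filterlim_at_right)
      have "(\<lambda>k. min (ennreal (next_dyadic k (v (fst p)))) s') \<longlonglongrightarrow> min (ennreal (v (fst p))) s'"
        by (intro tendsto_min tendsto_const tendsto_ennrealI next_dyadic_tendsto)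
      also have "min (ennreal (v (fst p))) s' = ?u" unfolding v by (rule min_absorb1[OF less_imp_le[OF us']])
      finally show "(\<lambda>k. min (ennreal (next_dyadic k (v (fst p)))) s') \<longlonglongrightarrow> ?u" .
      have "?u < min (ennreal (next_dyadic k (v (fst p)))) s'" for k
        using next_dyadic_gt[of "v (fst p)" k] v0[of "fst p"] us' by (simp add: v[symmetric] ennreal_less_iff)
      then show "\<forall>\<^sub>F k in sequentially. ?u < min (ennreal (next_dyadic k (v (fst p)))) s'" by simp
    qed
    from filterlim_compose[OF path_right_ext0[OF w u, of h] this] show ?thesis
      by (simp add: g_def h_def continuous_dist_compl)
  qed
  have "(\<lambda>p. ext0 h (path X (min (ennreal (fst p)) s) (snd p))) \<in> borel_measurable (borel \<Otimes>\<^sub>M N s')"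
    by (rule borel_measurable_LIMSEQ_metric[OF gm lim])
  then have "{p\<in>space (borel \<Otimes>\<^sub>M N s'). 0 < ext0 h (path X (min (ennreal (fst p)) s) (snd p))} \<in> sets (borel \<Otimes>\<^sub>M N s')"
    by measurable
  moreover have "0 < ext0 h y \<longleftrightarrow> y \<in> Some ` U" for y
    by (cases y) (auto simp: h_def dist_compl_pos_iff[OF U])
  ultimately show "{p\<in>space (borel \<Otimes>\<^sub>M N s'). path X (min (ennreal (fst p)) s) (snd p) \<in> Some ` U} \<in> sets (borel \<Otimes>\<^sub>M N s')"
    by simp
qed

lemma path_joint_measurable:
  "(\<lambda>(t::real, w). path X (ennreal t) w) \<in> borel \<Otimes>\<^sub>M N top \<rightarrow>\<^sub>M cemetery_borel"
  using progressive_measurable[of top top] by simp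

lemma path_min_measurable:
  assumes \<rho>: "\<rho> \<in> borel_measurable (N s')" and s: "s < s' \<or> s' = top" "s < top"
  shows "(\<lambda>w. path X (min (\<rho> w) s) w) \<in> N s' \<rightarrow>\<^sub>M cemetery_borel"
proof -
  have "min (ennreal (enn2real (min (\<rho> w) s))) s = min (\<rho> w) s" for w
    using s by (subst ennreal_enn2real) (auto simp: min_less_iff_disj)
  moreover have "(\<lambda>w. (case (enn2real (min (\<rho> w) s), w) of (t, w) \<Rightarrow> path X (min (ennreal t) s) w)) \<in> N s' \<rightarrow>\<^sub>M cemetery_borel"
    by (rule measurable_compose[OF _ progressive_measurable[OF s(1)]]) (use \<rho> in measurable)
  ultimately show ?thesis by simp
qed

lemma path_random_measurable:
  assumes \<rho>[measurable]: "\<rho> \<in> borel_measurable (N top)"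
  shows "(\<lambda>w. path X (\<rho> w) w) \<in> N top \<rightarrow>\<^sub>M cemetery_borel"
proof -
  have [measurable]: "(\<lambda>w. path X (ennreal (enn2real (\<rho> w))) w) \<in> N top \<rightarrow>\<^sub>M cemetery_borel"
  proof -
    have "(\<lambda>w. (enn2real (\<rho> w), w)) \<in> N top \<rightarrow>\<^sub>M borel \<Otimes>\<^sub>M N top" by measurable
    from measurable_compose[OF this path_joint_measurable] show ?thesis by simp
  qed
  have [measurable]: "(\<lambda>w. None) \<in> N top \<rightarrow>\<^sub>M (cemetery_borel :: 'a option measure)" by simp
  have "(\<lambda>w. if \<rho> w < top then path X (ennreal (enn2real (\<rho> w))) w else None) \<in> N top \<rightarrow>\<^sub>M cemetery_borel"
    by measurable
  then show ?thesis
    by (rule measurable_cong[THEN iffD1, rotated]) (auto simp: path_infty less_top[symmetric])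
qed

lemma space_F [simp]: "space (F t) = Om X"
  unfolding right_filtration_def using sets.sets_into_space[of _ "N top"] by (intro space_measure_of) auto

lemma sets_F: "sets (F t) = (\<Inter>s\<in>insert top {t<..}. sets (N s))"
proof -
  have "sigma_algebra (Om X) (\<Inter>s\<in>insert top {t<..}. sets (N s))"
    unfolding sigma_algebra_iff2
  proof (intro conjI ballI allI impI)
    show "(\<Inter>s\<in>insert top {t<..}. sets (N s)) \<subseteq> Pow (Om X)"
      using sets.sets_into_space[of _ "N top"] by auto
    show "Om X - A \<in> (\<Inter>s\<in>insert top {t<..}. sets (N s))" if "A \<in> (\<Inter>s\<in>insert top {t<..}. sets (N s))" for A
      using that sets.compl_sets[of A "N _"] by simp
    show "\<Union> (range A) \<in> (\<Inter>s\<in>insert top {t<..}. sets (N s))"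
      if "range A \<subseteq> (\<Inter>s\<in>insert top {t<..}. sets (N s))" for A :: "nat \<Rightarrow> 'w set"
      using that by (intro INT_I sets.countable_UN) blast
  qed auto
  then show ?thesis
    unfolding right_filtration_def infinity_ennreal_def by (rule sigma_algebra.sets_measure_of_eq)
qed

lemma filtration_F: "filtration (Om X) F"
proof
  show "sets (F i) \<subseteq> sets (F j)" if "i \<le> j" for i j
    unfolding sets_F using that by (intro INF_superset_mono) auto
qed simp

abbreviation "Fpre \<equiv> filtration.pre_sigma (Om X) F"

lemmas space_Fpre [simp] = filtration.space_pre_sigma[OF filtration_F]

lemma measurable_FD:
  assumes f: "f \<in> F t \<rightarrow>\<^sub>M M" and s: "t < s \<or> s = top" shows "f \<in> N s \<rightarrow>\<^sub>M M"
proof (rule measurableI)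
  show "f x \<in> space M" if "x \<in> space (N s)" for x
    using measurable_space[OF f] that by simp
  show "f -` A \<inter> space (N s) \<in> sets (N s)" if "A \<in> sets M" for A
    using measurable_sets[OF f that] s by (auto simp: sets_F)
qed

lemma stopping_measurable:
  assumes "stopping_time F \<rho>" shows "\<rho> \<in> borel_measurable (N top)"
  by (rule measurable_stopping_time[OF assms]) (auto simp: sets_F)

lemma Fpre_sub: 
  assumes "stopping_time F \<rho>" shows "sets (Fpre \<rho>) \<subseteq> sets (N top)"
proof
  fix A assume A: "A \<in> sets (Fpre \<rho>)"
  have "{w\<in>A. \<rho> w \<le> top} \<in> sets (F top)"
    by (rule filtration.sets_pre_sigmaD[OF filtration_F assms A])
  then show "A \<in> sets (N top)" by (simp add: sets_F)
qed

lemma stopping_min_measurable: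
  assumes "stopping_time F \<rho>" "t < s" shows "(\<lambda>w. min (\<rho> w) t) \<in> borel_measurable (N s)"
proof (rule borel_measurableI_le)
  fix q
  have "{x \<in> Om X. \<rho> x \<le> q} \<in> sets (N s)" if "q < t"
    using stopping_timeD[OF assms(1), of q] that assms(2) by (auto simp: pred_def sets_F)
  moreover have "{x \<in> space (N s). min (\<rho> x) t \<le> q} = (if q < t then {x \<in> Om X. \<rho> x \<le> q} else space (N s))"
    by (auto simp: min_le_iff_disj)
  ultimately show "{x \<in> space (N s). min (\<rho> x) t \<le> q} \<in> sets (N s)" by (auto simp del: space_N)
qed

text \<open>On the event that \<rho> is at most t, the position at \<rho> equals the position at
  \<open>min (\<rho> w) t\<close>, which is measurable for every \<sigma>-algebra \<open>N s\<close>
  with s > t.\<close>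

lemma path_stopping_sets:
  assumes \<rho>: "stopping_time F \<rho>" and \<Lambda>: "\<Lambda> \<in> sets (Fpre \<rho>)" and B: "B \<in> sets cemetery_borel"
  shows "{w\<in>\<Lambda>. path X (\<rho> w) w \<in> B} \<in> sets (Fpre \<rho>)"
proof (rule filtration.sets_pre_sigmaI[OF filtration_F \<rho>])
  fix t
  have sub: "\<Lambda> \<subseteq> Om X" using \<Lambda> sets.sets_into_space[of \<Lambda> "Fpre \<rho>"] by simp
  have "{w \<in> {w \<in> \<Lambda>. path X (\<rho> w) w \<in> B}. \<rho> w \<le> t} \<in> sets (N s)" if s: "t < s \<or> s = top" for s
  proof (cases "t = top")
    case True
    then have "s = top" using s by auto
    have "{w\<in>Om X. path X (\<rho> w) w \<in> B} \<in> sets (N top)"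
      using measurable_sets[OF path_random_measurable[OF stopping_measurable[OF \<rho>]] B] by (simp add: vimage_def Int_def conj_commute)
    then have "\<Lambda> \<inter> {w\<in>Om X. path X (\<rho> w) w \<in> B} \<in> sets (N top)" using \<Lambda> Fpre_sub[OF \<rho>] by auto
    also have "\<Lambda> \<inter> {w\<in>Om X. path X (\<rho> w) w \<in> B} = {w \<in> {w \<in> \<Lambda>. path X (\<rho> w) w \<in> B}. \<rho> w \<le> t}"
      using sub True by auto
    finally show ?thesis using \<open>s = top\<close> by simp
  next
    case False
    then have t: "t < top" "t < s" using s by (auto simp: less_top)
    have "(\<lambda>w. path X (min (min (\<rho> w) t) t) w) \<in> N s \<rightarrow>\<^sub>M cemetery_borel"
      by (rule path_min_measurable[OF stopping_min_measurable[OF \<rho>]]) (use t in auto)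
    from measurable_sets[OF this B] have "{w\<in>Om X. path X (min (\<rho> w) t) w \<in> B} \<in> sets (N s)"
      by (simp add: vimage_def Int_def conj_commute)
    moreover have "{w\<in>\<Lambda>. \<rho> w \<le> t} \<in> sets (N s)"
      using filtration.sets_pre_sigmaD[OF filtration_F \<rho> \<Lambda>, of t] t by (auto simp: sets_F)
    ultimately have "{w\<in>\<Lambda>. \<rho> w \<le> t} \<inter> {w\<in>Om X. path X (min (\<rho> w) t) w \<in> B} \<in> sets (N s)" by auto
    also have "{w\<in>\<Lambda>. \<rho> w \<le> t} \<inter> {w\<in>Om X. path X (min (\<rho> w) t) w \<in> B} = {w \<in> {w \<in> \<Lambda>. path X (\<rho> w) w \<in> B}. \<rho> w \<le> t}"
      using sub by (auto simp: min_def)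
    finally show ?thesis .
  qed
  then show "{w \<in> {w \<in> \<Lambda>. path X (\<rho> w) w \<in> B}. \<rho> w \<le> t} \<in> sets (F t)"
    by (auto simp: sets_F)
qed

lemma stopping_time_add:
  assumes "stopping_time F \<rho>" shows "stopping_time F (\<lambda>w. \<rho> w + s)"
proof (rule stopping_timeI)
  fix t
  show "Measurable.pred (F t) (\<lambda>w. \<rho> w + s \<le> t)"
  proof (cases "s \<le> t")
    case True
    show ?thesis
    proof (cases "t = top")
      case True then show ?thesis by simp
    next
      case False
      then have "\<rho> w + s \<le> t \<longleftrightarrow> \<rho> w \<le> t - s" for w
        using True by (intro ennreal_add_le_iff_le_diff)
      then show ?thesis
        using filtration.stopping_time_le_const[OF filtration_F assms, of "t - s" t] by (simp add: diff_le_self_ennreal)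
    qed
  next
    case False
    then have "\<not> \<rho> w + s \<le> t" for w
      by (metis add.commute dual_order.trans le_iff_add)
    then show ?thesis by simp
  qed
qed

end

text \<open>The image of the measure with density \<open>v\<close> under \<phi>, and the mixture of
  the kernels \<open>K w\<close> with weight \<open>v\<close>, are finite measures that agree on an
  intersection-stable generator, hence are equal. Markov properties stated for sets pass to
  functions this way.\<close>

lemma kernel_transfer:
  fixes g :: "'b \<Rightarrow> ennreal"
  assumes v: "v \<in> borel_measurable M" and \<phi>: "\<phi> \<in> M \<rightarrow>\<^sub>M S" and K: "K \<in> M \<rightarrow>\<^sub>M subprob_algebra S"
    and ne: "space M \<noteq> {}"
    and fin: "(\<integral>\<^sup>+w. v w \<partial>M) < top"
    and G: "Int_stable G" "sets S = sigma_sets (space S) G" "space S \<in> G"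
    and eq: "\<And>A. A \<in> G \<Longrightarrow> (\<integral>\<^sup>+w. v w * indicator A (\<phi> w) \<partial>M) = (\<integral>\<^sup>+w. v w * emeasure (K w) A \<partial>M)"
    and g: "g \<in> borel_measurable S"
  shows "(\<integral>\<^sup>+w. v w * g (\<phi> w) \<partial>M) = (\<integral>\<^sup>+w. v w * (\<integral>\<^sup>+x. g x \<partial>K w) \<partial>M)"
proof -
  note [measurable] = v \<phi> K g
  have K': "K \<in> density M v \<rightarrow>\<^sub>M subprob_algebra S" using K by simp
  have "distr (density M v) S \<phi> = density M v \<bind> K"
  proof (rule measure_eqI_generator_eq[OF G(1)])
    have sb: "sets (density M v \<bind> K) = sets S"
      using sets_bind[OF sets_kernel[OF K'], of "density M v"] ne by simp
    show "G \<subseteq> Pow (space S)"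
      using G(2) sets.space_closed[of S] by (auto intro: sigma_sets.Basic)
    show "sets (distr (density M v) S \<phi>) = sigma_sets (space S) G" using G(2) by simp
    show "sets (density M v \<bind> K) = sigma_sets (space S) G" using G(2) sb by simp
    show "range (\<lambda>_::nat. space S) \<subseteq> G" "(\<Union>i::nat. space S) = space S" using G(3) by auto
    have "emeasure (distr (density M v) S \<phi>) (space S) = (\<integral>\<^sup>+w. v w \<partial>M)"
      using measurable_space[OF \<phi>]
      by (auto simp: emeasure_distr emeasure_density intro!: nn_integral_cong split: split_indicator)
    then show "emeasure (distr (density M v) S \<phi>) (space S) \<noteq> \<infinity>" for i :: nat using fin by simp
    fix A assume "A \<in> G"
    then have A[measurable]: "A \<in> sets S" using G(2) by (auto intro: sigma_sets.Basic)
    have [measurable]: "(\<lambda>w. emeasure (K w) A) \<in> borel_measurable M"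
      using measurable_emeasure_subprob_algebra[OF A] K by (rule measurable_compose[rotated])
    have [measurable]: "(\<lambda>w. indicator A (\<phi> w) :: ennreal) \<in> borel_measurable M" by measurable
    have "emeasure (distr (density M v) S \<phi>) A = (\<integral>\<^sup>+w. indicator A w \<partial>distr (density M v) S \<phi>)" by simp
    also have "\<dots> = (\<integral>\<^sup>+w. v w * indicator A (\<phi> w) \<partial>M)"
      by (subst nn_integral_distr) (auto simp: nn_integral_density)
    also have "\<dots> = (\<integral>\<^sup>+w. emeasure (K w) A \<partial>density M v)"
      by (subst eq[OF \<open>A \<in> G\<close>]) (auto simp: nn_integral_density)
    also have "\<dots> = emeasure (density M v \<bind> K) A"
      using ne by (subst emeasure_bind[OF _ K' A]) auto
    finally show "emeasure (distr (density M v) S \<phi>) A = emeasure (density M v \<bind> K) A" .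
  qed
  then have "(\<integral>\<^sup>+x. g x \<partial>distr (density M v) S \<phi>) = (\<integral>\<^sup>+x. g x \<partial>(density M v \<bind> K))" by simp
  also have "\<dots> = (\<integral>\<^sup>+w. (\<integral>\<^sup>+x. g x \<partial>K w) \<partial>density M v)"
    by (rule nn_integral_bind[OF g K'])
  also have "\<dots> = (\<integral>\<^sup>+w. v w * (\<integral>\<^sup>+x. g x \<partial>K w) \<partial>M)"
    by (rule nn_integral_density) (use nn_integral_measurable_subprob_algebra[OF g] K in \<open>auto intro: measurable_compose\<close>)
  finally show ?thesis
    by (subst (asm) nn_integral_distr) (auto simp: nn_integral_density)
qed

context hunt
begin

abbreviation \<E> :: "'a option \<Rightarrow> ('w \<Rightarrow> ennreal) \<Rightarrow> ennreal" where
  "\<E> y Z \<equiv> nn_integral (law X y) Z"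

lemma law_ne: "Om X \<noteq> {}"
  using prob_space.not_empty[OF prob_law] by simp

lemma strong_markov_path:
  assumes "stopping_time F \<sigma>" "t < top" "B \<in> sets cemetery_borel" "\<Lambda> \<in> sets (Fpre \<sigma>)"
  shows "emeasure (law X y) {w\<in>\<Lambda>. \<sigma> w < top \<and> path X (\<sigma> w + t) w \<in> B} =
        (\<E> y (\<lambda>w. indicator {w\<in>\<Lambda>. \<sigma> w < top} w *
           emeasure (law X (path X (\<sigma> w) w)) {w'\<in>Om X. path X t w' \<in> B}))"
  using hunt_process assms unfolding hunt_process_def strong_markov_def infinity_ennreal_def
  by (subst mult.commute) blast

lemma marginal_measurable:
  "B \<in> sets cemetery_borel \<Longrightarrow> (\<lambda>y. emeasure (law X y) {w\<in>Om X. path X t w \<in> B}) \<in> borel_measurable cemetery_borel"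
  using hunt_process by (auto simp: hunt_process_def markov_laws_def)

abbreviation marginal :: "ennreal \<Rightarrow> 'a option \<Rightarrow> 'a option measure" where
  "marginal t y \<equiv> distr (law X y) cemetery_borel (path X t)"

lemma path_measurable_top [measurable]: "path X t \<in> N top \<rightarrow>\<^sub>M cemetery_borel"
  by (rule path_measurable) simp

lemma marginal_kernel: "marginal t \<in> cemetery_borel \<rightarrow>\<^sub>M subprob_algebra cemetery_borel"
proof (rule measurable_subprob_algebra)
  fix y show "subprob_space (marginal t y)"
    by (intro prob_space_imp_subprob_space prob_space.prob_space_distr[OF prob_law]) simp
next
  fix B :: "'a option set" assume B: "B \<in> sets cemetery_borel"
  show "(\<lambda>y. emeasure (marginal t y) B) \<in> borel_measurable cemetery_borel"
    using marginal_measurable[OF B, of t] B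
    by (simp add: emeasure_distr vimage_def Int_def conj_commute)
qed simp

lemma nn_integral_marginal:
  "g \<in> borel_measurable cemetery_borel \<Longrightarrow> (\<integral>\<^sup>+z. g z \<partial>marginal t y) = (\<E> y (\<lambda>w. g (path X t w)))"
  by (rule nn_integral_distr) auto

lemma measurable_law_path:
  "g \<in> borel_measurable cemetery_borel \<Longrightarrow> (\<lambda>y. \<integral>\<^sup>+w. g (path X t w) \<partial>law X y) \<in> borel_measurable cemetery_borel"
  using measurable_compose[OF marginal_kernel nn_integral_measurable_subprob_algebra, of g t]
  by (simp add: nn_integral_marginal)

lemma indicator_stopping_measurable:
  assumes \<sigma>: "stopping_time F \<sigma>" and \<Lambda>: "\<Lambda> \<in> sets (Fpre \<sigma>)"
  shows "{w\<in>\<Lambda>. \<sigma> w < top} \<in> sets (Fpre \<sigma>)"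
proof -
  have "{w\<in>space (Fpre \<sigma>). \<sigma> w < top} \<in> sets (Fpre \<sigma>)"
    using filtration.measurable_stopping_time_pre_sigma[OF filtration_F \<sigma>] by measurable
  then have "\<Lambda> \<inter> {w\<in>space (Fpre \<sigma>). \<sigma> w < top} \<in> sets (Fpre \<sigma>)" using \<Lambda> by blast
  also have "\<Lambda> \<inter> {w\<in>space (Fpre \<sigma>). \<sigma> w < top} = {w\<in>\<Lambda>. \<sigma> w < top}"
    using sets.sets_into_space[OF \<Lambda>] by auto
  finally show ?thesis .
qed

lemma indicator_stopping_measurable_top:
  assumes "stopping_time F \<sigma>" "\<Lambda> \<in> sets (Fpre \<sigma>)"
  shows "(indicator {w\<in>\<Lambda>. \<sigma> w < top} :: 'w \<Rightarrow> ennreal) \<in> borel_measurable (N top)"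
  using indicator_stopping_measurable[OF assms] Fpre_sub[OF assms(1)]
  by (intro borel_measurable_indicator) auto

lemma strong_markov_path_fun:
  assumes \<sigma>: "stopping_time F \<sigma>" and t: "t < top" and \<Lambda>: "\<Lambda> \<in> sets (Fpre \<sigma>)"
    and g: "g \<in> borel_measurable cemetery_borel"
  shows "(\<E> y (\<lambda>w. indicator {w\<in>\<Lambda>. \<sigma> w < top} w * g (path X (\<sigma> w + t) w))) =
     (\<E> y (\<lambda>w. indicator {w\<in>\<Lambda>. \<sigma> w < top} w * (\<E> (path X (\<sigma> w) w) (\<lambda>w'. g (path X t w')))))"
proof -
  note [measurable] = stopping_measurable[OF \<sigma>] indicator_stopping_measurable_top[OF \<sigma> \<Lambda>]
  have m1: "(\<lambda>w. path X (\<sigma> w + t) w) \<in> N top \<rightarrow>\<^sub>M cemetery_borel"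
    by (rule path_random_measurable) simp
  have m2: "(\<lambda>w. path X (\<sigma> w) w) \<in> N top \<rightarrow>\<^sub>M cemetery_borel"
    by (rule path_random_measurable) simp
  have "(\<E> y (\<lambda>w. indicator {w\<in>\<Lambda>. \<sigma> w < top} w * g (path X (\<sigma> w + t) w))) =
     (\<E> y (\<lambda>w. indicator {w\<in>\<Lambda>. \<sigma> w < top} w * (\<integral>\<^sup>+z. g z \<partial>marginal t (path X (\<sigma> w) w))))"
  proof (rule kernel_transfer[OF _ _ _ _ _ sets.Int_stable sets.sigma_sets_eq[symmetric] sets.top _ g])
    show "(\<lambda>w. marginal t (path X (\<sigma> w) w)) \<in> law X y \<rightarrow>\<^sub>M subprob_algebra cemetery_borel"
      using measurable_compose[OF m2 marginal_kernel] by simp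
    fix A :: "'a option set" assume A: "A \<in> sets cemetery_borel"
    have S: "{w\<in>\<Lambda>. \<sigma> w < top \<and> path X (\<sigma> w + t) w \<in> A} \<in> sets (N top)"
    proof -
      have "{w\<in>\<Lambda>. \<sigma> w < top} \<in> sets (N top)"
        using indicator_stopping_measurable[OF \<sigma> \<Lambda>] Fpre_sub[OF \<sigma>] by auto
      then have "{w\<in>\<Lambda>. \<sigma> w < top} \<inter> ((\<lambda>w. path X (\<sigma> w + t) w) -` A \<inter> space (N top)) \<in> sets (N top)"
        using measurable_sets[OF m1 A] by blast
      also have "{w\<in>\<Lambda>. \<sigma> w < top} \<inter> ((\<lambda>w. path X (\<sigma> w + t) w) -` A \<inter> space (N top)) = {w\<in>\<Lambda>. \<sigma> w < top \<and> path X (\<sigma> w + t) w \<in> A}"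
        using sets.sets_into_space[OF \<Lambda>] by auto
      finally show ?thesis .
    qed
    have "(\<E> y (\<lambda>w. indicator {w\<in>\<Lambda>. \<sigma> w < top} w * indicator A (path X (\<sigma> w + t) w)))
       = (\<E> y (\<lambda>w. indicator {w\<in>\<Lambda>. \<sigma> w < top \<and> path X (\<sigma> w + t) w \<in> A} w))"
      by (intro nn_integral_cong) (auto split: split_indicator)
    also have "\<dots> = emeasure (law X y) {w\<in>\<Lambda>. \<sigma> w < top \<and> path X (\<sigma> w + t) w \<in> A}"
      using S by (intro nn_integral_indicator) (simp add: sets_law)
    also have "\<dots> = (\<E> y (\<lambda>w. indicator {w\<in>\<Lambda>. \<sigma> w < top} w * emeasure (marginal t (path X (\<sigma> w) w)) A))"
      unfolding strong_markov_path[OF \<sigma> t A \<Lambda>] using A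
      by (intro nn_integral_cong) (auto simp: emeasure_distr vimage_def Int_def conj_commute)
    finally show "(\<E> y (\<lambda>w. indicator {w\<in>\<Lambda>. \<sigma> w < top} w * indicator A (path X (\<sigma> w + t) w))) =
       (\<E> y (\<lambda>w. indicator {w\<in>\<Lambda>. \<sigma> w < top} w * emeasure (marginal t (path X (\<sigma> w) w)) A))" .
  next
    have "(\<E> y (\<lambda>w. indicator {w\<in>\<Lambda>. \<sigma> w < top} w)) \<le> (\<E> y (\<lambda>w. 1))"
      by (intro nn_integral_mono) (simp split: split_indicator)
    also have "\<dots> < top" using prob_space.emeasure_space_1[OF prob_law[of y]] by simp
    finally show "(\<E> y (\<lambda>w. indicator {w\<in>\<Lambda>. \<sigma> w < top} w)) < top" .
  qed (use m1 law_ne in simp_all)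
  then show ?thesis by (simp add: nn_integral_marginal[OF g])
qed

section \<open>Strong Markov property for functionals of the whole path\<close>

definition cylinder :: "ennreal set \<Rightarrow> (ennreal \<Rightarrow> 'a option set) \<Rightarrow> 'w set" where
  "cylinder T B = {w\<in>Om X. \<forall>t\<in>T. path X t w \<in> B t}"

lemma cylinder_sets:
  assumes "finite T" "\<And>t. B t \<in> sets cemetery_borel" shows "cylinder T B \<in> sets (N top)"
proof -
  have "cylinder T B = (if T = {} then Om X else (\<Inter>t\<in>T. path X t -` B t \<inter> Om X))" by (auto simp: cylinder_def)
  moreover have "path X t -` B t \<inter> Om X \<in> sets (N top)" for t
    using measurable_sets[OF path_measurable_top assms(2)] by simp
  ultimately show ?thesis using assms(1) sets.top[of "N top"]
    by (auto simp del: INT_simps intro!: sets.finite_INT)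
qed

text \<open>Measurability in the starting point and the strong Markov property are bundled because
  an induction over cylinders needs each to prove the other.\<close>

definition markov_set :: "'w set \<Rightarrow> bool" where
  "markov_set A \<longleftrightarrow> A \<in> sets (N top) \<and>
     (\<lambda>y. emeasure (law X y) A) \<in> borel_measurable cemetery_borel \<and>
     (\<forall>\<sigma> \<Lambda> y. stopping_time F \<sigma> \<longrightarrow> \<Lambda> \<in> sets (Fpre \<sigma>) \<longrightarrow>
        emeasure (law X y) {w\<in>\<Lambda>. \<sigma> w < top \<and> shift X (\<sigma> w) w \<in> A} =
        (\<E> y (\<lambda>w. indicator {w\<in>\<Lambda>. \<sigma> w < top} w * emeasure (law X (path X (\<sigma> w) w)) A)))"

text \<open>Split off the smallest time \<open>s\<close> of the cylinder. The remaining times,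
  shifted back by \<open>s\<close>, form a smaller cylinder, to which the strong Markov property at
  \<sigma> + s applies by induction; what is left is a function \<open>g\<close> of the single
  position at \<sigma> + s. Taking \<sigma> = 0 gives the law of the cylinder itself.\<close>

lemma markov_set_cylinder:
  assumes "finite T" "T \<subseteq> {..<top}" "\<And>t. B t \<in> sets cemetery_borel"
  shows "markov_set (cylinder T B)"
  using assms
proof (induction "card T" arbitrary: T B)
  case 0
  then have [simp]: "cylinder T B = Om X" by (auto simp: cylinder_def)
  have e: "emeasure (law X y) (Om X) = 1" for y
    using prob_space.emeasure_space_1[OF prob_law[of y]] by simp
  show ?case unfolding markov_set_def
  proof (intro conjI allI impI)
    show "cylinder T B \<in> sets (N top)" using sets.top[of "N top"] by simp
    fix \<sigma> \<Lambda> y assume \<sigma>: "stopping_time F \<sigma>" and \<Lambda>: "\<Lambda> \<in> sets (Fpre \<sigma>)"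
    have "{w\<in>\<Lambda>. \<sigma> w < top \<and> shift X (\<sigma> w) w \<in> cylinder T B} = {w\<in>\<Lambda>. \<sigma> w < top}"
      using sets.sets_into_space[OF \<Lambda>] by (auto intro: shift_Om simp del: infinity_ennreal_def simp: infinity_ennreal_def[symmetric])
    moreover have "{w\<in>\<Lambda>. \<sigma> w < top} \<in> sets (law X y)"
      using indicator_stopping_measurable[OF \<sigma> \<Lambda>] Fpre_sub[OF \<sigma>] by (auto simp: sets_law)
    ultimately show "emeasure (law X y) {w\<in>\<Lambda>. \<sigma> w < top \<and> shift X (\<sigma> w) w \<in> cylinder T B} =
        (\<E> y (\<lambda>w. indicator {w\<in>\<Lambda>. \<sigma> w < top} w * emeasure (law X (path X (\<sigma> w) w)) (cylinder T B)))"
      by (simp add: e)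
  qed (simp add: e)
next
  case (Suc n)
  define s where "s = Min T"
  have T: "finite T" "T \<noteq> {}" using Suc by auto
  have s: "s \<in> T" "\<And>t. t \<in> T \<Longrightarrow> s \<le> t" using T by (auto simp: s_def)
  have st: "s < top" using s Suc by auto
  define T' where "T' = (\<lambda>t. t - s) ` (T - {s})"
  define B' where "B' t = B (s + t)" for t
  have diff: "s + (t - s) = t" if "t \<in> T" for t
    using s(2)[OF that] by (rule add_diff_inverse_ennreal)
  have inj: "inj_on (\<lambda>t. t - s) (T - {s})"
    by (rule inj_onI) (metis DiffD1 diff)
  have IH: "markov_set (cylinder T' B')"
  proof (rule Suc.hyps(1))
    show "n = card T'" unfolding T'_def card_image[OF inj] using Suc.hyps(2) s T by simp
    show "T' \<subseteq> {..<top}" unfolding T'_def using Suc.prems(2) by (auto intro: le_less_trans[OF diff_le_self_ennreal])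
  qed (use T Suc.prems in \<open>auto simp: T'_def B'_def\<close>)
  have Ts: "(\<forall>t\<in>T. P t) \<longleftrightarrow> P s \<and> (\<forall>t\<in>T'. P (s + t))" for P
  proof -
    have "(\<forall>t\<in>T'. P (s + t)) \<longleftrightarrow> (\<forall>t\<in>T - {s}. P t)"
      by (auto simp: T'_def diff)
    then show ?thesis using s(1) by blast
  qed
  have shift_cyl: "shift X (\<sigma> w) w \<in> cylinder T B \<longleftrightarrow>
      path X (\<sigma> w + s) w \<in> B s \<and> shift X (\<sigma> w + s) w \<in> cylinder T' B'"
    if "w \<in> Om X" "\<sigma> w < top" for \<sigma> w
  proof -
    have "\<sigma> w + s < top" using that st by (simp add: ennreal_add_less_top)
    then show ?thesis
      unfolding cylinder_def using that shift_Om[of w] path_shift[of w]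
      by (simp add: Ts B'_def add.assoc)
  qed
  note IHm = IH[unfolded markov_set_def, THEN conjunct2, THEN conjunct1]
  note IHs = IH[unfolded markov_set_def, THEN conjunct2, THEN conjunct2, rule_format]
  define g where "g z = indicator (B s) z * emeasure (law X z) (cylinder T' B')" for z
  have g: "g \<in> borel_measurable cemetery_borel"
    unfolding g_def using IHm Suc.prems(3)[of s] by measurable
  have step: "emeasure (law X y) {w\<in>\<Lambda>. \<sigma> w < top \<and> shift X (\<sigma> w) w \<in> cylinder T B} =
        (\<E> y (\<lambda>w. indicator {w\<in>\<Lambda>. \<sigma> w < top} w * g (path X (\<sigma> w + s) w)))"
    if \<sigma>: "stopping_time F \<sigma>" and \<Lambda>: "\<Lambda> \<in> sets (Fpre \<sigma>)" for \<sigma> \<Lambda> y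
  proof -
    have sub: "\<Lambda> \<subseteq> Om X" using sets.sets_into_space[OF \<Lambda>] by simp
    have \<sigma>s: "stopping_time F (\<lambda>w. \<sigma> w + s)" by (rule stopping_time_add[OF \<sigma>])
    define \<Lambda>' where "\<Lambda>' = {w\<in>\<Lambda>. path X (\<sigma> w + s) w \<in> B s}"
    have "\<Lambda> \<in> sets (Fpre (\<lambda>w. \<sigma> w + s))"
      using filtration.mono_pre_sigma[OF filtration_F \<sigma> \<sigma>s] \<Lambda> by auto
    then have \<Lambda>': "\<Lambda>' \<in> sets (Fpre (\<lambda>w. \<sigma> w + s))"
      unfolding \<Lambda>'_def by (intro path_stopping_sets \<sigma>s Suc.prems)
    have fin: "\<sigma> w + s < top \<longleftrightarrow> \<sigma> w < top" for w using st by (simp add: ennreal_add_less_top)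
    have "{w\<in>\<Lambda>. \<sigma> w < top \<and> shift X (\<sigma> w) w \<in> cylinder T B}
        = {w\<in>\<Lambda>'. \<sigma> w + s < top \<and> shift X (\<sigma> w + s) w \<in> cylinder T' B'}"
      unfolding \<Lambda>'_def fin using sub shift_cyl[of _ \<sigma>] by auto
    then have "emeasure (law X y) {w\<in>\<Lambda>. \<sigma> w < top \<and> shift X (\<sigma> w) w \<in> cylinder T B} =
       (\<E> y (\<lambda>w. indicator {w\<in>\<Lambda>'. \<sigma> w + s < top} w * emeasure (law X (path X (\<sigma> w + s) w)) (cylinder T' B')))"
      using IHs[OF \<sigma>s \<Lambda>'] by simp
    also have "\<dots> = (\<E> y (\<lambda>w. indicator {w\<in>\<Lambda>. \<sigma> w < top} w * g (path X (\<sigma> w + s) w)))"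
      by (intro nn_integral_cong) (auto simp: g_def \<Lambda>'_def st ennreal_add_less_top split: split_indicator)
    finally show ?thesis .
  qed
  have start: "emeasure (law X y) (cylinder T B) = (\<E> y (\<lambda>w. g (path X s w)))" for y
  proof -
    have st0: "stopping_time F (\<lambda>_. 0)" by (rule stopping_time_const)
    have L: "Om X \<in> sets (Fpre (\<lambda>_. 0))" using sets.top[of "Fpre (\<lambda>_. 0)"] by simp
    \<comment> \<open>\<open>shift X 0\<close> is not assumed to be the identity, but it leaves all
      positions unchanged, and a cylinder depends on positions only.\<close>
    have "{w\<in>Om X. 0 < (top::ennreal) \<and> shift X 0 w \<in> cylinder T B} = cylinder T B"
      using shift_Om[of _ 0] path_shift[of _ 0] by (auto simp: cylinder_def)
    with step[OF st0 L, of y] show ?thesis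
      by (simp cong: nn_integral_cong_simp)
  qed
  show ?case unfolding markov_set_def
  proof (intro conjI allI impI)
    show "cylinder T B \<in> sets (N top)" using T Suc.prems by (intro cylinder_sets) auto
    show "(\<lambda>y. emeasure (law X y) (cylinder T B)) \<in> borel_measurable cemetery_borel"
      unfolding start by (rule measurable_law_path[OF g])
    fix \<sigma> \<Lambda> y assume \<sigma>: "stopping_time F \<sigma>" and \<Lambda>: "\<Lambda> \<in> sets (Fpre \<sigma>)"
    show "emeasure (law X y) {w\<in>\<Lambda>. \<sigma> w < top \<and> shift X (\<sigma> w) w \<in> cylinder T B} =
        (\<E> y (\<lambda>w. indicator {w\<in>\<Lambda>. \<sigma> w < top} w * emeasure (law X (path X (\<sigma> w) w)) (cylinder T B)))"
      unfolding step[OF \<sigma> \<Lambda>] start by (rule strong_markov_path_fun[OF \<sigma> st \<Lambda> g])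
  qed
qed

abbreviation "cylinders \<equiv> {cylinder T B |T B. finite T \<and> T \<subseteq> {..<top} \<and> (\<forall>t. B t \<in> sets cemetery_borel)}"

lemma sets_N_top_cylinder:
  "sets (N top) = sigma_sets (Om X) {cylinder T B |T B. finite T \<and> T \<subseteq> {..<top} \<and> (\<forall>t. B t \<in> sets cemetery_borel)}"
    (is "_ = sigma_sets _ ?C")
  unfolding sets_N
proof (rule sigma_sets_eqI)
  fix A assume "A \<in> {path X s -` B \<inter> Om X |s B. s \<le> top \<and> B \<in> sets cemetery_borel}"
  then obtain s B where A: "A = path X s -` B \<inter> Om X" "B \<in> sets cemetery_borel" by auto
  show "A \<in> sigma_sets (Om X) ?C"
  proof (cases "s = top")
    case True
    then have "A = (if None \<in> B then Om X else {})" using A path_infty by auto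
    moreover have "Om X \<in> sigma_sets (Om X) ?C" by (rule sigma_sets_top)
    ultimately show ?thesis by (auto intro: sigma_sets.Empty)
  next
    case False
    then have "A = cylinder {s} (\<lambda>_. B)" using A by (auto simp: cylinder_def)
    moreover have "cylinder {s} (\<lambda>_. B) \<in> ?C" using A False by (auto simp: less_top intro!: exI[of _ "{s}"] exI[of _ "\<lambda>_. B"])
    ultimately show ?thesis by auto
  qed
next
  fix A assume "A \<in> ?C"
  then have "A \<in> sets (N top)" using cylinder_sets by auto
  then show "A \<in> sigma_sets (Om X) {path X s -` B \<inter> Om X |s B. s \<le> top \<and> B \<in> sets cemetery_borel}"
    by (simp add: sets_N)
qed

lemma Int_stable_cylinders: "Int_stable cylinders"
proof (rule Int_stableI)
  fix a b assume "a \<in> cylinders" "b \<in> cylinders"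
  then obtain T B T' B' where *: "a = cylinder T B" "b = cylinder T' B'" "finite T" "finite T'" "T \<subseteq> {..<top}" "T' \<subseteq> {..<top}"
    "\<forall>t. B t \<in> sets cemetery_borel" "\<forall>t. B' t \<in> sets cemetery_borel" by auto
  have "a \<inter> b = cylinder (T \<union> T') (\<lambda>t. (if t \<in> T then B t else UNIV) \<inter> (if t \<in> T' then B' t else UNIV))"
    by (auto simp: * cylinder_def)
  moreover have "UNIV \<in> sets (cemetery_borel :: 'a option measure)" using sets.top[of "cemetery_borel :: 'a option measure"] by simp
  then have "\<forall>t. (if t \<in> T then B t else UNIV) \<inter> (if t \<in> T' then B' t else UNIV) \<in> sets cemetery_borel"
    using * by auto
  ultimately show "a \<inter> b \<in> cylinders" using * by blast
qed

lemma Om_cylinders: "Om X \<in> cylinders"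
proof -
  have "UNIV \<in> sets (cemetery_borel :: 'a option measure)" using sets.top[of "cemetery_borel :: 'a option measure"] by simp
  moreover have "cylinder {} (\<lambda>_. UNIV) = Om X" by (simp add: cylinder_def)
  ultimately show ?thesis by (intro CollectI exI[of _ "{}"] exI[of _ "\<lambda>_. UNIV"]) auto
qed

lemma law_kernel: "law X \<in> cemetery_borel \<rightarrow>\<^sub>M subprob_algebra (N top)"
proof (rule measurable_subprob_algebra_generated[OF sets_N_top_cylinder Int_stable_cylinders])
  show "cylinders \<subseteq> Pow (Om X)" by (auto simp: cylinder_def)
  show "(\<lambda>y. emeasure (law X y) A) \<in> borel_measurable cemetery_borel" if "A \<in> cylinders" for A
    using that markov_set_cylinder by (auto simp: markov_set_def)
  show "(\<lambda>y. emeasure (law X y) (Om X)) \<in> borel_measurable cemetery_borel"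
    using Om_cylinders markov_set_cylinder by (auto simp: markov_set_def)
qed (auto simp: sets_law intro: prob_space_imp_subprob_space prob_law)

lemma measurable_expectation:
  "Z \<in> borel_measurable (N top) \<Longrightarrow> (\<lambda>y. \<integral>\<^sup>+w. Z w \<partial>law X y) \<in> borel_measurable cemetery_borel"
  by (rule measurable_compose[OF law_kernel nn_integral_measurable_subprob_algebra])

text \<open>Nothing is known about \<open>shift X \<infinity>\<close>. The default value
  \<open>w\<close> makes the map measurable; every use multiplies by the indicator of finite
  \<sigma>.\<close>

definition shifted :: "('w \<Rightarrow> ennreal) \<Rightarrow> 'w \<Rightarrow> 'w" where
  "shifted \<sigma> w = (if \<sigma> w < top then shift X (\<sigma> w) w else w)"

lemma shifted_Om: "w \<in> Om X \<Longrightarrow> shifted \<sigma> w \<in> Om X"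
  using shift_Om[of w] by (simp add: shifted_def)

lemma path_shifted: "w \<in> Om X \<Longrightarrow> path X s (shifted \<sigma> w) = (if \<sigma> w < top then path X (\<sigma> w + s) w else path X s w)"
  using path_shift[of w] by (simp add: shifted_def)

lemma shifted_measurable:
  assumes \<sigma>[measurable]: "\<sigma> \<in> borel_measurable (N top)" shows "shifted \<sigma> \<in> N top \<rightarrow>\<^sub>M N top"
proof (rule measurable_sigma_sets[OF sets_N])
  show "{path X s -` B \<inter> Om X |s B. s \<le> top \<and> B \<in> sets cemetery_borel} \<subseteq> Pow (Om X)" by auto
  show "shifted \<sigma> \<in> space (N top) \<rightarrow> Om X" using shifted_Om by auto
  fix A assume "A \<in> {path X s -` B \<inter> Om X |s B. s \<le> top \<and> B \<in> sets cemetery_borel}"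
  then obtain s B where A: "A = path X s -` B \<inter> Om X" "B \<in> sets cemetery_borel" by auto
  have [measurable]: "(\<lambda>w. path X (\<sigma> w + s) w) \<in> N top \<rightarrow>\<^sub>M cemetery_borel"
    by (rule path_random_measurable) measurable
  have "(\<lambda>w. if \<sigma> w < top then path X (\<sigma> w + s) w else path X s w) \<in> N top \<rightarrow>\<^sub>M cemetery_borel"
    by measurable
  from measurable_sets[OF this A(2)] show "shifted \<sigma> -` A \<inter> space (N top) \<in> sets (N top)"
    by (rule back_subst[of "\<lambda>x. x \<in> sets (N top)"]) (auto simp: A path_shifted shifted_Om)
qed

text \<open>The cylinder case extends to all \<open>Z\<close> by uniqueness of measures, for a fixed
  event of the past of \<sigma>. The two densities \<open>a\<close> and \<open>b\<close> then have
  equal integrals over all such events, so they cannot be told apart by any weight \<open>Y\<close>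
  measurable with respect to that past.\<close>

theorem strong_markov_expectation:
  assumes \<sigma>: "stopping_time F \<sigma>" and Y: "Y \<in> borel_measurable (Fpre \<sigma>)" and Z: "Z \<in> borel_measurable (N top)"
  shows "(\<E> y (\<lambda>w. Y w * (indicator {w. \<sigma> w < top} w * Z (shifted \<sigma> w)))) =
     (\<E> y (\<lambda>w. Y w * (indicator {w. \<sigma> w < top} w * (\<E> (path X (\<sigma> w) w) (\<lambda>w'. Z w')))))"
proof -
  note \<sigma>m[measurable] = stopping_measurable[OF \<sigma>]
  note [measurable] = shifted_measurable[OF \<sigma>m] Z path_random_measurable[OF \<sigma>m]
  define a where "a w = indicator {w. \<sigma> w < top} w * Z (shifted \<sigma> w)" for w
  define b where "b w = indicator {w. \<sigma> w < top} w * (\<E> (path X (\<sigma> w) w) (\<lambda>w'. Z w'))" for w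
  have ind: "(indicator {w. \<sigma> w < top} :: 'w \<Rightarrow> ennreal) \<in> borel_measurable (N top)"
    by (rule measurable_cong[THEN iffD1, of _ "\<lambda>w. if \<sigma> w < top then 1 else 0"]) (auto split: split_indicator)
  have am[measurable]: "a \<in> borel_measurable (N top)" unfolding a_def using ind by measurable
  have bm[measurable]: "b \<in> borel_measurable (N top)"
    unfolding b_def using ind measurable_compose[OF path_random_measurable[OF \<sigma>m] measurable_expectation[OF Z]] by measurable
  have eq: "(\<E> y (\<lambda>w. indicator \<Lambda> w * a w)) = (\<E> y (\<lambda>w. indicator \<Lambda> w * b w))"
    if \<Lambda>: "\<Lambda> \<in> sets (Fpre \<sigma>)" for \<Lambda>
  proof -
    let ?L = "{w\<in>\<Lambda>. \<sigma> w < top}"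
    have "(\<E> y (\<lambda>w. indicator ?L w * Z (shifted \<sigma> w))) =
       (\<E> y (\<lambda>w. indicator ?L w * (\<E> (path X (\<sigma> w) w) (\<lambda>w'. Z w'))))"
    proof (rule kernel_transfer[OF _ _ _ _ _ Int_stable_cylinders _ _ _ Z])
      show "(indicator ?L :: 'w \<Rightarrow> ennreal) \<in> borel_measurable (law X y)"
        using indicator_stopping_measurable_top[OF \<sigma> \<Lambda>] by simp
      show "(\<lambda>w. law X (path X (\<sigma> w) w)) \<in> law X y \<rightarrow>\<^sub>M subprob_algebra (N top)"
        using measurable_compose[OF path_random_measurable[OF \<sigma>m] law_kernel] by simp
      have "(\<E> y (\<lambda>w. indicator ?L w)) \<le> (\<E> y (\<lambda>w. 1))"
        by (intro nn_integral_mono) (simp split: split_indicator)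
      also have "\<dots> < top" using prob_space.emeasure_space_1[OF prob_law[of y]] by simp
      finally show "(\<E> y (\<lambda>w. indicator ?L w)) < top" .
      show "sets (N top) = sigma_sets (space (N top)) cylinders" by (simp add: sets_N_top_cylinder)
      show "space (N top) \<in> cylinders" using Om_cylinders by simp
      fix A assume "A \<in> cylinders"
      then have A: "markov_set A" using markov_set_cylinder by blast
      then have An: "A \<in> sets (N top)" by (simp add: markov_set_def)
      have Ln: "?L \<in> sets (N top)"
        using indicator_stopping_measurable[OF \<sigma> \<Lambda>] Fpre_sub[OF \<sigma>] by auto
      have "?L \<inter> (shifted \<sigma> -` A \<inter> space (N top)) \<in> sets (N top)"
        using Ln measurable_sets[OF shifted_measurable[OF \<sigma>m] An] by blast
      moreover have eqS: "?L \<inter> (shifted \<sigma> -` A \<inter> space (N top)) = {w\<in>\<Lambda>. \<sigma> w < top \<and> shift X (\<sigma> w) w \<in> A}"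
        using sets.sets_into_space[OF \<Lambda>] by (auto simp: shifted_def)
      ultimately have S: "{w\<in>\<Lambda>. \<sigma> w < top \<and> shift X (\<sigma> w) w \<in> A} \<in> sets (law X y)" by (simp add: sets_law)
      have "(\<E> y (\<lambda>w. indicator ?L w * indicator A (shifted \<sigma> w))) =
         (\<E> y (\<lambda>w. indicator {w\<in>\<Lambda>. \<sigma> w < top \<and> shift X (\<sigma> w) w \<in> A} w))"
        by (intro nn_integral_cong) (auto simp: shifted_def split: split_indicator)
      also have "\<dots> = emeasure (law X y) {w\<in>\<Lambda>. \<sigma> w < top \<and> shift X (\<sigma> w) w \<in> A}"
        using S by simp
      also have "\<dots> = (\<E> y (\<lambda>w. indicator ?L w * emeasure (law X (path X (\<sigma> w) w)) A))"
        using A \<sigma> \<Lambda> by (simp add: markov_set_def)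
      finally show "(\<E> y (\<lambda>w. indicator ?L w * indicator A (shifted \<sigma> w))) = \<dots>" .
    qed (use shifted_measurable[OF \<sigma>m] law_ne in simp_all)
    then show ?thesis
      by (simp add: a_def b_def indicator_inter_arith[symmetric] mult.assoc[symmetric] Collect_conj_eq)
  qed
  have Fs: "sets (Fpre \<sigma>) \<subseteq> sets (law X y)" using Fpre_sub[OF \<sigma>] by (simp add: sets_law)
  have id: "(\<lambda>w. w) \<in> law X y \<rightarrow>\<^sub>M Fpre \<sigma>"
    using Fs by (intro measurableI) (auto intro!: sets.Int)
  have Ym[measurable]: "Y \<in> borel_measurable (law X y)"
    using measurable_compose[OF id Y] by simp
  \<comment> \<open>\<open>distr\<close> along the identity restricts a measure to the smaller
    \<sigma>-algebra \<open>Fpre \<sigma>\<close>.\<close>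
  have "distr (density (law X y) a) (Fpre \<sigma>) (\<lambda>w. w) = distr (density (law X y) b) (Fpre \<sigma>) (\<lambda>w. w)"
  proof (rule measure_eqI)
    fix A assume "A \<in> sets (distr (density (law X y) a) (Fpre \<sigma>) (\<lambda>w. w))"
    then have A: "A \<in> sets (Fpre \<sigma>)" by simp
    then have "A \<in> sets (law X y)" using Fs by auto
    then have "emeasure (density (law X y) a) A = emeasure (density (law X y) b) A"
      using eq[OF A] by (simp add: emeasure_density mult.commute)
    moreover have "A \<inter> Om X = A" using sets.sets_into_space[OF A] by auto
    ultimately show "emeasure (distr (density (law X y) a) (Fpre \<sigma>) (\<lambda>w. w)) A = emeasure (distr (density (law X y) b) (Fpre \<sigma>) (\<lambda>w. w)) A"
      using id A by (simp add: emeasure_distr)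
  qed simp
  then have "(\<integral>\<^sup>+w. Y w \<partial>distr (density (law X y) a) (Fpre \<sigma>) (\<lambda>w. w)) = (\<integral>\<^sup>+w. Y w \<partial>distr (density (law X y) b) (Fpre \<sigma>) (\<lambda>w. w))"
    by simp
  then have "(\<E> y (\<lambda>w. a w * Y w)) = (\<E> y (\<lambda>w. b w * Y w))"
    using id Y am bm Ym by (simp add: nn_integral_distr nn_integral_density)
  then show ?thesis by (simp add: a_def b_def mult.commute)
qed

end

section \<open>Exit times\<close>

lemma ennreal_rat_between:
  fixes a b :: ennreal assumes "a < b" shows "\<exists>q::rat. a < ennreal (of_rat q) \<and> ennreal (of_rat q) < b"
proof -
  obtain c where c: "a < c" "c < b" using dense[OF assms] by auto
  obtain d where d: "a < d" "d < c" using dense[OF c(1)] by auto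
  obtain c' where c': "c = ennreal c'" "0 \<le> c'" using c(2) by (cases c) auto
  obtain d' where d': "d = ennreal d'" "0 \<le> d'" using d(2) by (cases d) auto
  have "d' < c'" using d(2) c' d' by (simp add: ennreal_less_iff)
  then obtain q where q: "d' < of_rat q" "of_rat q < c'" using of_rat_dense by blast
  have "d < ennreal (of_rat q)" "ennreal (of_rat q) < c"
    using q c' d' by (auto intro!: ennreal_lessI simp del: zero_less_of_rat_iff)
  then show ?thesis using c d by (blast intro: less_trans)
qed

context hunt
begin

text \<open>Strict inequalities are enough for a right-continuous filtration: the event that \<rho>
  is at most t is an intersection of events \<rho> < u with u decreasing to t and staying below any
  given s > t.\<close>

lemma stopping_timeI_less:
  assumes "\<And>t. {w\<in>Om X. \<rho> w < t} \<in> sets (N t)"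
  shows "stopping_time F \<rho>"
proof (rule stopping_timeI)
  fix t
  have "{w\<in>Om X. \<rho> w \<le> t} \<in> sets (N s)" if s: "t < s \<or> s = top" for s
  proof (cases "t = top")
    case True then show ?thesis using sets.top[of "N s"] by simp
  next
    case False
    then have "t < s" using s by (auto simp: less_top)
    obtain u where u: "\<And>n::nat. t < u n" "\<And>n. u n < s" "u \<longlonglongrightarrow> t"
      using approx_from_above_dense_linorder[OF \<open>t < s\<close>]
      proof -
        obtain v where v: "\<And>n::nat. t < v n" "v \<longlonglongrightarrow> t" using approx_from_above_dense_linorder[OF \<open>t < s\<close>] by blast
        then have "\<forall>\<^sub>F n in sequentially. v n < s" using \<open>t < s\<close> by (simp add: order_tendstoD)
        then obtain k where "\<And>n. n \<ge> k \<Longrightarrow> v n < s" by (auto simp: eventually_sequentially)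
        then show ?thesis using v that[of "\<lambda>n. v (n + k)"] by (simp add: LIMSEQ_ignore_initial_segment)
      qed
    have "{w\<in>Om X. \<rho> w \<le> t} = (\<Inter>n. {w\<in>Om X. \<rho> w < u n})"
    proof (intro equalityI subsetI)
      fix w assume "w \<in> (\<Inter>n. {w\<in>Om X. \<rho> w < u n})"
      then have "w \<in> Om X" "\<And>n. \<rho> w \<le> u n" by (auto intro: less_imp_le)
      then show "w \<in> {w\<in>Om X. \<rho> w \<le> t}" using LIMSEQ_le_const[OF u(3)] by blast
    qed (use u(1) in \<open>auto intro: le_less_trans\<close>)
    moreover have "{w\<in>Om X. \<rho> w < u n} \<in> sets (N s)" for n
      using subsetD[OF sets_N_mono[OF less_imp_le[OF u(2)]] assms] .
    ultimately show ?thesis by (auto intro!: sets.countable_INT)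
  qed
  then show "Measurable.pred (F t) (\<lambda>x. \<rho> x \<le> t)" by (auto simp: pred_def sets_F)
qed

definition near_exit :: "'a set \<Rightarrow> nat \<Rightarrow> 'w \<Rightarrow> ennreal" where
  "near_exit D n w = Inf {t. ext0 (dist_compl D) (path X t w) < 1 / real (Suc n)}"

text \<open>A measurable version of the time of the first exit from an open set \<open>D\<close>, time \<open>0\<close> included.\<close>

definition exit_at :: "'a set \<Rightarrow> 'w \<Rightarrow> ennreal" where
  "exit_at D w = (SUP n. near_exit D n w)"

definition exit_Inf :: "'a set \<Rightarrow> 'w \<Rightarrow> ennreal" where
  "exit_Inf D w = Inf {t. path X t w \<notin> Some ` D}"

text \<open>The strict inequality in \<open>near_exit\<close> is an open condition. By
  right-continuity it persists on an interval to the right, which contains a rational time, and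
  countably many times give measurability.\<close>

lemma near_exit_less_iff:
  assumes w: "w \<in> Om X"
  shows "near_exit D n w < t \<longleftrightarrow>
    (\<exists>q::rat. ennreal (of_rat q) < t \<and> ext0 (dist_compl D) (path X (ennreal (of_rat q)) w) < 1 / real (Suc n))"
proof
  assume "near_exit D n w < t"
  then obtain s where s: "s < t" "ext0 (dist_compl D) (path X s w) < 1 / real (Suc n)"
    by (auto simp: near_exit_def Inf_less_iff)
  then have st: "s < top" by (auto intro: less_le_trans)
  have "\<forall>\<^sub>F u in at_right s. ext0 (dist_compl D) (path X u w) < 1 / real (Suc n)"
    using path_right_ext0[OF w, of s "dist_compl D"] st s(2) by (auto simp: continuous_dist_compl intro: order_tendstoD)
  then obtain b where b: "b > s" "\<And>u. s < u \<Longrightarrow> u < b \<Longrightarrow> ext0 (dist_compl D) (path X u w) < 1 / real (Suc n)"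
    using eventually_at_right[OF s(1)] by auto
  obtain q where "s < ennreal (of_rat q)" "ennreal (of_rat q) < min b t"
    using ennreal_rat_between[of s "min b t"] b s by auto
  then show "\<exists>q::rat. ennreal (of_rat q) < t \<and> ext0 (dist_compl D) (path X (ennreal (of_rat q)) w) < 1 / real (Suc n)"
    using b by auto
next
  assume "\<exists>q::rat. ennreal (of_rat q) < t \<and> ext0 (dist_compl D) (path X (ennreal (of_rat q)) w) < 1 / real (Suc n)"
  then show "near_exit D n w < t" by (auto simp: near_exit_def Inf_less_iff)
qed

lemma near_exit_stopping: "stopping_time F (near_exit D n)"
proof (rule stopping_timeI_less)
  fix t
  have "{w\<in>Om X. near_exit D n w < t} = (\<Union>q\<in>{q::rat. ennreal (of_rat q) < t}.
      {w\<in>space (N t). ext0 (dist_compl D) (path X (ennreal (of_rat q)) w) < 1 / real (Suc n)})"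
    using near_exit_less_iff by auto
  also have "\<dots> \<in> sets (N t)"
  proof (rule sets.countable_UN'')
    fix q :: rat assume "q \<in> {q. ennreal (of_rat q) < t}"
    then have "path X (ennreal (of_rat q)) \<in> N t \<rightarrow>\<^sub>M cemetery_borel"
      by (intro path_measurable) auto
    then show "{w\<in>space (N t). ext0 (dist_compl D) (path X (ennreal (of_rat q)) w) < 1 / real (Suc n)} \<in> sets (N t)"
      using measurable_ext0[OF dist_compl_measurable, of D] by measurable
  qed auto
  finally show "{w\<in>Om X. near_exit D n w < t} \<in> sets (N t)" .
qed

lemma exit_at_stopping: "stopping_time F (exit_at D)"
proof (rule stopping_timeI)
  fix t show "Measurable.pred (F t) (\<lambda>w. exit_at D w \<le> t)"
    unfolding exit_at_def SUP_le_iff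
    using stopping_timeD[OF near_exit_stopping, of D _ t] by (auto intro!: pred_intros_countable)
qed

lemmas exit_at_measurable [measurable] = stopping_measurable[OF exit_at_stopping]

lemma near_exit_value:
  assumes w: "w \<in> Om X" and fin: "near_exit D n w < top"
  shows "ext0 (dist_compl D) (path X (near_exit D n w) w) \<le> 1 / real (Suc n)"
proof (rule ccontr)
  let ?s = "near_exit D n w"
  assume "\<not> ?thesis"
  then have gt: "1 / real (Suc n) < ext0 (dist_compl D) (path X ?s w)" by simp
  have "\<forall>\<^sub>F u in at_right ?s. 1 / real (Suc n) < ext0 (dist_compl D) (path X u w)"
    using path_right_ext0[OF w, of ?s "dist_compl D"] fin gt by (auto simp: continuous_dist_compl intro: order_tendstoD)
  then obtain b where b: "b > ?s" "\<And>u. ?s < u \<Longrightarrow> u < b \<Longrightarrow> 1 / real (Suc n) < ext0 (dist_compl D) (path X u w)"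
    using eventually_at_right[OF fin] by auto
  from b(1) obtain t where t: "t < b" "ext0 (dist_compl D) (path X t w) < 1 / real (Suc n)"
    by (subst (asm) near_exit_def) (auto simp: Inf_less_iff)
  have "?s \<le> t" using t(2) by (auto simp: near_exit_def intro: Inf_lower)
  then show False using b(2)[of t] t gt by (cases "?s = t") (auto simp: less_le)
qed

lemma not_Some_image: "open D \<Longrightarrow> z \<notin> Some ` D \<longleftrightarrow> ext0 (dist_compl D) z \<le> 0"
  by (cases z) (auto simp: not_less[symmetric] dist_compl_pos_iff)

lemma near_exit_le: "open D \<Longrightarrow> path X t w \<notin> Some ` D \<Longrightarrow> near_exit D n w \<le> t"
  unfolding near_exit_def by (rule Inf_lower) (auto simp: not_Some_image intro: le_less_trans[of _ 0])

lemma exit_at_le: "open D \<Longrightarrow> path X t w \<notin> Some ` D \<Longrightarrow> exit_at D w \<le> t"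
  unfolding exit_at_def by (intro SUP_least near_exit_le)

text \<open>The paths that approach the complement of \<open>D\<close> but are back inside
  \<open>D\<close> at the limit of the approach times; off this set \<open>exit_at\<close> is the
  true exit time.\<close>

definition bad_exit :: "'a set \<Rightarrow> 'w set" where
  "bad_exit D = {w\<in>Om X. exit_at D w < top \<and> path X (exit_at D w) w \<in> Some ` D}"

lemma path_exit_at_measurable [measurable]: "(\<lambda>w. path X (exit_at D w) w) \<in> N top \<rightarrow>\<^sub>M cemetery_borel"
  by (rule path_random_measurable) simp

lemma bad_exit_sets:
  assumes "open D" shows "bad_exit D \<in> sets (N top)"
proof -
  have [measurable]: "Some ` D \<in> sets cemetery_borel" using assms by (intro Some_image_sets) auto
  have "{w\<in>space (N top). exit_at D w < top \<and> path X (exit_at D w) w \<in> Some ` D} \<in> sets (N top)"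
    by measurable
  then show ?thesis by (simp add: bad_exit_def)
qed

lemma quasi_left:
  assumes "\<And>n. stopping_time F (\<sigma> n)" "\<And>w. w \<in> Om X \<Longrightarrow> incseq (\<lambda>n. \<sigma> n w)"
  shows "AE w in law X y. (SUP n. \<sigma> n w) < top \<longrightarrow>
        limitin cemetery_topology (\<lambda>n. path X (\<sigma> n w) w) (path X (SUP n. \<sigma> n w) w) sequentially"
  using hunt_process assms unfolding hunt_process_def quasi_left_continuous_def infinity_ennreal_def by blast

text \<open>By quasi-left continuity the positions at the approach times converge to the position at
  their supremum. Their distance to the complement is at most 1/(n+1), so the limit has distance 0
  and cannot lie in the open set \<open>D\<close>.\<close>

lemma bad_exit_null:
  assumes D: "open D" shows "AE w in law X y. w \<notin> bad_exit D"
proof -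
  have inc: "incseq (\<lambda>n. near_exit D n w)" for w
  proof (rule incseq_SucI)
    fix n
    show "near_exit D n w \<le> near_exit D (Suc n) w"
      unfolding near_exit_def
      by (intro Inf_superset_mono Collect_mono impI) (erule less_trans, simp add: frac_less2)
  qed
  have "AE w in law X y. (SUP n. near_exit D n w) < top \<longrightarrow>
      limitin cemetery_topology (\<lambda>n. path X (near_exit D n w) w) (path X (SUP n. near_exit D n w) w) sequentially"
    by (intro quasi_left near_exit_stopping inc)
  then show ?thesis
  proof (eventually_elim, intro notI)
    fix w assume lim: "(SUP n. near_exit D n w) < top \<longrightarrow>
      limitin cemetery_topology (\<lambda>n. path X (near_exit D n w) w) (path X (SUP n. near_exit D n w) w) sequentially"
      and "w \<in> bad_exit D"
    then obtain x where w: "w \<in> Om X" and fin: "exit_at D w < top" and x: "path X (exit_at D w) w = Some x" "x \<in> D"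
      by (auto simp: bad_exit_def)
    have "limitin cemetery_topology (\<lambda>n. path X (near_exit D n w) w) (Some x) sequentially"
      using lim fin x by (auto simp: exit_at_def)
    from limitin_ext0[OF continuous_dist_compl this]
    have "(\<lambda>n. ext0 (dist_compl D) (path X (near_exit D n w) w)) \<longlonglongrightarrow> dist_compl D x" .
    moreover have "ext0 (dist_compl D) (path X (near_exit D n w) w) \<le> 1 / real (Suc n)" for n
    proof (rule near_exit_value[OF w])
      have "near_exit D n w \<le> exit_at D w" unfolding exit_at_def by (rule SUP_upper) simp
      then show "near_exit D n w < top" using fin by (rule le_less_trans)
    qed
    moreover have "(\<lambda>n. 1 / real (Suc n)) \<longlonglongrightarrow> 0" by (rule LIMSEQ_Suc[OF lim_1_over_n])
    ultimately have "dist_compl D x \<le> 0" by (intro LIMSEQ_le[of _ _ _ 0]) auto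
    then show False using dist_compl_pos_iff[OF D, of x] x by simp
  qed
qed

lemma exit_Inf_eq:
  assumes D: "open D" and w: "w \<in> Om X" "w \<notin> bad_exit D"
  shows "exit_Inf D w = exit_at D w"
proof (rule antisym)
  have "path X (exit_at D w) w \<notin> Some ` D"
    using w path_infty[OF w(1)] by (cases "exit_at D w = top") (auto simp: bad_exit_def less_top)
  then show "exit_Inf D w \<le> exit_at D w" by (auto simp: exit_Inf_def intro: Inf_lower)
  show "exit_at D w \<le> exit_Inf D w"
    unfolding exit_Inf_def by (rule Inf_greatest) (use exit_at_le[OF D] in auto)
qed

lemma path_exit_at:
  assumes "w \<in> Om X" "w \<notin> bad_exit D"
  shows "path X (exit_at D w) w \<notin> Some ` D"
  using assms path_infty[OF assms(1)] by (cases "exit_at D w = top") (auto simp: bad_exit_def less_top)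

lemma path_before_exit:
  assumes "open D" "t < exit_at D w" shows "path X t w \<in> Some ` D"
  using exit_at_le[OF assms(1), of t w] assms(2) by (metis not_le)

lemma exit_at_shift:
  assumes D: "open D" and w: "w \<in> Om X" "w \<notin> bad_exit D"
    and t: "t < top" "t \<le> exit_at D w" and b: "shift X t w \<notin> bad_exit D"
  shows "exit_at D w = t + exit_at D (shift X t w)"
proof -
  have s: "shift X t w \<in> Om X" using w t by (auto intro: shift_Om)
  have eq: "path X u (shift X t w) = path X (t + u) w" for u using path_shift[OF w(1)] t by simp
  show ?thesis
  proof (rule antisym)
    have "exit_at D w \<le> t + u" if "path X u (shift X t w) \<notin> Some ` D" for u
      using exit_at_le[OF D, of "t + u" w] that by (simp add: eq)
    from this[OF path_exit_at[OF s b]] show "exit_at D w \<le> t + exit_at D (shift X t w)" .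
    have "path X (exit_at D w - t) (shift X t w) \<notin> Some ` D"
      unfolding eq add_diff_inverse_ennreal[OF t(2)] by (rule path_exit_at[OF w])
    then have "exit_at D (shift X t w) \<le> exit_at D w - t" by (rule exit_at_le[OF D])
    then have "t + exit_at D (shift X t w) \<le> t + (exit_at D w - t)" by (rule add_left_mono)
    then show "t + exit_at D (shift X t w) \<le> exit_at D w" by (simp add: add_diff_inverse_ennreal[OF t(2)])
  qed
qed

lemma exit_at_mono:
  assumes "open D" "W \<subseteq> D" "open W" "w \<in> Om X" "w \<notin> bad_exit D"
  shows "exit_at W w \<le> exit_at D w"
  using path_exit_at[OF assms(4,5)] assms(2) by (intro exit_at_le assms) auto

text \<open>The strong Markov property carries exceptional sets over to the path after \<sigma>. The
  set must be null for every starting point, the cemetery included, since \<sigma> may occur after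
  death.\<close>

lemma AE_shifted:
  assumes \<sigma>: "stopping_time F \<sigma>" and A: "A \<in> sets (N top)" and null: "\<And>y. AE w in law X y. w \<notin> A"
  shows "AE w in law X y. \<sigma> w < top \<longrightarrow> shift X (\<sigma> w) w \<notin> A"
proof -
  have z: "(\<E> z (\<lambda>w'. indicator A w')) = 0" for z
    using null[of z] A by (subst nn_integral_0_iff_AE) (auto simp: sets_law indicator_def elim!: eventually_mono)
  have [measurable]: "\<sigma> \<in> borel_measurable (N top)" by (rule stopping_measurable[OF \<sigma>])
  have m: "(\<lambda>w. indicator {w. \<sigma> w < top} w * indicator A (shifted \<sigma> w) :: ennreal) \<in> borel_measurable (N top)"
  proof -
    have "(\<lambda>w. if \<sigma> w < top then indicator A (shifted \<sigma> w) else 0 :: ennreal) \<in> borel_measurable (N top)"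
      using shifted_measurable[of \<sigma>] A by measurable
    then show ?thesis by (rule measurable_cong[THEN iffD1, rotated]) (auto split: split_indicator)
  qed
  have "(\<E> y (\<lambda>w. 1 * (indicator {w. \<sigma> w < top} w * indicator A (shifted \<sigma> w)))) = 0"
    by (subst strong_markov_expectation[OF \<sigma>]) (use A z in auto)
  then have "AE w in law X y. indicator {w. \<sigma> w < top} w * indicator A (shifted \<sigma> w) = (0::ennreal)"
    using m by (subst (asm) nn_integral_0_iff_AE) auto
  then show ?thesis
    by eventually_elim (auto simp: shifted_def split: if_splits split_indicator_asm)
qed

lemma AE_Om: "AE w in law X y. w \<in> Om X"
  using AE_space[of "law X y"] by simp

lemma AE_exit_at_shift:
  assumes D: "open D" and \<sigma>: "stopping_time F \<sigma>"
  shows "AE w in law X y. w \<in> Om X \<and> w \<notin> bad_exit D \<and>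
     (\<sigma> w < top \<longrightarrow> shift X (\<sigma> w) w \<in> Om X \<and> shift X (\<sigma> w) w \<notin> bad_exit D \<and>
      (\<sigma> w \<le> exit_at D w \<longrightarrow> exit_at D w = \<sigma> w + exit_at D (shift X (\<sigma> w) w)))"
  using AE_Om bad_exit_null[OF D] AE_shifted[OF \<sigma> bad_exit_sets[OF D] bad_exit_null[OF D]]
proof eventually_elim
  case (elim w)
  then show ?case using exit_at_shift[OF D, of w "\<sigma> w"] by (auto intro: shift_Om)
qed

end

section \<open>Killing at a bounded rate\<close>

lemma nn_integral_Icc_eq_Ico:
  fixes f :: "real \<Rightarrow> ennreal"
  shows "(\<integral>\<^sup>+r. indicator {0..t} r * f r \<partial>lborel) = (\<integral>\<^sup>+r. indicator {0..<t} r * f r \<partial>lborel)"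
  by (intro nn_integral_cong_AE eventually_mono[OF AE_lborel_singleton[of t]]) (auto split: split_indicator)

lemma nn_integral_Icc_bound:
  assumes "\<And>r. f r \<le> ennreal \<kappa>" "s \<le> t" "0 \<le> \<kappa>"
  shows "(\<integral>\<^sup>+r. indicator {s..t} r * f r \<partial>lborel) \<le> ennreal (\<kappa> * (t - s))"
proof -
  have "(\<integral>\<^sup>+r. indicator {s..t} r * f r \<partial>lborel) \<le> (\<integral>\<^sup>+r. ennreal \<kappa> * indicator {s..t} r \<partial>lborel)"
    using assms by (intro nn_integral_mono) (auto split: split_indicator)
  also have "\<dots> = ennreal (\<kappa> * (t - s))"
    using assms by (simp add: nn_integral_cmult_indicator ennreal_mult)
  finally show ?thesis .
qed

text \<open>Time change along the additive functional \<open>a\<close>: the image of \<open>f(t) dt\<close> under \<open>a\<close> is Lebesgue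
  measure on \<open>[0, a(s)]\<close>. This replaces the fundamental theorem of calculus, as \<open>f\<close> is only measurable.\<close>

lemma clock_change:
  fixes f :: "real \<Rightarrow> ennreal" and h :: "real \<Rightarrow> ennreal"
  assumes [measurable]: "f \<in> borel_measurable borel" "h \<in> borel_measurable borel"
    and f: "\<And>r. f r \<le> ennreal \<kappa>" and \<kappa>: "0 \<le> \<kappa>" and s: "0 \<le> s"
  defines "a t \<equiv> enn2real (\<integral>\<^sup>+r. indicator {0..t} r * f r \<partial>lborel)"
  shows "(\<integral>\<^sup>+t. indicator {0..s} t * (f t * h (a t)) \<partial>lborel) = (\<integral>\<^sup>+y. indicator {0..a s} y * h y \<partial>lborel)"
proof -
  have A: "(\<integral>\<^sup>+r. indicator {0..t} r * f r \<partial>lborel) = ennreal (a t)" for t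
  proof -
    have "(\<integral>\<^sup>+r. indicator {0..t} r * f r \<partial>lborel) \<le> (\<integral>\<^sup>+r. indicator {0..max 0 t} r * f r \<partial>lborel)"
      by (intro nn_integral_mono) (auto split: split_indicator)
    also have "\<dots> < top" using le_less_trans[OF nn_integral_Icc_bound[OF f, of 0 "max 0 t"]] \<kappa> by auto
    finally show ?thesis by (simp add: a_def)
  qed
  have a0: "0 \<le> a t" for t by (simp add: a_def)
  have add: "ennreal (a t) = ennreal (a r) + (\<integral>\<^sup>+u. indicator {r..t} u * f u \<partial>lborel)" if "0 \<le> r" "r \<le> t" for r t
  proof -
    have "(\<integral>\<^sup>+u. indicator {0..t} u * f u \<partial>lborel) = (\<integral>\<^sup>+u. indicator {0..<r} u * f u + indicator {r..t} u * f u \<partial>lborel)"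
      using that by (intro nn_integral_cong) (auto split: split_indicator)
    also have "\<dots> = (\<integral>\<^sup>+u. indicator {0..<r} u * f u \<partial>lborel) + (\<integral>\<^sup>+u. indicator {r..t} u * f u \<partial>lborel)"
      by (rule nn_integral_add) auto
    finally show ?thesis by (simp add: A[symmetric] nn_integral_Icc_eq_Ico)
  qed
  have mono: "a r \<le> a t" if "r \<le> t" for r t
  proof -
    have "ennreal (a r) \<le> ennreal (a t)" unfolding A[symmetric]
      using that by (intro nn_integral_mono) (auto split: split_indicator)
    then show ?thesis using a0 by (simp add: ennreal_le_iff)
  qed
  have lip: "a t \<le> a r + \<kappa> * (t - r)" if "0 \<le> r" "r \<le> t" for r t
  proof -
    have "ennreal (a t) \<le> ennreal (a r) + ennreal (\<kappa> * (t - r))"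
      unfolding add[OF that] using nn_integral_Icc_bound[OF f that(2) \<kappa>] by (rule add_left_mono)
    also have "\<dots> = ennreal (a r + \<kappa> * (t - r))" using a0 that \<kappa> by (simp add: ennreal_plus)
    finally show ?thesis
      by (rule ennreal_le_iff[THEN iffD1, rotated]) (use a0[of r] that \<kappa> in auto)
  qed
  have am[measurable]: "a \<in> borel_measurable borel"
    by (rule borel_measurable_mono) (use mono in \<open>auto simp: mono_def\<close>)
  have cont: "continuous_on {0..} a"
  proof (rule lipschitz_on_continuous_on[of \<kappa>], rule lipschitz_onI)
    fix r t :: real assume "r \<in> {0..}" "t \<in> {0..}"
    then show "dist (a r) (a t) \<le> \<kappa> * dist r t"
      using lip[of r t] lip[of t r] mono[of r t] mono[of t r] by (cases "r \<le> t") (auto simp: dist_real_def)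
  qed (rule \<kappa>)
  define M1 where "M1 = distr (density lborel (\<lambda>t. indicator {0..s} t * f t)) borel a"
  define M2 where "M2 = density lborel (indicator {0..a s} :: real \<Rightarrow> ennreal)"
  have e1: "emeasure M1 B = (\<integral>\<^sup>+t. indicator {0..s} t * f t * indicator (a -` B) t \<partial>lborel)" if [measurable]: "B \<in> sets borel" for B
    using measurable_sets[OF am, of B] by (simp add: M1_def emeasure_distr emeasure_density)
  have e2: "emeasure M2 B = emeasure lborel ({0..a s} \<inter> B)" if "B \<in> sets borel" for B
    using that by (simp add: M2_def emeasure_density indicator_inter_arith[symmetric])
  have tot1: "emeasure M1 UNIV = ennreal (a s)" using A[of s] by (simp add: e1)
  have tot2: "emeasure M2 UNIV = ennreal (a s)" using a0 by (simp add: e2)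
  have "M1 = M2"
  proof (rule cdf_unique')
    show f1: "finite_borel_measure M1"
      by (intro finite_borel_measure.intro finite_borel_measure_axioms.intro finite_measureI)
        (use tot1 in \<open>simp_all add: M1_def\<close>)
    show f2: "finite_borel_measure M2"
      by (intro finite_borel_measure.intro finite_borel_measure_axioms.intro finite_measureI)
        (use tot2 in \<open>simp_all add: M2_def\<close>)
    have "emeasure M1 {..y} = emeasure M2 {..y}" for y
    proof -
      consider "y < 0" | "a s \<le> y" "0 \<le> y" | "0 \<le> y" "y < a s" by linarith
      then show ?thesis
      proof cases
        case 1
        then have "indicator (a -` {..y}) t = (0::ennreal)" for t using a0[of t] by (auto split: split_indicator)
        moreover have "{0..a s} \<inter> {..y} = {}" using 1 by auto
        ultimately show ?thesis by (simp add: e1 e2)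
      next
        case 2
        have "emeasure M1 {..y} = (\<integral>\<^sup>+t. indicator {0..s} t * f t \<partial>lborel)"
          unfolding e1[OF borel_closed[OF closed_atMost]]
          using 2 mono[of _ s] by (intro nn_integral_cong) (force split: split_indicator)
        moreover have "{0..a s} \<inter> {..y} = {0..a s}" using 2 by auto
        ultimately show ?thesis using a0 by (simp add: A e2)
      next
        \<comment> \<open>Only here is continuity of \<open>a\<close> used: the set where
          \<open>a\<close> is at most y is an interval from 0 to some t0, and the intermediate value
          theorem gives \<open>a t0 = y\<close>.\<close>
        case 3
        define S where "S = {t\<in>{0..s}. a t \<le> y}"
        have "closed S" unfolding S_def
          by (intro continuous_on_closed_Collect_le continuous_intros continuous_on_subset[OF cont]) auto
        then have "compact S" by (auto simp: compact_eq_bounded_closed S_def intro: bounded_subset[of "{0..s}"])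
        have "a 0 = 0" unfolding a_def nn_integral_Icc_eq_Ico by simp
        then have "0 \<in> S" using s 3 by (auto simp: S_def)
        obtain t0 where t0: "t0 \<in> S" "\<And>t. t \<in> S \<Longrightarrow> t \<le> t0"
          using compact_attains_sup[OF \<open>compact S\<close>] \<open>0 \<in> S\<close> by blast
        have S: "t \<in> S \<longleftrightarrow> t \<in> {0..t0}" for t
          using t0 mono[of t t0] by (auto simp: S_def)
        have "a t0 = y"
        proof (rule ccontr)
          assume "a t0 \<noteq> y"
          then have "a t0 < y" using t0 by (auto simp: S_def)
          then obtain t where "t0 \<le> t" "t \<le> s" "a t = y"
            using IVT'[of a t0 y s] 3 t0 continuous_on_subset[OF cont, of "{t0..s}"] by (auto simp: S_def)
          then have "t \<in> S" using t0 by (auto simp: S_def)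
          then show False using t0(2)[of t] \<open>t0 \<le> t\<close> \<open>a t = y\<close> \<open>a t0 < y\<close> by auto
        qed
        have "emeasure M1 {..y} = (\<integral>\<^sup>+t. indicator {0..t0} t * f t \<partial>lborel)"
          unfolding e1[OF borel_closed[OF closed_atMost]]
        proof (intro nn_integral_cong)
          fix t show "indicator {0..s} t * f t * indicator (a -` {..y}) t = indicator {0..t0} t * f t"
            using S[of t] by (auto simp: S_def split: split_indicator)
        qed
        also have "\<dots> = ennreal y" using A[of t0] \<open>a t0 = y\<close> by simp
        also have "{0..a s} \<inter> {..y} = {0..y}" using 3 by auto
        then have "ennreal y = emeasure M2 {..y}" using 3 by (simp add: e2)
        finally show ?thesis .
      qed
    qed
    then show "cdf M1 = cdf M2" by (simp add: cdf_def measure_def fun_eq_iff)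
  qed
  then have "(\<integral>\<^sup>+y. h y \<partial>M1) = (\<integral>\<^sup>+y. h y \<partial>M2)" by simp
  then show ?thesis
    by (simp add: M1_def M2_def nn_integral_distr nn_integral_density mult.assoc)
qed

lemma nn_integral_exp_Icc:
  assumes "0 \<le> x"
  shows "(\<integral>\<^sup>+y. indicator {0..x} y * ennreal (exp (- y)) \<partial>lborel) = ennreal (1 - exp (- x))"
    and "(\<integral>\<^sup>+y. indicator {0..x} y * ennreal (exp y) \<partial>lborel) = ennreal (exp x - 1)"
proof -
  have "(\<integral>\<^sup>+y. ennreal (exp (- y)) * indicator {0..x} y \<partial>lborel) = ennreal (- exp (- x) - (- exp (- 0)))"
    using assms by (intro nn_integral_FTC_Icc) (auto intro!: derivative_eq_intros)
  then show "(\<integral>\<^sup>+y. indicator {0..x} y * ennreal (exp (- y)) \<partial>lborel) = ennreal (1 - exp (- x))"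
    by (simp add: mult.commute)
  have "(\<integral>\<^sup>+y. ennreal (exp y) * indicator {0..x} y \<partial>lborel) = ennreal (exp x - exp 0)"
    using assms by (intro nn_integral_FTC_Icc) (auto intro!: derivative_eq_intros)
  then show "(\<integral>\<^sup>+y. indicator {0..x} y * ennreal (exp y) \<partial>lborel) = ennreal (exp x - 1)"
    by (simp add: mult.commute)
qed

section \<open>Feynman-Kac weights, Green operators and exit operators\<close>

text \<open>Boundedness keeps \<open>addf\<close> finite at all real times, so the weight
  \<open>fk\<close> is strictly positive and can be divided by.\<close>

definition rate :: "('a::heine_borel \<Rightarrow> ennreal) \<Rightarrow> bool" where
  "rate \<psi> \<longleftrightarrow> \<psi> \<in> borel_measurable borel \<and> (\<exists>\<kappa>\<ge>0. \<forall>z. \<psi> z \<le> ennreal \<kappa>)"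

lemma rate_measurable: "rate \<psi> \<Longrightarrow> \<psi> \<in> borel_measurable borel"
  by (simp add: rate_def)

lemma rate_const: "c < top \<Longrightarrow> rate (\<lambda>_. c)"
  by (auto simp: rate_def intro!: exI[of _ "enn2real c"])

context hunt
begin

definition addf :: "('a \<Rightarrow> ennreal) \<Rightarrow> real \<Rightarrow> 'w \<Rightarrow> ennreal" where
  "addf \<psi> t w = (\<integral>\<^sup>+r. indicator {0..t} r * ext0 \<psi> (path X (ennreal r) w) \<partial>lborel)"

definition fk :: "('a \<Rightarrow> ennreal) \<Rightarrow> real \<Rightarrow> 'w \<Rightarrow> real" where
  "fk \<psi> t w = exp (- enn2real (addf \<psi> t w))"

definition green_fun :: "('a \<Rightarrow> ennreal) \<Rightarrow> 'a set \<Rightarrow> ('a \<Rightarrow> ennreal) \<Rightarrow> 'w \<Rightarrow> ennreal" where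
  "green_fun \<psi> D g w = (\<integral>\<^sup>+t. indicator {t. 0 \<le> t \<and> ennreal t < exit_at D w} t *
     (ennreal (fk \<psi> t w) * ext0 g (path X (ennreal t) w)) \<partial>lborel)"

text \<open>For an infinite exit time \<open>enn2real\<close> returns 0 and the weight is 1; this is
  harmless because the path is then at the cemetery and the second factor vanishes.\<close>

definition exit_fun :: "('a \<Rightarrow> ennreal) \<Rightarrow> 'a set \<Rightarrow> ('a \<Rightarrow> ennreal) \<Rightarrow> 'w \<Rightarrow> ennreal" where
  "exit_fun \<psi> D u w = ennreal (fk \<psi> (enn2real (exit_at D w)) w) * ext0 u (path X (exit_at D w) w)"

text \<open>The Green operator and the exit operator of \<open>D\<close> for the process killed at rate \<open>\<psi>\<close>.\<close>

definition GK :: "('a \<Rightarrow> ennreal) \<Rightarrow> 'a set \<Rightarrow> ('a \<Rightarrow> ennreal) \<Rightarrow> 'a \<Rightarrow> ennreal" where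
  "GK \<psi> D g x = (\<E> (Some x) (\<lambda>w. green_fun \<psi> D g w))"

definition HK :: "('a \<Rightarrow> ennreal) \<Rightarrow> 'a set \<Rightarrow> ('a \<Rightarrow> ennreal) \<Rightarrow> 'a \<Rightarrow> ennreal" where
  "HK \<psi> D u x = (\<E> (Some x) (\<lambda>w. exit_fun \<psi> D u w))"

abbreviation "Gr \<equiv> GK (\<lambda>_. 0)"
abbreviation "Hr \<equiv> HK (\<lambda>_. 0)"

lemma path_pair_measurable [measurable (raw)]:
  assumes "f \<in> borel_measurable M" "h \<in> M \<rightarrow>\<^sub>M N top"
  shows "(\<lambda>x. path X (ennreal (f x)) (h x)) \<in> M \<rightarrow>\<^sub>M cemetery_borel"
  using measurable_compose[OF measurable_Pair[OF assms] path_joint_measurable] by simp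

lemma addf_measurable [measurable (raw)]:
  assumes [measurable]: "f \<in> borel_measurable M" "h \<in> M \<rightarrow>\<^sub>M N top" "\<psi> \<in> borel_measurable borel"
  shows "(\<lambda>x. addf \<psi> (f x) (h x)) \<in> borel_measurable M"
  unfolding addf_def indicator_def atLeastAtMost_iff
  using measurable_ext0[OF assms(3)] by measurable

lemma fk_measurable [measurable (raw)]:
  assumes [measurable]: "f \<in> borel_measurable M" "h \<in> M \<rightarrow>\<^sub>M N top" "\<psi> \<in> borel_measurable borel"
  shows "(\<lambda>x. fk \<psi> (f x) (h x)) \<in> borel_measurable M"
  unfolding fk_def by measurable

lemma green_fun_measurable [measurable (raw)]:
  assumes [measurable]: "\<psi> \<in> borel_measurable borel" "g \<in> borel_measurable borel"
  shows "green_fun \<psi> D g \<in> borel_measurable (N top)"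
  unfolding green_fun_def[abs_def] indicator_def mem_Collect_eq
  using measurable_ext0[OF assms(2)] by measurable

lemma exit_fun_measurable [measurable (raw)]:
  assumes [measurable]: "\<psi> \<in> borel_measurable borel" "u \<in> borel_measurable borel"
  shows "exit_fun \<psi> D u \<in> borel_measurable (N top)"
  unfolding exit_fun_def[abs_def] using measurable_ext0[OF assms(2)] by measurable

lemma GK_measurable [measurable (raw)]:
  assumes [measurable]: "\<psi> \<in> borel_measurable borel" "g \<in> borel_measurable borel"
  shows "GK \<psi> D g \<in> borel_measurable borel"
  unfolding GK_def[abs_def]
  by (rule measurable_compose[OF measurable_Some measurable_expectation]) measurable

lemma HK_measurable [measurable (raw)]:
  assumes [measurable]: "\<psi> \<in> borel_measurable borel" "u \<in> borel_measurable borel"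
  shows "HK \<psi> D u \<in> borel_measurable borel"
  unfolding HK_def[abs_def]
  by (rule measurable_compose[OF measurable_Some measurable_expectation]) measurable

lemma addf_finite: 
  assumes "rate \<psi>" shows "addf \<psi> t w < top"
proof -
  obtain \<kappa> where \<kappa>: "0 \<le> \<kappa>" "\<And>z. \<psi> z \<le> ennreal \<kappa>" using assms by (auto simp: rate_def)
  have b: "ext0 \<psi> z \<le> ennreal \<kappa>" for z using \<kappa> by (cases z) auto
  have "addf \<psi> t w \<le> (\<integral>\<^sup>+r. indicator {0..max 0 t} r * ext0 \<psi> (path X (ennreal r) w) \<partial>lborel)"
    unfolding addf_def by (intro nn_integral_mono) (auto split: split_indicator)
  also have "\<dots> < top" using le_less_trans[OF nn_integral_Icc_bound[OF b, of 0 "max 0 t"]] \<kappa> by auto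
  finally show ?thesis .
qed

lemma path_time_measurable [measurable]: 
  "w \<in> Om X \<Longrightarrow> (\<lambda>t::real. path X (ennreal t) w) \<in> borel \<rightarrow>\<^sub>M cemetery_borel"
  using path_pair_measurable[of "\<lambda>t. t" borel "\<lambda>_. w"] by simp

lemma nn_integral_shift:
  fixes f :: "real \<Rightarrow> ennreal" assumes [measurable]: "f \<in> borel_measurable borel"
  shows "(\<integral>\<^sup>+r. f r \<partial>lborel) = (\<integral>\<^sup>+r. f (s + r) \<partial>lborel)"
  using nn_integral_real_affine[of f 1 s] by simp

lemma path_shift_real:
  assumes "w \<in> Om X" "0 \<le> s" "0 \<le> r"
  shows "path X (ennreal r) (shift X (ennreal s) w) = path X (ennreal (s + r)) w"
  using path_shift[OF assms(1), of "ennreal s"] assms by (simp add: ennreal_plus)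

lemma addf_shift:
  assumes w: "w \<in> Om X" and st: "0 \<le> s" "0 \<le> t" and \<psi>: "\<psi> \<in> borel_measurable borel"
  shows "addf \<psi> (s + t) w = addf \<psi> s w + addf \<psi> t (shift X (ennreal s) w)"
proof -
  note [measurable] = path_time_measurable[OF w] measurable_ext0[OF \<psi>]
  let ?f = "\<lambda>r. ext0 \<psi> (path X (ennreal r) w)"
  have "addf \<psi> (s + t) w = (\<integral>\<^sup>+r. indicator {0..<s} r * ?f r + indicator {s..s+t} r * ?f r \<partial>lborel)"
    unfolding addf_def using st by (intro nn_integral_cong) (auto split: split_indicator)
  also have "\<dots> = (\<integral>\<^sup>+r. indicator {0..<s} r * ?f r \<partial>lborel) + (\<integral>\<^sup>+r. indicator {s..s+t} r * ?f r \<partial>lborel)"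
    by (rule nn_integral_add) auto
  also have "(\<integral>\<^sup>+r. indicator {s..s+t} r * ?f r \<partial>lborel) = (\<integral>\<^sup>+r. indicator {s..s+t} (s + r) * ?f (s + r) \<partial>lborel)"
    by (rule nn_integral_shift) measurable
  also have "\<dots> = addf \<psi> t (shift X (ennreal s) w)"
    unfolding addf_def using st
    by (intro nn_integral_cong) (auto simp: path_shift_real[OF w] split: split_indicator)
  finally show ?thesis by (simp add: addf_def nn_integral_Icc_eq_Ico)
qed

lemma fk_shift:
  assumes w: "w \<in> Om X" and st: "0 \<le> s" "0 \<le> t" and \<psi>: "rate \<psi>"
  shows "fk \<psi> (s + t) w = fk \<psi> s w * fk \<psi> t (shift X (ennreal s) w)"
  using addf_finite[OF \<psi>, of s w] addf_finite[OF \<psi>, of t "shift X (ennreal s) w"]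
  by (simp add: fk_def addf_shift[OF w st rate_measurable[OF \<psi>]] enn2real_plus exp_add[symmetric])

lemma fk_pos: "0 < fk \<psi> t w" and fk_le_1: "fk \<psi> t w \<le> 1"
  by (simp_all add: fk_def)

lemma fk_0: "t \<le> 0 \<Longrightarrow> fk \<psi> t w = 1"
proof -
  assume "t \<le> 0"
  then have "addf \<psi> t w = (\<integral>\<^sup>+r. 0 \<partial>(lborel::real measure))" unfolding addf_def nn_integral_Icc_eq_Ico
    by (intro nn_integral_cong) (auto split: split_indicator)
  then show ?thesis by (simp add: fk_def)
qed

lemma fk_zero_rate [simp]: "fk (\<lambda>_. 0) t w = 1"
proof -
  have "ext0 (\<lambda>_. 0::ennreal) z = 0" for z :: "'a option" by (cases z) auto
  then show ?thesis by (simp add: fk_def addf_def)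
qed

text \<open>Multiplicativity of the weight after a translation of time. Additivity of the exit time
  holds only off a null set and is therefore an assumption on the single path
  \<open>w\<close>.\<close>

lemma green_fun_tail:
  assumes w: "w \<in> Om X" and s: "0 \<le> s" and \<psi>: "rate \<psi>" and g: "g \<in> borel_measurable borel"
    and ex: "exit_at D w = ennreal s + exit_at D (shift X (ennreal s) w)"
  shows "ennreal (fk \<psi> s w) * green_fun \<psi> D g (shift X (ennreal s) w) =
    (\<integral>\<^sup>+t. indicator {t. s \<le> t \<and> ennreal t < exit_at D w} t * (ennreal (fk \<psi> t w) * ext0 g (path X (ennreal t) w)) \<partial>lborel)"
proof -
  note [measurable] = path_time_measurable[OF w] measurable_ext0[OF g] rate_measurable[OF \<psi>]
  have [measurable]: "(\<lambda>_::real. w) \<in> borel \<rightarrow>\<^sub>M N top" using w by simp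
  have [measurable]: "(\<lambda>_::real. shift X (ennreal s) w) \<in> borel \<rightarrow>\<^sub>M N top" using shift_Om[OF w] by simp
  let ?f = "\<lambda>t. ennreal (fk \<psi> t w) * ext0 g (path X (ennreal t) w)"
  let ?\<theta> = "shift X (ennreal s) w"
  have lt: "ennreal (s + t) < exit_at D w \<longleftrightarrow> ennreal t < exit_at D ?\<theta>" if "0 \<le> t" for t
    using that s by (simp add: ex ennreal_plus ennreal_add_left_cancel_less)
  have "(\<integral>\<^sup>+t. indicator {t. s \<le> t \<and> ennreal t < exit_at D w} t * ?f t \<partial>lborel) =
     (\<integral>\<^sup>+t. indicator {t. s \<le> t \<and> ennreal t < exit_at D w} (s + t) * ?f (s + t) \<partial>lborel)"
    by (rule nn_integral_shift) (unfold indicator_def mem_Collect_eq, measurable)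
  also have "\<dots> = (\<integral>\<^sup>+t. ennreal (fk \<psi> s w) * (indicator {t. 0 \<le> t \<and> ennreal t < exit_at D ?\<theta>} t *
      (ennreal (fk \<psi> t ?\<theta>) * ext0 g (path X (ennreal t) ?\<theta>))) \<partial>lborel)"
  proof (intro nn_integral_cong)
    fix t :: real
    show "indicator {t. s \<le> t \<and> ennreal t < exit_at D w} (s + t) * ?f (s + t) =
      ennreal (fk \<psi> s w) * (indicator {t. 0 \<le> t \<and> ennreal t < exit_at D ?\<theta>} t *
      (ennreal (fk \<psi> t ?\<theta>) * ext0 g (path X (ennreal t) ?\<theta>)))"
    proof (cases "0 \<le> t")
      case True
      then show ?thesis
        using lt[OF True] fk_shift[OF w s True \<psi>] path_shift_real[OF w s True] fk_pos[of \<psi> s w] fk_pos[of \<psi> t ?\<theta>]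
        by (auto simp: ennreal_mult less_imp_le mult_ac split: split_indicator)
    next
      case False
      then show ?thesis by (auto split: split_indicator)
    qed
  qed
  also have "\<dots> = ennreal (fk \<psi> s w) * green_fun \<psi> D g ?\<theta>"
    unfolding green_fun_def
    by (rule nn_integral_cmult) (unfold indicator_def mem_Collect_eq, measurable)
  finally show ?thesis by (rule sym)
qed

lemma green_fun_split:
  assumes w: "w \<in> Om X" and s: "0 \<le> s" and \<psi>: "rate \<psi>" and g: "g \<in> borel_measurable borel"
    and ex: "exit_at D w = ennreal s + exit_at D (shift X (ennreal s) w)"
  shows "green_fun \<psi> D g w =
    (\<integral>\<^sup>+t. indicator {0..<s} t * (ennreal (fk \<psi> t w) * ext0 g (path X (ennreal t) w)) \<partial>lborel) +
    ennreal (fk \<psi> s w) * green_fun \<psi> D g (shift X (ennreal s) w)"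
proof -
  note [measurable] = path_time_measurable[OF w] measurable_ext0[OF g] rate_measurable[OF \<psi>]
  have [measurable]: "(\<lambda>_::real. w) \<in> borel \<rightarrow>\<^sub>M N top" using w by simp
  let ?f = "\<lambda>t. ennreal (fk \<psi> t w) * ext0 g (path X (ennreal t) w)"
  have le: "ennreal s \<le> exit_at D w" by (simp add: ex)
  have "green_fun \<psi> D g w = (\<integral>\<^sup>+t. indicator {0..<s} t * ?f t + indicator {t. s \<le> t \<and> ennreal t < exit_at D w} t * ?f t \<partial>lborel)"
    unfolding green_fun_def
  proof (intro nn_integral_cong)
    fix t
    have "ennreal t < exit_at D w" if "0 \<le> t" "t < s"
      using that by (intro less_le_trans[OF _ le]) (simp add: ennreal_lessI)
    then show "indicator {t. 0 \<le> t \<and> ennreal t < exit_at D w} t * ?f t =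
        indicator {0..<s} t * ?f t + indicator {t. s \<le> t \<and> ennreal t < exit_at D w} t * ?f t"
      using s by (auto split: split_indicator)
  qed
  also have "\<dots> = (\<integral>\<^sup>+t. indicator {0..<s} t * ?f t \<partial>lborel) + (\<integral>\<^sup>+t. indicator {t. s \<le> t \<and> ennreal t < exit_at D w} t * ?f t \<partial>lborel)"
    by (rule nn_integral_add) (unfold indicator_def mem_Collect_eq, measurable)
  finally show ?thesis by (simp add: green_fun_tail[OF assms])
qed

lemma exit_fun_shift:
  assumes w: "w \<in> Om X" and s: "0 \<le> s" and \<psi>: "rate \<psi>"
    and ex: "exit_at D w = ennreal s + exit_at D (shift X (ennreal s) w)"
  shows "exit_fun \<psi> D u w = ennreal (fk \<psi> s w) * exit_fun \<psi> D u (shift X (ennreal s) w)"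
proof (cases "exit_at D (shift X (ennreal s) w)")
  case top
  then show ?thesis
    using path_infty[OF w] path_infty[OF shift_Om[OF w, of "ennreal s"]] ex by (simp add: exit_fun_def)
next
  case (real e)
  then have D: "exit_at D w = ennreal (s + e)" using ex s by (simp add: ennreal_plus)
  have "ennreal (fk \<psi> (s + e) w) = ennreal (fk \<psi> s w) * ennreal (fk \<psi> e (shift X (ennreal s) w))"
    unfolding fk_shift[OF w s real(1) \<psi>] using fk_pos by (intro ennreal_mult) (auto intro: less_imp_le)
  then show ?thesis
    unfolding exit_fun_def D real(2) path_shift_real[OF w s real(1)] using s real(1) by (simp add: mult.assoc del: ennreal_plus)
qed

text \<open>On the event that \<sigma> is at most t, the weight agrees with an expression
  \<open>c\<close> in which the path is frozen at time t, and that expression is progressively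
  measurable.\<close>

lemma fk_stopping_measurable:
  assumes \<sigma>: "stopping_time F \<sigma>" and \<psi>: "\<psi> \<in> borel_measurable borel"
  shows "(\<lambda>w. fk \<psi> (enn2real (\<sigma> w)) w) \<in> borel_measurable (Fpre \<sigma>)"
proof (rule measurableI)
  note [measurable] = stopping_measurable[OF \<sigma>] \<psi> measurable_ext0[OF \<psi>]
  fix B :: "real set" assume B[measurable]: "B \<in> sets borel"
  have "{w \<in> {w\<in>Om X. fk \<psi> (enn2real (\<sigma> w)) w \<in> B}. \<sigma> w \<le> t} \<in> sets (N s)" if s: "t < s \<or> s = top" for s t
  proof (cases "t = top")
    case True
    then have "s = top" using s by auto
    have "{w\<in>space (N top). fk \<psi> (enn2real (\<sigma> w)) w \<in> B} \<in> sets (N top)" by measurable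
    then show ?thesis using True \<open>s = top\<close> by simp
  next
    case False
    then have t: "t < top" "t < s" using s by (auto simp: top.not_eq_extremum)
    define c where "c w = exp (- enn2real (\<integral>\<^sup>+r. indicator {0..enn2real (min (\<sigma> w) t)} r * ext0 \<psi> (path X (min (ennreal r) t) w) \<partial>lborel))" for w
    have [measurable]: "(\<lambda>p. path X (min (ennreal (snd p)) t) (fst p)) \<in> N s \<Otimes>\<^sub>M borel \<rightarrow>\<^sub>M cemetery_borel"
      using measurable_compose[OF measurable_pair_swap' progressive_measurable[OF disjI1[OF t(2)]]]
      by (simp add: case_prod_beta)
    have [measurable]: "(\<lambda>w. min (\<sigma> w) t) \<in> borel_measurable (N s)" by (rule stopping_min_measurable[OF \<sigma> t(2)])
    have [measurable]: "c \<in> borel_measurable (N s)"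
      unfolding c_def[abs_def] indicator_def atLeastAtMost_iff by measurable
    have "Measurable.pred (N s) (\<lambda>w. \<sigma> w \<le> t)"
      using measurable_FD[OF stopping_timeD[OF \<sigma>, of t], of s] t(2) by simp
    then have "{w\<in>space (N s). c w \<in> B \<and> \<sigma> w \<le> t} \<in> sets (N s)" by measurable
    also have "{w\<in>space (N s). c w \<in> B \<and> \<sigma> w \<le> t} = {w \<in> {w\<in>Om X. fk \<psi> (enn2real (\<sigma> w)) w \<in> B}. \<sigma> w \<le> t}"
    proof -
      have "c w = fk \<psi> (enn2real (\<sigma> w)) w" if "\<sigma> w \<le> t" for w
      proof -
        have m: "min (\<sigma> w) t = \<sigma> w" using that by (rule min_absorb1)
        have "min (ennreal r) t = ennreal r" if r: "r \<le> enn2real (\<sigma> w)" for r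
        proof -
          have "ennreal r \<le> ennreal (enn2real (\<sigma> w))" using r by (rule ennreal_leI)
          also have "\<dots> = \<sigma> w" using \<open>\<sigma> w \<le> t\<close> t by (intro ennreal_enn2real) auto
          finally show ?thesis using \<open>\<sigma> w \<le> t\<close> by (intro min_absorb1) simp
        qed
        then have "(\<integral>\<^sup>+r. indicator {0..enn2real (\<sigma> w)} r * ext0 \<psi> (path X (min (ennreal r) t) w) \<partial>lborel) = addf \<psi> (enn2real (\<sigma> w)) w"
          unfolding addf_def by (intro nn_integral_cong) (auto split: split_indicator)
        then show ?thesis by (simp add: c_def fk_def m)
      qed
      then show ?thesis by auto
    qed
    finally show ?thesis .
  qed
  then have "{w\<in>Om X. fk \<psi> (enn2real (\<sigma> w)) w \<in> B} \<in> sets (Fpre \<sigma>)"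
    by (intro filtration.sets_pre_sigmaI[OF filtration_F \<sigma>]) (auto simp: sets_F)
  then show "(\<lambda>w. fk \<psi> (enn2real (\<sigma> w)) w) -` B \<inter> space (Fpre \<sigma>) \<in> sets (Fpre \<sigma>)"
    by (simp add: vimage_def Int_def conj_commute)
qed simp

lemma path_stopping_measurable:
  assumes \<sigma>: "stopping_time F \<sigma>" shows "(\<lambda>w. path X (\<sigma> w) w) \<in> Fpre \<sigma> \<rightarrow>\<^sub>M cemetery_borel"
proof (rule measurableI)
  fix B :: "'a option set" assume "B \<in> sets cemetery_borel"
  from path_stopping_sets[OF \<sigma> _ this, of "Om X"] sets.top[of "Fpre \<sigma>"]
  show "(\<lambda>w. path X (\<sigma> w) w) -` B \<inter> space (Fpre \<sigma>) \<in> sets (Fpre \<sigma>)"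
    by (simp add: vimage_def Int_def conj_commute)
qed simp

lemma AE_law_None: "AE w in law X None. \<forall>t. path X t w = None"
  using path0[of None] AE_Om[of None] by eventually_elim (auto intro: path_None_mono)

lemma green_fun_None: "(\<E> None (\<lambda>w. green_fun \<psi> D g w)) = 0"
proof -
  have "(\<E> None (\<lambda>w. green_fun \<psi> D g w)) = (\<E> None (\<lambda>w. 0))"
    by (intro nn_integral_cong_AE eventually_mono[OF AE_law_None]) (simp add: green_fun_def)
  then show ?thesis by simp
qed

lemma exit_fun_None: "(\<E> None (\<lambda>w. exit_fun \<psi> D u w)) = 0"
proof -
  have "(\<E> None (\<lambda>w. exit_fun \<psi> D u w)) = (\<E> None (\<lambda>w. 0))"
    by (intro nn_integral_cong_AE eventually_mono[OF AE_law_None]) (simp add: exit_fun_def)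
  then show ?thesis by simp
qed

text \<open>If the expectation of \<open>Z\<close> from the cemetery is 0, dead positions contribute
  nothing. An infinite \<sigma> also leads to the cemetery, so \<open>ext0\<close> absorbs the
  indicator of finite \<sigma>.\<close>

lemma strong_markov_ext0:
  assumes \<sigma>: "stopping_time F \<sigma>" and Y: "Y \<in> borel_measurable (Fpre \<sigma>)" and Z: "Z \<in> borel_measurable (N top)"
    and None0: "(\<E> None (\<lambda>w. Z w)) = 0"
  shows "(\<E> y (\<lambda>w. Y w * (indicator {w. \<sigma> w < top} w * Z (shift X (\<sigma> w) w)))) =
     (\<E> y (\<lambda>w. Y w * ext0 (\<lambda>x. \<integral>\<^sup>+w'. Z w' \<partial>law X (Some x)) (path X (\<sigma> w) w)))"
proof -
  have "(\<E> y (\<lambda>w. Y w * (indicator {w. \<sigma> w < top} w * Z (shift X (\<sigma> w) w)))) =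
      (\<E> y (\<lambda>w. Y w * (indicator {w. \<sigma> w < top} w * Z (shifted \<sigma> w))))"
    by (intro nn_integral_cong) (auto simp: shifted_def split: split_indicator)
  also note strong_markov_expectation[OF \<sigma> Y Z]
  also have "(\<E> y (\<lambda>w. Y w * (indicator {w. \<sigma> w < top} w * (\<E> (path X (\<sigma> w) w) (\<lambda>w'. Z w'))))) =
     (\<E> y (\<lambda>w. Y w * ext0 (\<lambda>x. \<integral>\<^sup>+w'. Z w' \<partial>law X (Some x)) (path X (\<sigma> w) w)))"
  proof (intro nn_integral_cong)
    fix w assume "w \<in> space (law X y)"
    then have w: "w \<in> Om X" by simp
    show "Y w * (indicator {w. \<sigma> w < top} w * (\<E> (path X (\<sigma> w) w) (\<lambda>w'. Z w'))) =
      Y w * ext0 (\<lambda>x. \<integral>\<^sup>+w'. Z w' \<partial>law X (Some x)) (path X (\<sigma> w) w)"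
      using None0 path_infty[OF w]
      by (cases "path X (\<sigma> w) w") (auto split: split_indicator simp: top.not_eq_extremum[symmetric])
  qed
  finally show ?thesis .
qed

lemma AE_exit_cases:
  assumes "open D" "open W" "W \<subseteq> D"
  shows "AE w in law X y. w \<in> Om X \<and> (exit_at W w = top \<longrightarrow> exit_at D w = top) \<and>
    (exit_at W w < top \<longrightarrow> exit_at D w = exit_at W w + exit_at D (shift X (exit_at W w) w))"
  using AE_exit_at_shift[OF assms(1) exit_at_stopping[of W]]
proof eventually_elim
  case (elim w)
  then have "exit_at W w \<le> exit_at D w" by (intro exit_at_mono assms) auto
  then show ?case using elim by (auto simp: top_unique)
qed

section \<open>Decomposition at the exit from a smaller set\<close>

text \<open>The time integral is cut at the exit from \<open>W\<close>. The weight accumulated until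
  then belongs to the past, and the rest is the same functional of the shifted path.\<close>

theorem GK_strong_markov:
  assumes D: "open D" "open W" "W \<subseteq> D" and \<psi>: "rate \<psi>" and g: "g \<in> borel_measurable borel"
  shows "GK \<psi> D g x = GK \<psi> W g x + HK \<psi> W (GK \<psi> D g) x"
proof -
  let ?\<sigma> = "exit_at W"
  define Y where "Y w = ennreal (fk \<psi> (enn2real (?\<sigma> w)) w)" for w
  note \<psi>m[measurable] = rate_measurable[OF \<psi>] and g[measurable]
  have Y: "Y \<in> borel_measurable (Fpre ?\<sigma>)"
    unfolding Y_def using fk_stopping_measurable[OF exit_at_stopping \<psi>m] by measurable
  have Z: "green_fun \<psi> D g \<in> borel_measurable (N top)" by measurable
  have shm[measurable]: "(\<lambda>w. Y w * (indicator {w. ?\<sigma> w < top} w * green_fun \<psi> D g (shifted ?\<sigma> w))) \<in> borel_measurable (N top)"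
    unfolding Y_def indicator_def mem_Collect_eq
    using measurable_compose[OF shifted_measurable[OF exit_at_measurable] Z] by measurable
  have "GK \<psi> D g x = (\<E> (Some x) (\<lambda>w. green_fun \<psi> W g w + Y w * (indicator {w. ?\<sigma> w < top} w * green_fun \<psi> D g (shifted ?\<sigma> w))))"
    unfolding GK_def
  proof (intro nn_integral_cong_AE eventually_mono[OF AE_exit_cases[OF D]], elim conjE)
    fix w assume w: "w \<in> Om X" and t: "?\<sigma> w = top \<longrightarrow> exit_at D w = top"
      and s: "?\<sigma> w < top \<longrightarrow> exit_at D w = ?\<sigma> w + exit_at D (shift X (?\<sigma> w) w)"
    show "green_fun \<psi> D g w = green_fun \<psi> W g w + Y w * (indicator {w. ?\<sigma> w < top} w * green_fun \<psi> D g (shifted ?\<sigma> w))"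
    proof (cases "?\<sigma> w")
      case top then show ?thesis using t by (simp add: green_fun_def)
    next
      case (real r)
      have ind: "indicator {0..<r} t = (indicator {t. 0 \<le> t \<and> ennreal t < ?\<sigma> w} t :: ennreal)" for t
        using real by (auto simp: ennreal_less_iff split: split_indicator)
      show ?thesis
        using green_fun_split[OF w real(1) \<psi> g, of D] s real
        by (simp add: Y_def shifted_def ind green_fun_def[of \<psi> W])
    qed
  qed
  also have "\<dots> = GK \<psi> W g x + (\<E> (Some x) (\<lambda>w. Y w * (indicator {w. ?\<sigma> w < top} w * green_fun \<psi> D g (shifted ?\<sigma> w))))"
    unfolding GK_def by (rule nn_integral_add) auto
  also have "(\<E> (Some x) (\<lambda>w. Y w * (indicator {w. ?\<sigma> w < top} w * green_fun \<psi> D g (shifted ?\<sigma> w))))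
     = (\<E> (Some x) (\<lambda>w. Y w * (indicator {w. ?\<sigma> w < top} w * green_fun \<psi> D g (shift X (?\<sigma> w) w))))"
    by (intro nn_integral_cong) (auto simp: shifted_def split: split_indicator)
  also have "\<dots> = HK \<psi> W (GK \<psi> D g) x"
    unfolding strong_markov_ext0[OF exit_at_stopping Y Z green_fun_None]
    unfolding HK_def exit_fun_def Y_def GK_def[abs_def] by (rule refl)
  finally show ?thesis .
qed

theorem HK_strong_markov:
  assumes D: "open D" "open W" "W \<subseteq> D" and \<psi>: "rate \<psi>" and u: "u \<in> borel_measurable borel"
  shows "HK \<psi> D u x = HK \<psi> W (HK \<psi> D u) x"
proof -
  let ?\<sigma> = "exit_at W"
  define Y where "Y w = ennreal (fk \<psi> (enn2real (?\<sigma> w)) w)" for w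
  note \<psi>m[measurable] = rate_measurable[OF \<psi>] and u[measurable]
  have Y: "Y \<in> borel_measurable (Fpre ?\<sigma>)"
    unfolding Y_def using fk_stopping_measurable[OF exit_at_stopping \<psi>m] by measurable
  have Z: "exit_fun \<psi> D u \<in> borel_measurable (N top)" by measurable
  have "HK \<psi> D u x = (\<E> (Some x) (\<lambda>w. Y w * (indicator {w. ?\<sigma> w < top} w * exit_fun \<psi> D u (shift X (?\<sigma> w) w))))"
    unfolding HK_def
  proof (intro nn_integral_cong_AE eventually_mono[OF AE_exit_cases[OF D]], elim conjE)
    fix w assume w: "w \<in> Om X" and t: "?\<sigma> w = top \<longrightarrow> exit_at D w = top"
      and s: "?\<sigma> w < top \<longrightarrow> exit_at D w = ?\<sigma> w + exit_at D (shift X (?\<sigma> w) w)"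
    show "exit_fun \<psi> D u w = Y w * (indicator {w. ?\<sigma> w < top} w * exit_fun \<psi> D u (shift X (?\<sigma> w) w))"
    proof (cases "?\<sigma> w")
      case top then show ?thesis using t path_infty[OF w] by (simp add: exit_fun_def)
    next
      case (real r)
      then show ?thesis using exit_fun_shift[OF w real(1) \<psi>, of D u] s by (simp add: Y_def)
    qed
  qed
  also have "\<dots> = HK \<psi> W (HK \<psi> D u) x"
    unfolding strong_markov_ext0[OF exit_at_stopping Y Z exit_fun_None]
    unfolding HK_def[of \<psi> W] exit_fun_def[of \<psi> W] Y_def HK_def[of \<psi> D, abs_def] by (rule refl)
  finally show ?thesis .
qed

lemma AE_exit_outside:
  assumes "open D" "z \<notin> D" shows "AE w in law X (Some z). exit_at D w = 0 \<and> path X 0 w = Some z"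
  using path0[of "Some z"]
proof eventually_elim
  case (elim w)
  then have "exit_at D w \<le> 0" using assms by (intro exit_at_le) auto
  then show ?case using elim by simp
qed

text \<open>This is the gain from letting time 0 count as an exit: off \<open>D\<close> the exit
  operator is the identity at every point, regular or not.\<close>

lemma HK_outside: "open D \<Longrightarrow> z \<notin> D \<Longrightarrow> HK \<psi> D u z = u z"
proof -
  assume "open D" "z \<notin> D"
  from AE_exit_outside[OF this] have "HK \<psi> D u z = (\<E> (Some z) (\<lambda>w. u z))"
    unfolding HK_def by (intro nn_integral_cong_AE) (erule eventually_mono, auto simp: exit_fun_def fk_0)
  then show ?thesis using prob_space.emeasure_space_1[OF prob_law[of "Some z"]] by simp
qed

lemma GK_outside: "open D \<Longrightarrow> z \<notin> D \<Longrightarrow> GK \<psi> D g z = 0"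
proof -
  assume "open D" "z \<notin> D"
  from AE_exit_outside[OF this] have "GK \<psi> D g z = (\<E> (Some z) (\<lambda>w. 0))"
    unfolding GK_def by (intro nn_integral_cong_AE) (erule eventually_mono, auto simp: green_fun_def)
  then show ?thesis by simp
qed

text \<open>Markov property at all fixed times before the exit; \<open>Z' t\<close> is what \<open>Z \<circ> \<theta>\<^sub>t\<close> looks like there.\<close>

lemma GK_expectation:
  assumes D: "open D" and \<psi>': "\<psi>' \<in> borel_measurable borel" and \<psi>: "\<psi> \<in> borel_measurable borel"
    and Z: "Z \<in> borel_measurable (N top)" and None0: "(\<E> None (\<lambda>w. Z w)) = 0"
    and Z': "(\<lambda>p. Z' (fst p) (snd p)) \<in> borel_measurable (borel \<Otimes>\<^sub>M N top)"
    and eq: "\<And>w t. w \<in> Om X \<Longrightarrow> 0 \<le> t \<Longrightarrow> exit_at D w = ennreal t + exit_at D (shift X (ennreal t) w) \<Longrightarrow>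
       Z (shift X (ennreal t) w) = Z' t w"
  shows "GK \<psi>' D (\<lambda>z. \<psi> z * (\<E> (Some z) (\<lambda>w. Z w))) x =
    (\<E> (Some x) (\<lambda>w. (\<integral>\<^sup>+t. indicator {t. 0 \<le> t \<and> ennreal t < exit_at D w} t *
      (ennreal (fk \<psi>' t w) * ext0 \<psi> (path X (ennreal t) w) * Z' t w) \<partial>lborel)))"
proof -
  let ?P = "law X (Some x)"
  interpret P: prob_space ?P by (rule prob_law)
  interpret Q: pair_sigma_finite ?P "lborel :: real measure" by standard
  note [measurable] = \<psi> \<psi>' Z measurable_ext0[OF \<psi>]
  define e where "e z = (\<E> (Some z) (\<lambda>w. Z w))" for z
  have e[measurable]: "e \<in> borel_measurable borel"
    unfolding e_def[abs_def] by (rule measurable_compose[OF measurable_Some measurable_expectation[OF Z]])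
  note [measurable] = measurable_ext0[OF e]
  have pr: "ext0 (\<lambda>z. \<psi> z * e z) y = ext0 \<psi> y * ext0 e y" for y by (cases y) auto
  define Y where "Y t w = indicator {t. 0 \<le> t \<and> ennreal t < exit_at D w} t * (ennreal (fk \<psi>' t w) * ext0 \<psi> (path X (ennreal t) w))" for t w
  have sP: "sets ?P = sets (N top)" using sets_law by simp
  have s1: "sets (?P \<Otimes>\<^sub>M lborel) = sets (N top \<Otimes>\<^sub>M borel)" by (intro sets_pair_measure_cong sP) simp
  have meq: "measurable (?P \<Otimes>\<^sub>M lborel) M = measurable (N top \<Otimes>\<^sub>M borel) M" for M :: "ennreal measure"
    by (rule measurable_cong_sets[OF s1 refl])
  have [measurable]: "(\<lambda>p. Y (snd p) (fst p)) \<in> borel_measurable (N top \<Otimes>\<^sub>M borel)"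
    unfolding Y_def indicator_def mem_Collect_eq by measurable
  have [measurable]: "(\<lambda>p. Z' (snd p) (fst p)) \<in> borel_measurable (N top \<Otimes>\<^sub>M borel)"
    using measurable_compose[OF measurable_pair_swap' Z'] by (simp add: case_prod_beta)
  have "GK \<psi>' D (\<lambda>z. \<psi> z * e z) x = (\<integral>\<^sup>+w. (\<integral>\<^sup>+t. Y t w * ext0 e (path X (ennreal t) w) \<partial>lborel) \<partial>?P)"
    unfolding GK_def green_fun_def by (simp add: pr Y_def mult.assoc)
  also have "\<dots> = (\<integral>\<^sup>+t. (\<integral>\<^sup>+w. Y t w * ext0 e (path X (ennreal t) w) \<partial>?P) \<partial>lborel)"
    by (rule Q.Fubini'[symmetric]) (unfold meq case_prod_beta, measurable)
  also have "\<dots> = (\<integral>\<^sup>+t. (\<integral>\<^sup>+w. Y t w * Z' t w \<partial>?P) \<partial>lborel)"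
  proof (rule nn_integral_cong)
    fix t :: real
    show "(\<integral>\<^sup>+w. Y t w * ext0 e (path X (ennreal t) w) \<partial>?P) = (\<integral>\<^sup>+w. Y t w * Z' t w \<partial>?P)"
    proof (cases "0 \<le> t")
      case False then show ?thesis by (simp add: Y_def)
    next
      case True
      let ?c = "\<lambda>_::'w. ennreal t"
      have c: "stopping_time F ?c" by (rule stopping_time_const)
      have ind: "(\<lambda>w. indicator {t. 0 \<le> t \<and> ennreal t < exit_at D w} t :: ennreal) \<in> borel_measurable (Fpre ?c)"
        unfolding indicator_def mem_Collect_eq
        using filtration.stopping_time_less[OF filtration_F c exit_at_stopping[of D]] by measurable
      have fkm: "(\<lambda>w. fk \<psi>' t w) \<in> borel_measurable (Fpre ?c)"
        using fk_stopping_measurable[OF c \<psi>'] True by (simp only: enn2real_ennreal)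
      have Y: "Y t \<in> borel_measurable (Fpre ?c)"
        unfolding Y_def[abs_def]
        by (intro borel_measurable_times_ennreal ind measurable_compose[OF fkm measurable_ennreal]
            measurable_compose[OF path_stopping_measurable[OF c] measurable_ext0[OF \<psi>]])
      have "(\<integral>\<^sup>+w. Y t w * ext0 e (path X (ennreal t) w) \<partial>?P) = (\<integral>\<^sup>+w. Y t w * Z (shift X (ennreal t) w) \<partial>?P)"
      proof -
        have h1: "(\<integral>\<^sup>+w. Y t w * (indicator {w::'w. ennreal t < top} w * Z (shift X (ennreal t) w)) \<partial>?P) =
            (\<integral>\<^sup>+w. Y t w * ext0 e (path X (ennreal t) w) \<partial>?P)"
          unfolding e_def[abs_def] by (rule strong_markov_ext0[OF c Y Z None0])
        have h2: "(\<integral>\<^sup>+w. Y t w * (indicator {w::'w. ennreal t < top} w * Z (shift X (ennreal t) w)) \<partial>?P) =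
            (\<integral>\<^sup>+w. Y t w * Z (shift X (ennreal t) w) \<partial>?P)"
          by (intro nn_integral_cong) (auto split: split_indicator)
        show ?thesis by (rule trans[OF h1[symmetric] h2])
      qed
      also have "\<dots> = (\<integral>\<^sup>+w. Y t w * Z' t w \<partial>?P)"
        by (intro nn_integral_cong_AE eventually_mono[OF AE_exit_at_shift[OF D c]])
           (use eq True in \<open>auto simp: Y_def split: split_indicator\<close>)
      finally show ?thesis .
    qed
  qed
  also have "\<dots> = (\<integral>\<^sup>+w. (\<integral>\<^sup>+t. Y t w * Z' t w \<partial>lborel) \<partial>?P)"
    by (rule Q.Fubini') (unfold meq case_prod_beta, measurable)
  finally show ?thesis by (simp add: Y_def mult.assoc e_def)
qed

section \<open>Perturbation formulas for killing\<close>

text \<open>The clock change with exp(-y) and with exp(y). The second form serves integrals in which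
  the weight between two times appears as a quotient of weights.\<close>

lemma fk_clock:
  assumes w: "w \<in> Om X" and \<psi>: "rate \<psi>" and s: "0 \<le> s"
  shows "(\<integral>\<^sup>+t. indicator {0..s} t * (ennreal (fk \<psi> t w) * ext0 \<psi> (path X (ennreal t) w)) \<partial>lborel) = ennreal (1 - fk \<psi> s w)"
    and "(\<integral>\<^sup>+t. indicator {0..s} t * (ennreal (1 / fk \<psi> t w) * ext0 \<psi> (path X (ennreal t) w)) \<partial>lborel) = ennreal (1 / fk \<psi> s w - 1)"
proof -
  obtain \<kappa> where \<kappa>: "0 \<le> \<kappa>" "\<And>z. \<psi> z \<le> ennreal \<kappa>" using \<psi> by (auto simp: rate_def)
  let ?f = "\<lambda>r::real. ext0 \<psi> (path X (ennreal r) w)"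
  have b: "?f r \<le> ennreal \<kappa>" for r using \<kappa> by (cases "path X (ennreal r) w") auto
  have m: "?f \<in> borel_measurable borel"
    by (rule measurable_compose[OF path_time_measurable[OF w] measurable_ext0[OF rate_measurable[OF \<psi>]]])
  note cc = clock_change[OF m _ b \<kappa>(1) s, folded addf_def]
  show "(\<integral>\<^sup>+t. indicator {0..s} t * (ennreal (fk \<psi> t w) * ext0 \<psi> (path X (ennreal t) w)) \<partial>lborel) = ennreal (1 - fk \<psi> s w)"
    using cc[of "\<lambda>y. ennreal (exp (- y))"] nn_integral_exp_Icc(1)[OF enn2real_nonneg[of "addf \<psi> s w"]]
    by (simp add: fk_def mult.commute)
  show "(\<integral>\<^sup>+t. indicator {0..s} t * (ennreal (1 / fk \<psi> t w) * ext0 \<psi> (path X (ennreal t) w)) \<partial>lborel) = ennreal (1 / fk \<psi> s w - 1)"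
  proof -
    have inv: "1 / fk \<psi> t w = exp (enn2real (addf \<psi> t w))" for t by (simp add: fk_def exp_minus field_simps)
    show ?thesis unfolding inv
      using cc[of "\<lambda>y. ennreal (exp y)"] nn_integral_exp_Icc(2)[OF enn2real_nonneg[of "addf \<psi> s w"]]
      by (simp add: mult.commute)
  qed
qed

lemma fk_clock_Ico:
  assumes "w \<in> Om X" "rate \<psi>" "0 \<le> s"
  shows "(\<integral>\<^sup>+t. indicator {0..<s} t * (ennreal (fk \<psi> t w) * ext0 \<psi> (path X (ennreal t) w)) \<partial>lborel) = ennreal (1 - fk \<psi> s w)"
  using fk_clock(1)[OF assms] by (simp add: nn_integral_Icc_eq_Ico)

lemma add_diff_ennreal_1: "0 \<le> a \<Longrightarrow> a \<le> 1 \<Longrightarrow> ennreal a + ennreal (1 - a) = 1"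
  by (subst ennreal_plus[symmetric]) auto

text \<open>One minus the weight at the exit is the integral over t of the weight times \<psi>.
  Multiply by the exit value of u and apply the Markov property at each time t.\<close>

lemma HK_perturb:
  assumes D: "open D" and \<psi>: "rate \<psi>" and u: "u \<in> borel_measurable borel"
  shows "Hr D u x = HK \<psi> D u x + GK \<psi> D (\<lambda>z. \<psi> z * Hr D u z) x"
proof -
  note \<psi>m[measurable] = rate_measurable[OF \<psi>] and u[measurable]
  let ?Z = "exit_fun (\<lambda>_. 0) D u"
  have r0: "rate (\<lambda>_. 0)" by (rule rate_const) simp
  have "GK \<psi> D (\<lambda>z. \<psi> z * Hr D u z) x =
    (\<E> (Some x) (\<lambda>w. (\<integral>\<^sup>+t. indicator {t. 0 \<le> t \<and> ennreal t < exit_at D w} t *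
      (ennreal (fk \<psi> t w) * ext0 \<psi> (path X (ennreal t) w) * ?Z w) \<partial>lborel)))"
    unfolding HK_def
    by (rule GK_expectation[OF D \<psi>m \<psi>m _ exit_fun_None])
       (auto simp: exit_fun_shift[OF _ _ r0] intro!: measurable_compose[OF measurable_snd exit_fun_measurable])
  also have "\<dots> = (\<E> (Some x) (\<lambda>w. ennreal (1 - fk \<psi> (enn2real (exit_at D w)) w) * ?Z w))"
  proof (intro nn_integral_cong)
    fix w assume "w \<in> space (law X (Some x))"
    then have w: "w \<in> Om X" by simp
    note [measurable] = path_time_measurable[OF w] measurable_ext0[OF \<psi>m]
    have [measurable]: "(\<lambda>_::real. w) \<in> borel \<rightarrow>\<^sub>M N top" using w by simp
    show "(\<integral>\<^sup>+t. indicator {t. 0 \<le> t \<and> ennreal t < exit_at D w} t *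
      (ennreal (fk \<psi> t w) * ext0 \<psi> (path X (ennreal t) w) * ?Z w) \<partial>lborel) =
      ennreal (1 - fk \<psi> (enn2real (exit_at D w)) w) * ?Z w"
    proof (cases "exit_at D w")
      case top then show ?thesis using path_infty[OF w] by (simp add: exit_fun_def)
    next
      case (real s)
      have ind: "indicator {t. 0 \<le> t \<and> ennreal t < exit_at D w} t = (indicator {0..<s} t :: ennreal)" for t
        using real by (auto simp: ennreal_less_iff split: split_indicator)
      have "(\<integral>\<^sup>+t. indicator {0..<s} t * (ennreal (fk \<psi> t w) * ext0 \<psi> (path X (ennreal t) w) * ?Z w) \<partial>lborel)
        = (\<integral>\<^sup>+t. indicator {0..<s} t * (ennreal (fk \<psi> t w) * ext0 \<psi> (path X (ennreal t) w)) * ?Z w \<partial>lborel)"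
        by (simp add: mult.assoc)
      also have "\<dots> = ennreal (1 - fk \<psi> s w) * ?Z w"
        by (subst nn_integral_multc) (simp_all add: fk_clock_Ico[OF w \<psi> real(1)])
      finally show ?thesis unfolding ind using real by simp
    qed
  qed
  finally have "HK \<psi> D u x + GK \<psi> D (\<lambda>z. \<psi> z * Hr D u z) x =
     (\<E> (Some x) (\<lambda>w. exit_fun \<psi> D u w + ennreal (1 - fk \<psi> (enn2real (exit_at D w)) w) * ?Z w))"
    unfolding HK_def by (subst nn_integral_add) auto
  also have "\<dots> = Hr D u x"
    unfolding HK_def
  proof (intro nn_integral_cong)
    fix w 
    let ?a = "fk \<psi> (enn2real (exit_at D w)) w"
    have "exit_fun \<psi> D u w = ennreal ?a * ?Z w" by (simp add: exit_fun_def)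
    then have "exit_fun \<psi> D u w + ennreal (1 - ?a) * ?Z w = (ennreal ?a + ennreal (1 - ?a)) * ?Z w"
      by (simp add: distrib_right)
    then show "exit_fun \<psi> D u w + ennreal (1 - ?a) * ?Z w = ?Z w"
      using add_diff_ennreal_1[OF less_imp_le[OF fk_pos] fk_le_1, of \<psi> "enn2real (exit_at D w)" w] by simp
  qed
  finally show ?thesis ..
qed

lemma green_fun_tail_inner:
  assumes w: "w \<in> Om X" and v: "v \<in> borel_measurable borel" and h: "h \<in> borel_measurable borel"
    and W: "\<And>r. 0 \<le> r \<Longrightarrow> (\<integral>\<^sup>+t. indicator {0..r} t * v t \<partial>lborel) = V r"
  shows "(\<integral>\<^sup>+t. indicator {t. 0 \<le> t \<and> ennreal t < exit_at D w} t *
      (v t * (\<integral>\<^sup>+r. indicator {r. t \<le> r \<and> ennreal r < exit_at D w} r * h r \<partial>lborel)) \<partial>lborel) =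
     (\<integral>\<^sup>+r. indicator {r. 0 \<le> r \<and> ennreal r < exit_at D w} r * (V r * h r) \<partial>(lborel::real measure))"
    (is "?L = ?R")
proof -
  let ?E = "exit_at D w"
  note [measurable] = v h
  have [measurable]: "(\<lambda>p::real\<times>real. indicator {t. 0 \<le> t \<and> ennreal t < ?E} (fst p) * (v (fst p) * (indicator {r. fst p \<le> r \<and> ennreal r < ?E} (snd p) * h (snd p))))
    \<in> borel_measurable (borel \<Otimes>\<^sub>M borel)"
    unfolding indicator_def mem_Collect_eq by measurable
  have "?L = (\<integral>\<^sup>+t. (\<integral>\<^sup>+r. indicator {t. 0 \<le> t \<and> ennreal t < ?E} t * (v t * (indicator {r. t \<le> r \<and> ennreal r < ?E} r * h r)) \<partial>lborel) \<partial>lborel)"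
  proof (intro nn_integral_cong)
    fix t :: real
    have m: "(\<lambda>r. indicator {r. t \<le> r \<and> ennreal r < ?E} r * h r) \<in> borel_measurable lborel"
      unfolding indicator_def mem_Collect_eq by measurable
    show "indicator {t. 0 \<le> t \<and> ennreal t < ?E} t * (v t * (\<integral>\<^sup>+r. indicator {r. t \<le> r \<and> ennreal r < ?E} r * h r \<partial>lborel))
      = (\<integral>\<^sup>+r. indicator {t. 0 \<le> t \<and> ennreal t < ?E} t * (v t * (indicator {r. t \<le> r \<and> ennreal r < ?E} r * h r)) \<partial>lborel)"
      unfolding mult.assoc[symmetric]
      using nn_integral_cmult[OF m, of "indicator {t. 0 \<le> t \<and> ennreal t < ?E} t * v t"]
      by (simp add: mult.assoc)
  qed
  also have "\<dots> = (\<integral>\<^sup>+r. (\<integral>\<^sup>+t. indicator {t. 0 \<le> t \<and> ennreal t < ?E} t * (v t * (indicator {r. t \<le> r \<and> ennreal r < ?E} r * h r)) \<partial>lborel) \<partial>lborel)"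
    by (rule lborel_pair.Fubini') (simp add: case_prod_beta)
  also have "\<dots> = ?R"
  proof (intro nn_integral_cong)
    fix r :: real
    have lt: "ennreal t < ?E" if "t \<le> r" "ennreal r < ?E" for t
      using that by (meson ennreal_leI le_less_trans)
    have "(\<integral>\<^sup>+t. indicator {t. 0 \<le> t \<and> ennreal t < ?E} t * (v t * (indicator {r. t \<le> r \<and> ennreal r < ?E} r * h r)) \<partial>lborel)
      = (\<integral>\<^sup>+t. (indicator {0..r} t * v t) * (indicator {r. 0 \<le> r \<and> ennreal r < ?E} r * h r) \<partial>lborel)"
    proof (rule nn_integral_cong)
      fix t
      show "indicator {t. 0 \<le> t \<and> ennreal t < ?E} t * (v t * (indicator {r. t \<le> r \<and> ennreal r < ?E} r * h r))
        = (indicator {0..r} t * v t) * (indicator {r. 0 \<le> r \<and> ennreal r < ?E} r * h r)"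
        using lt[of t] by (cases "0 \<le> t"; cases "t \<le> r"; cases "ennreal r < ?E") (simp_all add: indicator_def)
    qed
    also have "\<dots> = (\<integral>\<^sup>+t. indicator {0..r} t * v t \<partial>lborel) * (indicator {r. 0 \<le> r \<and> ennreal r < ?E} r * h r)"
      by (rule nn_integral_multc) simp
    also have "\<dots> = indicator {r. 0 \<le> r \<and> ennreal r < ?E} r * (V r * h r)"
      using W[of r] by (auto split: split_indicator)
    finally show "(\<integral>\<^sup>+t. indicator {t. 0 \<le> t \<and> ennreal t < ?E} t * (v t * (indicator {r. t \<le> r \<and> ennreal r < ?E} r * h r)) \<partial>lborel)
       = indicator {r. 0 \<le> r \<and> ennreal r < ?E} r * (V r * h r)" .
  qed
  finally show ?thesis .
qed

lemma tail_measurable: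
  assumes [measurable]: "\<psi> \<in> borel_measurable borel" "g \<in> borel_measurable borel"
  shows "(\<lambda>p. \<integral>\<^sup>+r. indicator {r. fst p \<le> r \<and> ennreal r < exit_at D (snd p)} r *
       (ennreal (fk \<psi> r (snd p)) * ext0 g (path X (ennreal r) (snd p))) \<partial>(lborel::real measure)) \<in> borel_measurable (borel \<Otimes>\<^sub>M N top)"
  unfolding indicator_def mem_Collect_eq using measurable_ext0[OF assms(2)] by measurable

text \<open>The resolvent equation in both orders. In either order the second term equals the
  expected integral of (1 - fk) times g: in the first the weight runs up to time t, in the second it
  runs from t to r as the quotient of \<open>fk\<close> at r and at t, and Tonelli lets the inner
  integral over t be computed by \<open>fk_clock\<close>.\<close>

lemma GK_perturb:
  assumes D: "open D" and \<psi>: "rate \<psi>" and g: "g \<in> borel_measurable borel"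
  shows "Gr D g x = GK \<psi> D g x + GK \<psi> D (\<lambda>z. \<psi> z * Gr D g z) x" (is ?thesis1)
    and "Gr D g x = GK \<psi> D g x + Gr D (\<lambda>z. \<psi> z * GK \<psi> D g z) x" (is ?thesis2)
proof -
  note \<psi>m[measurable] = rate_measurable[OF \<psi>] and g[measurable]
  have r0: "rate (\<lambda>_. 0)" by (rule rate_const) simp
  have z0: "(\<lambda>_::'a. 0::ennreal) \<in> borel_measurable borel" by simp
  let ?P = "law X (Some x)"
  let ?I = "\<lambda>w t. indicator {t. 0 \<le> t \<and> ennreal t < exit_at D w} t :: ennreal"
  let ?g = "\<lambda>w r::real. ext0 g (path X (ennreal r) w)"
  let ?p = "\<lambda>w r::real. ext0 \<psi> (path X (ennreal r) w)"
  let ?J = "\<lambda>\<psi> t w. \<integral>\<^sup>+r. indicator {r. t \<le> r \<and> ennreal r < exit_at D w} r * (ennreal (fk \<psi> r w) * ?g w r) \<partial>(lborel::real measure)"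
  have pm: "?p w \<in> borel_measurable borel" and gm: "?g w \<in> borel_measurable borel"
    and fm: "(\<lambda>t. fk \<psi> t w) \<in> borel_measurable borel" if w: "w \<in> Om X" for w
  proof -
    have [measurable]: "(\<lambda>_::real. w) \<in> borel \<rightarrow>\<^sub>M N top" using w by simp
    note [measurable] = path_time_measurable[OF w] measurable_ext0[OF \<psi>m] measurable_ext0[OF g]
    show "?p w \<in> borel_measurable borel" "?g w \<in> borel_measurable borel" "(\<lambda>t. fk \<psi> t w) \<in> borel_measurable borel"
      by measurable
  qed
  have sum: "GK \<psi> D g x + (\<integral>\<^sup>+w. (\<integral>\<^sup>+r. ?I w r * (ennreal (1 - fk \<psi> r w) * ?g w r) \<partial>lborel) \<partial>?P) = Gr D g x"
  proof -
    have [measurable]: "(\<lambda>w. \<integral>\<^sup>+r. ?I w r * (ennreal (1 - fk \<psi> r w) * ?g w r) \<partial>lborel) \<in> borel_measurable (N top)"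
      unfolding indicator_def mem_Collect_eq using measurable_ext0[OF g] by measurable
    have "GK \<psi> D g x + (\<integral>\<^sup>+w. (\<integral>\<^sup>+r. ?I w r * (ennreal (1 - fk \<psi> r w) * ?g w r) \<partial>lborel) \<partial>?P)
      = (\<integral>\<^sup>+w. green_fun \<psi> D g w + (\<integral>\<^sup>+r. ?I w r * (ennreal (1 - fk \<psi> r w) * ?g w r) \<partial>lborel) \<partial>?P)"
      unfolding GK_def by (rule nn_integral_add[symmetric]) auto
    also have "\<dots> = Gr D g x"
      unfolding GK_def
    proof (intro nn_integral_cong)
      fix w assume "w \<in> space ?P"
      then have w: "w \<in> Om X" by simp
      note [measurable] = pm[OF w] gm[OF w] fm[OF w]
      have "green_fun \<psi> D g w + (\<integral>\<^sup>+r. ?I w r * (ennreal (1 - fk \<psi> r w) * ?g w r) \<partial>lborel)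
        = (\<integral>\<^sup>+r. ?I w r * (ennreal (fk \<psi> r w) * ?g w r) + ?I w r * (ennreal (1 - fk \<psi> r w) * ?g w r) \<partial>lborel)"
        unfolding green_fun_def
        by (rule nn_integral_add[symmetric]) (unfold indicator_def mem_Collect_eq, measurable)
      also have "\<dots> = green_fun (\<lambda>_. 0) D g w"
        unfolding green_fun_def
      proof (intro nn_integral_cong)
        fix r
        have "?I w r * (ennreal (fk \<psi> r w) * ?g w r) + ?I w r * (ennreal (1 - fk \<psi> r w) * ?g w r)
           = ?I w r * ((ennreal (fk \<psi> r w) + ennreal (1 - fk \<psi> r w)) * ?g w r)"
          by (simp only: distrib_left distrib_right)
        also have "ennreal (fk \<psi> r w) + ennreal (1 - fk \<psi> r w) = 1"
          by (rule add_diff_ennreal_1[OF less_imp_le[OF fk_pos] fk_le_1])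
        finally show "?I w r * (ennreal (fk \<psi> r w) * ?g w r) + ?I w r * (ennreal (1 - fk \<psi> r w) * ?g w r) =
          ?I w r * (ennreal (fk (\<lambda>_. 0) r w) * ?g w r)" by simp
      qed
      finally show "green_fun \<psi> D g w + (\<integral>\<^sup>+r. ?I w r * (ennreal (1 - fk \<psi> r w) * ?g w r) \<partial>lborel) = green_fun (\<lambda>_. 0) D g w" .
    qed
    finally show ?thesis .
  qed
  have "GK \<psi> D (\<lambda>z. \<psi> z * Gr D g z) x =
    (\<integral>\<^sup>+w. (\<integral>\<^sup>+t. ?I w t * (ennreal (fk \<psi> t w) * ?p w t * ?J (\<lambda>_. 0) t w) \<partial>lborel) \<partial>?P)"
    unfolding GK_def[of "\<lambda>_. 0"]
    using green_fun_tail[OF _ _ r0 g]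
    by (intro GK_expectation[OF D \<psi>m \<psi>m _ green_fun_None] tail_measurable[OF z0 g]) auto
  also have "\<dots> = (\<integral>\<^sup>+w. (\<integral>\<^sup>+r. ?I w r * (ennreal (1 - fk \<psi> r w) * ?g w r) \<partial>lborel) \<partial>?P)"
  proof (rule nn_integral_cong)
    fix w assume "w \<in> space ?P"
    then have w: "w \<in> Om X" by simp
    note [measurable] = pm[OF w] gm[OF w] fm[OF w]
    show "(\<integral>\<^sup>+t. ?I w t * (ennreal (fk \<psi> t w) * ?p w t * ?J (\<lambda>_. 0) t w) \<partial>lborel) =
       (\<integral>\<^sup>+r. ?I w r * (ennreal (1 - fk \<psi> r w) * ?g w r) \<partial>lborel)"
      using green_fun_tail_inner[OF w _ gm[OF w] fk_clock(1)[OF w \<psi>], of D] by simp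
  qed
  finally show ?thesis1 using sum by simp
  have "Gr D (\<lambda>z. \<psi> z * GK \<psi> D g z) x =
    (\<integral>\<^sup>+w. (\<integral>\<^sup>+t. ?I w t * (ennreal (fk (\<lambda>_. 0) t w) * ?p w t * (ennreal (1 / fk \<psi> t w) * ?J \<psi> t w)) \<partial>lborel) \<partial>?P)"
    unfolding GK_def[of \<psi>]
  proof (rule GK_expectation[OF D z0 \<psi>m _ green_fun_None])
    show "green_fun \<psi> D g \<in> borel_measurable (N top)" by measurable
    show "(\<lambda>p. ennreal (1 / fk \<psi> (fst p) (snd p)) * ?J \<psi> (fst p) (snd p)) \<in> borel_measurable (borel \<Otimes>\<^sub>M N top)"
      using tail_measurable[OF \<psi>m g] by measurable
    fix w t assume "w \<in> Om X" "(0::real) \<le> t" "exit_at D w = ennreal t + exit_at D (shift X (ennreal t) w)"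
    note green_fun_tail[OF this(1,2) \<psi> g this(3)]
    then have "ennreal (1 / fk \<psi> t w) * ?J \<psi> t w = ennreal (1 / fk \<psi> t w) * (ennreal (fk \<psi> t w) * green_fun \<psi> D g (shift X (ennreal t) w))"
      by simp
    also have "\<dots> = green_fun \<psi> D g (shift X (ennreal t) w)"
      using fk_pos[of \<psi> t w] by (simp add: mult.assoc[symmetric] ennreal_mult[symmetric])
    finally show "green_fun \<psi> D g (shift X (ennreal t) w) = ennreal (1 / fk \<psi> t w) * ?J \<psi> t w" ..
  qed
  also have "\<dots> = (\<integral>\<^sup>+w. (\<integral>\<^sup>+r. ?I w r * (ennreal (1 - fk \<psi> r w) * ?g w r) \<partial>lborel) \<partial>?P)"
  proof (rule nn_integral_cong)
    fix w assume "w \<in> space ?P"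
    then have w: "w \<in> Om X" by simp
    note [measurable] = pm[OF w] gm[OF w] fm[OF w]
    have "(\<integral>\<^sup>+t. ?I w t * (ennreal (fk (\<lambda>_. 0) t w) * ?p w t * (ennreal (1 / fk \<psi> t w) * ?J \<psi> t w)) \<partial>lborel) =
        (\<integral>\<^sup>+t. ?I w t * ((ennreal (1 / fk \<psi> t w) * ?p w t) * ?J \<psi> t w) \<partial>lborel)"
      by (intro nn_integral_cong) (simp add: mult_ac)
    also have "\<dots> = (\<integral>\<^sup>+r. ?I w r * (ennreal (1 / fk \<psi> r w - 1) * (ennreal (fk \<psi> r w) * ?g w r)) \<partial>lborel)"
      by (rule green_fun_tail_inner[OF w _ _ fk_clock(2)[OF w \<psi>]]) measurable
    also have "\<dots> = (\<integral>\<^sup>+r. ?I w r * (ennreal (1 - fk \<psi> r w) * ?g w r) \<partial>lborel)"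
    proof (intro nn_integral_cong)
      fix r
      have "ennreal (1 / fk \<psi> r w - 1) * ennreal (fk \<psi> r w) = ennreal (1 - fk \<psi> r w)"
        using fk_pos[of \<psi> r w] fk_le_1[of \<psi> r w] by (subst ennreal_mult[symmetric]) (auto simp: field_simps)
      then show "?I w r * (ennreal (1 / fk \<psi> r w - 1) * (ennreal (fk \<psi> r w) * ?g w r)) = ?I w r * (ennreal (1 - fk \<psi> r w) * ?g w r)"
        by (simp add: mult.assoc[symmetric])
    qed
    finally show "(\<integral>\<^sup>+t. ?I w t * (ennreal (fk (\<lambda>_. 0) t w) * ?p w t * (ennreal (1 / fk \<psi> t w) * ?J \<psi> t w)) \<partial>lborel) =
      (\<integral>\<^sup>+r. ?I w r * (ennreal (1 - fk \<psi> r w) * ?g w r) \<partial>lborel)" .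
  qed
  finally show ?thesis2 using sum by simp
qed

section \<open>Monotonicity and linearity of the operators\<close>

lemma GK_mono:
  assumes D: "open D" and "\<And>z. z \<in> D \<Longrightarrow> g z \<le> g' z" shows "GK \<psi> D g x \<le> GK \<psi> D g' x"
  unfolding GK_def green_fun_def
proof (intro nn_integral_mono)
  fix w t show "indicator {t. 0 \<le> t \<and> ennreal t < exit_at D w} t * (ennreal (fk \<psi> t w) * ext0 g (path X (ennreal t) w))
      \<le> indicator {t. 0 \<le> t \<and> ennreal t < exit_at D w} t * (ennreal (fk \<psi> t w) * ext0 g' (path X (ennreal t) w))"
    using path_before_exit[OF D, of "ennreal t" w] assms(2)
    by (auto split: split_indicator intro!: mult_left_mono)
qed

lemma GK_cong:
  assumes "open D" "\<And>z. z \<in> D \<Longrightarrow> g z = g' z" shows "GK \<psi> D g x = GK \<psi> D g' x"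
  by (intro antisym GK_mono assms) (simp_all add: assms)

lemma AE_exit: "open D \<Longrightarrow> AE w in law X y. w \<in> Om X \<and> path X (exit_at D w) w \<notin> Some ` D"
proof -
  assume "open D"
  from AE_Om[of y] bad_exit_null[OF this, of y] show ?thesis by eventually_elim (simp add: path_exit_at)
qed

lemma HK_mono:
  assumes D: "open D" and "\<And>z. z \<notin> D \<Longrightarrow> u z \<le> u' z" shows "HK \<psi> D u x \<le> HK \<psi> D u' x"
  unfolding HK_def exit_fun_def
proof (intro nn_integral_mono_AE eventually_mono[OF AE_exit[OF D]] mult_left_mono)
  fix w assume "w \<in> Om X \<and> path X (exit_at D w) w \<notin> Some ` D"
  then show "ext0 u (path X (exit_at D w) w) \<le> ext0 u' (path X (exit_at D w) w)"
    using assms(2) by (cases "path X (exit_at D w) w") auto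
qed simp

lemma HK_cong:
  assumes "open D" "\<And>z. z \<notin> D \<Longrightarrow> u z = u' z" shows "HK \<psi> D u x = HK \<psi> D u' x"
  by (intro antisym HK_mono assms) (simp_all add: assms)

lemma ext0_add: "ext0 (\<lambda>z. g z + g' z) y = ext0 g y + (ext0 g' y :: ennreal)"
  and ext0_cmult: "ext0 (\<lambda>z. c * g z) y = c * (ext0 g y :: ennreal)"
  by (cases y; simp)+

lemma GK_add:
  assumes [measurable]: "\<psi> \<in> borel_measurable borel" "g \<in> borel_measurable borel" "g' \<in> borel_measurable borel"
  shows "GK \<psi> D (\<lambda>z. g z + g' z) x = GK \<psi> D g x + GK \<psi> D g' x"
proof -
  have "green_fun \<psi> D (\<lambda>z. g z + g' z) w = green_fun \<psi> D g w + green_fun \<psi> D g' w" if w: "w \<in> Om X" for w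
  proof -
    have [measurable]: "(\<lambda>_::real. w) \<in> borel \<rightarrow>\<^sub>M N top" using w by simp
    note [measurable] = path_time_measurable[OF w] measurable_ext0[OF assms(2)] measurable_ext0[OF assms(3)]
    show ?thesis unfolding green_fun_def ext0_add distrib_left
      by (rule nn_integral_add) (unfold indicator_def mem_Collect_eq, measurable)
  qed
  then have "GK \<psi> D (\<lambda>z. g z + g' z) x = (\<E> (Some x) (\<lambda>w. green_fun \<psi> D g w + green_fun \<psi> D g' w))"
    unfolding GK_def by (intro nn_integral_cong) auto
  also have "\<dots> = GK \<psi> D g x + GK \<psi> D g' x"
    unfolding GK_def by (rule nn_integral_add) auto
  finally show ?thesis .
qed

lemma GK_cmult:
  assumes [measurable]: "\<psi> \<in> borel_measurable borel" "g \<in> borel_measurable borel"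
  shows "GK \<psi> D (\<lambda>z. c * g z) x = c * GK \<psi> D g x"
proof -
  have "green_fun \<psi> D (\<lambda>z. c * g z) w = c * green_fun \<psi> D g w" if w: "w \<in> Om X" for w
  proof -
    have [measurable]: "(\<lambda>_::real. w) \<in> borel \<rightarrow>\<^sub>M N top" using w by simp
    note [measurable] = path_time_measurable[OF w] measurable_ext0[OF assms(2)]
    have "green_fun \<psi> D (\<lambda>z. c * g z) w = (\<integral>\<^sup>+t. c * (indicator {t. 0 \<le> t \<and> ennreal t < exit_at D w} t *
        (ennreal (fk \<psi> t w) * ext0 g (path X (ennreal t) w))) \<partial>lborel)"
      unfolding green_fun_def ext0_cmult by (simp add: mult_ac)
    also have "\<dots> = c * green_fun \<psi> D g w"
      unfolding green_fun_def by (rule nn_integral_cmult) (unfold indicator_def mem_Collect_eq, measurable)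
    finally show ?thesis .
  qed
  then have "GK \<psi> D (\<lambda>z. c * g z) x = (\<E> (Some x) (\<lambda>w. c * green_fun \<psi> D g w))"
    unfolding GK_def by (intro nn_integral_cong) auto
  also have "\<dots> = c * GK \<psi> D g x"
    unfolding GK_def by (rule nn_integral_cmult) auto
  finally show ?thesis .
qed

lemma HK_add:
  assumes [measurable]: "\<psi> \<in> borel_measurable borel" "g \<in> borel_measurable borel" "g' \<in> borel_measurable borel"
  shows "HK \<psi> D (\<lambda>z. g z + g' z) x = HK \<psi> D g x + HK \<psi> D g' x"
proof -
  have eq: "exit_fun \<psi> D (\<lambda>z. g z + g' z) w = exit_fun \<psi> D g w + exit_fun \<psi> D g' w" for w
    by (simp add: exit_fun_def ext0_add distrib_left)
  show ?thesis unfolding HK_def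
    by (subst nn_integral_add[symmetric]) (auto intro!: nn_integral_cong simp: eq)
qed

lemma HK_cmult:
  assumes [measurable]: "\<psi> \<in> borel_measurable borel" "g \<in> borel_measurable borel"
  shows "HK \<psi> D (\<lambda>z. c * g z) x = c * HK \<psi> D g x"
proof -
  have eq: "exit_fun \<psi> D (\<lambda>z. c * g z) w = c * exit_fun \<psi> D g w" for w
    by (simp add: exit_fun_def ext0_cmult mult_ac)
  show ?thesis unfolding HK_def
    by (subst nn_integral_cmult[symmetric]) (auto intro!: nn_integral_cong simp: eq)
qed

lemma HK_le_const:
  assumes "open D" "\<And>z. z \<notin> D \<Longrightarrow> u z \<le> c" shows "HK \<psi> D u x \<le> c"
proof -
  have "HK \<psi> D u x \<le> (\<E> (Some x) (\<lambda>w. c))"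
    unfolding HK_def exit_fun_def
  proof (intro nn_integral_mono_AE eventually_mono[OF AE_exit[OF assms(1)]])
    fix w assume "w \<in> Om X \<and> path X (exit_at D w) w \<notin> Some ` D"
    then have "ext0 u (path X (exit_at D w) w) \<le> c"
      using assms(2) by (cases "path X (exit_at D w) w") auto
    then show "ennreal (fk \<psi> (enn2real (exit_at D w)) w) * ext0 u (path X (exit_at D w) w) \<le> c"
      using mult_mono[of "ennreal (fk \<psi> (enn2real (exit_at D w)) w)" 1 "ext0 u (path X (exit_at D w) w)" c]
        fk_le_1 by simp
  qed
  then show ?thesis using prob_space.emeasure_space_1[OF prob_law[of "Some x"]] by simp
qed

lemma ennreal_fk_le_1: "ennreal (fk \<psi> t w) \<le> 1"
  using fk_le_1 by simp

lemma GK_le_GK0: "GK \<psi> D g x \<le> Gr D g x"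
  unfolding GK_def green_fun_def
  by (intro nn_integral_mono mult_left_mono mult_right_mono) (auto simp: fk_le_1)

lemma HK_le_HK0: "HK \<psi> D u x \<le> Hr D u x"
  unfolding HK_def exit_fun_def
  by (intro nn_integral_mono mult_right_mono) (auto simp: fk_le_1)

lemma GK_domain_mono:
  assumes "open D" "open W" "W \<subseteq> D" "g \<in> borel_measurable borel"
  shows "Gr W g x \<le> Gr D g x"
  using GK_strong_markov[OF assms(1-3) rate_const assms(4)] by simp

section \<open>Removing a constant discount rate\<close>

lemma fk_const_tendsto: "(\<lambda>n. fk (\<lambda>_. ennreal (1 / real (Suc n))) t w) \<longlonglongrightarrow> 1"
proof -
  have b: "ext0 (\<lambda>_. ennreal c) z \<le> ennreal c" for c and z :: "'a option" by (cases z) auto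
  have e: "enn2real (addf (\<lambda>_. ennreal (1 / real (Suc n))) t w) \<le> 1 / real (Suc n) * max 0 t" for n
  proof -
    have "addf (\<lambda>_. ennreal (1 / real (Suc n))) t w \<le> (\<integral>\<^sup>+r. indicator {0..max 0 t} r * ext0 (\<lambda>_. ennreal (1 / real (Suc n))) (path X (ennreal r) w) \<partial>lborel)"
      unfolding addf_def by (intro nn_integral_mono) (auto split: split_indicator)
    also have "\<dots> \<le> ennreal (1 / real (Suc n) * (max 0 t - 0))"
      by (rule nn_integral_Icc_bound[OF b]) auto
    finally show ?thesis by (intro enn2real_leI) auto
  qed
  have "(\<lambda>n. 1 / real (Suc n) * max 0 t) \<longlonglongrightarrow> 0 * max 0 t"
    by (intro tendsto_mult tendsto_const LIMSEQ_Suc[OF lim_1_over_n])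
  then have l0: "(\<lambda>n. 1 / real (Suc n) * max 0 t) \<longlonglongrightarrow> 0" by simp
  have "(\<lambda>n. enn2real (addf (\<lambda>_. ennreal (1 / real (Suc n))) t w)) \<longlonglongrightarrow> 0"
    by (rule tendsto_sandwich[OF always_eventually always_eventually tendsto_const l0]) (intro allI enn2real_nonneg e)+
  then have "(\<lambda>n. exp (- enn2real (addf (\<lambda>_. ennreal (1 / real (Suc n))) t w))) \<longlonglongrightarrow> exp (- 0)"
    by (rule tendsto_exp[OF tendsto_minus])
  then show ?thesis by (simp add: fk_def)
qed

lemma fk_const_mult_liminf:
  "liminf (\<lambda>n. c * (ennreal (fk (\<lambda>_. ennreal (1 / real (Suc n))) t w) * d)) = c * (d::ennreal)"
proof -
  have "(\<lambda>n. ennreal (fk (\<lambda>_. ennreal (1 / real (Suc n))) t w)) \<longlonglongrightarrow> ennreal 1"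
    by (intro tendsto_ennrealI fk_const_tendsto)
  then have "(\<lambda>n. (c * d) * ennreal (fk (\<lambda>_. ennreal (1 / real (Suc n))) t w)) \<longlonglongrightarrow> (c * d) * ennreal 1"
    by (rule tendsto_mult_ennreal[OF tendsto_const]) auto
  then have "liminf (\<lambda>n. (c * d) * ennreal (fk (\<lambda>_. ennreal (1 / real (Suc n))) t w)) = c * d"
    by (intro lim_imp_Liminf) auto
  then show ?thesis by (simp add: mult_ac)
qed

text \<open>Dynkin's formula is available only with a positive discount. The weights for the rates
  1/(n+1) tend to 1, so Fatou's lemma removes the discount from any upper bound that is uniform in
  it.\<close>

lemma GK_discount_le:
  assumes g[measurable]: "g \<in> borel_measurable borel" and le: "\<And>\<alpha>. 0 < \<alpha> \<Longrightarrow> GK (\<lambda>_. ennreal \<alpha>) D g x \<le> B"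
  shows "Gr D g x \<le> B"
proof -
  let ?a = "\<lambda>n _. ennreal (1 / real (Suc n))"
  have "Gr D g x \<le> (\<E> (Some x) (\<lambda>w. liminf (\<lambda>n. green_fun (?a n) D g w)))"
    unfolding GK_def
  proof (intro nn_integral_mono)
    fix w assume "w \<in> space (law X (Some x))"
    then have w: "w \<in> Om X" by simp
    have [measurable]: "(\<lambda>_::real. w) \<in> borel \<rightarrow>\<^sub>M N top" using w by simp
    note [measurable] = path_time_measurable[OF w] measurable_ext0[OF g]
    have "green_fun (\<lambda>_. 0) D g w = (\<integral>\<^sup>+t. liminf (\<lambda>n. indicator {t. 0 \<le> t \<and> ennreal t < exit_at D w} t *
      (ennreal (fk (?a n) t w) * ext0 g (path X (ennreal t) w))) \<partial>lborel)"
      unfolding green_fun_def fk_const_mult_liminf by simp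
    also have "\<dots> \<le> liminf (\<lambda>n. green_fun (?a n) D g w)"
      unfolding green_fun_def by (rule nn_integral_liminf) (unfold indicator_def mem_Collect_eq, measurable)
    finally show "green_fun (\<lambda>_. 0) D g w \<le> liminf (\<lambda>n. green_fun (?a n) D g w)" .
  qed
  also have "\<dots> \<le> liminf (\<lambda>n. GK (?a n) D g x)"
    unfolding GK_def by (rule nn_integral_liminf) simp
  also have "\<dots> \<le> liminf (\<lambda>n. B)"
    by (intro Liminf_mono always_eventually allI le) simp
  also have "\<dots> = B" by (simp add: Liminf_const)
  finally show ?thesis .
qed

lemma HK_discount_le:
  assumes g[measurable]: "u \<in> borel_measurable borel" and le: "\<And>\<alpha>. 0 < \<alpha> \<Longrightarrow> HK (\<lambda>_. ennreal \<alpha>) D u x \<le> B"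
  shows "Hr D u x \<le> B"
proof -
  let ?a = "\<lambda>n _. ennreal (1 / real (Suc n))"
  have "Hr D u x = (\<E> (Some x) (\<lambda>w. liminf (\<lambda>n. exit_fun (?a n) D u w)))"
    unfolding HK_def exit_fun_def
    using fk_const_mult_liminf[of 1] by simp
  also have "\<dots> \<le> liminf (\<lambda>n. HK (?a n) D u x)"
    unfolding HK_def by (rule nn_integral_liminf) simp
  also have "\<dots> \<le> liminf (\<lambda>n. B)"
    by (intro Liminf_mono always_eventually allI le) simp
  also have "\<dots> = B" by (simp add: Liminf_const)
  finally show ?thesis .
qed

end

section \<open>Semigroup, generator and Dynkin's formula\<close>

definition bounded_borel :: "('a::topological_space \<Rightarrow> real) \<Rightarrow> bool" where
  "bounded_borel f \<longleftrightarrow> f \<in> borel_measurable borel \<and> (\<exists>b. \<forall>x. \<bar>f x\<bar> \<le> b)"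

lemma bounded_borel_measurable: "bounded_borel f \<Longrightarrow> f \<in> borel_measurable borel"
  by (simp add: bounded_borel_def)

lemma bounded_borel_C_zero: "f \<in> C_zero \<Longrightarrow> bounded_borel f"
  by (auto simp: C_zero_def bounded_borel_def bounded_iff intro: borel_measurable_continuous_onI)

lemma bounded_borel_const: "bounded_borel (\<lambda>_. c)"
  by (auto simp: bounded_borel_def)

lemma bounded_borel_add: "bounded_borel f \<Longrightarrow> bounded_borel g \<Longrightarrow> bounded_borel (\<lambda>x. f x + g x)"
proof -
  assume "bounded_borel f" "bounded_borel g"
  then obtain a b where "f \<in> borel_measurable borel" "g \<in> borel_measurable borel" "\<And>x. \<bar>f x\<bar> \<le> a" "\<And>x. \<bar>g x\<bar> \<le> b"
    by (auto simp: bounded_borel_def)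
  moreover from this have "\<bar>f x + g x\<bar> \<le> a + b" for x
    by (meson abs_triangle_ineq add_mono order_trans)
  ultimately show ?thesis by (auto simp: bounded_borel_def)
qed

lemma bounded_borel_cmult: "bounded_borel f \<Longrightarrow> bounded_borel (\<lambda>x. c * f x)"
proof -
  assume "bounded_borel f"
  then obtain a where "f \<in> borel_measurable borel" "\<And>x. \<bar>f x\<bar> \<le> a" by (auto simp: bounded_borel_def)
  moreover from this have "\<bar>c * f x\<bar> \<le> \<bar>c\<bar> * a" for x by (simp add: abs_mult mult_left_mono)
  ultimately show ?thesis by (auto simp: bounded_borel_def)
qed

locale conservative_hunt = hunt X for X :: "('w, 'a::heine_borel) process" +
  assumes conservative: "conservative X" and feller: "feller X"
begin

abbreviation P :: "real \<Rightarrow> ('a \<Rightarrow> real) \<Rightarrow> 'a \<Rightarrow> real" where "P \<equiv> semigroup_op X"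

lemma ext0_bounded: "\<bar>ext0 f y\<bar> \<le> max 0 b" if "\<And>x. \<bar>f x\<bar> \<le> b" for f :: "'a \<Rightarrow> real"
  using that by (cases y) (auto simp: le_max_iff_disj)

lemma integrable_path:
  assumes "bounded_borel f" shows "integrable (law X y) (\<lambda>w. ext0 f (path X t w))"
proof -
  interpret prob_space "law X y" by (rule prob_law)
  obtain b where "\<And>x. \<bar>f x\<bar> \<le> b" using assms by (auto simp: bounded_borel_def)
  note [measurable] = measurable_ext0[OF bounded_borel_measurable[OF assms]]
  show ?thesis
    by (rule integrable_const_bound[of _ "max 0 b"]) (use ext0_bounded[of f b] \<open>\<And>x. \<bar>f x\<bar> \<le> b\<close> in auto)
qed

lemma P_one: "0 \<le> t \<Longrightarrow> P t (\<lambda>_. 1) x = 1"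
  using conservative by (simp add: conservative_def)

lemma P_add: "bounded_borel f \<Longrightarrow> bounded_borel g \<Longrightarrow> P t (\<lambda>x. f x + g x) x = P t f x + P t g x"
proof -
  assume fg: "bounded_borel f" "bounded_borel g"
  have "ext0 (\<lambda>x. f x + g x) y = ext0 f y + ext0 g y" for y by (cases y) auto
  then show ?thesis unfolding semigroup_op_def using integrable_path fg by (simp add: Bochner_Integration.integral_add)
qed

lemma P_cmult: "P t (\<lambda>x. c * f x) x = c * P t f x"
proof -
  have "ext0 (\<lambda>x. c * f x) y = c * ext0 f y" for y by (cases y) auto
  then show ?thesis unfolding semigroup_op_def by simp
qed

lemma P_add_const: "0 \<le> t \<Longrightarrow> bounded_borel f \<Longrightarrow> P t (\<lambda>x. f x + c) x = P t f x + c"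
  using P_add[of f "\<lambda>_. c * 1" t x] P_cmult[of t c "\<lambda>_. 1" x] P_one[of t x]
  by (simp add: bounded_borel_const)

lemma ext0_ennreal: "ext0 (\<lambda>z. ennreal (f z)) y = ennreal (ext0 f y)"
  by (cases y) auto

lemma ext0_nonneg: "(\<And>x. 0 \<le> f x) \<Longrightarrow> 0 \<le> (ext0 f y :: real)"
  by (cases y) auto

lemma P_nonneg: "(\<And>x. 0 \<le> f x) \<Longrightarrow> 0 \<le> P t f x"
  unfolding semigroup_op_def by (intro integral_nonneg_AE always_eventually allI ext0_nonneg)

lemma nn_P: 
  assumes "bounded_borel f" "\<And>x. 0 \<le> f x"
  shows "(\<E> (Some x) (\<lambda>w. ext0 (\<lambda>z. ennreal (f z)) (path X (ennreal t) w))) = ennreal (P t f x)"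
  unfolding semigroup_op_def ext0_ennreal
  by (intro nn_integral_eq_integral integrable_path assms always_eventually allI ext0_nonneg)

lemma P_bound:
  assumes "bounded_borel f" "\<And>x. \<bar>f x\<bar> \<le> b" "0 \<le> t" shows "\<bar>P t f x\<bar> \<le> b"
proof -
  have "0 \<le> P t (\<lambda>x. f x + b) x" using assms(2) by (intro P_nonneg) (metis abs_le_iff minus_le_iff add.commute le_minus_iff diff_minus_eq_add diff_ge_0_iff_ge)
  moreover have "0 \<le> P t (\<lambda>x. (-1) * f x + b) x" using assms(2) by (intro P_nonneg) (auto simp: abs_le_iff)
  ultimately show ?thesis
    using P_add_const[OF assms(3,1), of b x] P_add_const[OF assms(3) bounded_borel_cmult[OF assms(1), of "-1"], of b x]
      P_cmult[of t "-1" f x] by simp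
qed

lemma P_measurable_nonneg:
  assumes "bounded_borel f" "\<And>x. 0 \<le> f x" shows "P t f \<in> borel_measurable borel"
proof -
  have "(\<lambda>x. \<integral>\<^sup>+w. ext0 (\<lambda>z. ennreal (f z)) (path X (ennreal t) w) \<partial>law X (Some x)) \<in> borel_measurable borel"
    using measurable_compose[OF measurable_Some measurable_law_path[OF measurable_ext0[of "\<lambda>z. ennreal (f z)"]]]
      bounded_borel_measurable[OF assms(1)] by simp
  then have "(\<lambda>x. enn2real (ennreal (P t f x))) \<in> borel_measurable borel"
    unfolding nn_P[OF assms] by measurable
  then show ?thesis using P_nonneg[OF assms(2)] by simp
qed

lemma bounded_borel_P:
  assumes f: "bounded_borel f" and t: "0 \<le> t" shows "bounded_borel (P t f)"
proof -
  obtain b where b: "\<And>x. \<bar>f x\<bar> \<le> b" using f by (auto simp: bounded_borel_def)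
  have "0 \<le> f x + b" for x using b[of x] by linarith
  then have "P t (\<lambda>x. f x + b) \<in> borel_measurable borel"
    by (intro P_measurable_nonneg bounded_borel_add f bounded_borel_const)
  then have "(\<lambda>x. P t (\<lambda>x. f x + b) x - b) \<in> borel_measurable borel" by measurable
  then have "P t f \<in> borel_measurable borel" using P_add_const[OF t f] by simp
  then show ?thesis using P_bound[OF f b t] by (auto simp: bounded_borel_def)
qed

lemma semigroup_nonneg:
  assumes f: "bounded_borel f" "\<And>x. 0 \<le> f x" and st: "0 \<le> s" "0 \<le> t"
  shows "P (s + t) f x = P s (P t f) x"
proof -
  let ?g = "ext0 (\<lambda>z. ennreal (f z))"
  have g: "?g \<in> borel_measurable cemetery_borel"
    by (rule measurable_ext0) (use bounded_borel_measurable[OF f(1)] in measurable)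
  have c: "stopping_time F (\<lambda>_. ennreal s)" by (rule stopping_time_const)
  have "Om X \<in> sets (Fpre (\<lambda>_. ennreal s))" using sets.top[of "Fpre (\<lambda>_. ennreal s)"] by simp
  from strong_markov_path_fun[OF c _ this g, of "ennreal t" "Some x"]
  have "(\<E> (Some x) (\<lambda>w. indicator {w\<in>Om X. ennreal s < top} w * ?g (path X (ennreal s + ennreal t) w))) =
     (\<E> (Some x) (\<lambda>w. indicator {w\<in>Om X. ennreal s < top} w * (\<integral>\<^sup>+w'. ?g (path X (ennreal t) w') \<partial>law X (path X (ennreal s) w))))"
    by simp
  moreover have "(\<E> (Some x) (\<lambda>w. indicator {w\<in>Om X. ennreal s < top} w * ?g (path X (ennreal s + ennreal t) w))) =
     (\<E> (Some x) (\<lambda>w. ?g (path X (ennreal (s + t)) w)))"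
    using st by (intro nn_integral_cong) (auto simp: ennreal_plus)
  moreover have "(\<E> (Some x) (\<lambda>w. indicator {w\<in>Om X. ennreal s < top} w * (\<integral>\<^sup>+w'. ?g (path X (ennreal t) w') \<partial>law X (path X (ennreal s) w)))) =
     (\<E> (Some x) (\<lambda>w. ext0 (\<lambda>z. ennreal (P t f z)) (path X (ennreal s) w)))"
  proof (rule nn_integral_cong)
    fix w assume "w \<in> space (law X (Some x))"
    moreover have "(\<E> None (\<lambda>w'. ?g (path X (ennreal t) w'))) = 0"
    proof -
      have "(\<E> None (\<lambda>w'. ?g (path X (ennreal t) w'))) = (\<E> None (\<lambda>w'. 0))"
        by (intro nn_integral_cong_AE eventually_mono[OF AE_law_None]) simp
      then show ?thesis by simp
    qed
    ultimately show "indicator {w\<in>Om X. ennreal s < top} w * (\<integral>\<^sup>+w'. ?g (path X (ennreal t) w') \<partial>law X (path X (ennreal s) w))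
       = ext0 (\<lambda>z. ennreal (P t f z)) (path X (ennreal s) w)"
      using nn_P[OF f] by (cases "path X (ennreal s) w") auto
  qed
  ultimately have "ennreal (P (s + t) f x) = ennreal (P s (P t f) x)"
    using nn_P[OF f, where t="s + t" and x=x] nn_P[OF bounded_borel_P[OF f(1) st(2)] P_nonneg[OF f(2)], where t=s and x=x] by simp
  then show ?thesis using P_nonneg[OF f(2)] by (simp add: P_nonneg)
qed

lemma semigroup:
  assumes f: "bounded_borel f" and st: "0 \<le> s" "0 \<le> t"
  shows "P (s + t) f x = P s (P t f) x"
proof -
  obtain b where b: "\<And>x. \<bar>f x\<bar> \<le> b" using f by (auto simp: bounded_borel_def)
  have nn: "0 \<le> f x + b" for x using b[of x] by linarith
  have "P (s + t) (\<lambda>x. f x + b) x = P s (P t (\<lambda>x. f x + b)) x"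
    by (intro semigroup_nonneg bounded_borel_add f bounded_borel_const nn st)
  moreover have "P t (\<lambda>x. f x + b) = (\<lambda>x. P t f x + b)" using P_add_const[OF st(2) f] by auto
  ultimately show ?thesis
    using P_add_const[of "s + t" f b x] P_add_const[OF st(1) bounded_borel_P[OF f st(2)], of b x] f st by simp
qed

lemma P_lin3:
  assumes "bounded_borel f1" "bounded_borel f2" "bounded_borel f3"
  shows "P t (\<lambda>z. a * f1 z + b * f2 z + c * f3 z) x = a * P t f1 x + b * P t f2 x + c * P t f3 x"
  by (simp add: P_add P_cmult assms bounded_borel_add bounded_borel_cmult)

context
  fixes f g assumes gen: "generates C_zero X f g"
begin

lemma gen_C_zero: "f \<in> C_zero" "g \<in> C_zero"
  using gen by (auto simp: generates_def)

lemma gen_bounded: "bounded_borel f" "bounded_borel g"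
  using gen_C_zero by (auto intro: bounded_borel_C_zero)

lemma uniform_limit_at_right0D:
  assumes "uniform_limit UNIV h l (at_right (0::real))" "0 < e"
  obtains d where "0 < d" "\<And>t x. 0 < t \<Longrightarrow> t < d \<Longrightarrow> \<bar>h t x - l x\<bar> < (e::real)"
proof -
  have "\<forall>\<^sub>F t in at_right 0. \<forall>x\<in>UNIV. dist (h t x) (l x) < e"
    using assms by (rule uniform_limitD)
  then obtain b where "b > 0" "\<And>t. 0 < t \<Longrightarrow> t < b \<Longrightarrow> \<forall>x. dist (h t x) (l x) < e"
    unfolding eventually_at_right_field by auto
  then show ?thesis using that[of b] by (auto simp: dist_real_def)
qed

text \<open>P is a contraction, so the uniform convergence of the difference quotients at 0 is
  carried to every time s, which gives right derivatives with a uniform rate. A left difference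
  quotient at t is a right one at an earlier y, and P y g is uniformly close to P t g.\<close>

lemma gen_derivative:
  assumes t: "0 \<le> t"
  shows "((\<lambda>t. P t f x) has_real_derivative P t g x) (at t within {0..})"
  unfolding has_field_derivative_iff
proof (rule tendstoI)
  fix e :: real assume "0 < e"
  then have e: "0 < e / 3" by simp
  obtain d1 where d1: "0 < d1" "\<And>t x. 0 < t \<Longrightarrow> t < d1 \<Longrightarrow> \<bar>(P t f x - f x) / t - g x\<bar> < e / 3"
    by (rule uniform_limit_at_right0D[OF conjunct2[OF conjunct2[OF gen[unfolded generates_def]]] e]) blast
  have ug: "uniform_limit UNIV (\<lambda>t. P t g) g (at_right 0)" using feller gen_C_zero(2) by (auto simp: feller_def)
  obtain d2 where d2: "0 < d2" "\<And>t x. 0 < t \<Longrightarrow> t < d2 \<Longrightarrow> \<bar>P t g x - g x\<bar> < e / 3"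
    by (rule uniform_limit_at_right0D[OF ug e]) blast
  have A: "\<bar>(P (s + h) f x - P s f x) / h - P s g x\<bar> \<le> e / 3" if "0 \<le> s" "0 < h" "h < d1" for s h
  proof -
    let ?k = "\<lambda>z. (1 / h) * P h f z + (- 1 / h) * f z + (- 1) * g z"
    have k: "bounded_borel ?k"
      using that by (intro bounded_borel_add bounded_borel_cmult bounded_borel_P gen_bounded) auto
    have "P s ?k x = (1 / h) * P s (P h f) x + (- 1 / h) * P s f x + (- 1) * P s g x"
      using that by (intro P_lin3 bounded_borel_P gen_bounded) auto
    also have "\<dots> = (P (s + h) f x - P s f x) / h - P s g x"
      using semigroup[OF gen_bounded(1), of s h x] that by (simp add: diff_divide_distrib)
    finally have "P s ?k x = (P (s + h) f x - P s f x) / h - P s g x" .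
    moreover have "\<bar>?k z\<bar> \<le> e / 3" for z
      using d1(2)[OF that(2,3), of z] by (simp add: diff_divide_distrib)
    ultimately show ?thesis using P_bound[OF k _ that(1), of "e / 3" x] by simp
  qed
  have B: "\<bar>P (s + h) g x - P s g x\<bar> \<le> e / 3" if "0 \<le> s" "0 < h" "h < d2" for s h
  proof -
    let ?k = "\<lambda>z. 1 * P h g z + (- 1) * g z + 0 * g z"
    have k: "bounded_borel ?k"
      using that by (intro bounded_borel_add bounded_borel_cmult bounded_borel_P gen_bounded) auto
    have "P s ?k x = 1 * P s (P h g) x + (- 1) * P s g x + 0 * P s g x"
      using that by (intro P_lin3 bounded_borel_P gen_bounded) auto
    also have "\<dots> = P (s + h) g x - P s g x"
      using semigroup[OF gen_bounded(2), of s h x] that by simp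
    finally have "P s ?k x = P (s + h) g x - P s g x" .
    moreover have "\<bar>?k z\<bar> \<le> e / 3" for z using d2(2)[OF that(2,3), of z] by simp
    ultimately show ?thesis using P_bound[OF k _ that(1), of "e / 3" x] by simp
  qed
  show "\<forall>\<^sub>F y in at t within {0..}. dist ((P y f x - P t f x) / (y - t)) (P t g x) < e"
    unfolding eventually_at
  proof (intro exI[of _ "min d1 d2"] conjI ballI impI)
    show "0 < min d1 d2" using d1 d2 by simp
    fix y assume y: "y \<in> {0..}" "y \<noteq> t \<and> dist y t < min d1 d2"
    show "dist ((P y f x - P t f x) / (y - t)) (P t g x) < e"
    proof (cases "t < y")
      case True
      then show ?thesis using A[OF t, of "y - t"] y e by (simp add: dist_real_def)
    next
      case False
      then have "y < t" using y by simp
      then have 1: "\<bar>(P t f x - P y f x) / (t - y) - P y g x\<bar> \<le> e / 3" and 2: "\<bar>P t g x - P y g x\<bar> \<le> e / 3"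
        using A[of y "t - y"] B[of y "t - y"] y by (auto simp: dist_real_def)
      have "(P y f x - P t f x) / (y - t) = (P t f x - P y f x) / (t - y)"
        using \<open>y < t\<close> by (simp add: divide_simps) (simp add: algebra_simps)
      then have "\<bar>(P y f x - P t f x) / (y - t) - P t g x\<bar> < e" using 1 2 e by linarith
      then show ?thesis by (simp add: dist_real_def)
    qed
  qed
qed

end

end

text \<open>The integrand is the derivative of minus exp(-\<alpha> t) (p + c/\<alpha>). The constant
  \<open>c\<close> makes it non-negative, so that monotone convergence over the intervals from 0 to
  n applies.\<close>

lemma laplace_transform_derivative:
  fixes p q :: "real \<Rightarrow> real"
  assumes \<alpha>: "0 < \<alpha>" and c: "0 \<le> c"
    and der: "\<And>t. 0 \<le> t \<Longrightarrow> (p has_real_derivative q t) (at t within {0..})"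
    and b: "\<And>t. 0 \<le> t \<Longrightarrow> \<bar>p t\<bar> \<le> b" and nn: "\<And>t. 0 \<le> t \<Longrightarrow> 0 \<le> \<alpha> * p t - q t + c"
    and [measurable]: "p \<in> borel_measurable borel" "q \<in> borel_measurable borel"
  shows "(\<integral>\<^sup>+t. indicator {0..} t * ennreal (exp (- \<alpha> * t) * (\<alpha> * p t - q t + c)) \<partial>lborel) = ennreal (p 0 + c / \<alpha>)"
proof -
  let ?f = "\<lambda>t. exp (- \<alpha> * t) * (\<alpha> * p t - q t + c)"
  let ?F = "\<lambda>t. - (exp (- \<alpha> * t) * (p t + c / \<alpha>))"
  have I: "(\<integral>\<^sup>+t. ennreal (?f t) * indicator {0..real n} t \<partial>lborel) = ennreal (?F (real n) - ?F 0)" for n :: nat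
  proof -
    have "(?f has_integral (?F (real n) - ?F 0)) {0..real n}"
    proof (rule fundamental_theorem_of_calculus)
    fix t assume t: "t \<in> {0..real n}"
    have dp: "(p has_real_derivative q t) (at t within {0..real n})"
      using der[of t] t by (auto intro: has_field_derivative_subset)
    have de: "((\<lambda>t. exp (- \<alpha> * t)) has_real_derivative (- \<alpha> * exp (- \<alpha> * t))) (at t within {0..real n})"
      by (auto intro!: derivative_eq_intros)
    have dc: "((\<lambda>t. p t + c / \<alpha>) has_real_derivative q t) (at t within {0..real n})"
      using DERIV_add[OF dp DERIV_const[of "c / \<alpha>"]] by simp
    have "(?F has_real_derivative ?f t) (at t within {0..real n})"
      by (rule DERIV_cong[OF DERIV_minus[OF DERIV_mult[OF de dc]]]) (use \<alpha> in \<open>simp add: field_simps\<close>)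
    then show "(?F has_vector_derivative ?f t) (at t within {0..real n})"
      by (simp add: has_real_derivative_iff_has_vector_derivative)
    qed simp
    then have "((\<lambda>t. if t \<in> {0..real n} then ?f t else 0) has_integral (?F (real n) - ?F 0)) UNIV"
      by (rule has_integral_restrict_UNIV[THEN iffD2])
    then have "(\<integral>\<^sup>+t. ennreal (if t \<in> {0..real n} then ?f t else 0) \<partial>lborel) = ennreal (?F (real n) - ?F 0)"
      using nn by (intro nn_integral_has_integral_lborel) auto
    then show ?thesis
    proof (rule trans[rotated])
      show "(\<integral>\<^sup>+t. ennreal (?f t) * indicator {0..real n} t \<partial>lborel) = (\<integral>\<^sup>+t. ennreal (if t \<in> {0..real n} then ?f t else 0) \<partial>lborel)"
        by (rule nn_integral_cong) (auto split: split_indicator)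
    qed
  qed
  have "filterlim (\<lambda>n. - \<alpha> * real n) at_bot sequentially"
    using \<alpha> by (intro filterlim_tendsto_neg_mult_at_bot[OF tendsto_const _ filterlim_real_sequentially]) auto
  then have L0: "(\<lambda>n. exp (- \<alpha> * real n)) \<longlonglongrightarrow> 0"
    by (rule filterlim_compose[OF exp_at_bot])
  have "(\<lambda>n. exp (- \<alpha> * real n) * (b + c / \<alpha>)) \<longlonglongrightarrow> 0 * (b + c / \<alpha>)"
    by (intro tendsto_mult tendsto_const L0)
  then have L1: "(\<lambda>n. exp (- \<alpha> * real n) * (b + c / \<alpha>)) \<longlonglongrightarrow> 0" by simp
  have "norm (exp (- \<alpha> * real n) * (p (real n) + c / \<alpha>)) \<le> exp (- \<alpha> * real n) * (b + c / \<alpha>)" for n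
  proof -
    have "\<bar>p (real n) + c / \<alpha>\<bar> \<le> b + c / \<alpha>"
      using b[of "real n"] divide_nonneg_pos[OF c \<alpha>] by linarith
    then show ?thesis by (simp add: abs_mult)
  qed
  then have "(\<lambda>n. exp (- \<alpha> * real n) * (p (real n) + c / \<alpha>)) \<longlonglongrightarrow> 0"
    by (intro Lim_null_comparison[OF always_eventually L1]) auto
  then have "(\<lambda>n. ?F (real n) - ?F 0) \<longlonglongrightarrow> - 0 - ?F 0"
    by (intro tendsto_intros)
  then have L: "(\<lambda>n. ennreal (?F (real n) - ?F 0)) \<longlonglongrightarrow> ennreal (p 0 + c / \<alpha>)"
    by (intro tendsto_ennrealI) (simp add: add.commute)
  have inc: "incseq (\<lambda>n t. ennreal (?f t) * indicator {0..real n} t)"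
    by (auto simp: incseq_def le_fun_def split: split_indicator)
  have "(\<integral>\<^sup>+t. indicator {0..} t * ennreal (?f t) \<partial>lborel) = (\<integral>\<^sup>+t. (SUP n. ennreal (?f t) * indicator {0..real n} t) \<partial>lborel)"
  proof (rule nn_integral_cong)
    fix t :: real
    show "indicator {0..} t * ennreal (?f t) = (SUP n. ennreal (?f t) * indicator {0..real n} t)"
    proof (cases "0 \<le> t")
      case True
      obtain n where n: "t \<le> real n" using real_arch_simple by blast
      have "(SUP n. ennreal (?f t) * indicator {0..real n} t) = ennreal (?f t)"
      proof (rule antisym)
        show "ennreal (?f t) \<le> (SUP n. ennreal (?f t) * indicator {0..real n} t)"
          by (rule SUP_upper2[of n]) (use n True in auto)
      qed (auto intro!: SUP_least split: split_indicator)
      then show ?thesis using True by simp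
    qed simp
  qed
  also have "\<dots> = (SUP n. (\<integral>\<^sup>+t. ennreal (?f t) * indicator {0..real n} t \<partial>lborel))"
    by (rule nn_integral_monotone_convergence_SUP[OF inc]) measurable
  also have "\<dots> = (SUP n. ennreal (?F (real n) - ?F 0))" unfolding I ..
  also have "\<dots> = ennreal (p 0 + c / \<alpha>)"
  proof (rule LIMSEQ_unique[OF LIMSEQ_SUP L])
    show "incseq (\<lambda>n. ennreal (?F (real n) - ?F 0))"
      unfolding I[symmetric] using inc by (auto simp: incseq_def le_fun_def intro!: nn_integral_mono)
  qed
  finally show ?thesis .
qed

context hunt
begin

lemma fk_rate_mono:
  assumes "rate \<psi>'" "\<And>z. \<psi> z \<le> \<psi>' z" shows "fk \<psi>' t w \<le> fk \<psi> t w"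
proof -
  have "ext0 \<psi> y \<le> ext0 \<psi>' y" for y using assms(2) by (cases y) auto
  then have "addf \<psi> t w \<le> addf \<psi>' t w"
    unfolding addf_def by (intro nn_integral_mono mult_left_mono) auto
  then show ?thesis using addf_finite[OF assms(1)] by (simp add: fk_def enn2real_mono)
qed

lemma GK_rate_mono:
  assumes "rate \<psi>'" "\<And>z. \<psi> z \<le> \<psi>' z" shows "GK \<psi>' D g x \<le> GK \<psi> D g x"
  unfolding GK_def green_fun_def
  by (intro nn_integral_mono mult_left_mono mult_right_mono ennreal_leI fk_rate_mono assms) auto

end

section \<open>Resolvents of a conservative process and Dynkin's formula\<close>

context conservative_hunt
begin

text \<open>Integer times suffice, as a dead path stays dead.\<close>

lemma AE_conservative: "AE w in law X (Some x). w \<in> Om X \<and> (\<forall>t<top. path X t w \<noteq> None)"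
proof -
  have "AE w in law X (Some x). path X (ennreal (real n)) w \<noteq> None" for n
  proof -
    interpret prob_space "law X (Some x)" by (rule prob_law)
    note [measurable] = measurable_ext0[of "\<lambda>_::'a. 1::real"]
    have "expectation (\<lambda>w. 1 - ext0 (\<lambda>_. 1::real) (path X (ennreal (real n)) w)) = 1 - P (real n) (\<lambda>_. 1) x"
      unfolding semigroup_op_def
      by (subst Bochner_Integration.integral_diff) (auto intro!: integrable_path bounded_borel_const simp: prob_space[simplified])
    then have "expectation (\<lambda>w. 1 - ext0 (\<lambda>_. 1::real) (path X (ennreal (real n)) w)) = 0" by (simp add: P_one)
    moreover have "integrable (law X (Some x)) (\<lambda>w. 1 - ext0 (\<lambda>_. 1::real) (path X (ennreal (real n)) w))"
      by (intro Bochner_Integration.integrable_diff integrable_path bounded_borel_const) auto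
    moreover have "0 \<le> 1 - ext0 (\<lambda>_. 1::real) y" for y :: "'a option" by (cases y) auto
    ultimately have "AE w in law X (Some x). 1 - ext0 (\<lambda>_. 1::real) (path X (ennreal (real n)) w) = 0"
      by (subst (asm) integral_nonneg_eq_0_iff_AE) auto
    then show ?thesis
    proof eventually_elim
      case (elim w) then show ?case by (cases "path X (ennreal (real n)) w") auto
    qed
  qed
  then have "AE w in law X (Some x). \<forall>n::nat. path X (ennreal (real n)) w \<noteq> None"
    by (simp add: AE_all_countable)
  with AE_Om show ?thesis
  proof eventually_elim
    case (elim w)
    have "path X t w \<noteq> None" if t: "t < top" for t
    proof
      assume N: "path X t w = None"
      obtain n where "t \<le> ennreal (real n)"
      proof -
        obtain r where "t = ennreal r" using t by (cases t) auto
        moreover obtain n where "r \<le> real n" using real_arch_simple by blast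
        ultimately show ?thesis using that ennreal_leI by blast
      qed
      with path_None_mono[OF elim(1) N this] elim(2) show False by auto
    qed
    then show ?case using elim by simp
  qed
qed

lemma exit_at_UNIV:
  assumes "w \<in> Om X" "\<forall>t<top. path X t w \<noteq> None" "w \<notin> bad_exit UNIV" shows "exit_at UNIV w = top"
proof (rule ccontr)
  assume "exit_at UNIV w \<noteq> top"
  then have "path X (exit_at UNIV w) w \<noteq> None" using assms(2) by (simp add: top.not_eq_extremum)
  moreover have "path X (exit_at UNIV w) w \<notin> Some ` UNIV" by (rule path_exit_at[OF assms(1,3)])
  ultimately show False by auto
qed

lemma fk_const:
  assumes "\<forall>t<top. path X t w \<noteq> None" "0 \<le> \<alpha>" "0 \<le> t" shows "fk (\<lambda>_. ennreal \<alpha>) t w = exp (- \<alpha> * t)"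
proof -
  have "ext0 (\<lambda>_. ennreal \<alpha>) (path X (ennreal r) w) = ennreal \<alpha>" for r
    using assms(1)[rule_format, of "ennreal r"] by auto
  then have "addf (\<lambda>_. ennreal \<alpha>) t w = ennreal (t * \<alpha>)"
    unfolding addf_def using assms(2,3) by (simp add: nn_integral_multc ennreal_mult)
  then show ?thesis using assms by (simp add: fk_def mult.commute)
qed

lemma law_pair_sets: "sets (law X y \<Otimes>\<^sub>M lborel) = sets (N top \<Otimes>\<^sub>M (borel :: real measure))"
  by (intro sets_pair_measure_cong) (simp_all add: sets_law)

lemma GK_resolvent:
  assumes \<alpha>: "0 < \<alpha>" and h: "bounded_borel h" "\<And>z. 0 \<le> h z"
  shows "GK (\<lambda>_. ennreal \<alpha>) UNIV (\<lambda>z. ennreal (h z)) x = (\<integral>\<^sup>+t. indicator {0..} t * ennreal (exp (- \<alpha> * t) * P t h x) \<partial>lborel)"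
proof -
  let ?P = "law X (Some x)"
  interpret P: prob_space ?P by (rule prob_law)
  interpret Q: pair_sigma_finite ?P "lborel :: real measure" by standard
  let ?h = "ext0 (\<lambda>z. ennreal (h z))"
  have hm: "(\<lambda>z. ennreal (h z)) \<in> borel_measurable borel" using bounded_borel_measurable[OF h(1)] by measurable
  note [measurable] = measurable_ext0[OF hm]
  have meq: "measurable (?P \<Otimes>\<^sub>M (lborel :: real measure)) M = measurable (N top \<Otimes>\<^sub>M borel) M" for M :: "ennreal measure"
    by (rule measurable_cong_sets[OF law_pair_sets refl])
  have "GK (\<lambda>_. ennreal \<alpha>) UNIV (\<lambda>z. ennreal (h z)) x = (\<integral>\<^sup>+w. (\<integral>\<^sup>+t. indicator {0..} t * ennreal (exp (- \<alpha> * t)) * ?h (path X (ennreal t) w) \<partial>lborel) \<partial>?P)"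
    unfolding GK_def green_fun_def
  proof (rule nn_integral_cong_AE, use AE_conservative[of x] bad_exit_null[OF open_UNIV, of "Some x"] in eventually_elim)
    fix w assume w: "w \<in> Om X \<and> (\<forall>t<top. path X t w \<noteq> None)" "w \<notin> bad_exit UNIV"
    then have e: "exit_at UNIV w = top" using exit_at_UNIV by blast
    show "(\<integral>\<^sup>+t. indicator {t. 0 \<le> t \<and> ennreal t < exit_at UNIV w} t * (ennreal (fk (\<lambda>_. ennreal \<alpha>) t w) * ?h (path X (ennreal t) w)) \<partial>lborel)
      = (\<integral>\<^sup>+t. indicator {0..} t * ennreal (exp (- \<alpha> * t)) * ?h (path X (ennreal t) w) \<partial>lborel)"
      using w \<alpha> fk_const[of w \<alpha>] unfolding e
      by (intro nn_integral_cong) (auto split: split_indicator)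
  qed
  also have "\<dots> = (\<integral>\<^sup>+t. (\<integral>\<^sup>+w. indicator {0..} t * ennreal (exp (- \<alpha> * t)) * ?h (path X (ennreal t) w) \<partial>?P) \<partial>lborel)"
    by (rule Q.Fubini'[symmetric]) (unfold meq case_prod_beta, measurable)
  also have "\<dots> = (\<integral>\<^sup>+t. indicator {0..} t * ennreal (exp (- \<alpha> * t) * P t h x) \<partial>lborel)"
  proof (rule nn_integral_cong)
    fix t :: real
    have "(\<lambda>w. ?h (path X (ennreal t) w)) \<in> borel_measurable ?P" by simp
    then show "(\<integral>\<^sup>+w. indicator {0..} t * ennreal (exp (- \<alpha> * t)) * ?h (path X (ennreal t) w) \<partial>?P) = indicator {0..} t * ennreal (exp (- \<alpha> * t) * P t h x)"
      by (simp add: nn_integral_cmult nn_P[OF h] ennreal_mult P_nonneg h(2) mult.assoc)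
  qed
  finally show ?thesis .
qed

lemma P_time_measurable:
  assumes "bounded_borel h" shows "(\<lambda>t. P t h x) \<in> borel_measurable borel"
proof -
  obtain b where b: "\<And>x. \<bar>h x\<bar> \<le> b" using assms by (auto simp: bounded_borel_def)
  interpret P: prob_space "law X (Some x)" by (rule prob_law)
  note [measurable] = measurable_ext0[OF bounded_borel_measurable[OF assms]]
  have s: "sets (borel \<Otimes>\<^sub>M law X (Some x)) = sets ((borel :: real measure) \<Otimes>\<^sub>M N top)"
    by (intro sets_pair_measure_cong) (simp_all add: sets_law)
  show ?thesis
    unfolding semigroup_op_def
    by (rule P.borel_measurable_lebesgue_integral) (unfold measurable_cong_sets[OF s refl] case_prod_beta, measurable)
qed

lemma GK_resolvent_const:
  assumes \<alpha>: "0 < \<alpha>" and c: "0 \<le> c"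
  shows "GK (\<lambda>_. ennreal \<alpha>) UNIV (\<lambda>z. ennreal c) x = ennreal (c / \<alpha>)"
proof -
  have Pc: "P t (\<lambda>_. c) x = c" if "0 \<le> t" for t
    using P_cmult[of t c "\<lambda>_. 1" x] P_one[OF that, of x] by simp
  have "GK (\<lambda>_. ennreal \<alpha>) UNIV (\<lambda>z. ennreal c) x = (\<integral>\<^sup>+t. indicator {0..} t * ennreal (exp (- \<alpha> * t) * P t (\<lambda>_. c) x) \<partial>lborel)"
    by (rule GK_resolvent[OF \<alpha> bounded_borel_const c])
  also have "\<dots> = (\<integral>\<^sup>+t. indicator {0..} t * ennreal (exp (- \<alpha> * t) * (\<alpha> * 0 - 0 + c)) \<partial>lborel)"
    by (intro nn_integral_cong) (auto simp: Pc split: split_indicator)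
  also have "\<dots> = ennreal (0 + c / \<alpha>)"
    by (rule laplace_transform_derivative[where p="\<lambda>_. 0" and q="\<lambda>_. 0" and b=0]) (use \<alpha> c in auto)
  finally show ?thesis by simp
qed

lemma GK_resolvent_finite:
  assumes \<alpha>: "0 < \<alpha>" and "\<And>z. k z \<le> ennreal b" shows "GK (\<lambda>_. ennreal \<alpha>) UNIV k x < top"
proof -
  have "GK (\<lambda>_. ennreal \<alpha>) UNIV k x \<le> GK (\<lambda>_. ennreal \<alpha>) UNIV (\<lambda>_. ennreal (max 0 b)) x"
    by (intro GK_mono order_trans[OF assms(2)]) (auto intro: ennreal_leI)
  also have "\<dots> = ennreal (max 0 b / \<alpha>)" by (rule GK_resolvent_const[OF \<alpha>]) simp
  finally show ?thesis by (rule le_less_trans) simp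
qed

text \<open>This is f = R(\<alpha> f - g), with R the \<alpha>-resolvent and the two parts of g on
  opposite sides. A constant c bounding g is added to have a non-negative argument and is cancelled
  at the end, because R c = c/\<alpha> is finite.\<close>

lemma resolvent_identity:
  assumes gen: "generates C_zero X f g" and f: "\<And>z. 0 \<le> f z" and \<alpha>: "0 < \<alpha>"
  shows "ennreal (f x) + GK (\<lambda>_. ennreal \<alpha>) UNIV (\<lambda>z. ennreal (g z)) x =
    GK (\<lambda>_. ennreal \<alpha>) UNIV (\<lambda>z. ennreal (\<alpha> * f z)) x + GK (\<lambda>_. ennreal \<alpha>) UNIV (\<lambda>z. ennreal (- g z)) x"
proof -
  note bf = gen_bounded(1)[OF gen] and bg = gen_bounded(2)[OF gen]
  have [measurable]: "f \<in> borel_measurable borel" "g \<in> borel_measurable borel"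
    using bf bg by (auto intro: bounded_borel_measurable)
  obtain b where b: "\<And>x. \<bar>f x\<bar> \<le> b" using bf by (auto simp: bounded_borel_def)
  obtain c where c: "\<And>x. \<bar>g x\<bar> \<le> c" using bg by (auto simp: bounded_borel_def)
  have c0: "0 \<le> c" using c[of undefined] by linarith
  let ?R = "\<lambda>k. GK (\<lambda>_. ennreal \<alpha>) UNIV k x"
  let ?h = "\<lambda>z. \<alpha> * f z + (- 1) * g z + c * 1"
  have h0: "0 \<le> ?h z" for z using c[of z] f[of z] \<alpha> by (smt (verit) mult_nonneg_nonneg)
  have bh: "bounded_borel ?h" by (intro bounded_borel_add bounded_borel_cmult bf bg bounded_borel_const)
  have am: "(\<lambda>_::'a. ennreal \<alpha>) \<in> borel_measurable borel" by simp
  have P0: "P 0 f x = f x"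
  proof -
    have "P 0 f x = (\<integral>w. f x \<partial>law X (Some x))"
      unfolding semigroup_op_def
      using measurable_compose[OF path_measurable_top measurable_ext0[of f]]
      by (intro integral_cong_AE eventually_mono[OF path0]) auto
    then show ?thesis using prob_space.prob_space[OF prob_law[of "Some x"]] by simp
  qed
  have "?R (\<lambda>z. ennreal (?h z)) = (\<integral>\<^sup>+t. indicator {0..} t * ennreal (exp (- \<alpha> * t) * P t ?h x) \<partial>lborel)"
    by (rule GK_resolvent[OF \<alpha> bh h0])
  also have "\<dots> = (\<integral>\<^sup>+t. indicator {0..} t * ennreal (exp (- \<alpha> * t) * (\<alpha> * P t f x - P t g x + c)) \<partial>lborel)"
  proof (intro nn_integral_cong)
    fix t
    have "P t ?h x = \<alpha> * P t f x - P t g x + c" if "0 \<le> t"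
      using P_lin3[OF bf bg bounded_borel_const[of 1], of t \<alpha> "- 1" c x] P_one[OF that, of x] by simp
    then show "indicator {0..} t * ennreal (exp (- \<alpha> * t) * P t ?h x) =
      indicator {0..} t * ennreal (exp (- \<alpha> * t) * (\<alpha> * P t f x - P t g x + c))"
      by (auto split: split_indicator)
  qed
  also have "\<dots> = ennreal (P 0 f x + c / \<alpha>)"
  proof (rule laplace_transform_derivative[OF \<alpha> c0, where b=b])
    fix t :: real assume t: "0 \<le> t"
    show "((\<lambda>t. P t f x) has_real_derivative P t g x) (at t within {0..})" by (rule gen_derivative[OF gen t])
    show "\<bar>P t f x\<bar> \<le> b" by (rule P_bound[OF bf b t])
    show "0 \<le> \<alpha> * P t f x - P t g x + c"
      using P_nonneg[of f t x] f P_bound[OF bg c t, of x] \<alpha> by (smt (verit) mult_nonneg_nonneg)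
  qed (auto intro: P_time_measurable bf bg)
  finally have Rh: "?R (\<lambda>z. ennreal (?h z)) = ennreal (f x) + ennreal (c / \<alpha>)"
    using f c0 \<alpha> by (simp add: P0 ennreal_plus)
  have "ennreal (?h z) + ennreal (g z) = ennreal (\<alpha> * f z) + ennreal (- g z) + ennreal c" for z
  proof (cases "0 \<le> g z")
    case True
    then have "ennreal (?h z) + ennreal (g z) = ennreal (\<alpha> * f z + c)" using h0[of z] by (simp add: ennreal_plus[symmetric] del: ennreal_plus)
    then show ?thesis using True f[of z] \<alpha> c0 by (simp add: ennreal_neg ennreal_plus)
  next
    case False
    have "0 \<le> \<alpha> * f z" "0 \<le> \<alpha> * f z - g z" using f[of z] \<alpha> False by (auto intro: order_trans[of _ "\<alpha> * f z"])
    then have "ennreal (?h z) = ennreal (\<alpha> * f z) + ennreal (- g z) + ennreal c" using False c0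
      by (simp add: ennreal_plus[symmetric] del: ennreal_plus)
    then show ?thesis using False by (simp add: ennreal_neg)
  qed
  then have "?R (\<lambda>z. ennreal (?h z) + ennreal (g z)) = ?R (\<lambda>z. ennreal (\<alpha> * f z) + ennreal (- g z) + ennreal c)"
    by simp
  then have "?R (\<lambda>z. ennreal (?h z)) + ?R (\<lambda>z. ennreal (g z)) =
      ?R (\<lambda>z. ennreal (\<alpha> * f z)) + ?R (\<lambda>z. ennreal (- g z)) + ?R (\<lambda>z. ennreal c)"
    by (simp add: GK_add)
  then have "ennreal (c / \<alpha>) + (ennreal (f x) + ?R (\<lambda>z. ennreal (g z))) =
      ennreal (c / \<alpha>) + (?R (\<lambda>z. ennreal (\<alpha> * f z)) + ?R (\<lambda>z. ennreal (- g z)))"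
    unfolding Rh GK_resolvent_const[OF \<alpha> c0] by (simp add: ac_simps)
  then show ?thesis by (simp add: ennreal_add_left_cancel)
qed

text \<open>The resolvent identity is used at \<open>x\<close> and, inside the exit operator, at the
  exit position; each resolvent splits into its part before the exit and its exit term. The exit
  terms cancel, being finite for a positive discount.\<close>

theorem dynkin:
  assumes gen: "generates C_zero X f g" and f: "\<And>z. 0 \<le> f z" and \<alpha>: "0 < \<alpha>" and D: "open D"
  shows "ennreal (f x) + GK (\<lambda>_. ennreal \<alpha>) D (\<lambda>z. ennreal (g z)) x =
    GK (\<lambda>_. ennreal \<alpha>) D (\<lambda>z. ennreal (\<alpha> * f z)) x + GK (\<lambda>_. ennreal \<alpha>) D (\<lambda>z. ennreal (- g z)) x
    + HK (\<lambda>_. ennreal \<alpha>) D (\<lambda>z. ennreal (f z)) x"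
proof -
  have [measurable]: "f \<in> borel_measurable borel" "g \<in> borel_measurable borel"
    using gen_bounded[OF gen] by (auto intro: bounded_borel_measurable)
  obtain b where b: "\<And>x. \<bar>f x\<bar> \<le> b" using gen_bounded(1)[OF gen] by (auto simp: bounded_borel_def)
  obtain c where c: "\<And>x. \<bar>g x\<bar> \<le> c" using gen_bounded(2)[OF gen] by (auto simp: bounded_borel_def)
  let ?a = "\<lambda>_::'a. ennreal \<alpha>"
  let ?R = "\<lambda>k. GK ?a UNIV k"
  have r: "rate ?a" by (rule rate_const) simp
  have am[measurable]: "?a \<in> borel_measurable borel" by simp
  have R: "?R k x = GK ?a D k x + HK ?a D (?R k) x" if "k \<in> borel_measurable borel" for k
    using GK_strong_markov[OF open_UNIV D _ r that] by simp
  have id: "ennreal (f z) + ?R (\<lambda>z. ennreal (g z)) z = ?R (\<lambda>z. ennreal (\<alpha> * f z)) z + ?R (\<lambda>z. ennreal (- g z)) z" for z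
    by (rule resolvent_identity[OF gen f \<alpha>])
  then have "HK ?a D (\<lambda>z. ennreal (f z) + ?R (\<lambda>z. ennreal (g z)) z) x = HK ?a D (\<lambda>z. ?R (\<lambda>z. ennreal (\<alpha> * f z)) z + ?R (\<lambda>z. ennreal (- g z)) z) x"
    by simp
  then have Hid: "HK ?a D (\<lambda>z. ennreal (f z)) x + HK ?a D (?R (\<lambda>z. ennreal (g z))) x =
     HK ?a D (?R (\<lambda>z. ennreal (\<alpha> * f z))) x + HK ?a D (?R (\<lambda>z. ennreal (- g z))) x"
    by (simp add: HK_add)
  let ?G = "\<lambda>k. GK ?a D k x" and ?H = "\<lambda>k. HK ?a D k x"
  have "ennreal (f x) + (?G (\<lambda>z. ennreal (g z)) + ?H (?R (\<lambda>z. ennreal (g z)))) =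
     (?G (\<lambda>z. ennreal (\<alpha> * f z)) + ?H (?R (\<lambda>z. ennreal (\<alpha> * f z)))) + (?G (\<lambda>z. ennreal (- g z)) + ?H (?R (\<lambda>z. ennreal (- g z))))"
    using id[of x] by (simp add: R)
  also have "\<dots> = ?G (\<lambda>z. ennreal (\<alpha> * f z)) + ?G (\<lambda>z. ennreal (- g z)) + (?H (\<lambda>z. ennreal (f z)) + ?H (?R (\<lambda>z. ennreal (g z))))"
    unfolding Hid by (simp add: ac_simps)
  finally have "?H (?R (\<lambda>z. ennreal (g z))) + (ennreal (f x) + ?G (\<lambda>z. ennreal (g z))) =
     ?H (?R (\<lambda>z. ennreal (g z))) + (?G (\<lambda>z. ennreal (\<alpha> * f z)) + ?G (\<lambda>z. ennreal (- g z)) + ?H (\<lambda>z. ennreal (f z)))"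
    by (simp add: ac_simps)
  moreover have "?H (?R (\<lambda>z. ennreal (g z))) \<noteq> top"
  proof -
    have "?H (?R (\<lambda>z. ennreal (g z))) \<le> ?R (\<lambda>z. ennreal (g z)) x" using R[of "\<lambda>z. ennreal (g z)"] by simp
    also have "\<dots> < top"
      by (rule GK_resolvent_finite[OF \<alpha>, of _ c]) (use c in \<open>auto intro!: ennreal_leI simp: abs_le_iff\<close>)
    finally show ?thesis by simp
  qed
  ultimately show ?thesis by (simp add: ennreal_add_left_cancel)
qed

end

text \<open>A test function between \<open>K\<close> and \<open>U\<close> gives M1(K) \<le> M2(U)
  and the reverse; letting \<open>U\<close> shrink to \<open>K\<close> gives equality on compact
  subsets of \<open>V\<close>. Finiteness of M2 near \<open>K\<close> comes from M1 by the same
  comparison. Intersecting with the closed set \<open>E\<close> keeps compact sets compact and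
  inside \<open>V\<close>, so the intersection-stable family of all compact sets can be
  used.\<close>

lemma measure_eq_by_test_functions:
  fixes M1 M2 :: "'a::heine_borel measure"
  assumes sets1[measurable_cong]: "sets M1 = sets borel" and sets2[measurable_cong]: "sets M2 = sets borel"
    and fin: "emeasure M1 UNIV < top" and V: "open V" and E: "closed E" "E \<subseteq> V"
    and test: "\<And>K U. compact K \<Longrightarrow> open U \<Longrightarrow> K \<subseteq> U \<Longrightarrow> U \<subseteq> V \<Longrightarrow> \<exists>\<phi>. \<phi> \<in> borel_measurable borel \<and>
      (\<forall>z\<in>K. \<phi> z = (1::real)) \<and> (\<forall>z. z \<notin> U \<longrightarrow> \<phi> z = 0) \<and> (\<forall>z. 0 \<le> \<phi> z \<and> \<phi> z \<le> 1) \<and>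
      (\<integral>\<^sup>+z. ennreal (\<phi> z) \<partial>M1) = (\<integral>\<^sup>+z. ennreal (\<phi> z) \<partial>M2)"
    and B: "B \<in> sets borel"
  shows "emeasure M1 (B \<inter> E) = emeasure M2 (B \<inter> E)"
proof -
  have test1: "emeasure M K \<le> (\<integral>\<^sup>+z. ennreal (\<phi> z) \<partial>M)" and test2: "(\<integral>\<^sup>+z. ennreal (\<phi> z) \<partial>M) \<le> emeasure M U"
    if "sets M = sets borel" "compact K" "open U" "\<phi> \<in> borel_measurable borel" "\<forall>z\<in>K. \<phi> z = (1::real)" "\<forall>z. z \<notin> U \<longrightarrow> \<phi> z = 0" "\<forall>z. 0 \<le> \<phi> z \<and> \<phi> z \<le> 1"
    for M and K U :: "'a set" and \<phi>
  proof -
    have "emeasure M K = (\<integral>\<^sup>+z. indicator K z \<partial>M)"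
      using that by (intro nn_integral_indicator[symmetric]) (auto intro: borel_compact)
    also have "\<dots> \<le> (\<integral>\<^sup>+z. ennreal (\<phi> z) \<partial>M)"
      using that by (intro nn_integral_mono) (auto split: split_indicator)
    finally show "emeasure M K \<le> (\<integral>\<^sup>+z. ennreal (\<phi> z) \<partial>M)" .
    have "(\<integral>\<^sup>+z. ennreal (\<phi> z) \<partial>M) \<le> (\<integral>\<^sup>+z. indicator U z \<partial>M)"
      using that by (intro nn_integral_mono) (auto split: split_indicator)
    also have "\<dots> = emeasure M U"
      using that by (intro nn_integral_indicator) auto
    finally show "(\<integral>\<^sup>+z. ennreal (\<phi> z) \<partial>M) \<le> emeasure M U" .
  qed
  have le: "emeasure M1 K \<le> emeasure M2 U" "emeasure M2 K \<le> emeasure M1 U"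
    if KU: "compact K" "open U" "K \<subseteq> U" "U \<subseteq> V" for K U
  proof -
    obtain \<phi> where \<phi>: "\<phi> \<in> borel_measurable borel" "\<forall>z\<in>K. \<phi> z = (1::real)" "\<forall>z. z \<notin> U \<longrightarrow> \<phi> z = 0" "\<forall>z. 0 \<le> \<phi> z \<and> \<phi> z \<le> 1"
      "(\<integral>\<^sup>+z. ennreal (\<phi> z) \<partial>M1) = (\<integral>\<^sup>+z. ennreal (\<phi> z) \<partial>M2)" using test[OF KU] by blast
    show "emeasure M1 K \<le> emeasure M2 U"
      using test1[OF sets1 KU(1,2) \<phi>(1-4)] test2[OF sets2 KU(1,2) \<phi>(1-4)] \<phi>(5) by simp
    show "emeasure M2 K \<le> emeasure M1 U"
      using test1[OF sets2 KU(1,2) \<phi>(1-4)] test2[OF sets1 KU(1,2) \<phi>(1-4)] \<phi>(5) by simp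
  qed
  have compact: "emeasure M1 K = emeasure M2 K" if K: "compact K" "K \<subseteq> V" for K
  proof (cases "K = {}")
    case False
    obtain e where e: "0 < e" "{x. infdist x K \<le> e} \<subseteq> V"
      using compact_in_open_separated[OF False K(1) V K(2)] by blast
    define C where "C = {x. infdist x K \<le> e}"
    have C: "compact C" unfolding C_def by (rule compact_infdist_le[OF False K(1) e(1)])
    have CV: "C \<subseteq> V" using e by (simp add: C_def)
    define U where "U n = {x. infdist x K < e / real (Suc n)}" for n
    have oU: "open (U n)" for n unfolding U_def by (intro open_Collect_less continuous_intros)
    have eb: "e / real (Suc n) \<le> e" for n using e(1) by (simp add: divide_le_eq)
    have UC: "U n \<subseteq> C" for n unfolding U_def C_def using eb[of n] by auto
    have KU: "K \<subseteq> U n" for n using e(1) by (auto simp: U_def)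
    have UV: "U n \<subseteq> V" for n using UC CV by blast
    have dec: "decseq U"
    proof (rule decseq_SucI)
      fix n
      have "e / real (Suc (Suc n)) \<le> e / real (Suc n)" using e(1) by (intro divide_left_mono) auto
      then show "U (Suc n) \<subseteq> U n" unfolding U_def by (intro Collect_mono impI) (rule less_le_trans)
    qed
    have INT: "(\<Inter>n. U n) = K"
    proof (intro equalityI subsetI)
      fix x assume "x \<in> (\<Inter>n. U n)"
      then have "infdist x K \<le> e / real (Suc n)" for n by (auto simp: U_def less_imp_le)
      moreover have "(\<lambda>n. e / real (Suc n)) \<longlonglongrightarrow> 0"
        using tendsto_mult[OF tendsto_const[of e] LIMSEQ_Suc[OF lim_1_over_n]] by simp
      ultimately have "infdist x K \<le> 0" by (intro LIMSEQ_le_const) auto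
      then have "infdist x K = 0" using infdist_nonneg[of x K] by linarith
      then show "x \<in> K" using in_closed_iff_infdist_zero[OF compact_imp_closed[OF K(1)] False] by blast
    qed (use KU in auto)
    have lim: "(\<lambda>n. emeasure M (U n)) \<longlonglongrightarrow> emeasure M K" if "sets M = sets borel" "\<And>n. emeasure M (U n) \<noteq> \<infinity>" for M
      unfolding INT[symmetric] using oU that dec by (intro Lim_emeasure_decseq) auto
    have "emeasure M1 UNIV \<noteq> \<infinity>" using fin by simp
    then have f1: "emeasure M1 (U n) \<noteq> \<infinity>" for n
      using emeasure_mono[of "U n" UNIV M1] sets1 by (auto simp: top_unique)
    have f2: "emeasure M2 (U n) \<noteq> \<infinity>" for n
    proof -
      have "emeasure M2 (U n) \<le> emeasure M2 C" using UC C by (intro emeasure_mono) (auto simp: sets2 intro: borel_compact)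
      also have "\<dots> \<le> emeasure M1 V" by (rule le(2)[OF C V CV]) simp
      also have "\<dots> \<le> emeasure M1 UNIV" using V by (intro emeasure_mono) (auto simp: sets1)
      finally show ?thesis using fin by auto
    qed
    show ?thesis
    proof (rule antisym)
      show "emeasure M1 K \<le> emeasure M2 K"
        by (rule LIMSEQ_le_const[OF lim[OF sets2 f2]]) (use le(1)[OF K(1) oU KU UV] in auto)
      show "emeasure M2 K \<le> emeasure M1 K"
        by (rule LIMSEQ_le_const[OF lim[OF sets1 f1]]) (use le(2)[OF K(1) oU KU UV] in auto)
    qed
  qed simp
  have Em[measurable]: "E \<in> sets borel" using E by auto
  have "density M1 (indicator E) = density M2 (indicator E)"
  proof (rule measure_eqI_generator_eq[where E="{K. compact K}" and \<Omega>=UNIV and A="\<lambda>n. cball undefined (real n)"])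
    show "Int_stable {K :: 'a set. compact K}" by (auto simp: Int_stable_def compact_Int)
    have "sigma_sets UNIV {K :: 'a set. compact K} = sigma_sets UNIV {K. closed K}"
    proof (rule sigma_sets_eqI)
      fix a :: "'a set" assume "a \<in> {K. closed K}"
      then have "a \<inter> cball undefined (real n) \<in> {K. compact K}" for n
        by (auto simp: closed_Int_compact)
      then have "(\<Union>n. a \<inter> cball undefined (real n)) \<in> sigma_sets UNIV {K. compact K}"
        by (intro sigma_sets.Union sigma_sets.Basic)
      moreover have "(\<Union>n. a \<inter> cball undefined (real n)) = a"
        using real_arch_simple[of "dist undefined _"] by (auto simp: mem_cball)
      ultimately show "a \<in> sigma_sets UNIV {K. compact K}" by simp
    qed (auto intro: compact_imp_closed)
    then have b: "sets borel = sigma_sets UNIV {K :: 'a set. compact K}"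
      unfolding borel_eq_closed by simp
    show "sets (density M1 (indicator E)) = sigma_sets UNIV {K. compact K}" "sets (density M2 (indicator E)) = sigma_sets UNIV {K. compact K}"
      using b sets1 sets2 by auto
    fix K :: "'a set" assume "K \<in> {K. compact K}"
    then have K: "compact K" by simp
    then have [measurable]: "K \<in> sets borel" by (rule borel_compact)
    have "compact (K \<inter> E)" using K E(1) by (rule compact_Int_closed)
    then have "emeasure M1 (K \<inter> E) = emeasure M2 (K \<inter> E)" using E by (intro compact) auto
    then show "emeasure (density M1 (indicator E)) K = emeasure (density M2 (indicator E)) K"
      by (simp add: emeasure_density indicator_inter_arith[symmetric] Int_commute sets1 sets2)
  next
    have "emeasure (density M1 (indicator E)) A \<le> emeasure M1 UNIV" if "A \<in> sets borel" for A
      using that emeasure_mono[of "A \<inter> E" UNIV M1]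
      by (simp add: emeasure_density indicator_inter_arith[symmetric] Int_commute sets1)
    then show "emeasure (density M1 (indicator E)) (cball undefined (real n)) \<noteq> \<infinity>" for n
    proof -
      have "emeasure (density M1 (indicator E)) (cball undefined (real n)) \<le> emeasure M1 UNIV"
        by (rule \<open>\<And>A. A \<in> sets borel \<Longrightarrow> emeasure (density M1 (indicator E)) A \<le> emeasure M1 UNIV\<close>) auto
      then show ?thesis using fin by (auto simp: top_unique)
    qed
    show "(\<Union>n. cball (undefined::'a) (real n)) = UNIV"
      using real_arch_simple[of "dist undefined _"] by (auto simp: mem_cball)
  qed auto
  then have "emeasure (density M1 (indicator E)) B = emeasure (density M2 (indicator E)) B" by simp
  then show ?thesis using B by (simp add: emeasure_density indicator_inter_arith[symmetric] Int_commute sets1 sets2)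
qed

section \<open>Dynkin's formula without discount\<close>

context conservative_hunt
begin

context
  fixes f g assumes gen: "generates C_zero X f g" and f: "\<And>z. 0 \<le> f z"
begin

lemma gen_ennreal_measurable [measurable]:
  "(\<lambda>z. ennreal (f z)) \<in> borel_measurable borel" "(\<lambda>z. ennreal (g z)) \<in> borel_measurable borel"
  "(\<lambda>z. ennreal (- g z)) \<in> borel_measurable borel"
  using gen_bounded[OF gen] bounded_borel_measurable by (auto intro!: measurable_compose[OF _ measurable_ennreal])

lemma dynkin_HK_le:
  assumes D: "open D"
  shows "Hr D (\<lambda>z. ennreal (f z)) x \<le> ennreal (f x) + Gr D (\<lambda>z. ennreal (g z)) x"
proof (rule HK_discount_le)
  fix \<alpha> :: real assume \<alpha>: "0 < \<alpha>"
  have "HK (\<lambda>_. ennreal \<alpha>) D (\<lambda>z. ennreal (f z)) x \<le> ennreal (f x) + GK (\<lambda>_. ennreal \<alpha>) D (\<lambda>z. ennreal (g z)) x"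
    unfolding dynkin[OF gen f \<alpha> D] by simp
  also have "\<dots> \<le> ennreal (f x) + Gr D (\<lambda>z. ennreal (g z)) x"
    by (rule add_left_mono[OF GK_le_GK0])
  finally show "HK (\<lambda>_. ennreal \<alpha>) D (\<lambda>z. ennreal (f z)) x \<le> ennreal (f x) + Gr D (\<lambda>z. ennreal (g z)) x" .
qed simp

text \<open>When f is 0 on \<open>D\<close>, the terms with f x, \<alpha> f and the negative part of
  g drop out, and Dynkin's formula reduces to one equality. It is applied to test functions
  supported away from \<open>D\<close>.\<close>

lemma dynkin_vanishing:
  assumes D: "open D" and f0: "\<And>z. z \<in> D \<Longrightarrow> f z = 0" and g0: "\<And>z. z \<in> D \<Longrightarrow> 0 \<le> g z" and x: "x \<in> D"
  shows "Hr D (\<lambda>z. ennreal (f z)) x = Gr D (\<lambda>z. ennreal (g z)) x"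
proof (rule antisym)
  show "Hr D (\<lambda>z. ennreal (f z)) x \<le> Gr D (\<lambda>z. ennreal (g z)) x"
    using dynkin_HK_le[OF D, of x] f0[OF x] by simp
  show "Gr D (\<lambda>z. ennreal (g z)) x \<le> Hr D (\<lambda>z. ennreal (f z)) x"
  proof (rule GK_discount_le)
    fix \<alpha> :: real assume \<alpha>: "0 < \<alpha>"
    let ?a = "\<lambda>_::'a. ennreal \<alpha>"
    have "GK ?a D (\<lambda>z. ennreal (\<alpha> * f z)) x \<le> GK ?a D (\<lambda>_. 0) x" "GK ?a D (\<lambda>z. ennreal (- g z)) x \<le> GK ?a D (\<lambda>_. 0) x"
      using f0 g0 by (auto intro!: GK_mono[OF D] simp: ennreal_neg)
    moreover have "GK ?a D (\<lambda>_. 0) x = 0" using GK_cmult[of ?a "\<lambda>_. 0" D 0 x] by simp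
    ultimately have "GK ?a D (\<lambda>z. ennreal (g z)) x = HK ?a D (\<lambda>z. ennreal (f z)) x"
      using dynkin[OF gen f \<alpha> D, of x] f0[OF x] by simp
    then show "GK ?a D (\<lambda>z. ennreal (g z)) x \<le> Hr D (\<lambda>z. ennreal (f z)) x"
      using HK_le_HK0[of ?a D "\<lambda>z. ennreal (f z)" x] by simp
  qed simp
qed

text \<open>The discount costs \<alpha> times the potential of f, which is small for small \<alpha>
  because that potential is finite. The bound must hold for every \<alpha>; since Green operators
  grow as the rate decreases, \<alpha> may be replaced by its minimum with a small \<beta>.\<close>

lemma dynkin_ge:
  assumes D: "open D" and fin: "Gr D (\<lambda>z. ennreal (f z)) x < top"
  shows "ennreal (f x) + Gr D (\<lambda>z. ennreal (g z)) x \<le>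
    Gr D (\<lambda>z. ennreal (- g z)) x + Hr D (\<lambda>z. ennreal (f z)) x" (is "_ \<le> ?B")
proof (rule ennreal_le_epsilon)
  fix e :: real assume e: "0 < e"
  let ?g = "\<lambda>z. ennreal (g z)"
  obtain c where c: "Gr D (\<lambda>z. ennreal (f z)) x = ennreal c" "0 \<le> c" using fin by (cases "Gr D (\<lambda>z. ennreal (f z)) x") auto
  define \<beta> where "\<beta> = e / (c + 1)"
  have \<beta>: "0 < \<beta>" "\<beta> * c \<le> e" using e c by (auto simp: \<beta>_def field_simps)
  have main: "ennreal (f x) + GK (\<lambda>_. ennreal \<alpha>) D ?g x \<le> ?B + ennreal e" if \<alpha>: "0 < \<alpha>" for \<alpha>
  proof -
    define \<gamma> where "\<gamma> = min \<alpha> \<beta>"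
    have \<gamma>: "0 < \<gamma>" "\<gamma> \<le> \<alpha>" "\<gamma> \<le> \<beta>" using \<alpha> \<beta> by (auto simp: \<gamma>_def)
    have "ennreal (f x) + GK (\<lambda>_. ennreal \<alpha>) D ?g x \<le> ennreal (f x) + GK (\<lambda>_. ennreal \<gamma>) D ?g x"
      using \<gamma> by (intro add_left_mono GK_rate_mono rate_const) (auto intro: ennreal_leI)
    also have "\<dots> \<le> Gr D (\<lambda>z. ennreal (\<gamma> * f z)) x + ?B"
      unfolding dynkin[OF gen f \<gamma>(1) D] add.assoc by (intro add_mono GK_le_GK0 HK_le_HK0)
    also have "Gr D (\<lambda>z. ennreal (\<gamma> * f z)) x = ennreal (\<gamma> * c)"
      using GK_cmult[of "\<lambda>_. 0" "\<lambda>z. ennreal (f z)" D "ennreal \<gamma>" x] \<gamma> f c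
        bounded_borel_measurable[OF gen_bounded(1)[OF gen]] by (simp add: ennreal_mult)
    also have "ennreal (\<gamma> * c) \<le> ennreal e"
      using \<gamma> \<beta> c by (intro ennreal_leI) (meson mult_right_mono order_trans)
    finally show ?thesis by (simp add: add.commute)
  qed
  have "Gr D ?g x \<le> (?B + ennreal e) - ennreal (f x)"
  proof (rule GK_discount_le)
    fix \<alpha> :: real assume "0 < \<alpha>"
    from main[OF this] show "GK (\<lambda>_. ennreal \<alpha>) D ?g x \<le> (?B + ennreal e) - ennreal (f x)"
      by (simp add: ennreal_le_minus_iff add.commute)
  qed simp
  moreover have "ennreal (f x) \<le> ?B + ennreal e"
    using main[of 1] by (auto intro: order_trans[rotated] simp: le_iff_add)
  ultimately show "ennreal (f x) + Gr D ?g x \<le> ?B + ennreal e"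
    using add_left_mono[of "Gr D ?g x" "(?B + ennreal e) - ennreal (f x)" "ennreal (f x)"] add_diff_inverse_ennreal[of "ennreal (f x)" "?B + ennreal e"]
    by simp
qed

end

section \<open>Generators at infinity and off the support\<close>

lemma generates_unique: "generates C X f g \<Longrightarrow> generates C X f g' \<Longrightarrow> g = g'"
  unfolding generates_def
  by (intro ext) (auto intro!: tendsto_unique[OF trivial_limit_at_right_real] dest!: tendsto_uniform_limitI)

lemma generator_eqI: "generates C X f g \<Longrightarrow> generator C X f = g"
  unfolding generator_def by (rule the_equality) (auto dest: generates_unique)

lemma C_zero_C_infinity: "f \<in> C_zero \<Longrightarrow> f \<in> C_infinity"
  by (auto simp: C_zero_def C_infinity_def)

text \<open>Conservativeness makes the generator of a constant vanish, so the hypotheses on 1 - f at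
  infinity become hypotheses on -g for a test function f.\<close>

lemma generator_C_infinity:
  assumes gen: "generates C_zero X f g"
  shows "generator C_infinity X f = g" "generator C_infinity X (\<lambda>z. 1 - f z) = (\<lambda>z. - g z)"
proof -
  show "generator C_infinity X f = g"
    using gen by (intro generator_eqI) (auto simp: generates_def C_zero_C_infinity)
  have u: "uniform_limit UNIV (\<lambda>t x. (P t f x - f x) / t) g (at_right 0)" using gen by (simp add: generates_def)
  have C: "f \<in> C_zero" "g \<in> C_zero" by (rule gen_C_zero[OF gen])+
  show "generator C_infinity X (\<lambda>z. 1 - f z) = (\<lambda>z. - g z)"
  proof (intro generator_eqI, unfold generates_def, intro conjI)
    have "limit_at_infinity f 0" "limit_at_infinity g 0" "continuous_on UNIV f" "continuous_on UNIV g"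
      using C by (auto simp: C_zero_def)
    then have "limit_at_infinity (\<lambda>z. 1 - f z) 1" "limit_at_infinity (\<lambda>z. - g z) 0"
      by (auto simp: limit_at_infinity_def)
    then show "(\<lambda>z. 1 - f z) \<in> C_infinity" "(\<lambda>z. - g z) \<in> C_infinity"
      using \<open>continuous_on UNIV f\<close> \<open>continuous_on UNIV g\<close> unfolding C_infinity_def
      by (auto intro!: continuous_intros)
    have "uniform_limit UNIV (\<lambda>t x. - ((P t f x - f x) / t)) (\<lambda>z. - g z) (at_right 0)"
      by (rule uniform_limit_uminus[OF u])
    moreover have "\<forall>\<^sub>F t in at_right 0. \<forall>x\<in>UNIV. - ((P t f x - f x) / t) = (P t (\<lambda>z. 1 - f z) x - (1 - f x)) / t"
    proof (rule eventually_mono[OF eventually_at_right_less], intro ballI)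
      fix t x assume t: "(0::real) < t"
      have "P t (\<lambda>z. (- 1) * f z + 1) x = (- 1) * P t f x + 1"
        using P_add_const[OF _ bounded_borel_cmult[OF gen_bounded(1)[OF gen]], of t "- 1" 1 x] P_cmult[of t "- 1" f x] t by simp
      then show "- ((P t f x - f x) / t) = (P t (\<lambda>z. 1 - f z) x - (1 - f x)) / t"
        by (simp add: minus_divide_left)
    qed
    ultimately show "uniform_limit UNIV (\<lambda>t x. (P t (\<lambda>z. 1 - f z) x - (1 - f x)) / t) (\<lambda>z. - g z) (at_right 0)"
      by (subst (asm) uniform_limit_cong) auto
  qed
qed

lemma generates_tendsto:
  assumes "generates C_zero X f g" shows "((\<lambda>t. (P t f x - f x) / t) \<longlongrightarrow> g x) (at_right 0)"
  using assms by (auto simp: generates_def dest!: tendsto_uniform_limitI)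

text \<open>Off the support of f both the generator and the Levy integral are the limit of P t f /
  t.\<close>

lemma generator_levy_eq:
  assumes gen: "generates C_zero X f g" and J: "levy_kernel X J" and x: "x \<notin> closure {z. f z \<noteq> 0}" and f: "\<And>z. 0 \<le> f z"
  shows "ennreal (g x) = (\<integral>\<^sup>+z. ennreal (f z) \<partial>J x)" "0 \<le> g x"
proof -
  have C: "f \<in> C_zero" by (rule gen_C_zero[OF gen])
  have *: "integrable (J x) f" "((\<lambda>t. P t f x / t) \<longlongrightarrow> (\<integral>y. f y \<partial>J x)) (at_right 0)"
    using J C x by (auto simp: levy_kernel_def C_zero_def)
  have "f x = 0" using subsetD[OF closure_subset, of x "{z. f z \<noteq> 0}"] x by auto
  then have "((\<lambda>t. P t f x / t) \<longlongrightarrow> g x) (at_right 0)" using generates_tendsto[OF gen, of x] by simp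
  then have "g x = (\<integral>y. f y \<partial>J x)" using *(2) by (intro tendsto_unique[OF trivial_limit_at_right_real])
  then show "ennreal (g x) = (\<integral>\<^sup>+z. ennreal (f z) \<partial>J x)" "0 \<le> g x"
    using nn_integral_eq_integral[OF *(1)] f by (auto intro: integral_nonneg_AE)
qed

end

section \<open>Green kernels and the Levy system\<close>

lemma measurable_case_option_default:
  "case_option d (\<lambda>z. z) \<in> (cemetery_borel :: 'a::heine_borel option measure) \<rightarrow>\<^sub>M borel"
proof (rule measurableI)
  fix B :: "'a set" assume "B \<in> sets borel"
  then have "Some ` B \<in> sets (cemetery_borel :: 'a option measure)" by (rule Some_image_sets)
  moreover have "case_option d (\<lambda>z. z) -` B \<inter> space cemetery_borel = Some ` B \<union> (if d \<in> B then {None} else {})"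
    by (auto split: option.splits)
  ultimately show "case_option d (\<lambda>z. z) -` B \<inter> space cemetery_borel \<in> sets cemetery_borel"
    using None_sets by (auto simp del: Un_insert_right)
qed simp

context conservative_hunt
begin

lemma HK_rate_mono:
  assumes "rate \<psi>'" "\<And>z. \<psi> z \<le> \<psi>' z" shows "HK \<psi>' D g x \<le> HK \<psi> D g x"
  unfolding HK_def exit_fun_def
  by (intro nn_integral_mono mult_right_mono ennreal_leI fk_rate_mono assms) auto

text \<open>Removing the discount treats one term at a time. So the two terms on the left get
  independent rates, both dominated by the case of the smaller rate, and the discounts are removed
  one after the other.\<close>

lemma dynkin_le:
  assumes gen: "generates C_zero X f g" and f: "\<And>z. 0 \<le> f z" and D: "open D"
  shows "Gr D (\<lambda>z. ennreal (- g z)) x + Hr D (\<lambda>z. ennreal (f z)) x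
    \<le> ennreal (f x) + Gr D (\<lambda>z. ennreal (g z)) x" (is "?G + ?H \<le> ?B")
proof -
  note [measurable] = gen_ennreal_measurable[OF gen f]
  have le: "GK (\<lambda>_. ennreal \<alpha>) D (\<lambda>z. ennreal (- g z)) x + HK (\<lambda>_. ennreal \<alpha>') D (\<lambda>z. ennreal (f z)) x \<le> ?B"
    if "0 < \<alpha>" "0 < \<alpha>'" for \<alpha> \<alpha>'
  proof -
    define \<beta> where "\<beta> = min \<alpha> \<alpha>'"
    have \<beta>: "0 < \<beta>" "\<beta> \<le> \<alpha>" "\<beta> \<le> \<alpha>'" using that by (auto simp: \<beta>_def)
    have "GK (\<lambda>_. ennreal \<alpha>) D (\<lambda>z. ennreal (- g z)) x + HK (\<lambda>_. ennreal \<alpha>') D (\<lambda>z. ennreal (f z)) x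
      \<le> GK (\<lambda>_. ennreal \<beta>) D (\<lambda>z. ennreal (- g z)) x + HK (\<lambda>_. ennreal \<beta>) D (\<lambda>z. ennreal (f z)) x"
      using \<beta> by (intro add_mono GK_rate_mono HK_rate_mono rate_const) (auto intro: ennreal_leI)
    also have "\<dots> \<le> ennreal (f x) + GK (\<lambda>_. ennreal \<beta>) D (\<lambda>z. ennreal (g z)) x"
      unfolding dynkin[OF gen f \<beta>(1) D] by (simp add: add.assoc add_increasing)
    also have "\<dots> \<le> ?B" by (rule add_left_mono[OF GK_le_GK0])
    finally show ?thesis .
  qed
  have sub: "b + a \<le> c" if "b \<le> c - a" "a \<le> c" for a b c :: ennreal
    using that by (metis add_left_mono add.commute add_diff_inverse_ennreal)
  have H: "?H + GK (\<lambda>_. ennreal \<alpha>) D (\<lambda>z. ennreal (- g z)) x \<le> ?B" if \<alpha>: "0 < \<alpha>" for \<alpha>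
  proof (rule sub)
    show "?H \<le> ?B - GK (\<lambda>_. ennreal \<alpha>) D (\<lambda>z. ennreal (- g z)) x"
      by (rule HK_discount_le) (use le[OF \<alpha>] in \<open>auto simp: ennreal_le_minus_iff add.commute\<close>)
    show "GK (\<lambda>_. ennreal \<alpha>) D (\<lambda>z. ennreal (- g z)) x \<le> ?B"
      using le[OF \<alpha> zero_less_one] by (rule order_trans[rotated]) simp
  qed
  show ?thesis
  proof (rule sub)
    show "?G \<le> ?B - ?H"
      by (rule GK_discount_le) (use H in \<open>auto simp: ennreal_le_minus_iff add.commute\<close>)
    show "?H \<le> ?B" using H[OF zero_less_one] by (rule order_trans[rotated]) simp
  qed
qed

text \<open>A finite expected exit time forces the exit to happen, and a conservative process is
  then still alive.\<close>

lemma HK_one: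
  assumes D: "open D" and fin: "Gr D (\<lambda>_. 1) x < top"
  shows "Hr D (\<lambda>_. 1) x = 1"
proof -
  have "AE w in law X (Some x). green_fun (\<lambda>_. 0) D (\<lambda>_. 1) w \<noteq> \<infinity>"
    using fin by (intro nn_integral_PInf_AE) (auto simp: GK_def)
  then have "AE w in law X (Some x). exit_fun (\<lambda>_. 0) D (\<lambda>_. 1) w = 1"
    using AE_conservative[of x]
  proof eventually_elim
    case (elim w)
    have "exit_at D w \<noteq> top"
    proof
      assume t: "exit_at D w = top"
      have one: "ext0 (\<lambda>_. 1::ennreal) (path X (ennreal t) w) = 1" for t
        using elim(2)[THEN conjunct2, rule_format, of "ennreal t"] by auto
      have "green_fun (\<lambda>_. 0) D (\<lambda>_. 1) w = (\<integral>\<^sup>+t. indicator {0..} t \<partial>(lborel::real measure))"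
        unfolding green_fun_def t by (intro nn_integral_cong) (auto simp: one split: split_indicator)
      also have "\<dots> = top"
      proof (rule ccontr)
        assume "(\<integral>\<^sup>+t. indicator {0..} t \<partial>(lborel::real measure)) \<noteq> top"
        then obtain n :: nat where n: "emeasure lborel {0::real..} < of_nat n"
          using ennreal_Ex_less_of_nat[of "emeasure lborel {0::real..}"] by (auto simp: top.not_eq_extremum)
        have "of_nat n = emeasure lborel {0..real n}" by (simp add: ennreal_of_nat_eq_real_of_nat)
        also have "\<dots> \<le> emeasure lborel {0::real..}" by (intro emeasure_mono) auto
        finally show False using n by simp
      qed
      finally show False using elim(1) by simp
    qed
    then have "path X (exit_at D w) w \<noteq> None" using elim(2) by (simp add: top.not_eq_extremum)
    then show ?case by (auto simp: exit_fun_def)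
  qed
  then have "Hr D (\<lambda>_. 1) x = (\<E> (Some x) (\<lambda>w. 1))"
    unfolding HK_def by (rule nn_integral_cong_AE)
  then show ?thesis using prob_space.emeasure_space_1[OF prob_law[of "Some x"]] by simp
qed

end

text \<open>What is known of one process without reference to its dual; it is instantiated for the
  process and for the dual alike.\<close>

locale jump_hunt = conservative_hunt X for X :: "('w, 'a::heine_borel) process" +
  fixes m :: "'a measure" and j :: "'a \<Rightarrow> 'a \<Rightarrow> real" and \<D> :: "('a \<Rightarrow> real) set" and G :: "'a set \<Rightarrow> 'a \<Rightarrow> 'a \<Rightarrow> ennreal"
  assumes sets_m: "sets m = sets borel" and sigma_finite_m: "sigma_finite_measure m" and full_support: "full_support m"
    and green: "\<And>D. open D \<Longrightarrow> green_kernel m X D (G D)"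
    and j_measurable: "case_prod j \<in> borel_measurable (borel \<Otimes>\<^sub>M borel)" and j_nonneg: "\<And>x y. 0 \<le> j x y"
    and j_pos: "\<And>x y. x \<noteq> y \<Longrightarrow> 0 < j x y"
    and levy: "levy_kernel X (\<lambda>x. density m (\<lambda>y. ennreal (j x y)))"
    and \<D>_domain: "\<D> \<subseteq> generator_domain C_zero X"
    and \<D>_tests: "\<And>K D. compact K \<Longrightarrow> open D \<Longrightarrow> K \<subseteq> D \<Longrightarrow> test_functions m \<D> K D \<noteq> {}"
begin

sublocale m: sigma_finite_measure m by (rule sigma_finite_m)
sublocale mm: pair_sigma_finite m m ..

lemma measurable_m [measurable_cong]: "sets m = sets borel" by (rule sets_m)

lemma space_m [simp]: "space m = UNIV" using sets_eq_imp_space_eq[OF sets_m] by simp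

lemma j_measurable_raw [measurable (raw)]:
  "f \<in> M \<rightarrow>\<^sub>M borel \<Longrightarrow> g \<in> M \<rightarrow>\<^sub>M borel \<Longrightarrow> (\<lambda>x. j (f x) (g x)) \<in> borel_measurable M"
  using measurable_compose[OF measurable_Pair j_measurable] by simp

lemma rate0: "rate (\<lambda>_. 0)" by (rule rate_const) simp

lemma G_measurable:
  "open D \<Longrightarrow> case_prod (G D) \<in> borel_measurable (borel \<Otimes>\<^sub>M borel)"
  using green by (simp add: green_kernel_def)

lemma G_measurable_raw [measurable (raw)]:
  "open D \<Longrightarrow> f \<in> M \<rightarrow>\<^sub>M borel \<Longrightarrow> g \<in> M \<rightarrow>\<^sub>M borel \<Longrightarrow> (\<lambda>x. G D (f x) (g x)) \<in> borel_measurable M"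
  using measurable_compose[OF measurable_Pair G_measurable] by simp

lemma G_outside: "open D \<Longrightarrow> x \<notin> D \<or> y \<notin> D \<Longrightarrow> G D x y = 0"
  using green by (auto simp: green_kernel_def)

text \<open>From a starting point inside \<open>D\<close> it makes no difference that
  \<open>exit_time\<close> counts positive times only.\<close>

lemma AE_exit_time:
  assumes D: "open D" "x \<in> D"
  shows "AE w in law X (Some x). exit_time X D w = exit_at D w"
  using path0[of "Some x"] AE_Om bad_exit_null[OF D(1)]
proof eventually_elim
  case (elim w)
  have "{t. 0 < t \<and> path X t w \<notin> Some ` D} = {t. path X t w \<notin> Some ` D}"
  proof (intro Collect_cong iffI)
    fix t assume "path X t w \<notin> Some ` D"
    then have "t \<noteq> 0" using elim(1) D(2) by auto
    then show "0 < t \<and> path X t w \<notin> Some ` D" using \<open>path X t w \<notin> Some ` D\<close> by (simp add: zero_less_iff_neq_zero)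
  qed auto
  then show ?case using exit_Inf_eq[OF D(1) elim(2,3)] by (simp add: exit_time_def exit_Inf_def)
qed

lemma Gr_eq:
  assumes D: "open D" and g[measurable]: "g \<in> borel_measurable borel"
  shows "Gr D g x = (\<integral>\<^sup>+y. g y * G D x y \<partial>m)"
proof (cases "x \<in> D")
  case True
  have "Gr D g x = (\<E> (Some x) (\<lambda>w. (\<integral>\<^sup>+t\<in>{t. 0 \<le> t \<and> ennreal t < exit_time X D w}. ext0 g (path X (ennreal t) w) \<partial>lborel)))"
    unfolding GK_def green_fun_def
    by (rule nn_integral_cong_AE, rule eventually_mono[OF AE_exit_time[OF D True]]) (simp add: mult.commute)
  also have "\<dots> = (\<integral>\<^sup>+y\<in>D. g y * G D x y \<partial>m)"
    using green[OF D] True g by (auto simp: green_kernel_def)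
  also have "\<dots> = (\<integral>\<^sup>+y. g y * G D x y \<partial>m)"
    using G_outside[OF D] by (intro nn_integral_cong) (auto split: split_indicator)
  finally show ?thesis .
next
  case False
  then show ?thesis using G_outside[OF D] GK_outside[OF D] by simp
qed

lemma Gr_mono_AE:
  assumes D: "open D" and [measurable]: "g \<in> borel_measurable borel" "g' \<in> borel_measurable borel"
    and le: "AE y in m. y \<in> D \<longrightarrow> g y \<le> g' y"
  shows "Gr D g x \<le> Gr D g' x"
  unfolding Gr_eq[OF D assms(2)] Gr_eq[OF D assms(3)]
proof (rule nn_integral_mono_AE, use le in eventually_elim)
  fix y assume "y \<in> D \<longrightarrow> g y \<le> g' y"
  then show "g y * G D x y \<le> g' y * G D x y"
    using G_outside[OF D] by (cases "y \<in> D") (auto intro: mult_right_mono)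
qed

lemma Gr_tonelli:
  assumes D: "open D" and k[measurable]: "case_prod k \<in> borel_measurable (borel \<Otimes>\<^sub>M borel)"
  shows "Gr D (\<lambda>y. \<integral>\<^sup>+z. k y z \<partial>m) x = (\<integral>\<^sup>+z. Gr D (\<lambda>y. k y z) x \<partial>m)"
proof -
  note [measurable] = D
  have [measurable]: "(\<lambda>y. \<integral>\<^sup>+z. k y z \<partial>m) \<in> borel_measurable borel" by measurable
  have km[measurable]: "(\<lambda>y. k y z) \<in> borel_measurable borel" for z by measurable
  have [measurable]: "(\<lambda>p. G D x (fst p)) \<in> borel_measurable (m \<Otimes>\<^sub>M m)" "(\<lambda>p. G D x (snd p)) \<in> borel_measurable (m \<Otimes>\<^sub>M m)"
    "(\<lambda>y. G D x y) \<in> borel_measurable m"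
    using D by measurable
  have "Gr D (\<lambda>y. \<integral>\<^sup>+z. k y z \<partial>m) x = (\<integral>\<^sup>+y. (\<integral>\<^sup>+z. k y z \<partial>m) * G D x y \<partial>m)"
    by (rule Gr_eq[OF D]) measurable
  also have "\<dots> = (\<integral>\<^sup>+y. (\<integral>\<^sup>+z. k y z * G D x y \<partial>m) \<partial>m)"
    by (intro nn_integral_cong nn_integral_multc[symmetric]) measurable
  also have "\<dots> = (\<integral>\<^sup>+z. (\<integral>\<^sup>+y. k y z * G D x y \<partial>m) \<partial>m)"
    by (rule mm.Fubini') (simp add: case_prod_beta)
  also have "\<dots> = (\<integral>\<^sup>+z. Gr D (\<lambda>y. k y z) x \<partial>m)"
    by (intro nn_integral_cong Gr_eq[OF D, symmetric] km)
  finally show ?thesis .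
qed

definition jump :: "('a \<Rightarrow> ennreal) \<Rightarrow> 'a \<Rightarrow> ennreal" where
  "jump u y = (\<integral>\<^sup>+z. u z * ennreal (j y z) \<partial>m)"

lemma jump_measurable [measurable (raw)]: "u \<in> borel_measurable borel \<Longrightarrow> jump u \<in> borel_measurable borel"
proof -
  assume [measurable]: "u \<in> borel_measurable borel"
  show ?thesis unfolding jump_def[abs_def] by measurable
qed

lemma Gr_jump:
  assumes D: "open D" and u[measurable]: "u \<in> borel_measurable borel"
  shows "Gr D (jump u) x = (\<integral>\<^sup>+z. u z * Gr D (\<lambda>y. ennreal (j y z)) x \<partial>m)"
proof -
  have "Gr D (jump u) x = (\<integral>\<^sup>+z. Gr D (\<lambda>y. u z * ennreal (j y z)) x \<partial>m)"
    unfolding jump_def[abs_def] by (rule Gr_tonelli[OF D]) measurable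
  also have "\<dots> = (\<integral>\<^sup>+z. u z * Gr D (\<lambda>y. ennreal (j y z)) x \<partial>m)"
    by (intro nn_integral_cong GK_cmult) measurable
  finally show ?thesis .
qed

lemma Gr_j_measurable:
  assumes D: "open D" shows "(\<lambda>z. Gr D (\<lambda>y. ennreal (j y z)) x) \<in> borel_measurable borel"
proof -
  note [measurable] = D
  have [measurable]: "(\<lambda>p. G D x (snd p)) \<in> borel_measurable (borel \<Otimes>\<^sub>M m)" using D by measurable
  have "(\<lambda>z. \<integral>\<^sup>+y. ennreal (j y z) * G D x y \<partial>m) \<in> borel_measurable borel"
    by measurable
  moreover have "Gr D (\<lambda>y. ennreal (j y z)) x = (\<integral>\<^sup>+y. ennreal (j y z) * G D x y \<partial>m)" for z
    by (rule Gr_eq[OF D]) measurable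
  ultimately show ?thesis by simp
qed

lemma test_function_generates:
  assumes "f \<in> test_functions m \<D> K U"
  obtains g where "generates C_zero X f g"
  using assms \<D>_domain by (auto simp: test_functions_def generator_domain_def)

text \<open>\<open>V\<close> is an open neighbourhood of \<open>E\<close> that misses
  \<open>D\<close>, so \<open>E\<close> is entered only by a jump. On \<open>D\<close> the generator
  of a test function supported in \<open>V\<close> is the jump integral, and Dynkin's formula
  identifies the two measures on such functions, which determine them on \<open>E\<close>.\<close>

theorem levy_system:
  assumes D: "open D" and E: "closed E" "E \<subseteq> V" and V: "open V" "V \<inter> D = {}" and x: "x \<in> D"
    and u[measurable]: "u \<in> borel_measurable borel" and u0: "\<And>z. z \<notin> E \<Longrightarrow> u z = 0"
  shows "Hr D u x = Gr D (jump u) x"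
proof -
  let ?p = "\<lambda>w. path X (exit_at D w) w"
  define v where "v w = (indicator (Some ` V) (?p w) :: ennreal)" for w
  \<comment> \<open>The value \<open>x\<close> at the cemetery is a dummy; the weight
    \<open>v\<close> is 0 there.\<close>
  define \<phi> where "\<phi> w = case_option x (\<lambda>z. z) (?p w)" for w
  have Vm[measurable]: "V \<in> sets borel" and Em[measurable]: "E \<in> sets borel" using V E by auto
  have [measurable]: "Some ` V \<in> sets cemetery_borel" by (rule Some_image_sets[OF Vm])
  have [measurable]: "v \<in> borel_measurable (N top)" unfolding v_def by measurable
  have [measurable]: "\<phi> \<in> N top \<rightarrow>\<^sub>M borel"
    unfolding \<phi>_def by (rule measurable_compose[OF path_exit_at_measurable measurable_case_option_default])
  define M1 where "M1 = distr (density (law X (Some x)) v) borel \<phi>"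
  note [measurable] = Gr_j_measurable[OF D, of x]
  define M2 where "M2 = density m (\<lambda>z. indicator V z * Gr D (\<lambda>y. ennreal (j y z)) x)"
  have I1: "(\<integral>\<^sup>+z. h z \<partial>M1) = Hr D (\<lambda>z. indicator V z * h z) x" if [measurable]: "h \<in> borel_measurable borel" for h
  proof -
    have "(\<integral>\<^sup>+z. h z \<partial>M1) = (\<E> (Some x) (\<lambda>w. v w * h (\<phi> w)))"
      unfolding M1_def by (simp add: nn_integral_distr nn_integral_density)
    also have "\<dots> = Hr D (\<lambda>z. indicator V z * h z) x"
      unfolding HK_def
    proof (rule nn_integral_cong)
      fix w show "v w * h (\<phi> w) = exit_fun (\<lambda>_. 0) D (\<lambda>z. indicator V z * h z) w"
        by (cases "?p w") (auto simp: v_def \<phi>_def exit_fun_def split: split_indicator)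
    qed
    finally show ?thesis .
  qed
  have I2: "(\<integral>\<^sup>+z. h z \<partial>M2) = Gr D (jump (\<lambda>z. indicator V z * h z)) x" if [measurable]: "h \<in> borel_measurable borel" for h
    unfolding M2_def by (simp add: nn_integral_density Gr_jump[OF D] mult_ac)
  have eq: "emeasure M1 (B \<inter> E) = emeasure M2 (B \<inter> E)" if "B \<in> sets borel" for B
  proof (rule measure_eq_by_test_functions[OF _ _ _ V(1) E _ that])
    show "sets M1 = sets borel" "sets M2 = sets borel" by (auto simp: M1_def M2_def sets_m)
    have "emeasure M1 UNIV = (\<integral>\<^sup>+z. 1 \<partial>M1)" by (simp add: M1_def)
    also have "\<dots> \<le> 1" unfolding I1[OF borel_measurable_const] by (rule HK_le_const[OF D]) (auto split: split_indicator)
    finally show "emeasure M1 UNIV < top" by (rule le_less_trans) simp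
    fix K U :: "'a set" assume K: "compact K" "open U" "K \<subseteq> U" "U \<subseteq> V"
    then obtain f where f: "f \<in> test_functions m \<D> K U" using \<D>_tests by blast
    then obtain g where gen: "generates C_zero X f g" by (rule test_function_generates)
    have fm[measurable]: "f \<in> borel_measurable borel" using gen_bounded(1)[OF gen] by (rule bounded_borel_measurable)
    have f1: "\<forall>z\<in>K. f z = 1" "\<And>z. z \<notin> U \<Longrightarrow> f z = 0" "\<And>z. 0 \<le> f z" "\<And>z. f z \<le> 1"
      using f by (auto simp: test_functions_def)
    have fV: "f z = 0" if "z \<in> D" for z using f1(2)[of z] that K V by blast
    have nc: "z \<notin> closure {z. f z \<noteq> 0}" if "z \<in> D" for z
    proof -
      have "{z. f z \<noteq> 0} \<subseteq> - D" using fV by auto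
      then have "closure {z. f z \<noteq> 0} \<subseteq> - D" using D by (intro closure_minimal) auto
      then show ?thesis using that by auto
    qed
    have g: "ennreal (g z) = jump (\<lambda>z. ennreal (f z)) z" "0 \<le> g z" if "z \<in> D" for z
      using generator_levy_eq[OF gen levy nc[OF that] f1(3)] by (auto simp: jump_def nn_integral_density mult.commute)
    have Vf: "(\<lambda>z. indicator V z * ennreal (f z)) = (\<lambda>z. ennreal (f z))"
    proof
      fix z show "indicator V z * ennreal (f z) = ennreal (f z)" using f1(2)[OF contra_subsetD[OF K(4)], of z] by (cases "z \<in> V") auto
    qed
    have "Hr D (\<lambda>z. ennreal (f z)) x = Gr D (\<lambda>z. ennreal (g z)) x"
      by (rule dynkin_vanishing[OF gen f1(3) D]) (use fV g x in auto)
    also have "\<dots> = Gr D (jump (\<lambda>z. ennreal (f z))) x" by (rule GK_cong[OF D]) (rule g)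
    finally have "(\<integral>\<^sup>+z. ennreal (f z) \<partial>M1) = (\<integral>\<^sup>+z. ennreal (f z) \<partial>M2)" by (simp add: I1 I2 Vf)
    then show "\<exists>\<phi>. \<phi> \<in> borel_measurable borel \<and> (\<forall>z\<in>K. \<phi> z = (1::real)) \<and> (\<forall>z. z \<notin> U \<longrightarrow> \<phi> z = 0) \<and>
      (\<forall>z. 0 \<le> \<phi> z \<and> \<phi> z \<le> 1) \<and> (\<integral>\<^sup>+z. ennreal (\<phi> z) \<partial>M1) = (\<integral>\<^sup>+z. ennreal (\<phi> z) \<partial>M2)"
      using f1 fm by (intro exI[of _ f]) auto
  qed
  have s: "sets M1 = sets borel" "sets M2 = sets borel" by (auto simp: M1_def M2_def sets_m)
  have "density M1 (indicator E) = density M2 (indicator E)"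
  proof (rule measure_eqI)
    fix B assume "B \<in> sets (density M1 (indicator E))"
    then have "B \<in> sets borel" using s by simp
    have dens: "emeasure (density M (indicator E)) B = emeasure M (B \<inter> E)" if "sets M = sets borel" for M
    proof -
      have BE: "B \<in> sets M" "E \<in> sets M" using \<open>B \<in> sets borel\<close> Em that by auto
      then have "emeasure (density M (indicator E)) B = (\<integral>\<^sup>+z. indicator E z * indicator B z \<partial>M)"
        by (subst emeasure_density) auto
      also have "\<dots> = (\<integral>\<^sup>+z. indicator (B \<inter> E) z \<partial>M)" by (intro nn_integral_cong) (auto split: split_indicator)
      finally show ?thesis using BE by simp
    qed
    show "emeasure (density M1 (indicator E)) B = emeasure (density M2 (indicator E)) B"
      unfolding dens[OF s(1)] dens[OF s(2)] by (rule eq) fact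
  qed (simp add: s)
  then have "(\<integral>\<^sup>+z. u z \<partial>density M1 (indicator E)) = (\<integral>\<^sup>+z. u z \<partial>density M2 (indicator E))" by simp
  then have "(\<integral>\<^sup>+z. indicator E z * u z \<partial>M1) = (\<integral>\<^sup>+z. indicator E z * u z \<partial>M2)"
    using s u Em by (simp add: nn_integral_density measurable_cong_sets[OF s(1) refl] measurable_cong_sets[OF s(2) refl])
  moreover have "(\<lambda>z. indicator E z * u z) = u" "(\<lambda>z. indicator V z * u z) = u"
    using u0 E(2) by (auto simp: fun_eq_iff split: split_indicator)
  ultimately show ?thesis by (simp add: I1 I2)
qed

end

lemma ennreal_le_divideI:
  assumes "ennreal b * x \<le> ennreal a" "0 < b" "0 \<le> a" shows "x \<le> ennreal (a / b)"
proof (cases x)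
  case (real t)
  then have "b * t \<le> a" using assms by (simp add: ennreal_mult[symmetric])
  then show ?thesis using real assms by (auto intro!: ennreal_leI simp: field_simps)
next
  case top
  then show ?thesis using assms by (simp add: ennreal_mult_top top_unique)
qed

context jump_hunt
begin

text \<open>The generator of a test function supported away from \<open>D\<close> is positive on \<open>D\<close> because all jumps
  are possible, it is continuous, and its potential is at most one by Dynkin's formula.\<close>

theorem green_bounded:
  assumes K: "compact K" and D: "open D" and r: "0 < r" and DB: "D \<inter> ball z0 r = {}"
  obtains C where "0 \<le> C" "\<And>y. Gr D (indicator K) y \<le> ennreal C"
proof -
  have "cball z0 (r / 4) \<subseteq> ball z0 (r / 2)" using r by auto
  then obtain f where f: "f \<in> test_functions m \<D> (cball z0 (r / 4)) (ball z0 (r / 2))"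
    using \<D>_tests[OF compact_cball open_ball] by blast
  then obtain g where gen: "generates C_zero X f g" by (rule test_function_generates)
  have f1: "f z = 1" if "z \<in> ball z0 (r / 4)" for z using f that by (auto simp: test_functions_def)
  have f0: "f z = 0" if "z \<notin> ball z0 (r / 2)" for z using f that by (auto simp: test_functions_def)
  have f01: "0 \<le> f z" "f z \<le> 1" for z using f by (auto simp: test_functions_def)
  note [measurable] = gen_ennreal_measurable[OF gen f01(1)]
  have D_far: "r \<le> dist z0 y" if "y \<in> D" for y
  proof (rule ccontr)
    assume "\<not> r \<le> dist z0 y"
    then have "y \<in> ball z0 r" by simp
    then show False using that DB by blast
  qed
  have g: "0 < g y" if y: "r \<le> dist z0 y" for y
  proof -
    have "{z. f z \<noteq> 0} \<subseteq> cball z0 (r / 2)"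
    proof
      fix z assume "z \<in> {z. f z \<noteq> 0}"
      then have "z \<in> ball z0 (r / 2)" using f0 by blast
      then show "z \<in> cball z0 (r / 2)" by simp
    qed
    then have "closure {z. f z \<noteq> 0} \<subseteq> cball z0 (r / 2)" by (rule closure_minimal) simp
    moreover have "y \<notin> cball z0 (r / 2)" using y r by simp
    ultimately have "y \<notin> closure {z. f z \<noteq> 0}" by blast
    from generator_levy_eq(1)[OF gen levy this f01(1)]
    have eq: "ennreal (g y) = (\<integral>\<^sup>+z. ennreal (j y z) * ennreal (f z) \<partial>m)" by (simp add: nn_integral_density)
    show ?thesis
    proof (rule ccontr)
      assume "\<not> 0 < g y"
      then have "(\<integral>\<^sup>+z. ennreal (j y z) * ennreal (f z) \<partial>m) = 0" using eq by (simp add: ennreal_neg)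
      then have "AE z in m. ennreal (j y z) * ennreal (f z) = 0" by (subst (asm) nn_integral_0_iff_AE) auto
      then have "AE z in m. z \<notin> ball z0 (r / 4)"
      proof eventually_elim
        case (elim z)
        show ?case
        proof
          assume z: "z \<in> ball z0 (r / 4)"
          then have "y \<noteq> z" using y r by auto
          then show False using elim j_pos[of y z] f1[OF z] by simp
        qed
      qed
      then have "emeasure m (ball z0 (r / 4)) = 0" by (subst (asm) AE_iff_measurable[of "ball z0 (r / 4)"]) (auto simp: sets_m)
      moreover have "ball z0 (r / 4) \<noteq> {}" using r by simp
      then have "0 < emeasure m (ball z0 (r / 4))" using full_support by (simp add: full_support_def)
      ultimately show False by simp
    qed
  qed
  \<comment> \<open>\<open>K \<inter> D\<close> need not be compact. The minimum of g is taken over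
    the compact set of points of \<open>K\<close> at distance at least r, which contains it; if that
    set is empty, any q works.\<close>
  obtain q where q: "0 < q" "\<And>y. y \<in> K \<inter> D \<Longrightarrow> q \<le> g y"
  proof (cases "K \<inter> {z. r \<le> dist z0 z} = {}")
    case True
    then show ?thesis using D_far by (intro that[of 1]) auto
  next
    case False
    have "compact (K \<inter> {z. r \<le> dist z0 z})"
      by (intro compact_Int_closed[OF K] closed_Collect_le continuous_intros)
    moreover have "continuous_on (K \<inter> {z. r \<le> dist z0 z}) g"
      using gen_C_zero(2)[OF gen] by (auto simp: C_zero_def intro: continuous_on_subset)
    ultimately obtain y0 where "y0 \<in> K \<inter> {z. r \<le> dist z0 z}" "\<And>y. y \<in> K \<inter> {z. r \<le> dist z0 z} \<Longrightarrow> g y0 \<le> g y"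
      using continuous_attains_inf[OF _ False] by blast
    then show ?thesis using g D_far by (intro that[of "g y0"]) auto
  qed
  have Km[measurable]: "K \<in> sets borel" using K by (rule borel_compact)
  have "Gr D (indicator K) y \<le> ennreal (1 / q)" for y
  proof (cases "y \<in> D")
    case True
    have fD: "f z = 0" if "z \<in> D" for z using D_far[OF that] r by (intro f0) simp
    have "ennreal q * Gr D (indicator K) y = Gr D (\<lambda>z. ennreal q * indicator K z) y"
      by (rule GK_cmult[symmetric]) auto
    also have "\<dots> \<le> Gr D (\<lambda>z. ennreal (g z)) y"
    proof (rule GK_mono[OF D])
      fix z assume "z \<in> D"
      then show "ennreal q * indicator K z \<le> ennreal (g z)" using q(2)[of z] by (cases "z \<in> K") (auto intro: ennreal_leI)
    qed
    also have "\<dots> = Hr D (\<lambda>z. ennreal (f z)) y"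
      by (rule dynkin_vanishing[OF gen f01(1) D, symmetric]) (use fD g D_far True in \<open>auto intro: less_imp_le\<close>)
    also have "\<dots> \<le> ennreal 1" by (rule HK_le_const[OF D]) (use f01 in \<open>auto intro: ennreal_leI\<close>)
    finally show ?thesis using q by (intro ennreal_le_divideI) auto
  qed (simp add: GK_outside[OF D])
  then show ?thesis using q by (intro that[of "1 / q"]) auto
qed

end

section \<open>Irregular boundary points\<close>

definition decay :: "ennreal \<Rightarrow> ennreal" where
  "decay a = (if a = top then 0 else ennreal (exp (- enn2real a)))"

lemma decay_measurable [measurable]: "decay \<in> borel_measurable borel"
  unfolding decay_def[abs_def] by measurable

lemma decay_le_1: "decay a \<le> 1"
  by (simp add: decay_def ennreal_le_1)

lemma decay_antimono: "a \<le> b \<Longrightarrow> decay b \<le> decay a"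
  unfolding decay_def by (auto simp: top_unique top.not_eq_extremum intro!: ennreal_leI enn2real_mono)

lemma decay_add:
  assumes "0 \<le> t" shows "decay (ennreal t + a) = ennreal (exp (- t)) * decay a"
proof (cases a)
  case (real r)
  then have "ennreal t + a = ennreal (t + r)" using assms by simp
  then show ?thesis using real assms by (simp add: decay_def ennreal_mult[symmetric] exp_add[symmetric] del: ennreal_plus)
qed (simp add: decay_def)

lemma decay_eq_1: "decay a = 1 \<Longrightarrow> a = 0"
  by (cases a) (auto simp: decay_def)

context hunt
begin

lemma shift_measurable [measurable]: "shift X (ennreal t) \<in> N top \<rightarrow>\<^sub>M N top"
  using shifted_measurable[of "\<lambda>_. ennreal t"] by (simp add: shifted_def[abs_def])

text \<open>The first time, from t on, outside \<open>D\<close>. Off \<open>D\<close> the functional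
  \<open>exit_at\<close> is always 0 and says nothing about regularity; the behaviour of this one as
  t tends to 0 does.\<close>

definition exit_after :: "'a set \<Rightarrow> real \<Rightarrow> 'w \<Rightarrow> ennreal" where
  "exit_after D t w = ennreal t + exit_at D (shift X (ennreal t) w)"

lemma exit_after_measurable [measurable]: "exit_after D t \<in> borel_measurable (N top)"
  unfolding exit_after_def[abs_def] by measurable

lemma exit_after_stopping:
  assumes t: "0 \<le> t" shows "stopping_time F (exit_after D t)"
proof -
  let ?\<rho> = "\<lambda>n w. ennreal t + near_exit D n (shift X (ennreal t) w)"
  have st: "stopping_time F (?\<rho> n)" for n
  proof (rule stopping_timeI_less)
    fix u
    let ?Q = "{q::rat. ennreal t + ennreal (of_rat q) < u}"
    have "{w\<in>Om X. ?\<rho> n w < u} = (\<Union>q\<in>?Q.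
        {w\<in>space (N u). ext0 (dist_compl D) (path X (ennreal t + ennreal (of_rat q)) w) < 1 / real (Suc n)})"
    proof (intro set_eqI)
      fix w
      show "w \<in> {w\<in>Om X. ?\<rho> n w < u} \<longleftrightarrow> w \<in> (\<Union>q\<in>?Q.
        {w\<in>space (N u). ext0 (dist_compl D) (path X (ennreal t + ennreal (of_rat q)) w) < 1 / real (Suc n)})"
      proof (cases "w \<in> Om X")
        case True
        have iff: "ennreal t + a < u \<longleftrightarrow> a < u - ennreal t" for a
          using less_diff_eq_ennreal[of u "ennreal t" a] by (simp add: add.commute)
        have "path X (ennreal (of_rat q)) (shift X (ennreal t) w) = path X (ennreal t + ennreal (of_rat q)) w" for q
          using path_shift[OF True] by simp
        moreover have "shift X (ennreal t) w \<in> Om X" using shift_Om[OF True] by simp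
        ultimately have "?\<rho> n w < u \<longleftrightarrow> (\<exists>q::rat. ennreal t + ennreal (of_rat q) < u \<and>
            ext0 (dist_compl D) (path X (ennreal t + ennreal (of_rat q)) w) < 1 / real (Suc n))"
          unfolding iff by (simp add: near_exit_less_iff)
        then show ?thesis using True by auto
      qed auto
    qed
    also have "\<dots> \<in> sets (N u)"
    proof (rule sets.countable_UN'')
      fix q :: rat assume "q \<in> ?Q"
      then have "path X (ennreal t + ennreal (of_rat q)) \<in> N u \<rightarrow>\<^sub>M cemetery_borel"
        by (intro path_measurable) auto
      then show "{w\<in>space (N u). ext0 (dist_compl D) (path X (ennreal t + ennreal (of_rat q)) w) < 1 / real (Suc n)} \<in> sets (N u)"
        using measurable_ext0[OF dist_compl_measurable, of D] by measurable
    qed auto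
    finally show "{w\<in>Om X. ?\<rho> n w < u} \<in> sets (N u)" .
  qed
  have SUP: "exit_after D t w = (SUP n. ?\<rho> n w)" for w
    unfolding exit_after_def exit_at_def by (rule ennreal_SUP_add_right) simp
  show ?thesis
  proof (rule stopping_timeI)
    fix u show "Measurable.pred (F u) (\<lambda>w. exit_after D t w \<le> u)"
      unfolding SUP SUP_le_iff using stopping_timeD[OF st, of _ u] by (auto intro!: pred_intros_countable)
  qed
qed

lemma exit_after_le:
  assumes "open D" "w \<in> Om X" "ennreal t \<le> u" "path X u w \<notin> Some ` D"
  shows "exit_after D t w \<le> u"
proof -
  have u: "ennreal t + (u - ennreal t) = u" using assms(3) by (simp add: add_diff_inverse_ennreal)
  have "path X (u - ennreal t) (shift X (ennreal t) w) = path X u w"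
    using path_shift[OF assms(2), of "ennreal t" "u - ennreal t"] u by simp
  then have "exit_at D (shift X (ennreal t) w) \<le> u - ennreal t" using assms by (intro exit_at_le) auto
  then have "exit_after D t w \<le> ennreal t + (u - ennreal t)" unfolding exit_after_def by (rule add_left_mono)
  then show ?thesis unfolding u .
qed

lemma AE_path_exit_after:
  assumes D: "open D"
  shows "AE w in law X y. path X (exit_after D t w) w \<notin> Some ` D"
  using AE_exit_at_shift[OF D stopping_time_const, of "ennreal t" y]
proof eventually_elim
  case (elim w)
  then have "path X (exit_at D (shift X (ennreal t) w)) (shift X (ennreal t) w) \<notin> Some ` D"
    by (intro path_exit_at) auto
  then show ?case using path_shift elim by (simp add: exit_after_def)
qed

text \<open>As t decreases to 0, these values increase to the Laplace transform at 1 of the first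
  exit at a positive time. A boundary point where they come arbitrarily close to 1 is
  regular.\<close>

definition exit_laplace :: "'a set \<Rightarrow> real \<Rightarrow> 'a \<Rightarrow> ennreal" where
  "exit_laplace D t y = (\<E> (Some y) (\<lambda>w. decay (exit_after D t w)))"

end

lemma nearly_borel_closed: "closed C \<Longrightarrow> nearly_borel X C"
  by (auto simp: nearly_borel_def intro!: exI[of _ C] bexI[of _ C])

context conservative_hunt
begin

text \<open>From the cemetery \<open>exit_after D t\<close> is t, so its decay is not 0 as
  \<open>strong_markov_ext0\<close> requires. The factor testing that the path is alive at time 0
  repairs this and is almost surely 1, the process being conservative.\<close>

lemma exit_laplace_eq:
  assumes D: "open D" and t: "0 \<le> t" and Y: "Y \<in> borel_measurable (Fpre \<sigma>)" and \<sigma>: "stopping_time F \<sigma>"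
  shows "(\<E> (Some x) (\<lambda>w. Y w * (indicator {w. \<sigma> w < top} w * decay (exit_after D t (shift X (\<sigma> w) w))))) =
     (\<E> (Some x) (\<lambda>w. Y w * ext0 (exit_laplace D t) (path X (\<sigma> w) w)))"
proof -
  define Z where "Z w = ext0 (\<lambda>_. 1) (path X 0 w) * decay (exit_after D t w)" for w
  note [measurable] = measurable_ext0[of "\<lambda>_::'a. 1::ennreal"]
  have Z: "Z \<in> borel_measurable (N top)" unfolding Z_def by measurable
  have "(\<E> None (\<lambda>w. Z w)) = (\<E> None (\<lambda>w. 0))"
    by (intro nn_integral_cong_AE eventually_mono[OF AE_law_None]) (simp add: Z_def)
  then have Z0: "(\<E> None (\<lambda>w. Z w)) = 0" by simp
  have ZS: "(\<E> (Some y) (\<lambda>w. Z w)) = exit_laplace D t y" for y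
    unfolding exit_laplace_def by (intro nn_integral_cong_AE eventually_mono[OF path0[of "Some y"]]) (simp add: Z_def)
  have "(\<E> (Some x) (\<lambda>w. Y w * (indicator {w. \<sigma> w < top} w * decay (exit_after D t (shift X (\<sigma> w) w))))) =
    (\<E> (Some x) (\<lambda>w. Y w * (indicator {w. \<sigma> w < top} w * Z (shift X (\<sigma> w) w))))"
  proof (intro nn_integral_cong_AE eventually_mono[OF AE_conservative[of x]])
    fix w assume w: "w \<in> Om X \<and> (\<forall>t<top. path X t w \<noteq> None)"
    have "Z (shift X (\<sigma> w) w) = decay (exit_after D t (shift X (\<sigma> w) w))" if "\<sigma> w < top"
      using that w path_shift[of w "\<sigma> w" 0] unfolding Z_def by auto
    then show "Y w * (indicator {w. \<sigma> w < top} w * decay (exit_after D t (shift X (\<sigma> w) w))) =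
      Y w * (indicator {w. \<sigma> w < top} w * Z (shift X (\<sigma> w) w))"
      by (cases "\<sigma> w < top") auto
  qed
  also note strong_markov_ext0[OF \<sigma> Y Z Z0]
  finally show ?thesis unfolding ZS .
qed

text \<open>By the Markov property at t the function is exp(-t) times P t of the bounded function
  \<open>exit_laplace D 0\<close>; since t > 0, the strong Feller property applies.\<close>

lemma exit_laplace_continuous:
  assumes sf: "strong_feller X" and D: "open D" and t: "0 < t"
  obtains h where "continuous_on UNIV h" "\<And>y. exit_laplace D t y = ennreal (h y)"
proof -
  define e where "e z = enn2real (exit_laplace D 0 z)" for z
  have "(\<lambda>y. \<integral>\<^sup>+w. decay (exit_after D 0 w) \<partial>law X y) \<in> borel_measurable cemetery_borel"
    by (rule measurable_expectation) measurable
  from measurable_compose[OF measurable_Some this]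
  have m[measurable]: "exit_laplace D 0 \<in> borel_measurable borel" by (simp add: exit_laplace_def[abs_def])
  have le: "exit_laplace D 0 z \<le> 1" for z
  proof -
    have "exit_laplace D 0 z \<le> (\<E> (Some z) (\<lambda>w. 1))"
      unfolding exit_laplace_def by (intro nn_integral_mono decay_le_1)
    then show ?thesis using prob_space.emeasure_space_1[OF prob_law[of "Some z"]] by simp
  qed
  have ee: "exit_laplace D 0 z = ennreal (e z)" for z
    using le[of z] by (cases "exit_laplace D 0 z") (auto simp: e_def top_unique)
  have e0: "0 \<le> e z" and e1: "e z \<le> 1" for z
    using le[of z] by (auto simp: e_def intro: enn2real_leI)
  have em: "e \<in> borel_measurable borel" unfolding e_def by measurable
  have be: "bounded_borel e" unfolding bounded_borel_def using em e0 e1 by (intro conjI exI[of _ 1]) auto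
  have c: "stopping_time F (\<lambda>_. ennreal t)" by (rule stopping_time_const)
  have "exit_laplace D t y = ennreal (exp (- t) * P t e y)" for y
  proof -
    have "exit_laplace D t y = (\<E> (Some y) (\<lambda>w. ennreal (exp (- t)) * (1 * (indicator {w::'w. ennreal t < top} w * decay (exit_after D 0 (shift X (ennreal t) w))))))"
      unfolding exit_laplace_def
    proof (rule nn_integral_cong_AE, rule eventually_mono[OF AE_Om])
      fix w assume w: "w \<in> Om X"
      have "shift X (ennreal t) w \<in> Om X" by (rule shift_Om[OF w]) simp
      have "exit_at D (shift X 0 (shift X (ennreal t) w)) = exit_at D (shift X (ennreal t) w)"
        unfolding exit_at_def near_exit_def using path_shift[OF \<open>shift X (ennreal t) w \<in> Om X\<close>, of 0] by simp
      then show "decay (exit_after D t w) = ennreal (exp (- t)) * (1 * (indicator {w::'w. ennreal t < top} w * decay (exit_after D 0 (shift X (ennreal t) w))))"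
        using decay_add[of t] t by (simp add: exit_after_def)
    qed
    also have "\<dots> = ennreal (exp (- t)) * (\<E> (Some y) (\<lambda>w. 1 * (indicator {w::'w. ennreal t < top} w * decay (exit_after D 0 (shift X (ennreal t) w)))))"
      by (rule nn_integral_cmult) simp
    also have "(\<E> (Some y) (\<lambda>w. 1 * (indicator {w::'w. ennreal t < top} w * decay (exit_after D 0 (shift X (ennreal t) w))))) =
       (\<E> (Some y) (\<lambda>w. 1 * ext0 (exit_laplace D 0) (path X (ennreal t) w)))"
      by (rule exit_laplace_eq[OF D order_refl _ c]) simp
    also have "exit_laplace D 0 = (\<lambda>z. ennreal (e z))" using ee by auto
    finally show ?thesis using nn_P[OF be e0] P_nonneg[of e t y, OF e0] by (simp add: ennreal_mult)
  qed
  moreover have "bounded (range e)" by (rule boundedI[of _ 1]) (use e0 e1 in auto)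
  then have "continuous_on UNIV (P t e)" using sf em t by (auto simp: strong_feller_def)
  then have "continuous_on UNIV (\<lambda>y. exp (- t) * P t e y)" by (intro continuous_intros)
  ultimately show ?thesis by (intro that)
qed

text \<open>Let \<open>A\<close> be the event that \<open>C\<close> is hit immediately and \<open>\<sigma>\<^sub>n\<close> the first visit to \<open>C\<close> after time
  \<open>1/(n+1)\<close>. On \<open>A\<close> the path visits \<open>C\<close>, and hence leaves \<open>D\<close>, again and again shortly after \<open>\<sigma>\<^sub>n\<close>; the
  strong Markov property at \<open>\<sigma>\<^sub>n\<close> and Fatou's lemma give \<open>P(A) \<le> q P(A)\<close>.\<close>

lemma thin_exit_laplace:
  assumes D: "open D" and C: "closed C" "C \<inter> D = {}" and q: "0 \<le> q" "q < 1"
    and le: "\<And>y n. y \<in> C \<Longrightarrow> exit_laplace D (1 / real (Suc n)) y \<le> ennreal q"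
  shows "thin X C"
  unfolding thin_def
proof (intro exI[of _ C] conjI allI)
  show "nearly_borel X C" by (rule nearly_borel_closed[OF C(1)])
  fix x
  let ?M = "law X (Some x)"
  define s where "s n = 1 / real (Suc n)" for n :: nat
  have s: "0 < s n" "0 \<le> s n" for n by (auto simp: s_def)
  have s_mono: "s j \<le> s i" if "i \<le> j" for i j using that by (simp add: s_def frac_le)
  have s_small: "\<exists>n. ennreal (s n) < e" if "0 < e" for e :: ennreal
  proof -
    have "(\<lambda>n. ennreal (s n)) \<longlonglongrightarrow> ennreal 0" unfolding s_def
      by (intro tendsto_ennrealI) (rule LIMSEQ_inverse_real_of_nat[unfolded inverse_eq_divide])
    then have "\<forall>\<^sub>F n in sequentially. ennreal (s n) < e" using that by (intro order_tendstoD(2)[of _ "ennreal 0"]) auto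
    then show ?thesis by (auto simp: eventually_sequentially)
  qed
  \<comment> \<open>Leaving the open complement of \<open>C\<close> means visiting \<open>C\<close>
    or dying, and death in finite time has probability 0.\<close>
  define \<sigma> where "\<sigma> n = exit_after (- C) (s n)" for n
  have oC: "open (- C)" using C by auto
  have \<sigma>: "stopping_time F (\<sigma> n)" for n unfolding \<sigma>_def by (rule exit_after_stopping[OF s(2)])
  have \<sigma>_ge: "ennreal (s n) \<le> \<sigma> n w" for n w by (simp add: \<sigma>_def exit_after_def)
  define T where "T w = (INF n. \<sigma> n w)" for w
  have "stopping_time F T"
  proof (rule stopping_timeI_less)
    fix t
    have "{w\<in>Om X. T w < t} = (\<Union>n. {w\<in>space (N t). \<sigma> n w < t})" by (auto simp: T_def Inf_less_iff)
    also have "\<dots> \<in> sets (N t)"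
    proof (rule sets.countable_UN)
      have "{w\<in>space (N t). \<sigma> n w < t} \<in> sets (N t)" for n
      proof -
        have "{w\<in>space (N t). \<sigma> n w < t} = (\<Union>q\<in>{q::rat. ennreal (of_rat q) < t}. {w\<in>space (N t). \<sigma> n w \<le> ennreal (of_rat q)})"
        proof (intro equalityI subsetI)
          fix w assume "w \<in> {w\<in>space (N t). \<sigma> n w < t}"
          then obtain q where "\<sigma> n w < ennreal (of_rat q)" "ennreal (of_rat q) < t" "w \<in> space (N t)"
            using ennreal_rat_between by blast
          then show "w \<in> (\<Union>q\<in>{q::rat. ennreal (of_rat q) < t}. {w\<in>space (N t). \<sigma> n w \<le> ennreal (of_rat q)})"
            by (auto intro: less_imp_le)
        qed (auto intro: le_less_trans)
        also have "\<dots> \<in> sets (N t)"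
        proof (rule sets.countable_UN'')
          fix q :: rat assume q: "q \<in> {q. ennreal (of_rat q) < t}"
          have "Measurable.pred (F (ennreal (of_rat q))) (\<lambda>w. \<sigma> n w \<le> ennreal (of_rat q))"
            using stopping_timeD[OF \<sigma>] .
          from measurable_FD[OF this, of t]
          show "{w\<in>space (N t). \<sigma> n w \<le> ennreal (of_rat q)} \<in> sets (N t)" using q by (simp add: pred_def)
        qed auto
        finally show ?thesis .
      qed
      then show "range (\<lambda>n. {w\<in>space (N t). \<sigma> n w < t}) \<subseteq> sets (N t)" by blast
    qed
    finally show "{w\<in>Om X. T w < t} \<in> sets (N t)" .
  qed
  define A where "A = {w\<in>Om X. T w \<le> 0}"
  \<comment> \<open>The event lies in the germ field at time 0 because the filtration is
    right-continuous. It therefore belongs to the past of every \<sigma> n, where the strong Markov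
    property will be used.\<close>
  have A0: "A \<in> sets (F 0)" using stopping_timeD[OF \<open>stopping_time F T\<close>, of 0] by (simp add: A_def pred_def)
  have AF: "A \<in> sets (F t)" for t
    using A0 filtration.sets_F_mono[OF filtration_F, of 0 t] by auto
  have AP: "A \<in> sets (Fpre (\<sigma> n))" for n
  proof -
    have "{w\<in>A. \<sigma> n w \<le> t} \<in> sets (F t)" for t
    proof -
      have "{w\<in>A. \<sigma> n w \<le> t} = A \<inter> {w\<in>space (F t). \<sigma> n w \<le> t}" by (auto simp: A_def)
      then show ?thesis using AF[of t] stopping_timeD[OF \<sigma>, of n t] by (simp add: pred_def)
    qed
    then show ?thesis by (simp add: filtration.sets_pre_sigma[OF filtration_F \<sigma>])
  qed
  have AN[measurable]: "A \<in> sets (N top)" using AP[of 0] Fpre_sub[OF \<sigma>, of 0] by auto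
  define u where "u n j w = indicator A w * (indicator {w. \<sigma> n w < top} w * decay (exit_after D (s j) (shift X (\<sigma> n w) w)))" for n j w
  have um: "u n j \<in> borel_measurable (N top)" for n j
  proof -
    note [measurable] = stopping_measurable[OF \<sigma>] shifted_measurable[OF stopping_measurable[OF \<sigma>]]
    have "u n j = (\<lambda>w. indicator A w * (indicator {w. \<sigma> n w < top} w * decay (exit_after D (s j) (shifted (\<sigma> n) w))))"
      by (auto simp: u_def shifted_def fun_eq_iff split: split_indicator)
    also have "\<dots> \<in> borel_measurable (N top)" unfolding indicator_def mem_Collect_eq by measurable
    finally show ?thesis .
  qed
  have good: "AE w in ?M. w \<in> Om X \<and> (\<forall>t<top. path X t w \<noteq> None) \<and> (\<forall>n. path X (\<sigma> n w) w \<notin> Some ` (- C))"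
  proof -
    have "AE w in ?M. \<forall>n. path X (\<sigma> n w) w \<notin> Some ` (- C)"
      unfolding AE_all_countable \<sigma>_def using AE_path_exit_after[OF oC] by blast
    with AE_conservative[of x] show ?thesis by eventually_elim auto
  qed
  have int_u: "(\<integral>\<^sup>+w. u n j w \<partial>?M) \<le> ennreal q * emeasure ?M A" for n j
  proof -
    have "(\<integral>\<^sup>+w. u n j w \<partial>?M) = (\<integral>\<^sup>+w. indicator A w * ext0 (exit_laplace D (s j)) (path X (\<sigma> n w) w) \<partial>?M)"
      unfolding u_def by (rule exit_laplace_eq[OF D s(2) _ \<sigma>]) (use AP in simp)
    also have "\<dots> \<le> (\<integral>\<^sup>+w. ennreal q * indicator A w \<partial>?M)"
    proof (rule nn_integral_mono_AE, rule eventually_mono[OF good])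
      fix w assume w: "w \<in> Om X \<and> (\<forall>t<top. path X t w \<noteq> None) \<and> (\<forall>n. path X (\<sigma> n w) w \<notin> Some ` (- C))"
      have "ext0 (exit_laplace D (s j)) (path X (\<sigma> n w) w) \<le> ennreal q"
      proof (cases "path X (\<sigma> n w) w")
        case (Some z)
        have "path X (\<sigma> n w) w \<notin> Some ` (- C)" using w by blast
        then have "z \<in> C" using Some by auto
        then show ?thesis using le[of z j] Some by (simp add: s_def)
      qed simp
      then show "indicator A w * ext0 (exit_laplace D (s j)) (path X (\<sigma> n w) w) \<le> ennreal q * indicator A w"
        by (auto split: split_indicator)
    qed
    also have "\<dots> = ennreal q * emeasure ?M A" by (subst nn_integral_cmult_indicator) (auto simp: sets_law)
    finally show ?thesis .
  qed
  \<comment> \<open>Fix a visit time \<sigma> i. For large n the visit \<sigma> n is earlier, and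
    for large j the waiting time s j fits in between, so at \<sigma> i the shifted path is outside
    \<open>D\<close> and its decay is at least that of \<sigma> i. On \<open>A\<close> the times
    \<sigma> i come arbitrarily close to 0.\<close>
  have lim: "1 \<le> liminf (\<lambda>n. liminf (\<lambda>j. u n j w))" (is "1 \<le> ?L")
    if w: "w \<in> Om X" "\<forall>t<top. path X t w \<noteq> None" "\<forall>n. path X (\<sigma> n w) w \<notin> Some ` (- C)" and A: "w \<in> A" for w
  proof -
    have "T w = 0" using A by (simp add: A_def)
    have \<sigma>_small: "\<exists>n. \<sigma> n w < e" if "0 < e" for e
      using that \<open>T w = 0\<close> unfolding T_def by (metis INF_less_iff UNIV_I)
    have \<sigma>_dec: "\<sigma> j w \<le> \<sigma> i w" if "i \<le> j" for i j
      unfolding \<sigma>_def[of j]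
    proof (rule exit_after_le[OF oC w(1)])
      show "ennreal (s j) \<le> \<sigma> i w" using s_mono[OF that] \<sigma>_ge[of i w] by (meson ennreal_leI order_trans)
    qed (use w(3) in blast)
    have bound: "decay (\<sigma> i w) \<le> ?L" if fin: "\<sigma> i w < top" for i
    proof (rule Liminf_bounded)
      have "0 < ennreal (s i)" using s(1)[of i] by simp
      then have "0 < \<sigma> i w" using \<sigma>_ge[of i w] by (rule less_le_trans)
      then obtain n0 where n0: "\<sigma> n0 w < \<sigma> i w" using \<sigma>_small by blast
      show "\<forall>\<^sub>F n in sequentially. decay (\<sigma> i w) \<le> liminf (\<lambda>j. u n j w)"
        unfolding eventually_sequentially
      proof (intro exI[of _ n0] allI impI)
        fix n assume "n0 \<le> n"
        then have lt: "\<sigma> n w < \<sigma> i w" using \<sigma>_dec[of n0 n] n0 by auto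
        then have fn: "\<sigma> n w < top" using fin by auto
        have "0 < \<sigma> i w - \<sigma> n w" using lt by (simp add: diff_gr0_ennreal)
        then obtain j0 where j0: "ennreal (s j0) < \<sigma> i w - \<sigma> n w" using s_small by blast
        show "decay (\<sigma> i w) \<le> liminf (\<lambda>j. u n j w)"
        proof (rule Liminf_bounded, unfold eventually_sequentially, intro exI[of _ j0] allI impI)
          fix j assume "j0 \<le> j"
          then have sj: "ennreal (s j) \<le> \<sigma> i w - \<sigma> n w" using j0 s_mono[of j0 j] by (meson ennreal_leI le_less_trans less_imp_le)
          have add: "\<sigma> n w + (\<sigma> i w - \<sigma> n w) = \<sigma> i w" using lt by (simp add: add_diff_inverse_ennreal)
          have "path X (\<sigma> i w - \<sigma> n w) (shift X (\<sigma> n w) w) = path X (\<sigma> i w) w"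
            using path_shift[OF w(1) fn, of "\<sigma> i w - \<sigma> n w"] add by simp
          moreover have "path X (\<sigma> i w) w \<notin> Some ` D"
            using w(2,3) fin C(2) by (metis ComplI IntI empty_iff imageE image_eqI option.exhaust)
          ultimately have "exit_after D (s j) (shift X (\<sigma> n w) w) \<le> \<sigma> i w - \<sigma> n w"
            by (intro exit_after_le[OF D shift_Om[OF w(1) fn] sj]) simp
          also have "\<dots> \<le> \<sigma> i w" by (rule diff_le_self_ennreal)
          finally have "decay (\<sigma> i w) \<le> decay (exit_after D (s j) (shift X (\<sigma> n w) w))" by (rule decay_antimono)
          then show "decay (\<sigma> i w) \<le> u n j w" using A fn by (simp add: u_def)
        qed
      qed
    qed
    have "ennreal (exp (- s k)) \<le> ?L" for k
    proof -
      obtain i where i: "\<sigma> i w < ennreal (s k)" using \<sigma>_small[of "ennreal (s k)"] s(1)[of k] by (auto)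
      have "ennreal (exp (- s k)) = decay (ennreal (s k))" using s(2)[of k] by (simp add: decay_def)
      also have "\<dots> \<le> decay (\<sigma> i w)" using i by (intro decay_antimono less_imp_le)
      also have "\<dots> \<le> ?L" using i by (intro bound) (auto intro: less_trans)
      finally show ?thesis .
    qed
    moreover have "(\<lambda>k. ennreal (exp (- s k))) \<longlonglongrightarrow> ennreal (exp (- 0))"
      unfolding s_def by (intro tendsto_ennrealI tendsto_exp tendsto_minus) (rule LIMSEQ_inverse_real_of_nat[unfolded inverse_eq_divide])
    ultimately show ?thesis by (intro LIMSEQ_le_const2[of "\<lambda>k. ennreal (exp (- s k))"]) auto
  qed
  have "emeasure ?M A = (\<integral>\<^sup>+w. indicator A w \<partial>?M)" by (simp add: sets_law)
  also have "\<dots> \<le> (\<integral>\<^sup>+w. liminf (\<lambda>n. liminf (\<lambda>j. u n j w)) \<partial>?M)"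
    by (intro nn_integral_mono_AE eventually_mono[OF good]) (use lim in \<open>auto split: split_indicator\<close>)
  also have "\<dots> \<le> liminf (\<lambda>n. \<integral>\<^sup>+w. liminf (\<lambda>j. u n j w) \<partial>?M)"
    by (rule nn_integral_liminf) (use um in simp)
  also have "\<dots> \<le> liminf (\<lambda>n. liminf (\<lambda>j. \<integral>\<^sup>+w. u n j w \<partial>?M))"
    by (intro Liminf_mono always_eventually allI nn_integral_liminf) (use um in simp)
  also have "\<dots> \<le> liminf (\<lambda>n::nat. liminf (\<lambda>j::nat. ennreal q * emeasure ?M A))"
    by (intro Liminf_mono always_eventually allI int_u)
  also have "\<dots> = ennreal q * emeasure ?M A" by (simp add: Liminf_const)
  finally have lt: "emeasure ?M A \<le> ennreal q * emeasure ?M A" .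
  have "emeasure ?M A \<le> 1" by (rule prob_space.emeasure_le_1[OF prob_law])
  then obtain a where a: "emeasure ?M A = ennreal a" "0 \<le> a" by (cases "emeasure ?M A") (auto simp: top_unique)
  have "a \<le> q * a" using lt a q by (simp add: ennreal_mult[symmetric])
  then have "a = 0" using a q by (metis (no_types) less_le mult_le_cancel_right1 not_le)
  then have "AE w in ?M. w \<notin> A" using a AN by (intro AE_not_in) (auto simp: null_sets_def sets_law)
  with AE_Om show "AE w in ?M. 0 < hitting_time X C w"
  proof eventually_elim
    case (elim w)
    have "T w \<le> hitting_time X C w"
      unfolding hitting_time_def
    proof (rule Inf_greatest)
      fix t assume "t \<in> {t. 0 < t \<and> path X t w \<in> Some ` C}"
      then have t: "0 < t" "path X t w \<notin> Some ` (- C)" by auto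
      obtain n where n: "ennreal (s n) < t" using s_small[OF t(1)] by blast
      have "T w \<le> \<sigma> n w" unfolding T_def by (rule INF_lower) simp
      also have "\<dots> \<le> t" unfolding \<sigma>_def by (rule exit_after_le[OF oC elim(1)]) (use n t in auto)
      finally show "T w \<le> t" .
    qed
    moreover have "0 < T w" using elim by (simp add: A_def zero_less_iff_neq_zero)
    ultimately show ?case by order
  qed
qed simp

text \<open>The points off \<open>D\<close> where all values of \<open>exit_laplace\<close> stay
  below 1 - 1/(k+1) form a closed thin set. The union over k contains every irregular boundary
  point; it is semi-polar, hence polar, and is not hit at positive times.\<close>

theorem AE_exit_regular:
  assumes sf: "strong_feller X" and polar: "\<And>A. semipolar X A \<Longrightarrow> polar X A" and D: "open D" and x: "x \<in> D"
  shows "AE w in law X (Some x). \<forall>z. path X (exit_at D w) w = Some z \<longrightarrow> z \<in> frontier D \<longrightarrow> z \<in> regular_boundary X D"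
proof -
  define s where "s n = 1 / real (Suc n)" for n :: nat
  have s: "0 < s n" "s n \<le> 1" for n by (auto simp: s_def)
  define A where "A k = {y\<in>- D. \<forall>n. exit_laplace D (s n) y \<le> ennreal (1 - s k)}" for k
  have "thin X (A k)" for k
  proof (rule thin_exit_laplace[OF D])
    have "closed {y. exit_laplace D (s n) y \<le> ennreal (1 - s k)}" for n
    proof -
      obtain h where "continuous_on UNIV h" "\<And>y. exit_laplace D (s n) y = ennreal (h y)"
        using exit_laplace_continuous[OF sf D s(1)] by blast
      then show ?thesis by (auto intro!: closed_Collect_le continuous_on_ennreal)
    qed
    then have "closed (- D \<inter> (\<Inter>n. {y. exit_laplace D (s n) y \<le> ennreal (1 - s k)}))" using D by auto
    also have "- D \<inter> (\<Inter>n. {y. exit_laplace D (s n) y \<le> ennreal (1 - s k)}) = A k" by (auto simp: A_def)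
    finally show "closed (A k)" .
    show "1 - s k < 1" "0 \<le> 1 - s k" using s[of k] by auto
    show "exit_laplace D (1 / real (Suc n)) y \<le> ennreal (1 - s k)" if "y \<in> A k" for y n
      using that by (auto simp: A_def s_def)
  qed (auto simp: A_def)
  then have "semipolar X (\<Union>k. A k)" by (auto simp: semipolar_def intro!: exI[of _ A])
  from polar[OF this] obtain B where B: "(\<Union>k. A k) \<subseteq> B" "AE w in law X (Some x). hitting_time X B w = top"
    by (auto simp: polar_def)
  have irreg: "z \<in> (\<Union>k. A k)" if z: "z \<in> frontier D" "z \<notin> regular_boundary X D" for z
  proof (rule ccontr)
    assume "z \<notin> (\<Union>k. A k)"
    moreover have "z \<notin> D" using z(1) D by (simp add: frontier_def interior_open)
    ultimately have "\<exists>n. ennreal (1 - s k) < exit_laplace D (s n) z" for k by (auto simp: A_def not_le)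
    then obtain n where n: "ennreal (1 - s k) < exit_laplace D (s (n k)) z" for k by metis
    define \<tau> where "\<tau> w = (INF n. exit_after D (s n) w)" for w
    have [measurable]: "\<tau> \<in> borel_measurable (N top)" unfolding \<tau>_def by measurable
    interpret prob_space "law X (Some z)" by (rule prob_law)
    have lower: "ennreal (1 - s k) \<le> (\<E> (Some z) (\<lambda>w. decay (\<tau> w)))" for k
    proof -
      have "exit_laplace D (s (n k)) z \<le> (\<E> (Some z) (\<lambda>w. decay (\<tau> w)))"
        unfolding exit_laplace_def \<tau>_def by (intro nn_integral_mono decay_antimono INF_lower) simp
      then show ?thesis using n[of k] by order
    qed
    have "(\<lambda>k. ennreal (1 - s k)) \<longlonglongrightarrow> ennreal (1 - 0)"
      unfolding s_def by (intro tendsto_ennrealI tendsto_diff tendsto_const) (rule LIMSEQ_inverse_real_of_nat[unfolded inverse_eq_divide])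
    then have "ennreal (1 - 0) \<le> (\<E> (Some z) (\<lambda>w. decay (\<tau> w)))"
      using lower by (intro LIMSEQ_le_const2[of "\<lambda>k. ennreal (1 - s k)"]) auto
    then have ge: "1 \<le> (\<E> (Some z) (\<lambda>w. decay (\<tau> w)))" by simp
    have "AE w in law X (Some z). 1 - decay (\<tau> w) = 0"
    proof -
      have le: "(\<E> (Some z) (\<lambda>w. decay (\<tau> w))) \<le> (\<E> (Some z) (\<lambda>w. 1))" by (intro nn_integral_mono decay_le_1)
      then have fin: "(\<E> (Some z) (\<lambda>w. decay (\<tau> w))) \<noteq> \<infinity>" by (auto simp: top_unique emeasure_space_1)
      have "(\<E> (Some z) (\<lambda>w. 1 - decay (\<tau> w))) = (\<E> (Some z) (\<lambda>w. 1)) - (\<E> (Some z) (\<lambda>w. decay (\<tau> w)))"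
        using fin by (intro nn_integral_diff) (auto simp: decay_le_1)
      also have "\<dots> = 0"
        using ge emeasure_space_1 by (intro diff_eq_0_ennreal) (auto simp del: space_law)
      finally show ?thesis by (subst (asm) nn_integral_0_iff_AE) auto
    qed
    moreover have "AE w in law X (Some z). \<forall>n. path X (exit_after D (s n) w) w \<notin> Some ` D"
      unfolding AE_all_countable using AE_path_exit_after[OF D] by blast
    ultimately have "AE w in law X (Some z). exit_time X D w = 0"
    proof eventually_elim
      case (elim w)
      have "decay (\<tau> w) = 1" using elim(1) decay_le_1[of "\<tau> w"] by (metis antisym diff_gr0_ennreal not_le less_irrefl)
      then have "\<tau> w = 0" by (rule decay_eq_1)
      have "exit_time X D w \<le> \<tau> w"
        unfolding \<tau>_def
      proof (rule INF_greatest)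
        fix n
        have "0 < exit_after D (s n) w" using s(1)[of n] by (simp add: exit_after_def add_pos_nonneg)
        then show "exit_time X D w \<le> exit_after D (s n) w"
          unfolding exit_time_def by (intro Inf_lower) (use elim(2) in auto)
      qed
      then show ?case using \<open>\<tau> w = 0\<close> by simp
    qed
    then show False using z by (auto simp: regular_boundary_def)
  qed
  show ?thesis
    using B(2) path0[of "Some x"] AE_exit[OF D, of "Some x"]
  proof eventually_elim
    case (elim w)
    show ?case
    proof (intro allI impI, rule ccontr)
      fix z assume z: "path X (exit_at D w) w = Some z" "z \<in> frontier D" "z \<notin> regular_boundary X D"
      have "z \<in> B" using irreg[OF z(2,3)] B(1) by auto
      \<comment> \<open>\<open>hitting_time\<close> counts positive times only, so the exit must be
        shown to be positive; it is, since the path starts inside \<open>D\<close>.\<close>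
      have "exit_at D w \<noteq> 0" using elim x by auto
      then have "hitting_time X B w \<le> exit_at D w"
        unfolding hitting_time_def using z(1) \<open>z \<in> B\<close> by (intro Inf_lower) (auto simp: zero_less_iff_neq_zero)
      then have "exit_at D w = top" using elim(1) by (simp add: top_unique)
      then show False using z(1) path_infty[of w] elim(3) by simp
    qed
  qed
qed

end

section \<open>Strong killing, killed Levy system and barriers\<close>

lemma ennreal_add_cancel_right:
  fixes a b c :: ennreal assumes "c < top" "a + c = b + c" shows "a = b"
  using assms ennreal_add_left_cancel_le[of c a b] ennreal_add_left_cancel_le[of c b a]
  by (auto simp: add.commute)

context hunt
begin

lemma GK_zero: "GK \<psi> D (\<lambda>_. 0) x = 0"
proof -
  have "ext0 (\<lambda>_. 0) y = (0::ennreal)" for y :: "'a option" by (cases y) auto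
  then show ?thesis by (simp add: GK_def green_fun_def)
qed

text \<open>By right-continuity the path spends some time t > 0 in \<open>U\<close>, so the weight
  is at most exp(-b t n). The unkilled exit functional dominates.\<close>

lemma HK_vanish:
  assumes D: "open D" and U: "open U" "z \<in> U" and z: "z \<in> D"
    and \<psi>: "\<And>n. rate (\<psi> n)" and b: "0 < b" and big: "\<And>n y. y \<in> U \<Longrightarrow> ennreal (b * real n) \<le> \<psi> n y"
    and h[measurable]: "h \<in> borel_measurable borel" and fin: "Hr D h z < top"
  shows "(\<lambda>n. HK (\<psi> n) D h z) \<longlonglongrightarrow> 0"
proof -
  note [measurable] = rate_measurable[OF \<psi>]
  have "(\<lambda>n. \<integral>\<^sup>+w. exit_fun (\<psi> n) D h w \<partial>law X (Some z)) \<longlonglongrightarrow> (\<E> (Some z) (\<lambda>w. 0))"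
  proof (rule nn_integral_dominated_convergence[where w = "exit_fun (\<lambda>_. 0) D h"])
    show "(\<E> (Some z) (\<lambda>w. exit_fun (\<lambda>_. 0) D h w)) < \<infinity>" using fin by (simp add: HK_def)
    show "AE w in law X (Some z). exit_fun (\<psi> n) D h w \<le> exit_fun (\<lambda>_. 0) D h w" for n
      using mult_right_mono[OF ennreal_fk_le_1] by (auto simp: exit_fun_def)
    have finA: "AE w in law X (Some z). exit_fun (\<lambda>_. 0) D h w \<noteq> \<infinity>"
      using fin by (intro nn_integral_PInf_AE) (auto simp: HK_def)
    show "AE w in law X (Some z). (\<lambda>n. exit_fun (\<psi> n) D h w) \<longlonglongrightarrow> 0"
      using finA path0[of "Some z"] AE_exit[OF D, of "Some z"] AE_exit[OF U(1), of "Some z"]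
    proof eventually_elim
      case (elim w)
      show ?case
      proof (cases "exit_at D w = top")
        case True
        then have "path X (exit_at D w) w = None" using path_infty[of w] elim by simp
        then show ?thesis by (simp add: exit_fun_def)
      next
        case False
        then obtain s where s: "exit_at D w = ennreal s" "0 \<le> s" by (cases "exit_at D w") auto
        have "exit_at D w \<noteq> 0" "exit_at U w \<noteq> 0" using elim z U by auto
        then obtain t where t: "0 < t" "ennreal t \<le> exit_at U w" "t \<le> s"
        proof (cases "exit_at U w")
          case (real r)
          then show ?thesis using that[of "min r s"] \<open>exit_at D w \<noteq> 0\<close> \<open>exit_at U w \<noteq> 0\<close> s
            by (auto simp: min_def not_le intro!: ennreal_leI)
        next
          case top
          then show ?thesis using that[of s] \<open>exit_at D w \<noteq> 0\<close> s by (cases "s = 0") auto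
        qed
        have le: "fk (\<psi> n) s w \<le> exp (- (b * t * real n))" for n
        proof -
          have "ennreal (b * real n * t) = (\<integral>\<^sup>+r. ennreal (b * real n) * indicator {0..<t} r \<partial>lborel)"
            using t(1) b by (subst nn_integral_cmult_indicator) (auto simp: ennreal_mult)
          also have "\<dots> \<le> addf (\<psi> n) s w"
            unfolding addf_def
          proof (rule nn_integral_mono)
            fix r :: real
            show "ennreal (b * real n) * indicator {0..<t} r \<le> indicator {0..s} r * ext0 (\<psi> n) (path X (ennreal r) w)"
            proof (cases "r \<in> {0..<t}")
              case True
              then have "ennreal r < ennreal t" by (simp add: ennreal_less_iff)
              then have "ennreal r < exit_at U w" using t(2) by (rule less_le_trans)
              then obtain y where "path X (ennreal r) w = Some y" "y \<in> U" using path_before_exit[OF U(1)] by blast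
              then show ?thesis using True t(3) big[of y n] by auto
            qed simp
          qed
          finally have "enn2real (ennreal (b * real n * t)) \<le> enn2real (addf (\<psi> n) s w)"
            by (intro enn2real_mono addf_finite \<psi>)
          then show ?thesis using b t by (simp add: fk_def mult_ac)
        qed
        have lim0: "(\<lambda>n. exp (- (b * t * real n))) \<longlonglongrightarrow> 0"
          using b t by real_asymp
        have "(\<lambda>n. fk (\<psi> n) s w) \<longlonglongrightarrow> 0"
          by (rule tendsto_sandwich[OF _ _ tendsto_const lim0]) (use le in \<open>auto intro!: always_eventually less_imp_le[OF fk_pos]\<close>)
        then have "(\<lambda>n. ennreal (fk (\<psi> n) s w) * exit_fun (\<lambda>_. 0) D h w) \<longlonglongrightarrow> ennreal 0 * exit_fun (\<lambda>_. 0) D h w"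
          using elim(1) \<open>(\<lambda>n. fk (\<psi> n) s w) \<longlonglongrightarrow> 0\<close> by (intro tendsto_mult_ennreal tendsto_ennrealI tendsto_const) auto
        then show ?thesis using s by (simp add: exit_fun_def)
      qed
    qed
  qed (simp_all add: exit_fun_measurable rate_measurable[OF \<psi>])
  then show ?thesis by (simp add: HK_def)
qed

text \<open>The perturbation formulas for exit and Green operators have the same correction term,
  because the unkilled quantities agree on \<open>W\<close>. Boundedness of u and the finite
  expected exit time make that term finite, so it cancels.\<close>

lemma levy_system_killed:
  assumes W: "open W" and \<psi>: "rate \<psi>" and u: "u \<in> borel_measurable borel" and q: "q \<in> borel_measurable borel"
    and eq: "\<And>x. x \<in> W \<Longrightarrow> Hr W u x = Gr W q x"
    and fin: "Gr W (\<lambda>_. 1) x < top" and ub: "\<And>z. u z \<le> ennreal b" and x: "x \<in> W"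
  shows "HK \<psi> W u x = GK \<psi> W q x"
proof -
  obtain \<kappa> where \<kappa>: "0 \<le> \<kappa>" "\<And>z. \<psi> z \<le> ennreal \<kappa>" using \<psi> by (auto simp: rate_def)
  let ?M = "GK \<psi> W (\<lambda>z. \<psi> z * Hr W u z) x"
  have "?M \<le> GK \<psi> W (\<lambda>z. (ennreal \<kappa> * ennreal b) * 1) x"
  proof (rule GK_mono[OF W])
    fix z assume "z \<in> W"
    have "Hr W u z \<le> ennreal b" by (rule HK_le_const[OF W ub])
    then show "\<psi> z * Hr W u z \<le> (ennreal \<kappa> * ennreal b) * 1" using \<kappa>(2)[of z] by (simp add: mult_mono)
  qed
  also have "\<dots> = (ennreal \<kappa> * ennreal b) * GK \<psi> W (\<lambda>_. 1) x"
    using rate_measurable[OF \<psi>] by (intro GK_cmult) auto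
  also have "\<dots> \<le> (ennreal \<kappa> * ennreal b) * Gr W (\<lambda>_. 1) x" by (intro mult_left_mono GK_le_GK0) simp
  also have "\<dots> < top" using fin by (simp add: ennreal_mult_less_top)
  finally have M: "?M < top" .
  have "HK \<psi> W u x + ?M = Hr W u x" by (rule HK_perturb[OF W \<psi> u, symmetric])
  also have "\<dots> = Gr W q x" by (rule eq[OF x])
  also have "\<dots> = GK \<psi> W q x + GK \<psi> W (\<lambda>z. \<psi> z * Gr W q z) x" by (rule GK_perturb(1)[OF W \<psi> q])
  also have "GK \<psi> W (\<lambda>z. \<psi> z * Gr W q z) x = ?M" using eq by (intro GK_cong[OF W]) simp
  finally show ?thesis by (rule ennreal_add_cancel_right[OF M])
qed

end

context conservative_hunt
begin

lemma generator_nonpos_at_max: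
  assumes gen: "generates C_zero X f g" and f: "\<And>z. f z \<le> 1" "f y = 1"
  shows "g y \<le> 0"
proof (rule tendsto_upperbound[OF generates_tendsto[OF gen]])
  show "\<forall>\<^sub>F t in at_right 0. (P t f y - f y) / t \<le> 0"
    unfolding eventually_at_right_field
  proof (intro exI[of _ 1] conjI allI impI)
    fix t :: real assume t: "0 < t" "t < 1"
    note b = gen_bounded(1)[OF gen]
    have "0 \<le> P t (\<lambda>z. (-1) * f z + 1) y" using f by (intro P_nonneg) simp
    also have "\<dots> = P t (\<lambda>z. (-1) * f z) y + 1" using t b by (intro P_add_const bounded_borel_cmult) auto
    also have "\<dots> = 1 - P t f y" unfolding P_cmult by simp
    finally show "(P t f y - f y) / t \<le> 0" using t f by (simp add: divide_nonpos_pos)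
  qed simp
qed simp

text \<open>Applying the Feynman-Kac identities to the exact Dynkin formula gives
  \<open>v = H\<^sup>\<psi>v + K\<^sup>\<psi>(\<psi>v + g)\<close> for \<open>v = 1 - f + \<epsilon>\<close>, and \<open>\<psi>v + g \<ge> 2\<delta> - \<delta>\<close>.\<close>

lemma killed_supersolution:
  assumes gen: "generates C_zero X f g" and f: "\<And>z. 0 \<le> f z" "\<And>z. f z \<le> 1"
    and \<delta>: "0 \<le> \<delta>" "\<And>z. - g z \<le> \<delta>" and W: "open W" and fin: "\<And>x. Gr W (\<lambda>_. 1) x < top"
    and \<psi>: "rate \<psi>" and \<epsilon>: "0 \<le> \<epsilon>"
    and big: "\<And>z. z \<in> W \<Longrightarrow> ennreal (2 * \<delta>) \<le> \<psi> z * ennreal (1 - f z + \<epsilon>)"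
  shows "HK \<psi> W (\<lambda>z. ennreal (1 - f z + \<epsilon>)) x + ennreal \<delta> * GK \<psi> W (\<lambda>_. 1) x \<le> ennreal (1 - f x + \<epsilon>)"
proof -
  let ?G = "Gr W" and ?H = "Hr W" and ?K = "GK \<psi> W"
  let ?v = "\<lambda>z. ennreal (1 - f z + \<epsilon>)" and ?f = "\<lambda>z. ennreal (f z)"
  let ?p = "\<lambda>z. ennreal (- g z)" and ?q = "\<lambda>z. ennreal (g z)"
  note [measurable] = gen_ennreal_measurable[OF gen f(1)] rate_measurable[OF \<psi>]
  have [measurable]: "f \<in> borel_measurable borel" using gen_bounded(1)[OF gen] by (rule bounded_borel_measurable)
  obtain b where b: "\<And>z. \<bar>g z\<bar> \<le> b" using gen_bounded(2)[OF gen] by (auto simp: bounded_borel_def)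
  obtain \<kappa> where \<kappa>: "0 \<le> \<kappa>" "\<And>z. \<psi> z \<le> ennreal \<kappa>" using \<psi> by (auto simp: rate_def)
  have G_fin: "?G k y < top" if "\<And>z. k z \<le> ennreal c" for k c y
  proof -
    have "?G k y \<le> ?G (\<lambda>_. ennreal c * 1) y" using that by (intro GK_mono[OF W]) simp
    also have "\<dots> = ennreal c * ?G (\<lambda>_. 1) y" by (rule GK_cmult) auto
    also have "\<dots> < top" using fin[of y] by (simp add: ennreal_mult_less_top)
    finally show ?thesis .
  qed
  have pq: "?p z \<le> ennreal b" "?q z \<le> ennreal b" for z using b[of z] by (auto intro!: ennreal_leI)
  have v_f: "?v z + ?f z = ennreal (1 + \<epsilon>)" for z
    using f[of z] \<epsilon> by (subst ennreal_plus[symmetric]) auto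
  have Hc: "?H (\<lambda>_. ennreal (1 + \<epsilon>)) y = ennreal (1 + \<epsilon>)" for y
    using HK_cmult[of "\<lambda>_. 0" "\<lambda>_. 1" W "ennreal (1 + \<epsilon>)" y] HK_one[OF W fin[of y]] by simp
  have Hv_f: "?H ?v y + ?H ?f y = ennreal (1 + \<epsilon>)" for y
    using HK_add[of "\<lambda>_. 0" ?v ?f W y] by (simp only: v_f Hc) simp
  \<comment> \<open>v and f add up to the constant 1 + \<epsilon>, which the exit operator
    preserves. So Dynkin's equality for f becomes one for v with the positive and negative parts of
    g exchanged.\<close>
  have dynkin_v: "?v y + ?G ?p y = ?H ?v y + ?G ?q y" for y
  proof -
    have "?f y + ?G ?q y = ?G ?p y + ?H ?f y"
      using dynkin_le[OF gen f(1) W, of y] dynkin_ge[OF gen f(1) W G_fin[of ?f 1], of y] f(2)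
      by (intro antisym) (auto intro!: ennreal_leI simp: ennreal_le_1)
    then have "?v y + ?G ?p y + ?H ?f y = (?v y + ?f y) + ?G ?q y" by (simp add: ac_simps)
    also have "\<dots> = ?H ?v y + ?G ?q y + ?H ?f y" unfolding v_f Hv_f[of y, symmetric] by (simp add: ac_simps)
    finally show ?thesis
    proof (rule ennreal_add_cancel_right[rotated])
      have "?H ?f y \<le> 1" by (rule HK_le_const[OF W]) (simp add: f ennreal_le_1)
      then show "?H ?f y < top" by (rule le_less_trans) simp
    qed
  qed
  \<comment> \<open>\<open>?M\<close> is the killed potential of \<psi> times one side of
    \<open>dynkin_v\<close>, hence also of the other side. Added to both sides it lets the
    perturbation formulas replace the killed operators by the unkilled ones and back; being finite,
    it cancels afterwards.\<close>
  let ?M = "?K (\<lambda>z. \<psi> z * (?v z + ?G ?p z)) x"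
  have \<psi>_add: "?K (\<lambda>z. \<psi> z * (k z + l z)) x = ?K (\<lambda>z. \<psi> z * k z) x + ?K (\<lambda>z. \<psi> z * l z) x"
    if [measurable]: "k \<in> borel_measurable borel" "l \<in> borel_measurable borel" for k l
    unfolding distrib_left by (rule GK_add) auto
  have M_fin: "?M < top"
  proof -
    have K_fin: "?K (\<lambda>z. \<psi> z * k z) x < top" if "k \<in> borel_measurable borel" and fin: "?G k x < top" for k
    proof -
      have "?K (\<lambda>z. \<psi> z * k z) x \<le> ?K (\<lambda>z. ennreal \<kappa> * k z) x" using \<kappa> by (intro GK_mono[OF W] mult_right_mono) auto
      also have "\<dots> = ennreal \<kappa> * ?K k x" using that by (intro GK_cmult) auto
      also have "\<dots> \<le> ennreal \<kappa> * ?G k x" by (intro mult_left_mono GK_le_GK0) simp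
      also have "\<dots> < top" using fin by (simp add: ennreal_mult_less_top)
      finally show ?thesis .
    qed
    have "?K (\<lambda>z. \<psi> z * ?G ?p z) x \<le> ?G ?p x"
      using GK_perturb(1)[OF W \<psi>, of ?p x] by simp
    also have "\<dots> < top" by (rule G_fin[OF pq(1)])
    finally have 1: "?K (\<lambda>z. \<psi> z * ?G ?p z) x < top" .
    have 2: "?K (\<lambda>z. \<psi> z * ?v z) x < top"
    proof (rule K_fin)
      show "?G ?v x < top" by (rule G_fin[of _ "1 + \<epsilon>"]) (use f in \<open>auto intro!: ennreal_leI\<close>)
    qed measurable
    show ?thesis by (subst \<psi>_add) (use 1 2 in auto)
  qed
  have Kid: "?K (\<lambda>z. \<psi> z * (?v z + ?G ?p z)) x = ?K (\<lambda>z. \<psi> z * (?H ?v z + ?G ?q z)) x"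
    unfolding dynkin_v ..
  have "HK \<psi> W ?v x + ?K ?q x + ?K (\<lambda>z. \<psi> z * ?v z) x + ?M =
      (HK \<psi> W ?v x + ?K (\<lambda>z. \<psi> z * ?H ?v z) x) + (?K ?q x + ?K (\<lambda>z. \<psi> z * ?G ?q z) x) + ?K (\<lambda>z. \<psi> z * ?v z) x"
    unfolding Kid by (subst \<psi>_add) (auto simp: ac_simps)
  also have "\<dots> = ?H ?v x + ?G ?q x + ?K (\<lambda>z. \<psi> z * ?v z) x"
    using HK_perturb[OF W \<psi>, of ?v x] GK_perturb(1)[OF W \<psi>, of ?q x] by simp
  also have "\<dots> = ?v x + ?G ?p x + ?K (\<lambda>z. \<psi> z * ?v z) x" unfolding dynkin_v ..
  also have "\<dots> = ?v x + ?K ?p x + ?M"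
    by (subst \<psi>_add, simp, simp, subst GK_perturb(1)[OF W \<psi>, of ?p x]) (auto simp: ac_simps)
  finally have eq: "HK \<psi> W ?v x + ?K ?q x + ?K (\<lambda>z. \<psi> z * ?v z) x = ?v x + ?K ?p x"
    by (rule ennreal_add_cancel_right[OF M_fin])
  have low: "?K (\<lambda>_. ennreal (2 * \<delta>)) x \<le> ?K (\<lambda>z. \<psi> z * ?v z) x"
    by (rule GK_mono[OF W big])
  have two: "?K (\<lambda>_. ennreal (2 * \<delta>)) x = ennreal \<delta> * ?K (\<lambda>_. 1) x + ennreal \<delta> * ?K (\<lambda>_. 1) x"
  proof -
    have "?K (\<lambda>_. ennreal (2 * \<delta>) * 1) x = ennreal (2 * \<delta>) * ?K (\<lambda>_. 1) x" by (rule GK_cmult) auto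
    moreover have "ennreal (2 * \<delta>) = ennreal \<delta> + ennreal \<delta>" using \<delta>(1) by (simp flip: ennreal_plus)
    ultimately show ?thesis by (simp only: mult_1_right distrib_right)
  qed
  have up: "?K ?p x \<le> ennreal \<delta> * ?K (\<lambda>_. 1) x"
  proof -
    have "?K ?p x \<le> ?K (\<lambda>_. ennreal \<delta> * 1) x" using \<delta>(2) by (intro GK_mono[OF W]) (auto intro: ennreal_leI)
    also have "\<dots> = ennreal \<delta> * ?K (\<lambda>_. 1) x" by (rule GK_cmult) auto
    finally show ?thesis .
  qed
  have "HK \<psi> W ?v x + (ennreal \<delta> * ?K (\<lambda>_. 1) x + ennreal \<delta> * ?K (\<lambda>_. 1) x)
      \<le> HK \<psi> W ?v x + ?K ?q x + ?K (\<lambda>z. \<psi> z * ?v z) x"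
    using low unfolding two by (intro add_mono) auto
  also have "\<dots> \<le> ?v x + ennreal \<delta> * ?K (\<lambda>_. 1) x" unfolding eq using up by (rule add_left_mono)
  finally have "HK \<psi> W ?v x + (ennreal \<delta> * ?K (\<lambda>_. 1) x + ennreal \<delta> * ?K (\<lambda>_. 1) x) \<le> ?v x + ennreal \<delta> * ?K (\<lambda>_. 1) x" .
  then have "ennreal \<delta> * ?K (\<lambda>_. 1) x + (HK \<psi> W ?v x + ennreal \<delta> * ?K (\<lambda>_. 1) x) \<le> ennreal \<delta> * ?K (\<lambda>_. 1) x + ?v x"
    by (simp add: ac_simps)
  moreover have "ennreal \<delta> * ?K (\<lambda>_. 1) x \<noteq> \<infinity>"
    using le_less_trans[OF GK_le_GK0 fin[of x], of \<psi>] by (simp add: ennreal_mult_eq_top_iff)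
  ultimately show ?thesis unfolding ennreal_add_left_cancel_le by blast
qed

end

context jump_hunt
begin

text \<open>The Levy kernel axiom gives integrability of bounded continuous functions that vanish
  near x; the cutoff \<open>f\<close> is one that dominates the indicator.\<close>

lemma jump_far_finite:
  assumes \<rho>: "0 < \<rho>" shows "jump (indicator {z. \<rho> \<le> dist x z}) x < top"
proof -
  define f where "f z = min 1 (max 0 (2 * dist x z / \<rho> - 1))" for z
  have f: "0 \<le> f z" "f z \<le> 1" for z by (auto simp: f_def)
  have cf: "continuous_on UNIV f" unfolding f_def using \<rho> by (intro continuous_intros) auto
  have bf: "bounded (range f)" by (rule boundedI[of _ 1]) (use f in auto)
  have "{z. f z \<noteq> 0} \<subseteq> {z. \<rho> / 2 \<le> dist x z}"
  proof
    fix z assume "z \<in> {z. f z \<noteq> 0}"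
    then have "\<not> 2 * dist x z / \<rho> - 1 \<le> 0" by (auto simp: f_def)
    then show "z \<in> {z. \<rho> / 2 \<le> dist x z}" using \<rho> by (simp add: field_simps)
  qed
  then have "closure {z. f z \<noteq> 0} \<subseteq> {z. \<rho> / 2 \<le> dist x z}"
    by (intro closure_minimal closed_Collect_le continuous_intros) auto
  then have "x \<notin> closure {z. f z \<noteq> 0}" using \<rho> by auto
  then have int: "integrable (density m (\<lambda>y. ennreal (j x y))) f" using levy cf bf by (auto simp: levy_kernel_def)
  have [measurable]: "f \<in> borel_measurable borel" by (rule borel_measurable_continuous_onI[OF cf])
  have "jump (indicator {z. \<rho> \<le> dist x z}) x \<le> (\<integral>\<^sup>+z. ennreal (j x z) * ennreal (f z) \<partial>m)"
    unfolding jump_def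
  proof (rule nn_integral_mono)
    fix z
    have "f z = 1" if "\<rho> \<le> dist x z" using that \<rho> by (simp add: f_def field_simps)
    then show "indicator {z. \<rho> \<le> dist x z} z * ennreal (j x z) \<le> ennreal (j x z) * ennreal (f z)"
      by (auto split: split_indicator)
  qed
  also have "\<dots> = (\<integral>\<^sup>+z. ennreal (f z) \<partial>density m (\<lambda>y. ennreal (j x y)))" by (simp add: nn_integral_density)
  also have "\<dots> = (\<integral>\<^sup>+z. ennreal (norm (f z)) \<partial>density m (\<lambda>y. ennreal (j x y)))" using f by simp
  also have "\<dots> < top" using int unfolding integrable_iff_bounded by simp
  finally show ?thesis .
qed

text \<open>A harmonic function is \<open>\<alpha>\<close> times its \<open>\<alpha>\<close>-potential up to a term that vanishes as
  \<open>\<alpha> \<rightarrow> \<infinity>\<close>, and potentials do not see null sets.\<close>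

lemma harmonic_le_AE:
  assumes D: "open D" and h[measurable]: "h \<in> borel_measurable borel" and harm: "\<And>z. z \<in> D \<Longrightarrow> h z = Hr D h z"
    and w: "w \<in> D" "h w < top" and ae: "AE z in m. z \<in> D \<longrightarrow> h z \<le> \<kappa>"
  shows "h w \<le> \<kappa>"
proof -
  define \<psi> where "\<psi> n = (\<lambda>_::'a. ennreal (1 * real n))" for n :: nat
  have \<psi>: "rate (\<psi> n)" for n unfolding \<psi>_def by (rule rate_const) simp
  have "(\<lambda>n. HK (\<psi> n) D h w) \<longlonglongrightarrow> 0"
  proof (rule HK_vanish[OF D open_UNIV _ w(1) \<psi> zero_less_one _ h])
    show "Hr D h w < top" using harm[OF w(1)] w(2) by simp
  qed (auto simp: \<psi>_def)
  then have "(\<lambda>n. HK (\<psi> (Suc n)) D h w + \<kappa>) \<longlonglongrightarrow> 0 + \<kappa>"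
    by (intro tendsto_add tendsto_const) (rule LIMSEQ_Suc)
  moreover have "h w \<le> HK (\<psi> (Suc n)) D h w + \<kappa>" for n
  proof -
    let ?\<psi> = "\<psi> (Suc n)"
    have n: "0 < real (Suc n)" by simp
    note [measurable] = rate_measurable[OF \<psi>]
    \<comment> \<open>Infinite where the bound fails. Inside \<open>D\<close> this happens only on a
      null set, so its potential vanishes.\<close>
    let ?b = "\<lambda>z. top * indicator {z. \<kappa> < h z} z :: ennreal"
    have [measurable]: "?b \<in> borel_measurable borel" by measurable
    have "h w = HK ?\<psi> D h w + GK ?\<psi> D (\<lambda>z. ?\<psi> z * Hr D h z) w"
      using HK_perturb[OF D \<psi> h] harm[OF w(1)] by simp
    also have "GK ?\<psi> D (\<lambda>z. ?\<psi> z * Hr D h z) w \<le> GK ?\<psi> D (\<lambda>z. ennreal (real (Suc n)) * (\<kappa> * 1 + ?b z)) w"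
    proof (rule GK_mono[OF D])
      fix z assume "z \<in> D"
      then have "Hr D h z \<le> \<kappa> * 1 + ?b z" using harm[of z] by (cases "\<kappa> < h z") auto
      then show "?\<psi> z * Hr D h z \<le> ennreal (real (Suc n)) * (\<kappa> * 1 + ?b z)" by (simp add: \<psi>_def mult_left_mono)
    qed
    also have "\<dots> = ennreal (real (Suc n)) * (\<kappa> * GK ?\<psi> D (\<lambda>_. 1) w + GK ?\<psi> D ?b w)"
      by (subst GK_cmult, simp, simp, subst GK_add, simp, simp, simp, subst GK_cmult, simp, simp, simp)
    also have "GK ?\<psi> D ?b w = 0"
    proof -
      have "GK ?\<psi> D ?b w \<le> Gr D ?b w" by (rule GK_le_GK0)
      also have "\<dots> \<le> Gr D (\<lambda>_. 0) w"
        by (rule Gr_mono_AE[OF D]) (use ae in \<open>auto elim!: eventually_mono split: split_indicator\<close>)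
      finally show ?thesis by (simp add: GK_zero)
    qed
    also have "ennreal (real (Suc n)) * (\<kappa> * GK ?\<psi> D (\<lambda>_. 1) w + 0) \<le> \<kappa>"
    proof -
      have "GK ?\<psi> D (\<lambda>_. 1) w \<le> GK ?\<psi> UNIV (\<lambda>_. ennreal 1) w"
        using GK_strong_markov[OF open_UNIV D _ \<psi>[of "Suc n"], of "\<lambda>_. 1" w] by simp
      also have "\<dots> = ennreal (1 / real (Suc n))"
        unfolding \<psi>_def mult_1 by (rule GK_resolvent_const[OF n]) simp
      finally have "ennreal (real (Suc n)) * (\<kappa> * GK ?\<psi> D (\<lambda>_. 1) w) \<le> \<kappa> * (ennreal (real (Suc n)) * ennreal (1 / real (Suc n)))"
        by (simp add: mult_left_mono mult.left_commute)
      also have "ennreal (real (Suc n)) * ennreal (1 / real (Suc n)) = 1"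
        using n by (subst ennreal_mult[symmetric]) auto
      finally show ?thesis by simp
    qed
    finally show ?thesis by (simp add: add_left_mono)
  qed
  ultimately have "h w \<le> 0 + \<kappa>" by (intro LIMSEQ_le_const[of "\<lambda>n. HK (\<psi> (Suc n)) D h w + \<kappa>"]) auto
  then show ?thesis by simp
qed

end

section \<open>Duality\<close>

text \<open>On the part of \<open>S\<close> where g < f and f is at most n, both integrals are
  finite, so the difference f - g has integral 0 there. These parts exhaust the exceptional set
  because f is finite on \<open>S\<close>.\<close>

lemma AE_le_by_integrals:
  fixes f g :: "'a \<Rightarrow> ennreal"
  assumes [measurable]: "f \<in> borel_measurable M" "g \<in> borel_measurable M" "S \<in> sets M"
    and S: "emeasure M S < top" and fin: "\<And>x. x \<in> S \<Longrightarrow> f x < top"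
    and le: "\<And>A. A \<in> sets M \<Longrightarrow> A \<subseteq> S \<Longrightarrow> (\<integral>\<^sup>+x. indicator A x * f x \<partial>M) \<le> (\<integral>\<^sup>+x. indicator A x * g x \<partial>M)"
  shows "AE x in M. x \<in> S \<longrightarrow> f x \<le> g x"
proof -
  have "AE x in M. \<not> (x \<in> S \<and> g x < f x \<and> f x \<le> of_nat n)" for n :: nat
  proof -
    define A where "A = {x\<in>space M. x \<in> S \<and> g x < f x \<and> f x \<le> of_nat n}"
    have [measurable]: "A \<in> sets M" unfolding A_def by measurable
    have AS: "A \<subseteq> S" by (auto simp: A_def)
    have "(\<integral>\<^sup>+x. indicator A x * f x \<partial>M) \<le> (\<integral>\<^sup>+x. of_nat n * indicator A x \<partial>M)"
      by (intro nn_integral_mono) (auto simp: A_def split: split_indicator)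
    also have "\<dots> = of_nat n * emeasure M A" by (rule nn_integral_cmult_indicator) fact
    also have "\<dots> < top" using le_less_trans[OF emeasure_mono[OF AS] S] by (auto simp: ennreal_mult_less_top of_nat_less_top)
    finally have f1: "(\<integral>\<^sup>+x. indicator A x * f x \<partial>M) < top" .
    have "(\<integral>\<^sup>+x. indicator A x * g x \<partial>M) \<le> (\<integral>\<^sup>+x. indicator A x * f x \<partial>M)"
      by (intro nn_integral_mono) (auto simp: A_def split: split_indicator)
    then have "(\<integral>\<^sup>+x. indicator A x * f x - indicator A x * g x \<partial>M) = 0"
      using f1 le[OF \<open>A \<in> sets M\<close> AS]
      by (subst nn_integral_diff) (auto simp: A_def top_unique less_imp_le split: split_indicator intro!: diff_eq_0_ennreal AE_I2)
    then have "AE x in M. indicator A x * f x - indicator A x * g x = 0"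
      by (subst (asm) nn_integral_0_iff_AE) auto
    then show ?thesis
      using AE_space
    proof eventually_elim
      case (elim x)
      show ?case
      proof
        assume "x \<in> S \<and> g x < f x \<and> f x \<le> of_nat n"
        then have "x \<in> A" and pos: "0 < f x - g x" using elim(2) by (auto simp: A_def diff_gr0_ennreal)
        then have "f x - g x = 0" using elim(1) by simp
        with pos show False by (metis less_irrefl)
      qed
    qed
  qed
  then have "AE x in M. \<forall>n::nat. \<not> (x \<in> S \<and> g x < f x \<and> f x \<le> of_nat n)" unfolding AE_all_countable by blast
  then show ?thesis
  proof eventually_elim
    case (elim x)
    show ?case
    proof (intro impI, rule ccontr)
      assume x: "x \<in> S" "\<not> f x \<le> g x"
      obtain n :: nat where "f x < of_nat n" using ennreal_Ex_less_of_nat fin[OF x(1)] by blast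
      then have "x \<in> S \<and> g x < f x \<and> f x \<le> of_nat n" using x by (simp add: not_le less_imp_le)
      then show False using elim by blast
    qed
  qed
qed

locale dual_hunt = A: jump_hunt X m j \<D> G + B: jump_hunt X' m j' \<D> G'
  for X :: "('w, 'a::heine_borel) process" and X' :: "('v, 'a) process" and m :: "'a measure"
    and j j' :: "'a \<Rightarrow> 'a \<Rightarrow> real" and \<D> and G G' :: "'a set \<Rightarrow> 'a \<Rightarrow> 'a \<Rightarrow> ennreal" +
  assumes G_dual: "\<And>D x y. open D \<Longrightarrow> G D x y = G' D y x" and j_dual: "\<And>x y. x \<noteq> y \<Longrightarrow> j x y = j' y x"
begin

lemma green_duality:
  assumes D: "open D" and [measurable]: "p \<in> borel_measurable borel" "q \<in> borel_measurable borel"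
  shows "(\<integral>\<^sup>+x. p x * A.Gr D q x \<partial>m) = (\<integral>\<^sup>+y. q y * B.Gr D p y \<partial>m)"
proof -
  note [measurable] = D
  have [measurable]: "(\<lambda>z. G D (fst z) (snd z)) \<in> borel_measurable (m \<Otimes>\<^sub>M m)" "(\<lambda>z. G D x z) \<in> borel_measurable m"
    "(\<lambda>z. G D z x) \<in> borel_measurable m" for x
    using D by measurable
  have "(\<integral>\<^sup>+x. p x * A.Gr D q x \<partial>m) = (\<integral>\<^sup>+x. (\<integral>\<^sup>+y. p x * (q y * G D x y) \<partial>m) \<partial>m)"
    unfolding A.Gr_eq[OF D assms(3)] by (intro nn_integral_cong nn_integral_cmult[symmetric]) measurable
  also have "\<dots> = (\<integral>\<^sup>+y. (\<integral>\<^sup>+x. p x * (q y * G D x y) \<partial>m) \<partial>m)"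
    by (rule A.mm.Fubini'[symmetric]) (simp add: case_prod_beta)
  also have "\<dots> = (\<integral>\<^sup>+y. (\<integral>\<^sup>+x. q y * (p x * G' D y x) \<partial>m) \<partial>m)"
    by (intro nn_integral_cong) (simp add: G_dual[OF D, symmetric] mult.left_commute)
  also have "\<dots> = (\<integral>\<^sup>+y. q y * B.Gr D p y \<partial>m)"
    unfolding B.Gr_eq[OF D assms(2)]
    by (intro nn_integral_cong nn_integral_cmult) (simp add: G_dual[OF D, symmetric])
  finally show ?thesis .
qed

text \<open>Both Green operators are expanded by the second perturbation formula. Applying unkilled
  duality to the correction terms and expanding once more leaves the same symmetric expression in
  both killed potentials, so the corrections are equal; \<open>fin\<close> makes them finite, and
  they cancel.\<close>

lemma killed_duality:
  assumes D: "open D" and \<psi>: "rate \<psi>" and [measurable]: "p \<in> borel_measurable borel" "q \<in> borel_measurable borel"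
    and fin: "(\<integral>\<^sup>+y. q y * B.Gr D p y \<partial>m) < top"
  shows "(\<integral>\<^sup>+x. p x * A.GK \<psi> D q x \<partial>m) = (\<integral>\<^sup>+y. q y * B.GK \<psi> D p y \<partial>m)"
proof -
  note [measurable] = rate_measurable[OF \<psi>]
  let ?K = "A.GK \<psi> D q" and ?K' = "B.GK \<psi> D p"
  have split: "(\<integral>\<^sup>+x. a x * (b x + c x) \<partial>m) = (\<integral>\<^sup>+x. a x * b x \<partial>m) + (\<integral>\<^sup>+x. a x * c x \<partial>m)"
    if [measurable]: "a \<in> borel_measurable borel" "b \<in> borel_measurable borel" "c \<in> borel_measurable borel" for a b c :: "'a \<Rightarrow> ennreal"
    unfolding distrib_left by (rule nn_integral_add) auto
  note pA = A.GK_perturb(2)[OF D \<psi>, of q] and pB = B.GK_perturb(2)[OF D \<psi>, of p]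
  have 1: "(\<integral>\<^sup>+x. p x * A.Gr D q x \<partial>m) = (\<integral>\<^sup>+x. p x * ?K x \<partial>m) + (\<integral>\<^sup>+x. p x * A.Gr D (\<lambda>z. \<psi> z * ?K z) x \<partial>m)"
    unfolding pA[OF assms(4)] by (rule split) measurable
  have 2: "(\<integral>\<^sup>+x. q x * B.Gr D p x \<partial>m) = (\<integral>\<^sup>+x. q x * ?K' x \<partial>m) + (\<integral>\<^sup>+x. q x * B.Gr D (\<lambda>z. \<psi> z * ?K' z) x \<partial>m)"
    unfolding pB[OF assms(3)] by (rule split) measurable
  have "(\<integral>\<^sup>+x. p x * A.Gr D (\<lambda>z. \<psi> z * ?K z) x \<partial>m) = (\<integral>\<^sup>+x. (\<psi> x * ?K x) * B.Gr D p x \<partial>m)"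
    by (rule green_duality[OF D]) measurable
  also have "\<dots> = (\<integral>\<^sup>+x. (\<psi> x * ?K x) * ?K' x \<partial>m) + (\<integral>\<^sup>+x. (\<psi> x * ?K x) * B.Gr D (\<lambda>z. \<psi> z * ?K' z) x \<partial>m)"
    unfolding pB[OF assms(3)] by (rule split) measurable
  also have "(\<integral>\<^sup>+x. (\<psi> x * ?K x) * B.Gr D (\<lambda>z. \<psi> z * ?K' z) x \<partial>m) = (\<integral>\<^sup>+x. (\<psi> x * ?K' x) * A.Gr D (\<lambda>z. \<psi> z * ?K z) x \<partial>m)"
    by (rule green_duality[OF D, symmetric]) measurable
  also have "(\<integral>\<^sup>+x. (\<psi> x * ?K x) * ?K' x \<partial>m) = (\<integral>\<^sup>+x. (\<psi> x * ?K' x) * ?K x \<partial>m)"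
    by (intro nn_integral_cong) (simp add: ac_simps)
  also have "\<dots> + (\<integral>\<^sup>+x. (\<psi> x * ?K' x) * A.Gr D (\<lambda>z. \<psi> z * ?K z) x \<partial>m) = (\<integral>\<^sup>+x. (\<psi> x * ?K' x) * A.Gr D q x \<partial>m)"
    unfolding pA[OF assms(4)] by (rule split[symmetric]) measurable
  also have "\<dots> = (\<integral>\<^sup>+x. q x * B.Gr D (\<lambda>z. \<psi> z * ?K' z) x \<partial>m)"
    by (rule green_duality[OF D]) measurable
  finally have eq: "(\<integral>\<^sup>+x. p x * A.Gr D (\<lambda>z. \<psi> z * ?K z) x \<partial>m) = (\<integral>\<^sup>+x. q x * B.Gr D (\<lambda>z. \<psi> z * ?K' z) x \<partial>m)" .
  have "(\<integral>\<^sup>+x. q x * B.Gr D (\<lambda>z. \<psi> z * ?K' z) x \<partial>m) < top"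
    using fin unfolding 2 by (simp add: ennreal_add_eq_top less_top[symmetric])
  moreover have "(\<integral>\<^sup>+x. p x * ?K x \<partial>m) + (\<integral>\<^sup>+x. q x * B.Gr D (\<lambda>z. \<psi> z * ?K' z) x \<partial>m) =
      (\<integral>\<^sup>+x. q x * ?K' x \<partial>m) + (\<integral>\<^sup>+x. q x * B.Gr D (\<lambda>z. \<psi> z * ?K' z) x \<partial>m)"
    using green_duality[OF D assms(3,4)] unfolding 1 2 eq .
  ultimately show ?thesis by (rule ennreal_add_cancel_right)
qed

end

section \<open>Estimates at infinity\<close>

locale hunt_at_infinity = dual_hunt X X' m j j' \<D> G G'
  for X :: "('w, 'a::heine_borel) process" and X' :: "('v, 'a) process" and m :: "'a measure"
    and j j' :: "'a \<Rightarrow> 'a \<Rightarrow> real" and \<D> and G G' :: "'a set \<Rightarrow> 'a \<Rightarrow> 'a \<Rightarrow> ennreal" +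
  fixes \<Phi> :: "real \<Rightarrow> real" and z0 :: 'a and r0 :: real
  assumes r0: "0 < r0" and R0: "\<And>(x::'a) r::real. - ball x (2 * r) \<noteq> {}"
    and V1: "assumption_V1 m z0" and Phi: "assumption_Phi \<Phi>"
    and B2a: "assumption_B2a m X X' \<D> \<Phi> z0 r0" and B2b: "assumption_B2b m X X' \<D> j z0 r0"
    and C2: "assumption_C2 m j j' \<Phi> z0 r0" and D2: "assumption_D2 m G G' \<Phi> z0 r0"
begin

abbreviation U :: "real \<Rightarrow> 'a set" where "U s \<equiv> - closed_ball z0 s"
abbreviation J :: "'a \<Rightarrow> ennreal" where "J y \<equiv> ennreal (j y z0)"

text \<open>The closure of a ball lies between the open ball and \<open>cball\<close>; which points
  of the sphere belong to it is unknown. Hence a strict inequality in one direction and a weak one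
  in the other.\<close>

lemma closed_ball_le: "y \<in> closed_ball z0 s \<Longrightarrow> dist z0 y \<le> s"
  using closure_minimal[OF ball_subset_cball[of z0 s] closed_cball] by auto
lemma closed_ball_lt: "dist z0 y < s \<Longrightarrow> y \<in> closed_ball z0 s"
  using closure_subset[of "ball z0 s"] by auto
lemma U_dist: "y \<in> U s \<Longrightarrow> s \<le> dist z0 y"
  using closed_ball_lt by (auto simp: not_less[symmetric])
lemma dist_U: "s < dist z0 y \<Longrightarrow> y \<in> U s"
  using closed_ball_le by (auto simp: not_le[symmetric])
lemma U_anti: "s \<le> s' \<Longrightarrow> U s' \<subseteq> U s"
  by (auto intro: closure_mono[THEN subsetD, of "ball z0 s"])
lemma U_open: "open (U s)" by auto
lemma closed_ball_compact: "compact (closed_ball z0 s)" by (simp add: compact_closure)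
lemma closed_ball_borel [measurable]: "closed_ball z0 s \<in> sets borel" by auto

lemma dist_z0_measurable [measurable]: "dist z0 \<in> borel_measurable borel"
  by (intro borel_measurable_continuous_onI continuous_intros)
lemma dist_sets [measurable]: "{y. s \<le> dist z0 y} \<in> sets borel" "{y. dist z0 y \<le> s} \<in> sets borel"
  "{y. dist z0 y < s} \<in> sets borel" "{y. dist z0 y = s} \<in> sets borel"
  by measurable
text \<open>(C2) compares jumps that start in the ball. Exchanging the arguments by duality makes it
  a comparison of jumps from far away that land in the ball, for both kernels.\<close>

lemma C2_kernel:
  assumes a: "1 < a" "a \<le> 2"
  obtains c where "1 \<le> c" "\<And>s z y. r0 \<le> s \<Longrightarrow> dist z0 z < s \<Longrightarrow> a * s \<le> dist z0 y \<Longrightarrow>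
    j y z \<le> c * j y z0 \<and> j y z0 \<le> c * j y z \<and> j' y z \<le> c * j' y z0 \<and> j' y z0 \<le> c * j' y z"
proof -
  obtain c where c: "1 \<le> c" and C: "\<And>r x y. r0 \<le> r \<Longrightarrow> x \<in> ball z0 r \<Longrightarrow> y \<in> - ball z0 (a * r) \<Longrightarrow>
        inverse c * j z0 y \<le> j x y \<and> j x y \<le> c * j z0 y \<and>
        inverse c * j' z0 y \<le> j' x y \<and> j' x y \<le> c * j' z0 y"
    using C2 a unfolding assumption_C2_def by meson
  show ?thesis
  proof (rule that[OF c])
    fix s z y assume s: "r0 \<le> s" and z: "dist z0 z < s" and y: "a * s \<le> dist z0 y"
    have "s < a * s" using a r0 s by simp
    then have "s < dist z0 y" "0 < s" using y r0 s by linarith+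
    then have "y \<noteq> z" "y \<noteq> z0" using z by auto
    then have "j z y = j' y z" "j z0 y = j' y z0" "j y z = j' z y" "j y z0 = j' z0 y" by (auto intro!: j_dual)
    moreover have "inverse c * j z0 y \<le> j z y \<and> j z y \<le> c * j z0 y \<and> inverse c * j' z0 y \<le> j' z y \<and> j' z y \<le> c * j' z0 y"
      using z y by (intro C[OF s]) auto
    ultimately show "j y z \<le> c * j y z0 \<and> j y z0 \<le> c * j y z \<and> j' y z \<le> c * j' y z0 \<and> j' y z0 \<le> c * j' y z"
      using c by (auto simp: field_simps)
  qed
qed

lemma far_point: "\<exists>y. 2 * r \<le> dist z0 y"
  using R0[of z0 r] by (auto simp: not_less)

section \<open>Volumes, the scale function and radii of null spheres\<close>

text \<open>Seen from a far point y, the jump density on the ball is bounded below by a positive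
  constant, while the total rate of jumps of size at least s is finite.\<close>

lemma vol_finite: "emeasure m (ball z0 r) < top"
proof -
  define s where "s = max r0 r"
  have s: "r0 \<le> s" "r \<le> s" "0 < s" using r0 by (auto simp: s_def)
  obtain y where y: "2 * s \<le> dist z0 y" using far_point by blast
  obtain c where c: "1 \<le> c" "\<And>s z y. r0 \<le> s \<Longrightarrow> dist z0 z < s \<Longrightarrow> 2 * s \<le> dist z0 y \<Longrightarrow>
    j y z \<le> c * j y z0 \<and> j y z0 \<le> c * j y z \<and> j' y z \<le> c * j' y z0 \<and> j' y z0 \<le> c * j' y z"
    using C2_kernel[of 2] by (metis one_less_numeral_iff order_refl semiring_norm(76))
  have jp: "0 < j y z0" using y s by (intro A.j_pos) auto
  have "ennreal (j y z0 / c) * emeasure m (ball z0 s) = (\<integral>\<^sup>+z. ennreal (j y z0 / c) * indicator (ball z0 s) z \<partial>m)"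
    by (subst nn_integral_cmult_indicator) (auto simp: A.sets_m)
  also have "\<dots> \<le> A.jump (indicator {z. s \<le> dist y z}) y"
    unfolding A.jump_def
  proof (rule nn_integral_mono)
    fix z
    show "ennreal (j y z0 / c) * indicator (ball z0 s) z \<le> indicator {z. s \<le> dist y z} z * ennreal (j y z)"
    proof (cases "z \<in> ball z0 s")
      case True
      then have "j y z0 \<le> c * j y z" using c(2)[OF s(1), of z y] y by auto
      then have "j y z0 / c \<le> j y z" using c by (simp add: field_simps)
      moreover have "s \<le> dist y z" using True y dist_triangle[of z0 y z] by (simp add: dist_commute)
      ultimately show ?thesis using True by (simp add: ennreal_leI)
    qed simp
  qed
  also have "\<dots> < top" by (rule A.jump_far_finite[OF s(3)])
  finally have "emeasure m (ball z0 s) < top" using jp c(1) by (auto simp: ennreal_mult_less_top)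
  moreover have "emeasure m (ball z0 r) \<le> emeasure m (ball z0 s)" using s by (intro emeasure_mono) (auto simp: A.sets_m)
  ultimately show ?thesis by simp
qed

definition vr :: "real \<Rightarrow> real" where "vr r = measure m (ball z0 r)"

lemma vol_eq: "emeasure m (ball z0 r) = ennreal (vr r)" and vol_eq': "vol m z0 r = ennreal (vr r)"
  using vol_finite[of r] by (auto simp: vr_def vol_def emeasure_eq_ennreal_measure)

lemma vr_pos: assumes "0 < r" shows "0 < vr r"
proof -
  have "ball z0 r \<noteq> {}" using assms by simp
  then have "0 < emeasure m (ball z0 r)" using A.full_support by (simp add: full_support_def)
  then show ?thesis by (simp add: vol_eq)
qed

lemma vr_mono: "r \<le> s \<Longrightarrow> vr r \<le> vr s"
proof -
  assume "r \<le> s"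
  then have "emeasure m (ball z0 r) \<le> emeasure m (ball z0 s)" by (intro emeasure_mono) (auto simp: A.sets_m)
  then show ?thesis by (simp add: vol_eq vr_def)
qed

lemma vr_double:
  obtains c where "1 \<le> c" "\<And>r. 0 < r \<Longrightarrow> vr (2 * r) \<le> c * vr r"
proof -
  obtain c where c: "1 < c" "\<And>r. 0 < r \<Longrightarrow> vol m z0 (2 * r) \<le> ennreal c * vol m z0 r"
    using V1 by (auto simp: assumption_V1_def)
  show ?thesis
  proof (rule that[of c])
    fix r :: real assume r: "0 < r"
    have "ennreal (vr (2 * r)) \<le> ennreal (c * vr r)"
      using c(2)[OF r] c(1) vr_pos[OF r] by (simp add: vol_eq' ennreal_mult)
    then show "vr (2 * r) \<le> c * vr r" using c(1) vr_pos[OF r] by (simp add: ennreal_le_iff)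
  qed (use c in simp)
qed

text \<open>Doubling and monotonicity would carry a zero of \<Phi> to a radius whose annulus
  contains a point y, and the lower bound in (C2) would then make the jump density at y
  infinite.\<close>

lemma Phi_pos: "0 < r \<Longrightarrow> 0 < \<Phi> r"
proof (rule ccontr)
  assume r: "0 < r" "\<not> 0 < \<Phi> r"
  obtain c where nonneg: "\<And>r. 0 \<le> r \<Longrightarrow> 0 \<le> \<Phi> r" and mono: "mono_on {0..} \<Phi>" and c: "1 < c" "\<And>r. 0 < r \<Longrightarrow> \<Phi> (2 * r) \<le> c * \<Phi> r"
    using Phi by (auto simp: assumption_Phi_def)
  have z: "\<Phi> (2 ^ k * r) = 0" for k
  proof (induction k)
    case 0 show ?case using r nonneg[of r] by simp
  next
    case (Suc k)
    have "\<Phi> (2 * (2 ^ k * r)) \<le> c * \<Phi> (2 ^ k * r)" using r by (intro c) simp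
    moreover have "0 \<le> \<Phi> (2 * (2 ^ k * r))" using r by (intro nonneg) simp
    ultimately show ?case using Suc by (simp add: mult.assoc)
  qed
  obtain y where y: "2 * r0 \<le> dist z0 y" using far_point by blast
  \<comment> \<open>With the factor 3/4 the distance of y lies strictly between s and 2s, and s is
    at least r0.\<close>
  define s where "s = dist z0 y * (3 / 4)"
  have s: "r0 \<le> s" "s < dist z0 y" "dist z0 y < 2 * s" using y r0 by (auto simp: s_def)
  obtain k :: nat where "s / r < 2 ^ k" using real_arch_pow[of 2 "s / r"] by auto
  then have "s \<le> 2 ^ k * r" using r by (simp add: field_simps)
  then have "\<Phi> s \<le> \<Phi> (2 ^ k * r)" using s r0 by (intro mono_onD[OF mono]) auto
  then have \<Phi>s: "\<Phi> s = 0" using z[of k] nonneg[of s] s r0 by simp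
  obtain c' where c': "0 < c'" "ennreal c' / (vol m z0 s * ennreal (\<Phi> s)) \<le> (INF y\<in>closed_annulus z0 s (2 * s). ennreal (min (j z0 y) (j' z0 y)))"
    using C2 s(1) unfolding assumption_C2_def by (metis one_less_numeral_iff order_refl semiring_norm(76))
  have "y \<in> closed_annulus z0 s (2 * s)"
    using s closure_subset[of "annulus z0 s (2 * s)"] by (auto simp: annulus_def)
  then have "ennreal c' / (vol m z0 s * ennreal (\<Phi> s)) \<le> ennreal (min (j z0 y) (j' z0 y))"
    using c'(2) by (rule order_trans[rotated, OF INF_lower])
  then show False using \<Phi>s c'(1) by (simp add: top_unique)
qed

lemma Phi_mono: "0 \<le> r \<Longrightarrow> r \<le> s \<Longrightarrow> \<Phi> r \<le> \<Phi> s"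
  using Phi by (auto simp: assumption_Phi_def intro: mono_onD)

text \<open>Spheres of different radii are disjoint and the ball of radius q has finite measure, so
  only countably many of them have mass. Null spheres are wanted since the generator of a test
  function is not controlled on the sphere itself.\<close>

lemma generic_radius:
  assumes "s < q" obtains \<rho> where "s < \<rho>" "\<rho> < q" "emeasure m {y. dist z0 y = \<rho>} = 0"
proof -
  define M where "M = distr (density m (indicator (ball z0 q))) borel (dist z0)"
  have "emeasure M (space M) = emeasure m (ball z0 q)"
    unfolding M_def by (subst emeasure_distr) (auto simp: emeasure_restricted A.sets_m)
  then interpret finite_measure M using vol_finite[of q] by (intro finite_measureI) auto
  have "uncountable {s<..<q}" using assms by (rule uncountable_open_interval[THEN iffD2])
  then have "\<not> {s<..<q} \<subseteq> {x. measure M {x} \<noteq> 0}" using countable_support countable_subset by blast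
  then obtain \<rho> where \<rho>: "s < \<rho>" "\<rho> < q" "measure M {\<rho>} = 0" by auto
  have vim: "dist z0 -` {\<rho>} \<in> sets m" using dist_sets(4)[of \<rho>] by (simp add: A.sets_m vimage_def)
  have "emeasure M {\<rho>} = emeasure m (ball z0 q \<inter> dist z0 -` {\<rho>})"
    unfolding M_def using vim by (subst emeasure_distr) (auto simp: emeasure_restricted A.sets_m)
  also have "ball z0 q \<inter> dist z0 -` {\<rho>} = {y. dist z0 y = \<rho>}" using \<rho> by auto
  finally show ?thesis using \<rho> that by (simp add: emeasure_eq_measure)
qed

text \<open>The Poisson kernel \<open>P\<^sub>D(w,z\<^sub>0)\<close>.\<close>

definition Pd :: "'a set \<Rightarrow> 'a \<Rightarrow> ennreal" where "Pd D w = A.Gr D J w"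

section \<open>Bounds for the Poisson kernel\<close>

lemma Pd_mono: "open D \<Longrightarrow> open D' \<Longrightarrow> D' \<subseteq> D \<Longrightarrow> Pd D' w \<le> Pd D w"
  unfolding Pd_def by (rule A.GK_domain_mono) auto

text \<open>The process can enter \<open>B(z\<^sub>0,r/2)\<close> from outside \<open>B(z\<^sub>0,r)\<close> only by a jump, and does so with
  probability at most one; the Levy system turns this into a Green function bound.\<close>

lemma far_green:
  assumes \<kappa>: "1 < \<kappa>" "\<kappa> \<le> 2"
  obtains c where "0 < c" "\<And>r D w. r0 \<le> r \<Longrightarrow> open D \<Longrightarrow> D \<subseteq> U r \<Longrightarrow>
    A.Gr D (\<lambda>y. indicator {y. \<kappa> * r \<le> dist z0 y} y * J y) w \<le> ennreal (c / vr r)"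
proof -
  obtain c where c: "1 \<le> c" "\<And>s z y. r0 \<le> s \<Longrightarrow> dist z0 z < s \<Longrightarrow> \<kappa> * s \<le> dist z0 y \<Longrightarrow>
    j y z \<le> c * j y z0 \<and> j y z0 \<le> c * j y z \<and> j' y z \<le> c * j' y z0 \<and> j' y z0 \<le> c * j' y z"
    using C2_kernel[OF \<kappa>] by blast
  obtain d where d: "1 \<le> d" "\<And>r. 0 < r \<Longrightarrow> vr (2 * r) \<le> d * vr r" using vr_double by blast
  show ?thesis
  proof (rule that[of "c * d"])
    show "0 < c * d" using c d by simp
    fix r D w assume r: "r0 \<le> r" and D: "open D" "D \<subseteq> U r"
    have rp: "0 < r" using r r0 by simp
    let ?g = "\<lambda>y. indicator {y. \<kappa> * r \<le> dist z0 y} y * J y"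
    show "A.Gr D ?g w \<le> ennreal (c * d / vr r)"
    proof (cases "w \<in> D")
      case True
      let ?E = "cball z0 (r / 2)"
      \<comment> \<open>\<open>c\<close> comes from the kernel comparison and \<open>d\<close> from
        comparing V(r) with V(r/2); then b J(y) is at most the rate of jumps from y into the ball of
        radius r/2.\<close>
      define b where "b = vr r / (c * d)"
      have b: "0 < b" using vr_pos[OF rp] c d by (simp add: b_def)
      have "ennreal b * A.Gr D ?g w = A.Gr D (\<lambda>y. ennreal b * ?g y) w" by (rule A.GK_cmult[symmetric]) auto
      also have "\<dots> \<le> A.Gr D (A.jump (indicator ?E)) w"
      proof (rule A.GK_mono[OF D(1)])
        fix y assume "y \<in> D"
        show "ennreal b * ?g y \<le> A.jump (indicator ?E) y"
        proof (cases "\<kappa> * r \<le> dist z0 y")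
          case True
          have "ennreal b * J y \<le> ennreal (j y z0 / c) * emeasure m ?E"
          proof -
            have "vr r \<le> d * vr (r / 2)" using d(2)[of "r / 2"] rp by simp
            then have "b * j y z0 \<le> j y z0 / c * vr (r / 2)"
              using c d A.j_nonneg[of y z0] unfolding b_def
              by (simp add: field_simps) (metis mult.commute mult.left_commute mult_left_mono)
            then have "ennreal b * J y \<le> ennreal (j y z0 / c) * ennreal (vr (r / 2))"
              using b c A.j_nonneg[of y z0] by (simp add: ennreal_mult[symmetric] vr_def ennreal_leI)
            also have "\<dots> \<le> ennreal (j y z0 / c) * emeasure m ?E"
              unfolding vol_eq[symmetric] by (intro mult_left_mono emeasure_mono) (auto simp: A.sets_m)
            finally show ?thesis .
          qed
          also have "\<dots> = (\<integral>\<^sup>+z. ennreal (j y z0 / c) * indicator ?E z \<partial>m)"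
            by (subst nn_integral_cmult_indicator) (auto simp: A.sets_m)
          also have "\<dots> \<le> A.jump (indicator ?E) y"
            unfolding A.jump_def
          proof (rule nn_integral_mono)
            fix z
            show "ennreal (j y z0 / c) * indicator ?E z \<le> indicator ?E z * ennreal (j y z)"
            proof (cases "z \<in> ?E")
              case True
              then have "j y z0 \<le> c * j y z" using c(2)[OF r, of z y] \<open>\<kappa> * r \<le> dist z0 y\<close> rp by auto
              then show ?thesis using True c by (simp add: ennreal_leI field_simps)
            qed simp
          qed
          finally show ?thesis using True by simp
        qed simp
      qed
      also have "\<dots> = A.Hr D (indicator ?E) w"
      proof (rule A.levy_system[OF D(1), symmetric])
        show "?E \<subseteq> ball z0 r" using rp by auto
        show "ball z0 r \<inter> D = {}" using D(2) U_dist[of _ r] by (fastforce simp: not_less[symmetric])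
      qed (use True in \<open>auto intro!: borel_measurable_indicator\<close>)
      also have "\<dots> \<le> 1" by (rule A.HK_le_const[OF D(1)]) (auto split: split_indicator)
      finally have "A.Gr D ?g w \<le> ennreal (1 / b)" using b by (intro ennreal_le_divideI) auto
      then show ?thesis by (simp add: b_def)
    qed (simp add: A.GK_outside[OF D(1)])
  qed
qed

lemma j_far_finite: "(\<integral>\<^sup>+y. indicator {y. r0 \<le> dist z0 y} y * J y \<partial>m) < top"
proof -
  have "(\<integral>\<^sup>+y. indicator {y. r0 \<le> dist z0 y} y * J y \<partial>m) = B.jump (indicator {y. r0 \<le> dist z0 y}) z0"
    unfolding B.jump_def
  proof (intro nn_integral_cong)
    fix y
    have "j y z0 = j' z0 y" if "r0 \<le> dist z0 y" using that r0 by (intro j_dual) auto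
    then show "indicator {y. r0 \<le> dist z0 y} y * J y = indicator {y. r0 \<le> dist z0 y} y * ennreal (j' z0 y)"
      by (auto split: split_indicator)
  qed
  also have "\<dots> < top" by (rule B.jump_far_finite[OF r0])
  finally show ?thesis .
qed

lemma D2_green:
  assumes a: "1 < a" "a < 2"
  obtains c where "0 < c" "\<And>r x y. r0 \<le> r \<Longrightarrow> dist z0 x < a * r \<Longrightarrow> 2 * r < dist z0 y \<Longrightarrow> dist z0 y < 4 * r \<Longrightarrow>
     G (U r) x y \<le> ennreal (c * \<Phi> r / vr r) \<and> G' (U r) x y \<le> ennreal (c * \<Phi> r / vr r)"
proof -
  obtain c where c: "0 < c" "\<And>r. r0 \<le> r \<Longrightarrow> (SUP x\<in>closed_ball z0 (a * r). SUP y\<in>closed_annulus z0 (2 * r) (4 * r).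
           max (G (U r) x y) (G' (U r) x y)) \<le> ennreal c * ennreal (\<Phi> r) / vol m z0 r"
    using D2 a unfolding assumption_D2_def by meson
  show ?thesis
  proof (rule that[OF c(1)])
    fix r x y assume r: "r0 \<le> r" and x: "dist z0 x < a * r" and y: "2 * r < dist z0 y" "dist z0 y < 4 * r"
    have rp: "0 < r" using r r0 by simp
    have "x \<in> closed_ball z0 (a * r)" using x by (rule closed_ball_lt)
    moreover have "y \<in> closed_annulus z0 (2 * r) (4 * r)"
      using y closure_subset[of "annulus z0 (2 * r) (4 * r)"] by (auto simp: annulus_def)
    ultimately have "max (G (U r) x y) (G' (U r) x y) \<le> (SUP x\<in>closed_ball z0 (a * r). SUP y\<in>closed_annulus z0 (2 * r) (4 * r).
           max (G (U r) x y) (G' (U r) x y))"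
      by (intro SUP_upper2[of x] SUP_upper2[of y]) auto
    also note c(2)[OF r]
    also have "ennreal c * ennreal (\<Phi> r) / vol m z0 r = ennreal (c * \<Phi> r / vr r)"
      using c(1) Phi_pos[OF rp] vr_pos[OF rp] by (simp add: vol_eq' ennreal_mult[symmetric] divide_ennreal)
    finally show "G (U r) x y \<le> ennreal (c * \<Phi> r / vr r) \<and> G' (U r) x y \<le> ennreal (c * \<Phi> r / vr r)" by simp
  qed
qed

text \<open>There is room to shrink the radius to s = 4r/5, still at least r0. All of
  \<open>D\<close> then lies at distance at least 5s/4, where \<open>far_green\<close> controls the
  whole of J.\<close>

lemma Pd_large:
  obtains c where "0 < c" "\<And>r D w. 5 / 4 * r0 \<le> r \<Longrightarrow> open D \<Longrightarrow> D \<subseteq> U r \<Longrightarrow> Pd D w \<le> ennreal (c / vr r)"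
proof -
  have \<kappa>: "(1::real) < 5 / 4" "5 / 4 \<le> (2::real)" by auto
  obtain c where c: "0 < c" "\<And>r D w. r0 \<le> r \<Longrightarrow> open D \<Longrightarrow> D \<subseteq> U r \<Longrightarrow>
    A.Gr D (\<lambda>y. indicator {y. 5 / 4 * r \<le> dist z0 y} y * J y) w \<le> ennreal (c / vr r)"
    by (rule far_green[OF \<kappa>]) blast
  obtain d where d: "1 \<le> d" "\<And>r. 0 < r \<Longrightarrow> vr (2 * r) \<le> d * vr r" using vr_double by blast
  show ?thesis
  proof (rule that[of "c * d"])
    show "0 < c * d" using c d by simp
    fix r D w assume r: "5 / 4 * r0 \<le> r" and D: "open D" "D \<subseteq> U r"
    define s where "s = r * (4 / 5)"
    have s: "r0 \<le> s" "s \<le> r" "5 / 4 * s = r" "0 < s" using r r0 by (auto simp: s_def)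
    have "Pd D w = A.Gr D (\<lambda>y. indicator {y. 5 / 4 * s \<le> dist z0 y} y * J y) w"
      unfolding Pd_def using D U_dist[of _ r] s(3) by (intro A.GK_cong) (auto split: split_indicator)
    also have "\<dots> \<le> ennreal (c / vr s)" using c(2)[OF s(1) D(1)] D(2) U_anti[OF s(2)] by blast
    also have "c / vr s \<le> c * d / vr r"
    proof -
      have "vr r \<le> vr (2 * s)" using s by (intro vr_mono) simp
      also have "\<dots> \<le> d * vr s" by (rule d(2)[OF s(4)])
      finally show ?thesis using vr_pos[OF s(4)] vr_pos[of r] s c d by (simp add: field_simps)
    qed
    then have "ennreal (c / vr s) \<le> ennreal (c * d / vr r)" by (rule ennreal_leI)
    finally show "Pd D w \<le> ennreal (c * d / vr r)" .
  qed
qed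

lemma vr_shrink:
  obtains c where "1 \<le> c" "\<And>r s. 0 < s \<Longrightarrow> r \<le> 2 * s \<Longrightarrow> vr r \<le> c * vr s"
proof -
  obtain d where d: "1 \<le> d" "\<And>r. 0 < r \<Longrightarrow> vr (2 * r) \<le> d * vr r" using vr_double by blast
  show ?thesis
  proof (rule that[OF d(1)])
    fix r s :: real assume "0 < s" "r \<le> 2 * s"
    then show "vr r \<le> d * vr s" using vr_mono[of r "2 * s"] d(2)[of s] by linarith
  qed
qed

text \<open>For r between r0 and 5 r0/4 the radius cannot be shrunk. The far part of J is still
  controlled by \<open>far_green\<close>; near the ball (D2) bounds the Green function, as w lies in
  the annulus, and J has finite mass. The constant contains \<Phi>(2 r0), which bounds \<Phi>(r) in
  this range.\<close>

lemma Pd_middle: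
  obtains c where "0 < c" "\<And>r D w. r0 \<le> r \<Longrightarrow> open D \<Longrightarrow> D \<subseteq> U r \<Longrightarrow> 2 * r < dist z0 w \<Longrightarrow> dist z0 w < 4 * r \<Longrightarrow>
    Pd D w \<le> ennreal (c / vr r)"
proof -
  obtain c1 where c1: "0 < c1" "\<And>r D w. 5 / 4 * r0 \<le> r \<Longrightarrow> open D \<Longrightarrow> D \<subseteq> U r \<Longrightarrow> Pd D w \<le> ennreal (c1 / vr r)"
    using Pd_large by blast
  have \<kappa>: "(1::real) < 3 / 2" "3 / 2 \<le> (2::real)" "3 / 2 < (2::real)" by auto
  obtain c2 where c2: "0 < c2" "\<And>r D w. r0 \<le> r \<Longrightarrow> open D \<Longrightarrow> D \<subseteq> U r \<Longrightarrow>
    A.Gr D (\<lambda>y. indicator {y. 3 / 2 * r \<le> dist z0 y} y * J y) w \<le> ennreal (c2 / vr r)"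
    by (rule far_green[OF \<kappa>(1,2)]) blast
  obtain c3 where c3: "0 < c3" "\<And>r x y. r0 \<le> r \<Longrightarrow> dist z0 x < 3 / 2 * r \<Longrightarrow> 2 * r < dist z0 y \<Longrightarrow> dist z0 y < 4 * r \<Longrightarrow>
     G (U r) x y \<le> ennreal (c3 * \<Phi> r / vr r) \<and> G' (U r) x y \<le> ennreal (c3 * \<Phi> r / vr r)"
    by (rule D2_green[OF \<kappa>(1,3)]) blast
  obtain K where K: "(\<integral>\<^sup>+y. indicator {y. r0 \<le> dist z0 y} y * J y \<partial>m) = ennreal K" "0 \<le> K"
    using j_far_finite by (cases "\<integral>\<^sup>+y. indicator {y. r0 \<le> dist z0 y} y * J y \<partial>m") auto
  define c4 where "c4 = c3 * \<Phi> (2 * r0) * K"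
  have c4: "0 \<le> c4" using c3 K Phi_pos[of "2 * r0"] r0 by (simp add: c4_def)
  show ?thesis
  proof (rule that[of "c1 + c2 + c4"])
    show "0 < c1 + c2 + c4" using c1 c2 c4 by simp
    fix r D w assume r: "r0 \<le> r" and D: "open D" "D \<subseteq> U r" and w: "2 * r < dist z0 w" "dist z0 w < 4 * r"
    have rp: "0 < r" using r r0 by simp
    note v = vr_pos[OF rp]
    show "Pd D w \<le> ennreal ((c1 + c2 + c4) / vr r)"
    proof (cases "5 / 4 * r0 \<le> r")
      case True
      have "Pd D w \<le> ennreal (c1 / vr r)" by (rule c1(2)[OF True D])
      also have "\<dots> \<le> ennreal ((c1 + c2 + c4) / vr r)" using v c1 c2 c4 by (intro ennreal_leI divide_right_mono) auto
      finally show ?thesis .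
    next
      case False
      let ?f = "\<lambda>y. indicator {y. 3 / 2 * r \<le> dist z0 y} y * J y" and ?n = "\<lambda>y. indicator {y. dist z0 y < 3 / 2 * r} y * J y"
      have "Pd D w = A.Gr D (\<lambda>y. ?f y + ?n y) w"
        unfolding Pd_def by (intro A.GK_cong[OF D(1)]) (auto split: split_indicator)
      also have "\<dots> = A.Gr D ?f w + A.Gr D ?n w" by (rule A.GK_add) auto
      also have "A.Gr D ?f w \<le> ennreal (c2 / vr r)" by (rule c2(2)[OF r D])
      also have "A.Gr D ?n w \<le> A.Gr (U r) ?n w" by (rule A.GK_domain_mono[OF U_open D]) auto
      also have "\<dots> = (\<integral>\<^sup>+y. ?n y * G (U r) w y \<partial>m)" by (rule A.Gr_eq[OF U_open]) auto
      also have "\<dots> \<le> (\<integral>\<^sup>+y. ennreal (c3 * \<Phi> r / vr r) * (indicator {y. r0 \<le> dist z0 y} y * J y) \<partial>m)"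
      proof (rule nn_integral_mono)
        fix y
        show "?n y * G (U r) w y \<le> ennreal (c3 * \<Phi> r / vr r) * (indicator {y. r0 \<le> dist z0 y} y * J y)"
        proof (cases "y \<in> U r \<and> dist z0 y < 3 / 2 * r")
          case True
          then have "G (U r) w y \<le> ennreal (c3 * \<Phi> r / vr r)"
            using c3(2)[OF r _ w, of y] G_dual[OF U_open[of r], of w y] by simp
          moreover have "r0 \<le> dist z0 y" using U_dist[of y r] True r by simp
          ultimately show ?thesis using True by (simp add: mult.commute mult_left_mono)
        next
          case F: False
          then have "?n y = 0 \<or> G (U r) w y = 0" using A.G_outside[OF U_open[of r], of w y] by (auto split: split_indicator)
          then show ?thesis by auto
        qed
      qed
      also have "\<dots> = ennreal (c3 * \<Phi> r / vr r) * ennreal K"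
        unfolding K(1)[symmetric] by (rule nn_integral_cmult) auto
      also have "\<dots> \<le> ennreal (c4 / vr r)"
      proof -
        have "\<Phi> r \<le> \<Phi> (2 * r0)" using False r0 rp by (intro Phi_mono) auto
        then have "c3 * \<Phi> r * K \<le> c4" unfolding c4_def using c3 K by (intro mult_right_mono mult_left_mono) auto
        then show ?thesis using v K c3 Phi_pos[OF rp]
          by (subst ennreal_mult[symmetric]) (auto intro!: ennreal_leI simp: divide_right_mono)
      qed
      finally have "Pd D w \<le> ennreal (c2 / vr r) + ennreal (c4 / vr r)" by (simp add: add_mono)
      also have "\<dots> = ennreal ((c2 + c4) / vr r)" using c2 c4 v by (simp add: add_divide_distrib)
      also have "\<dots> \<le> ennreal ((c1 + c2 + c4) / vr r)" using v c1 by (intro ennreal_leI divide_right_mono) auto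
      finally show ?thesis .
    qed
  qed
qed

text \<open>For large r the pointwise bound c/V(r) integrates to a constant. For r below 5 r0/4
  duality moves the Green operator onto the indicator of a ball, whose dual potential is bounded;
  the radius 5 r0/2 of that ball exceeds 2r.\<close>

lemma Pd_integral:
  obtains c where "0 < c" "\<And>r D. r0 \<le> r \<Longrightarrow> open D \<Longrightarrow> D \<subseteq> U r \<Longrightarrow>
    (\<integral>\<^sup>+w. indicator {w. dist z0 w \<le> 2 * r} w * Pd D w \<partial>m) \<le> ennreal c"
proof -
  obtain c1 where c1: "0 < c1" "\<And>r D w. 5 / 4 * r0 \<le> r \<Longrightarrow> open D \<Longrightarrow> D \<subseteq> U r \<Longrightarrow> Pd D w \<le> ennreal (c1 / vr r)"
    using Pd_large by blast
  obtain d where d: "1 \<le> d" "\<And>r s. 0 < s \<Longrightarrow> r \<le> 2 * s \<Longrightarrow> vr r \<le> d * vr s" using vr_shrink by blast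
  obtain K where K: "(\<integral>\<^sup>+y. indicator {y. r0 \<le> dist z0 y} y * J y \<partial>m) = ennreal K" "0 \<le> K"
    using j_far_finite by (cases "\<integral>\<^sup>+y. indicator {y. r0 \<le> dist z0 y} y * J y \<partial>m") auto
  have UB: "U r0 \<inter> ball z0 r0 = {}" using U_dist[of _ r0] by fastforce
  obtain C where C: "0 \<le> C" "\<And>y. B.Gr (U r0) (indicator (cball z0 (5 / 2 * r0))) y \<le> ennreal C"
    using B.green_bounded[OF compact_cball U_open r0 UB] by blast
  show ?thesis
  proof (rule that[of "c1 * d * d + C * K"])
    show "0 < c1 * d * d + C * K" using c1 C K d by (simp add: add_pos_nonneg)
    fix r D assume r: "r0 \<le> r" and D: "open D" "D \<subseteq> U r"
    have rp: "0 < r" using r r0 by simp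
    note v = vr_pos[OF rp]
    let ?I = "indicator {w. dist z0 w \<le> 2 * r} :: 'a \<Rightarrow> ennreal"
    show "(\<integral>\<^sup>+w. ?I w * Pd D w \<partial>m) \<le> ennreal (c1 * d * d + C * K)"
    proof (cases "5 / 4 * r0 \<le> r")
      case True
      have "(\<integral>\<^sup>+w. ?I w * Pd D w \<partial>m) \<le> (\<integral>\<^sup>+w. ennreal (c1 / vr r) * indicator (ball z0 (4 * r)) w \<partial>m)"
        using c1(2)[OF True D] rp by (intro nn_integral_mono) (auto split: split_indicator)
      also have "\<dots> = ennreal (c1 / vr r) * ennreal (vr (4 * r))"
        unfolding vol_eq[symmetric] by (rule nn_integral_cmult_indicator) (auto simp: A.sets_m)
      also have "\<dots> = ennreal (c1 / vr r * vr (4 * r))" by (rule ennreal_mult[symmetric]) (use c1 v in \<open>auto simp: vr_def\<close>)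
      also have "c1 / vr r * vr (4 * r) \<le> c1 * d * d"
      proof -
        have "vr (4 * r) \<le> d * vr (2 * r)" using rp by (intro d) auto
        also have "\<dots> \<le> d * (d * vr r)" using d rp by (intro mult_left_mono d) auto
        finally have "c1 / vr r * vr (4 * r) \<le> c1 / vr r * (d * (d * vr r))" using c1 v by (intro mult_left_mono) auto
        then show ?thesis using v by (simp add: mult_ac)
      qed
      then have "ennreal (c1 / vr r * vr (4 * r)) \<le> ennreal (c1 * d * d + C * K)" using C K by (intro ennreal_leI) (simp add: add_increasing2)
      finally show ?thesis .
    next
      case False
      let ?J = "\<lambda>y. indicator {y. r0 \<le> dist z0 y} y * J y"
      have "(\<integral>\<^sup>+w. ?I w * Pd D w \<partial>m) \<le> (\<integral>\<^sup>+w. ?I w * A.Gr (U r0) ?J w \<partial>m)"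
      proof (intro nn_integral_mono mult_left_mono)
        fix w
        have "Pd D w = A.Gr D ?J w"
          unfolding Pd_def using D U_dist[of _ r] r by (intro A.GK_cong) (fastforce split: split_indicator)+
        also have "\<dots> \<le> A.Gr (U r0) ?J w"
          by (rule A.GK_domain_mono[OF U_open D(1) order_trans[OF D(2) U_anti[OF r]]]) auto
        finally show "Pd D w \<le> A.Gr (U r0) ?J w" .
      qed simp
      also have "\<dots> = (\<integral>\<^sup>+y. ?J y * B.Gr (U r0) ?I y \<partial>m)"
        by (rule green_duality[OF U_open]) auto
      also have "\<dots> \<le> (\<integral>\<^sup>+y. ennreal C * ?J y \<partial>m)"
      proof (rule nn_integral_mono)
        fix y
        have "B.Gr (U r0) ?I y \<le> B.Gr (U r0) (indicator (cball z0 (5 / 2 * r0))) y"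
          using False by (intro B.GK_mono[OF U_open]) (auto split: split_indicator)
        also have "\<dots> \<le> ennreal C" by (rule C)
        finally show "?J y * B.Gr (U r0) ?I y \<le> ennreal C * ?J y" by (subst mult.commute) (rule mult_right_mono, simp_all)
      qed
      also have "\<dots> = ennreal C * ennreal K" unfolding K(1)[symmetric] by (rule nn_integral_cmult) auto
      also have "\<dots> = ennreal (C * K)" using C K by (simp add: ennreal_mult)
      also have "\<dots> \<le> ennreal (c1 * d * d + C * K)" using c1 d by (intro ennreal_leI) simp
      finally show ?thesis .
    qed
  qed
qed

section \<open>Probability of landing near a ball\<close>

text \<open>Inside radius \<rho> the test function is at its maximum and its generator is
  non-positive; between \<rho> and 3\<rho> (B2-b) applies; beyond 3\<rho> the generator is a jump
  integral, compared with J by (C2). The sphere of radius \<rho> is left out, hence the almost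
  everywhere bound.\<close>

lemma generator_bound:
  obtains c where "0 < c" "\<And>\<rho> f g. r0 \<le> \<rho> \<Longrightarrow> emeasure m {y. dist z0 y = \<rho>} = 0 \<Longrightarrow>
    f \<in> test_functions m \<D> (closed_ball z0 \<rho>) (ball z0 (2 * \<rho>)) \<Longrightarrow> generates C_zero X f g \<Longrightarrow>
    AE y in m. ennreal (g y) \<le> ennreal (c * vr \<rho>) * J y"
proof -
  have two: "(1::real) < 2" "2 \<le> (2::real)" by auto
  obtain c1 where c1: "0 < c1" "\<And>r f x. r0 \<le> r \<Longrightarrow> f \<in> test_functions m \<D> (closed_ball z0 r) (ball z0 (2 * r)) \<Longrightarrow>
     x \<in> closed_annulus z0 r ((2 + 1) * r) \<Longrightarrow>
       ennreal (max (generator C_infinity X f x) (generator C_infinity X' f x)) \<le> ennreal c1 * vol m z0 r * ennreal (j x z0)"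
    using B2b two unfolding assumption_B2b_def by meson
  have a: "(1::real) < 3 / 2" "3 / 2 \<le> (2::real)" by auto
  obtain c2 where c2: "1 \<le> c2" "\<And>s z y. r0 \<le> s \<Longrightarrow> dist z0 z < s \<Longrightarrow> 3 / 2 * s \<le> dist z0 y \<Longrightarrow>
    j y z \<le> c2 * j y z0 \<and> j y z0 \<le> c2 * j y z \<and> j' y z \<le> c2 * j' y z0 \<and> j' y z0 \<le> c2 * j' y z"
    by (rule C2_kernel[OF a]) blast
  obtain d where d: "1 \<le> d" "\<And>r s. 0 < s \<Longrightarrow> r \<le> 2 * s \<Longrightarrow> vr r \<le> d * vr s" using vr_shrink by blast
  show ?thesis
  proof (rule that[of "c1 + c2 * d"])
    show "0 < c1 + c2 * d" using c1 c2 d by (simp add: add_pos_pos)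
    fix \<rho> f g assume \<rho>: "r0 \<le> \<rho>" and null: "emeasure m {y. dist z0 y = \<rho>} = 0"
      and f: "f \<in> test_functions m \<D> (closed_ball z0 \<rho>) (ball z0 (2 * \<rho>))" and gen: "generates C_zero X f g"
    have rp: "0 < \<rho>" using \<rho> r0 by simp
    note v = vr_pos[OF rp]
    have f1: "f y = 1" if "y \<in> closed_ball z0 \<rho>" for y using f that by (simp add: test_functions_def)
    have f0: "f y = 0" if "2 * \<rho> \<le> dist z0 y" for y using f that by (auto simp: test_functions_def)
    have f01: "0 \<le> f y" "f y \<le> 1" for y using f by (auto simp: test_functions_def)
    have [measurable]: "f \<in> borel_measurable borel" using A.gen_bounded(1)[OF gen] by (rule bounded_borel_measurable)
    have "AE y in m. dist z0 y \<noteq> \<rho>"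
      using null by (intro AE_I[of _ _ "{y. dist z0 y = \<rho>}"]) (auto simp: A.sets_m)
    then show "AE y in m. ennreal (g y) \<le> ennreal ((c1 + c2 * d) * vr \<rho>) * J y"
    proof eventually_elim
      case (elim y)
      consider "dist z0 y < \<rho>" | "\<rho> < dist z0 y" "dist z0 y < 3 * \<rho>" | "3 * \<rho> \<le> dist z0 y" using elim by linarith
      then show ?case
      proof cases
        case 1
        then have "g y \<le> 0" using f1 f01 by (intro A.generator_nonpos_at_max[OF gen]) (auto intro: closed_ball_lt)
        then show ?thesis by (simp add: ennreal_neg)
      next
        case 2
        then have "y \<in> closed_annulus z0 \<rho> ((2 + 1) * \<rho>)"
          using closure_subset[of "annulus z0 \<rho> ((2 + 1) * \<rho>)"] by (auto simp: annulus_def)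
        from c1(2)[OF \<rho> f this] have "ennreal (max (g y) (generator C_infinity X' f y)) \<le> ennreal (c1 * vr \<rho>) * J y"
          using A.generator_C_infinity(1)[OF gen] c1(1) v by (simp add: vol_eq' ennreal_mult)
        then have "ennreal (g y) \<le> ennreal (c1 * vr \<rho>) * J y" by (rule order_trans[OF ennreal_leI[OF max.cobounded1]])
        also have "\<dots> \<le> ennreal ((c1 + c2 * d) * vr \<rho>) * J y"
          using c2 d v by (intro mult_right_mono ennreal_leI) auto
        finally show ?thesis .
      next
        case 3
        have "{z. f z \<noteq> 0} \<subseteq> cball z0 (2 * \<rho>)" 
        proof
          fix z assume "z \<in> {z. f z \<noteq> 0}"
          then show "z \<in> cball z0 (2 * \<rho>)" using f0[of z] by (cases "2 * \<rho> \<le> dist z0 z") auto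
        qed
        then have "closure {z. f z \<noteq> 0} \<subseteq> cball z0 (2 * \<rho>)" by (rule closure_minimal) simp
        then have "y \<notin> closure {z. f z \<noteq> 0}" using 3 rp by auto
        from A.generator_levy_eq(1)[OF gen A.levy this f01(1)]
        have "ennreal (g y) = (\<integral>\<^sup>+z. ennreal (f z) \<partial>density m (\<lambda>z. ennreal (j y z)))" .
        also have "\<dots> = (\<integral>\<^sup>+z. ennreal (j y z) * ennreal (f z) \<partial>m)" by (rule nn_integral_density) measurable
        also have "\<dots> \<le> (\<integral>\<^sup>+z. ennreal (c2 * j y z0) * indicator (ball z0 (2 * \<rho>)) z \<partial>m)"
        proof (rule nn_integral_mono)
          fix z
          show "ennreal (j y z) * ennreal (f z) \<le> ennreal (c2 * j y z0) * indicator (ball z0 (2 * \<rho>)) z"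
          proof (cases "z \<in> ball z0 (2 * \<rho>)")
            case True
            then have "j y z \<le> c2 * j y z0" using c2(2)[of "2 * \<rho>" z y] \<rho> rp 3 by auto
            then have "ennreal (j y z) * ennreal (f z) \<le> ennreal (c2 * j y z0) * 1"
              using f01[of z] by (intro mult_mono ennreal_leI) (auto simp: ennreal_le_1)
            then show ?thesis using True by simp
          next
            case False
            then show ?thesis using f0[of z] by simp
          qed
        qed
        also have "\<dots> = ennreal (c2 * j y z0) * ennreal (vr (2 * \<rho>))"
          unfolding vol_eq[symmetric] by (rule nn_integral_cmult_indicator) (auto simp: A.sets_m)
        also have "\<dots> = ennreal (c2 * vr (2 * \<rho>)) * J y"
          using c2 A.j_nonneg[of y z0] by (simp add: ennreal_mult[symmetric] vr_def mult_ac)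
        also have "\<dots> \<le> ennreal ((c1 + c2 * d) * vr \<rho>) * J y"
        proof (intro mult_right_mono ennreal_leI)
          have "c2 * vr (2 * \<rho>) \<le> c2 * (d * vr \<rho>)" using c2 rp by (intro mult_left_mono d) auto
          also have "\<dots> \<le> (c1 + c2 * d) * vr \<rho>" using c1 v by (simp add: distrib_right)
          finally show "c2 * vr (2 * \<rho>) \<le> (c1 + c2 * d) * vr \<rho>" .
        qed simp
        finally show ?thesis .
      qed
    qed
  qed
qed

text \<open>A test function for a null radius \<rho> slightly above s dominates the indicator and
  vanishes at x, so Dynkin's formula leaves the potential of its generator. The parameter q only
  ensures 2\<rho> \<le> |x|.\<close>

lemma landing_bound:
  obtains c where "0 < c" "\<And>s q D x. r0 \<le> s \<Longrightarrow> s < q \<Longrightarrow> q \<le> 2 * s \<Longrightarrow> open D \<Longrightarrow> D \<subseteq> U s \<Longrightarrow> 2 * q \<le> dist z0 x \<Longrightarrow>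
    A.Hr D (indicator (closed_ball z0 s)) x \<le> ennreal (c * vr s) * Pd D x"
proof -
  obtain c where c: "0 < c" "\<And>\<rho> f g. r0 \<le> \<rho> \<Longrightarrow> emeasure m {y. dist z0 y = \<rho>} = 0 \<Longrightarrow>
    f \<in> test_functions m \<D> (closed_ball z0 \<rho>) (ball z0 (2 * \<rho>)) \<Longrightarrow> generates C_zero X f g \<Longrightarrow>
    AE y in m. ennreal (g y) \<le> ennreal (c * vr \<rho>) * J y"
    by (rule generator_bound) blast
  obtain d where d: "1 \<le> d" "\<And>r s. 0 < s \<Longrightarrow> r \<le> 2 * s \<Longrightarrow> vr r \<le> d * vr s" using vr_shrink by blast
  show ?thesis
  proof (rule that[of "c * d"])
    show "0 < c * d" using c d by simp
    fix s q D x assume s: "r0 \<le> s" and q: "s < q" "q \<le> 2 * s" and D: "open D" "D \<subseteq> U s" and x: "2 * q \<le> dist z0 x"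
    obtain \<rho> where \<rho>: "s < \<rho>" "\<rho> < q" "emeasure m {y. dist z0 y = \<rho>} = 0" using generic_radius[OF q(1)] by blast
    have pos: "0 < s" "0 < \<rho>" "r0 \<le> \<rho>" using s r0 \<rho> by auto
    have "closed_ball z0 \<rho> \<subseteq> ball z0 (2 * \<rho>)" using closed_ball_le pos by fastforce
    then obtain f where f: "f \<in> test_functions m \<D> (closed_ball z0 \<rho>) (ball z0 (2 * \<rho>))"
      using A.\<D>_tests[OF closed_ball_compact open_ball] by blast
    then obtain g where gen: "generates C_zero X f g" by (rule A.test_function_generates)
    have f01: "0 \<le> f y" for y using f by (auto simp: test_functions_def)
    have "f x = 0" using f x \<rho>(2) by (auto simp: test_functions_def)
    note [measurable] = A.gen_ennreal_measurable[OF gen f01]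
    have "A.Hr D (indicator (closed_ball z0 s)) x \<le> A.Hr D (\<lambda>z. ennreal (f z)) x"
    proof (rule A.HK_mono[OF D(1)])
      fix z
      have "closed_ball z0 s \<subseteq> closed_ball z0 \<rho>" using \<rho> by (intro closure_mono) auto
      then show "indicator (closed_ball z0 s) z \<le> ennreal (f z)" using f by (auto simp: test_functions_def split: split_indicator)
    qed
    also have "\<dots> \<le> ennreal (f x) + A.Gr D (\<lambda>z. ennreal (g z)) x" by (rule A.dynkin_HK_le[OF gen f01 D(1)])
    also have "\<dots> = A.Gr D (\<lambda>z. ennreal (g z)) x" using \<open>f x = 0\<close> by simp
    also have "\<dots> \<le> A.Gr D (\<lambda>y. ennreal (c * vr \<rho>) * J y) x"
      using c(2)[OF pos(3) \<rho>(3) f gen] by (intro A.Gr_mono_AE[OF D(1)]) auto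
    also have "\<dots> = ennreal (c * vr \<rho>) * Pd D x" unfolding Pd_def by (rule A.GK_cmult) auto
    also have "\<dots> \<le> ennreal (c * d * vr s) * Pd D x"
    proof (intro mult_right_mono ennreal_leI)
      have "vr \<rho> \<le> d * vr s" using \<rho> q pos by (intro d) auto
      then show "c * vr \<rho> \<le> c * d * vr s" using c by (simp add: mult.assoc)
    qed simp
    finally show "A.Hr D (indicator (closed_ball z0 s)) x \<le> ennreal (c * d * vr s) * Pd D x" .
  qed
qed

text \<open>By the Levy system the exit distribution has density z \<mapsto> Gr D (j(\<cdot>,z)) on
  the inner ball, and (C2) compares this with \<open>Pd D x\<close> for all landing points at once,
  since t < s and \<open>D\<close> lies beyond a s.\<close>

lemma levy_landing:
  assumes a: "1 < a" "a \<le> 2"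
  obtains c where "1 \<le> c" "\<And>s t D u x. r0 \<le> s \<Longrightarrow> t < s \<Longrightarrow> open D \<Longrightarrow> D \<subseteq> U (a * s) \<Longrightarrow> x \<in> D \<Longrightarrow>
    u \<in> borel_measurable borel \<Longrightarrow> (\<And>z. t < dist z0 z \<Longrightarrow> u z = 0) \<Longrightarrow>
    A.Hr D u x \<le> ennreal c * Pd D x * (\<integral>\<^sup>+z. u z \<partial>m) \<and> Pd D x * (\<integral>\<^sup>+z. u z \<partial>m) \<le> ennreal c * A.Hr D u x"
proof -
  obtain c where c: "1 \<le> c" "\<And>s z y. r0 \<le> s \<Longrightarrow> dist z0 z < s \<Longrightarrow> a * s \<le> dist z0 y \<Longrightarrow>
    j y z \<le> c * j y z0 \<and> j y z0 \<le> c * j y z \<and> j' y z \<le> c * j' y z0 \<and> j' y z0 \<le> c * j' y z"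
    by (rule C2_kernel[OF a]) blast
  show ?thesis
  proof (rule that[OF c(1)])
    fix s t D and u :: "'a \<Rightarrow> ennreal" and x
    assume s: "r0 \<le> s" "t < s" and D: "open D" "D \<subseteq> U (a * s)" and x: "x \<in> D"
      and u[measurable]: "u \<in> borel_measurable borel" and u0: "\<And>z. t < dist z0 z \<Longrightarrow> u z = 0"
    have as: "s < a * s" using a s r0 by simp
    note [measurable] = A.Gr_j_measurable[OF D(1), of x]
    have Hr: "A.Hr D u x = (\<integral>\<^sup>+z. u z * A.Gr D (\<lambda>y. ennreal (j y z)) x \<partial>m)"
    proof -
      have "A.Hr D u x = A.Gr D (A.jump u) x"
      proof (rule A.levy_system[OF D(1)])
        show "cball z0 t \<subseteq> ball z0 (a * s)" using s as by auto
        show "ball z0 (a * s) \<inter> D = {}" using D(2) U_dist[of _ "a * s"] by (fastforce simp: not_less[symmetric])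
      qed (use x u u0 in auto)
      then show ?thesis by (simp add: A.Gr_jump[OF D(1)])
    qed
    have kernel: "A.Gr D (\<lambda>y. ennreal (j y z)) x \<le> ennreal c * Pd D x"
      "Pd D x \<le> ennreal c * A.Gr D (\<lambda>y. ennreal (j y z)) x" if z: "dist z0 z \<le> t" for z
    proof -
      have jz: "j y z \<le> c * j y z0" "j y z0 \<le> c * j y z" if "y \<in> D" for y
        using c(2)[OF s(1), of z y] z s U_dist[of y "a * s"] D(2) that by auto
      have "A.Gr D (\<lambda>y. ennreal (j y z)) x \<le> A.Gr D (\<lambda>y. ennreal c * J y) x"
        using jz(1) c A.j_nonneg by (intro A.GK_mono[OF D(1)]) (simp add: ennreal_mult[symmetric] ennreal_leI)
      also have "\<dots> = ennreal c * Pd D x" unfolding Pd_def by (rule A.GK_cmult) auto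
      finally show "A.Gr D (\<lambda>y. ennreal (j y z)) x \<le> ennreal c * Pd D x" .
      have "Pd D x \<le> A.Gr D (\<lambda>y. ennreal c * ennreal (j y z)) x"
        unfolding Pd_def using jz(2) c A.j_nonneg by (intro A.GK_mono[OF D(1)]) (simp add: ennreal_mult[symmetric] ennreal_leI)
      also have "\<dots> = ennreal c * A.Gr D (\<lambda>y. ennreal (j y z)) x" by (rule A.GK_cmult) auto
      finally show "Pd D x \<le> ennreal c * A.Gr D (\<lambda>y. ennreal (j y z)) x" .
    qed
    have "A.Hr D u x \<le> (\<integral>\<^sup>+z. ennreal c * Pd D x * u z \<partial>m)"
      unfolding Hr
    proof (rule nn_integral_mono)
      fix z show "u z * A.Gr D (\<lambda>y. ennreal (j y z)) x \<le> ennreal c * Pd D x * u z"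
        using kernel(1)[of z] u0[of z] by (cases "dist z0 z \<le> t") (auto simp: mult.commute[of "u z"] intro!: mult_right_mono)
    qed
    also have "\<dots> = ennreal c * Pd D x * (\<integral>\<^sup>+z. u z \<partial>m)" by (rule nn_integral_cmult) simp
    finally have 1: "A.Hr D u x \<le> ennreal c * Pd D x * (\<integral>\<^sup>+z. u z \<partial>m)" .
    have "Pd D x * (\<integral>\<^sup>+z. u z \<partial>m) = (\<integral>\<^sup>+z. Pd D x * u z \<partial>m)" by (rule nn_integral_cmult[symmetric]) simp
    also have "\<dots> \<le> (\<integral>\<^sup>+z. ennreal c * (u z * A.Gr D (\<lambda>y. ennreal (j y z)) x) \<partial>m)"
    proof (rule nn_integral_mono)
      fix z show "Pd D x * u z \<le> ennreal c * (u z * A.Gr D (\<lambda>y. ennreal (j y z)) x)"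
        using mult_right_mono[OF kernel(2)[of z], of "u z"] u0[of z] by (cases "dist z0 z \<le> t") (auto simp: ac_simps)
    qed
    also have "\<dots> = ennreal c * A.Hr D u x" unfolding Hr by (rule nn_integral_cmult) measurable
    finally show "A.Hr D u x \<le> ennreal c * Pd D x * (\<integral>\<^sup>+z. u z \<partial>m) \<and> Pd D x * (\<integral>\<^sup>+z. u z \<partial>m) \<le> ennreal c * A.Hr D u x"
      using 1 by blast
  qed
qed

section \<open>Killed potentials and the bound between 2r and 4r\<close>

text \<open>(B2-a) at radius 5r/4 with a = 6/5, as (5/4)(6/5) = 3/2. Doubling the constant makes the
  bound strict, so that some test function attains it although the hypothesis is about an
  infimum.\<close>

lemma barrier:
  obtains c where "0 < c" "\<And>r. r0 \<le> r \<Longrightarrow> \<exists>f g. f \<in> test_functions m \<D> (closed_ball z0 (5 / 4 * r)) (ball z0 (3 / 2 * r)) \<and>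
    generates C_zero X' f g \<and> (\<forall>z. - g z \<le> c / \<Phi> r)"
proof -
  have a: "(1::real) < 6 / 5" "6 / 5 \<le> (2::real)" by auto
  obtain c where c: "0 < c" "\<And>r. r0 \<le> r \<Longrightarrow> (INF f\<in>test_functions m \<D> (closed_ball z0 r) (ball z0 (6 / 5 * r)).
        SUP x. ereal (max (generator C_infinity X (\<lambda>z. 1 - f z) x) (generator C_infinity X' (\<lambda>z. 1 - f z) x)))
     \<le> ereal c / ereal (\<Phi> r)"
    using B2a a unfolding assumption_B2a_def by meson
  show ?thesis
  proof (rule that[of "2 * c"])
    show "0 < 2 * c" using c by simp
    fix r assume r: "r0 \<le> r"
    define s where "s = 5 / 4 * r"
    have s: "r0 \<le> s" "6 / 5 * s = 3 / 2 * r" "0 < r" "r \<le> s" using r r0 by (auto simp: s_def)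
    have \<Phi>: "0 < \<Phi> r" "\<Phi> r \<le> \<Phi> s" using Phi_pos[OF s(3)] Phi_mono[OF _ s(4)] s by auto
    note c(2)[OF s(1)]
    also have "ereal c / ereal (\<Phi> s) = ereal (c / \<Phi> s)" using \<Phi> by simp
    also have "\<dots> < ereal (2 * c / \<Phi> r)"
    proof -
      have "c / \<Phi> s \<le> c / \<Phi> r" using \<Phi> c by (intro divide_left_mono) auto
      also have "\<dots> < 2 * c / \<Phi> r" using \<Phi> c by (intro divide_strict_right_mono) auto
      finally show ?thesis by simp
    qed
    finally obtain f where f: "f \<in> test_functions m \<D> (closed_ball z0 s) (ball z0 (6 / 5 * s))"
      and lt: "(SUP x. ereal (max (generator C_infinity X (\<lambda>z. 1 - f z) x) (generator C_infinity X' (\<lambda>z. 1 - f z) x))) < ereal (2 * c / \<Phi> r)"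
      by (auto simp: INF_less_iff)
    obtain g where gen: "generates C_zero X' f g" using f by (rule B.test_function_generates)
    have "- g z \<le> 2 * c / \<Phi> r" for z
    proof -
      have "ereal (max (generator C_infinity X (\<lambda>z. 1 - f z) z) (generator C_infinity X' (\<lambda>z. 1 - f z) z)) < ereal (2 * c / \<Phi> r)"
        by (rule le_less_trans[OF SUP_upper lt]) simp
      then show ?thesis using B.generator_C_infinity(2)[OF gen] by simp
    qed
    then show "\<exists>f g. f \<in> test_functions m \<D> (closed_ball z0 (5 / 4 * r)) (ball z0 (3 / 2 * r)) \<and>
      generates C_zero X' f g \<and> (\<forall>z. - g z \<le> 2 * c / \<Phi> r)"
      using f gen unfolding s(2) by (auto simp: s_def)
  qed
qed

lemma dual_green_bounded:
  assumes "r0 \<le> r" "open D" "D \<subseteq> U r"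
  obtains C where "0 \<le> C" "\<And>y. B.Gr D (indicator (cball z0 s)) y \<le> ennreal C"
proof -
  have "0 < r" using assms r0 by simp
  moreover have "D \<inter> ball z0 r = {}" using assms(3) U_dist[of _ r] by (fastforce simp: not_less[symmetric])
  ultimately show ?thesis using B.green_bounded[OF compact_cball assms(2)] that by metis
qed

text \<open>The function \<open>1 - f + \<epsilon>\<close> is a supersolution for the killed process in \<open>D \<inter> B(z\<^sub>0,3r/2)\<close>, so it is
  enough to bound the killed potential outside of this set: (D2) does it for \<open>|z| < 19r/10\<close>, and
  farther away the potential is only reached by jumps.\<close>

lemma killed_green_bound:
  assumes \<delta>c: "0 < c0"
  obtains c where "0 < c" "\<And>r D S f g \<epsilon> \<psi> x. r0 \<le> r \<Longrightarrow> open D \<Longrightarrow> D \<subseteq> U r \<Longrightarrow>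
    S \<in> sets borel \<Longrightarrow> S \<subseteq> {y. 2 * r < dist z0 y \<and> dist z0 y < 4 * r} \<Longrightarrow>
    f \<in> test_functions m \<D> (closed_ball z0 (5 / 4 * r)) (ball z0 (3 / 2 * r)) \<Longrightarrow> generates C_zero X' f g \<Longrightarrow>
    (\<And>z. - g z \<le> c0 / \<Phi> r) \<Longrightarrow> 0 \<le> \<epsilon> \<Longrightarrow> rate \<psi> \<Longrightarrow>
    (\<And>z. dist z0 z < 3 / 2 * r \<Longrightarrow> ennreal (2 * (c0 / \<Phi> r)) \<le> \<psi> z * ennreal (1 - f z + \<epsilon>)) \<Longrightarrow>
    x \<in> D \<Longrightarrow> dist z0 x < 3 / 2 * r \<Longrightarrow>
    B.GK \<psi> D (indicator S) x \<le> ennreal (c * \<Phi> r / vr r) * emeasure m S * ennreal (1 - f x + \<epsilon>)"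
proof -
  have a: "(1::real) < 19 / 10" "19 / 10 < (2::real)" by auto
  obtain c1 where c1: "0 < c1" "\<And>r x y. r0 \<le> r \<Longrightarrow> dist z0 x < 19 / 10 * r \<Longrightarrow> 2 * r < dist z0 y \<Longrightarrow> dist z0 y < 4 * r \<Longrightarrow>
     G (U r) x y \<le> ennreal (c1 * \<Phi> r / vr r) \<and> G' (U r) x y \<le> ennreal (c1 * \<Phi> r / vr r)"
    by (rule D2_green[OF a]) blast
  \<comment> \<open>19/15 is the ratio of 19/10 to 3/2: jumps from inside 3r/2 to beyond 19r/10. The
    radius 19/10 stays below the limit 2 in (D2).\<close>
  have a2: "(1::real) < 19 / 15" "19 / 15 \<le> (2::real)" by auto
  obtain c2 where c2: "1 \<le> c2" "\<And>s z y. r0 \<le> s \<Longrightarrow> dist z0 z < s \<Longrightarrow> 19 / 15 * s \<le> dist z0 y \<Longrightarrow>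
    j y z \<le> c2 * j y z0 \<and> j y z0 \<le> c2 * j y z \<and> j' y z \<le> c2 * j' y z0 \<and> j' y z0 \<le> c2 * j' y z"
    by (rule C2_kernel[OF a2]) blast
  obtain c3 where c3: "0 < c3" "\<And>r D w. r0 \<le> r \<Longrightarrow> open D \<Longrightarrow> D \<subseteq> U r \<Longrightarrow> 2 * r < dist z0 w \<Longrightarrow> dist z0 w < 4 * r \<Longrightarrow>
    Pd D w \<le> ennreal (c3 / vr r)"
    using Pd_middle by blast
  \<comment> \<open>\<open>c1\<close> is the (D2) bound. Multiplied by \<delta> = c0/\<Phi>(r) and
    \<Phi>(r)/V(r), the second summand becomes c2 c3/V(r), the rate of far jumps weighted by the
    potential, per unit mass of S.\<close>
  define c where "c = c1 + c2 * c3 / c0"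
  show ?thesis
  proof (rule that[of c])
    show "0 < c" using c1 c2 c3 \<delta>c by (simp add: c_def add_pos_pos)
    fix r D S f g \<epsilon> \<psi> x
    assume r: "r0 \<le> r" and D: "open D" "D \<subseteq> U r" and Sm: "S \<in> sets borel" and S: "S \<subseteq> {y. 2 * r < dist z0 y \<and> dist z0 y < 4 * r}"
      and f: "f \<in> test_functions m \<D> (closed_ball z0 (5 / 4 * r)) (ball z0 (3 / 2 * r))" and gen: "generates C_zero X' f g"
      and g: "\<And>z. - g z \<le> c0 / \<Phi> r" and \<epsilon>: "0 \<le> \<epsilon>" and \<psi>: "rate \<psi>"
      and big: "\<And>z. dist z0 z < 3 / 2 * r \<Longrightarrow> ennreal (2 * (c0 / \<Phi> r)) \<le> \<psi> z * ennreal (1 - f z + \<epsilon>)"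
      and x: "x \<in> D" "dist z0 x < 3 / 2 * r"
    have rp: "0 < r" using r r0 by simp
    note v = vr_pos[OF rp] and \<Phi> = Phi_pos[OF rp]
    define \<delta> where "\<delta> = c0 / \<Phi> r"
    have \<delta>: "0 < \<delta>" using \<delta>c \<Phi> by (simp add: \<delta>_def)
    let ?p = "indicator S :: 'a \<Rightarrow> ennreal" and ?\<mu> = "emeasure m S"
    let ?v = "\<lambda>z. ennreal (1 - f z + \<epsilon>)"
    define W where "W = D \<inter> ball z0 (3 / 2 * r)"
    have W: "open W" "W \<subseteq> D" using D by (auto simp: W_def)
    have f01: "0 \<le> f z" "f z \<le> 1" for z using f by (auto simp: test_functions_def)
    have f0: "f z = 0" if "3 / 2 * r \<le> dist z0 z" for z using f that by (auto simp: test_functions_def)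
    have fm[measurable]: "f \<in> borel_measurable borel" using B.gen_bounded(1)[OF gen] by (rule bounded_borel_measurable)
    have pm[measurable]: "?p \<in> borel_measurable borel" using Sm by simp
    note [measurable] = rate_measurable[OF \<psi>]
    define k where "k = B.GK \<psi> D ?p"
    have km[measurable]: "k \<in> borel_measurable borel" unfolding k_def by measurable
    have k_le: "k z \<le> B.Gr D ?p z" for z unfolding k_def by (rule B.GK_le_GK0)
    have k_out: "k z = 0" if "z \<notin> D" for z unfolding k_def using that by (rule B.GK_outside[OF D(1)])
    obtain b where b: "0 \<le> b" "\<And>y. B.Gr D (indicator (cball z0 (4 * r))) y \<le> ennreal b"
      by (rule dual_green_bounded[OF r D]) blast
    have k_b: "k z \<le> ennreal b" for z
    proof -
      have "B.Gr D ?p z \<le> B.Gr D (indicator (cball z0 (4 * r))) z"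
        using S by (intro B.GK_mono[OF D(1)]) (auto split: split_indicator)
      then show ?thesis using k_le[of z] b(2)[of z] by (meson order_trans)
    qed
    have W1: "B.Gr W (\<lambda>_. 1) y < top" for y
    proof -
      obtain b1 where b1: "\<And>y. B.Gr W (indicator (cball z0 (3 / 2 * r))) y \<le> ennreal b1"
        by (rule dual_green_bounded[OF r W(1) order_trans[OF W(2) D(2)]]) blast
      have "B.Gr W (\<lambda>_. 1) y = B.Gr W (indicator (cball z0 (3 / 2 * r))) y"
        by (rule B.GK_cong[OF W(1)]) (auto simp: W_def split: split_indicator)
      then show ?thesis using b1[of y] by (simp add: le_less_trans)
    qed
    \<comment> \<open>\<open>S\<close> lies beyond 2r and thus outside \<open>W\<close>, so the
      potential has no source in \<open>W\<close> and only the exit term remains.\<close>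
    have k_W: "k x = B.HK \<psi> W k x"
    proof -
      have "k x = B.GK \<psi> W ?p x + B.HK \<psi> W k x"
        unfolding k_def by (rule B.GK_strong_markov[OF D(1) W \<psi> pm])
      also have "B.GK \<psi> W ?p x = B.GK \<psi> W (\<lambda>_. 0) x"
        using S rp by (intro B.GK_cong[OF W(1)]) (auto simp: W_def split: split_indicator)
      finally show ?thesis by (simp add: B.GK_zero)
    qed
    let ?k1 = "\<lambda>z. indicator {z. dist z0 z < 19 / 10 * r} z * k z" and ?k2 = "\<lambda>z. indicator {z. 19 / 10 * r \<le> dist z0 z} z * k z"
    have k_split: "B.HK \<psi> W k x = B.HK \<psi> W ?k1 x + B.HK \<psi> W ?k2 x"
    proof -
      have "B.HK \<psi> W k x = B.HK \<psi> W (\<lambda>z. ?k1 z + ?k2 z) x"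
        by (intro B.HK_cong[OF W(1)]) (auto split: split_indicator)
      also have "\<dots> = B.HK \<psi> W ?k1 x + B.HK \<psi> W ?k2 x" by (rule B.HK_add) measurable
      finally show ?thesis .
    qed
    let ?A = "ennreal (c1 * \<Phi> r / vr r) * ?\<mu>"
    have near: "B.HK \<psi> W ?k1 x \<le> ?A * B.HK \<psi> W ?v x"
    proof -
      have "B.HK \<psi> W ?k1 x \<le> B.HK \<psi> W (\<lambda>z. ?A * ?v z) x"
      proof (rule B.HK_mono[OF W(1)])
        fix z assume zW: "z \<notin> W"
        show "?k1 z \<le> ?A * ?v z"
        proof (cases "z \<in> D \<and> dist z0 z < 19 / 10 * r")
          case True
          then have "1 \<le> ?v z" using f0[of z] zW \<epsilon> by (simp add: W_def)
          have "k z \<le> B.Gr (U r) ?p z"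
            using k_le[of z] B.GK_domain_mono[OF U_open D pm, of z] by (meson order_trans)
          also have "\<dots> = (\<integral>\<^sup>+y. ?p y * G' (U r) z y \<partial>m)" by (rule B.Gr_eq[OF U_open pm])
          also have "\<dots> \<le> (\<integral>\<^sup>+y. ennreal (c1 * \<Phi> r / vr r) * ?p y \<partial>m)"
            using c1(2)[OF r, of z] S True by (intro nn_integral_mono) (auto split: split_indicator)
          also have "\<dots> = ?A" using Sm by (subst nn_integral_cmult_indicator) (auto simp: A.sets_m)
          also have "\<dots> \<le> ?A * ?v z" using mult_left_mono[OF \<open>1 \<le> ?v z\<close>, of ?A] by simp
          finally show ?thesis using True by simp
        next
          case False
          then show ?thesis using k_out[of z] by (auto split: split_indicator)
        qed
      qed
      also have "\<dots> = ?A * B.HK \<psi> W ?v x" by (rule B.HK_cmult) measurable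
      finally show ?thesis .
    qed
    let ?A2 = "ennreal (c2 * c3 / vr r) * ?\<mu>"
    have far: "B.HK \<psi> W ?k2 x \<le> ?A2 * B.GK \<psi> W (\<lambda>_. 1) x"
    proof -
      have "B.HK \<psi> W ?k2 x = B.GK \<psi> W (B.jump ?k2) x"
      proof (rule B.levy_system_killed[OF W(1) \<psi>])
        fix y assume "y \<in> W"
        show "B.Hr W ?k2 y = B.Gr W (B.jump ?k2) y"
        proof (rule B.levy_system[OF W(1)])
          show "closed {z. 19 / 10 * r \<le> dist z0 z}" by (intro closed_Collect_le continuous_intros)
          show "open {z. 3 / 2 * r < dist z0 z}" by (intro open_Collect_less continuous_intros)
          show "{z. 19 / 10 * r \<le> dist z0 z} \<subseteq> {z. 3 / 2 * r < dist z0 z}" using rp by auto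
          show "{z. 3 / 2 * r < dist z0 z} \<inter> W = {}" by (auto simp: W_def)
        qed (use \<open>y \<in> W\<close> in \<open>auto split: split_indicator\<close>)
      next
        show "B.jump ?k2 \<in> borel_measurable borel" by (rule B.jump_measurable) measurable
        show "?k2 z \<le> ennreal b" for z using k_b[of z] by (auto split: split_indicator)
        show "x \<in> W" using x by (simp add: W_def)
      qed (use W1 in auto)
      also have "\<dots> \<le> B.GK \<psi> W (\<lambda>_. ?A2 * 1) x"
      proof (rule B.GK_mono[OF W(1)])
        fix y assume "y \<in> W"
        then have y: "dist z0 y < 3 / 2 * r" by (simp add: W_def)
        have "B.jump ?k2 y \<le> (\<integral>\<^sup>+z. ennreal c2 * (J z * B.Gr D ?p z) \<partial>m)"
          unfolding B.jump_def
        proof (rule nn_integral_mono)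
          fix z
          show "?k2 z * ennreal (j' y z) \<le> ennreal c2 * (J z * B.Gr D ?p z)"
          proof (cases "19 / 10 * r \<le> dist z0 z")
            case True
            then have "j z y \<le> c2 * j z z0" using c2(2)[of "3 / 2 * r" y z] y r rp by auto
            moreover have "j z y = j' y z" using True y rp by (intro j_dual) auto
            ultimately have "ennreal (j' y z) \<le> ennreal c2 * J z"
              using c2 A.j_nonneg[of z z0] by (simp add: ennreal_mult[symmetric] ennreal_leI)
            from mult_mono[OF k_le[of z] this] show ?thesis using True by (simp add: ac_simps)
          qed simp
        qed
        also have "\<dots> = ennreal c2 * (\<integral>\<^sup>+z. J z * B.Gr D ?p z \<partial>m)" by (rule nn_integral_cmult) measurable
        \<comment> \<open>Duality turns the jump rate, weighted by the dual potential of
          \<open>S\<close>, into the Poisson kernel on \<open>S\<close>, which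
          \<open>Pd_middle\<close> bounds.\<close>
        also have "(\<integral>\<^sup>+z. J z * B.Gr D ?p z \<partial>m) = (\<integral>\<^sup>+z. ?p z * Pd D z \<partial>m)"
          unfolding Pd_def by (rule green_duality[OF D(1), symmetric]) measurable
        also have "\<dots> \<le> (\<integral>\<^sup>+z. ennreal (c3 / vr r) * ?p z \<partial>m)"
          using c3(2)[OF r D] S by (intro nn_integral_mono) (auto split: split_indicator)
        also have "\<dots> = ennreal (c3 / vr r) * ?\<mu>" using Sm by (subst nn_integral_cmult_indicator) (auto simp: A.sets_m)
        also have "ennreal c2 * (ennreal (c3 / vr r) * ?\<mu>) = ?A2 * 1"
          using c2 c3 v by (simp add: ennreal_mult[symmetric] mult.assoc[symmetric])
        finally show "B.jump ?k2 y \<le> ?A2 * 1" by (simp add: mult_left_mono)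
      qed
      also have "\<dots> = ?A2 * B.GK \<psi> W (\<lambda>_. 1) x" by (rule B.GK_cmult) measurable
      finally show ?thesis .
    qed
    let ?C = "ennreal (c * \<Phi> r / vr r) * ?\<mu>"
    have A_le: "?A \<le> ?C" "?A2 \<le> ?C * ennreal \<delta>"
    proof -
      show "?A \<le> ?C"
        using v \<Phi> c2 c3 \<delta>c by (intro mult_right_mono ennreal_leI divide_right_mono) (auto simp: c_def)
      have "c2 * c3 / vr r \<le> c * \<Phi> r / vr r * \<delta>"
      proof -
        have "c * \<Phi> r / vr r * \<delta> = c1 * c0 / vr r + c2 * c3 / vr r"
          using v \<Phi> \<delta>c by (simp add: c_def \<delta>_def field_simps)
        then show ?thesis using c1 v \<delta>c by simp
      qed
      then have "?A2 \<le> ennreal (c * \<Phi> r / vr r * \<delta>) * ?\<mu>" by (intro mult_right_mono ennreal_leI) auto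
      also have "\<dots> = ?C * ennreal \<delta>"
        using \<delta> v \<Phi> \<open>0 < c\<close> by (subst ennreal_mult) (auto simp: ac_simps)
      finally show "?A2 \<le> ?C * ennreal \<delta>" .
    qed
    have "k x \<le> ?A * B.HK \<psi> W ?v x + ?A2 * B.GK \<psi> W (\<lambda>_. 1) x"
      unfolding k_W k_split by (rule add_mono[OF near far])
    also have "\<dots> \<le> ?C * B.HK \<psi> W ?v x + ?C * ennreal \<delta> * B.GK \<psi> W (\<lambda>_. 1) x"
      by (intro add_mono mult_right_mono A_le) auto
    also have "\<dots> = ?C * (B.HK \<psi> W ?v x + ennreal \<delta> * B.GK \<psi> W (\<lambda>_. 1) x)" by (simp add: distrib_left mult.assoc)
    also have "\<dots> \<le> ?C * ?v x"
    proof (intro mult_left_mono B.killed_supersolution[OF gen f01 _ _ W(1) W1 \<psi> \<epsilon>])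
      show "- g z \<le> \<delta>" for z using g by (simp add: \<delta>_def)
      show "ennreal (2 * \<delta>) \<le> \<psi> z * ennreal (1 - f z + \<epsilon>)" if "z \<in> W" for z
        using big[of z] that by (simp add: W_def \<delta>_def)
    qed (use \<delta> in auto)
    finally show "B.GK \<psi> D ?p x \<le> ?C * ?v x" unfolding k_def .
  qed
qed

lemma harmonic_restrict:
  assumes D: "open D" "open W" "W \<subseteq> D" and h: "h \<in> borel_measurable borel" "\<And>z. h z = A.Hr D h z"
  shows "h z = A.Hr W h z"
proof -
  have "A.Hr D h = h" using h(2) by auto
  then show ?thesis using A.HK_strong_markov[OF D A.rate0 h(1), of z] by simp
qed

text \<open>\<open>D'\<close> arises from \<open>D\<close> by removing part of the region where the
  rates tend to infinity. After leaving \<open>D'\<close> the process is either outside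
  \<open>D\<close> or in that region, where the killed exit functions tend to 0; dominated
  convergence under the exit distribution of \<open>D'\<close> uses h itself as the bound.\<close>

lemma killing_limit:
  assumes D: "open D" "open D'" "D' \<subseteq> D" and V: "open V" "D - D' \<subseteq> V"
    and \<psi>: "\<And>n. rate (\<psi> n)" and b: "0 < b" and big: "\<And>n y. y \<in> V \<Longrightarrow> ennreal (b * real n) \<le> \<psi> n y"
    and h[measurable]: "h \<in> borel_measurable borel" and harm: "\<And>z. h z = A.Hr D h z" and fin: "\<And>z. h z < top"
    and le: "\<And>n. h y0 \<le> A.HK (\<psi> n) D h y0 + \<kappa>"
  shows "h y0 \<le> A.Hr D' (\<lambda>z. indicator (- D) z * h z) y0 + \<kappa>"
proof -
  note [measurable] = rate_measurable[OF \<psi>]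
  have Dm[measurable]: "D \<in> sets borel" using D by auto
  let ?k = "\<lambda>n. A.HK (\<psi> n) D h"
  have k_le: "?k n z \<le> h z" for n z using A.HK_le_HK0[of "\<psi> n" D h z] harm[of z] by simp
  have lim: "(\<lambda>n. ?k n z) \<longlonglongrightarrow> indicator (- D) z * h z" if "z \<notin> D'" for z
  proof (cases "z \<in> D")
    case True
    have "(\<lambda>n. ?k n z) \<longlonglongrightarrow> 0"
    proof (rule A.HK_vanish[OF D(1) V(1) _ True \<psi> b big h])
      show "z \<in> V" using True that V(2) by auto
      show "A.Hr D h z < top" using fin[of z] harm[of z] by simp
    qed
    then show ?thesis using True by simp
  next
    case False
    then show ?thesis by (simp add: A.HK_outside[OF D(1)])
  qed
  have "(\<lambda>n. \<integral>\<^sup>+w. A.exit_fun (\<lambda>_. 0) D' (?k n) w \<partial>law X (Some y0)) \<longlonglongrightarrow>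
      (\<integral>\<^sup>+w. A.exit_fun (\<lambda>_. 0) D' (\<lambda>z. indicator (- D) z * h z) w \<partial>law X (Some y0))"
  proof (rule nn_integral_dominated_convergence[where w = "A.exit_fun (\<lambda>_. 0) D' h"])
    show "(\<integral>\<^sup>+w. A.exit_fun (\<lambda>_. 0) D' h w \<partial>law X (Some y0)) < \<infinity>"
      using harmonic_restrict[OF D h harm, of y0] fin[of y0] by (simp add: A.HK_def)
    show "AE w in law X (Some y0). A.exit_fun (\<lambda>_. 0) D' (?k n) w \<le> A.exit_fun (\<lambda>_. 0) D' h w" for n
    proof (rule AE_I2)
      fix w
      show "A.exit_fun (\<lambda>_. 0) D' (?k n) w \<le> A.exit_fun (\<lambda>_. 0) D' h w"
        using k_le[of n] by (cases "path X (A.exit_at D' w) w") (auto simp: A.exit_fun_def)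
    qed
    show "AE w in law X (Some y0). (\<lambda>n. A.exit_fun (\<lambda>_. 0) D' (?k n) w) \<longlonglongrightarrow>
        A.exit_fun (\<lambda>_. 0) D' (\<lambda>z. indicator (- D) z * h z) w"
      using A.AE_exit[OF D(2), of "Some y0"]
    proof eventually_elim
      case (elim w)
      show ?case
        using lim elim by (cases "path X (A.exit_at D' w) w") (auto simp: A.exit_fun_def)
    qed
  qed (simp_all add: A.exit_fun_measurable)
  then have "(\<lambda>n. A.Hr D' (?k n) y0 + \<kappa>) \<longlonglongrightarrow> A.Hr D' (\<lambda>z. indicator (- D) z * h z) y0 + \<kappa>"
    unfolding A.HK_def[of "\<lambda>_. 0" D'] by (intro tendsto_add tendsto_const)
  moreover have "h y0 \<le> A.Hr D' (?k n) y0 + \<kappa>" for n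
  proof -
    have "?k n y0 = A.HK (\<psi> n) D' (?k n) y0" by (rule A.HK_strong_markov[OF D \<psi> h])
    also have "\<dots> \<le> A.Hr D' (?k n) y0" by (rule A.HK_le_HK0)
    finally show ?thesis using le[of n] by (meson add_right_mono order_trans)
  qed
  ultimately show ?thesis
    by (intro LIMSEQ_le_const[of "\<lambda>n. A.Hr D' (?k n) y0 + \<kappa>"]) auto
qed

text \<open>Only the case of a finite integral over the ball has content, and its finiteness is what
  killed duality requires. Testing with arbitrary sets \<open>S\<close> gives the bound almost
  everywhere on the open set \<open>M\<close>, for all rates at once, and harmonicity in
  \<open>M\<close> makes it hold at every point.\<close>

lemma harmonic_middle:
  obtains c where "0 < c" "\<And>r D h w. r0 \<le> r \<Longrightarrow> open D \<Longrightarrow> D \<subseteq> U r \<Longrightarrow> h \<in> borel_measurable borel \<Longrightarrow>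
    (\<And>z. h z < top) \<Longrightarrow> (\<And>z. h z = A.Hr D h z) \<Longrightarrow> (\<And>z. z \<notin> D \<Longrightarrow> z \<notin> closed_ball z0 r \<Longrightarrow> h z = 0) \<Longrightarrow>
    w \<in> D \<Longrightarrow> 2 * r < dist z0 w \<Longrightarrow> dist z0 w < 4 * r \<Longrightarrow>
    h w \<le> ennreal (c / vr r) * (\<integral>\<^sup>+z. indicator (ball z0 (2 * r)) z * h z \<partial>m)"
proof -
  obtain c0 where c0: "0 < c0" "\<And>r. r0 \<le> r \<Longrightarrow> \<exists>f g. f \<in> test_functions m \<D> (closed_ball z0 (5 / 4 * r)) (ball z0 (3 / 2 * r)) \<and>
    generates C_zero X' f g \<and> (\<forall>z. - g z \<le> c0 / \<Phi> r)"
    using barrier by blast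
  obtain c1 where c1: "0 < c1" "\<And>r D S f g \<epsilon> \<psi> x. r0 \<le> r \<Longrightarrow> open D \<Longrightarrow> D \<subseteq> U r \<Longrightarrow>
    S \<in> sets borel \<Longrightarrow> S \<subseteq> {y. 2 * r < dist z0 y \<and> dist z0 y < 4 * r} \<Longrightarrow>
    f \<in> test_functions m \<D> (closed_ball z0 (5 / 4 * r)) (ball z0 (3 / 2 * r)) \<Longrightarrow> generates C_zero X' f g \<Longrightarrow>
    (\<And>z. - g z \<le> c0 / \<Phi> r) \<Longrightarrow> 0 \<le> \<epsilon> \<Longrightarrow> rate \<psi> \<Longrightarrow>
    (\<And>z. dist z0 z < 3 / 2 * r \<Longrightarrow> ennreal (2 * (c0 / \<Phi> r)) \<le> \<psi> z * ennreal (1 - f z + \<epsilon>)) \<Longrightarrow>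
    x \<in> D \<Longrightarrow> dist z0 x < 3 / 2 * r \<Longrightarrow>
    B.GK \<psi> D (indicator S) x \<le> ennreal (c1 * \<Phi> r / vr r) * emeasure m S * ennreal (1 - f x + \<epsilon>)"
    by (rule killed_green_bound[OF c0(1)]) blast
  obtain c2 where c2: "0 < c2" "\<And>r D w. r0 \<le> r \<Longrightarrow> open D \<Longrightarrow> D \<subseteq> U r \<Longrightarrow> 2 * r < dist z0 w \<Longrightarrow> dist z0 w < 4 * r \<Longrightarrow>
    Pd D w \<le> ennreal (c2 / vr r)"
    using Pd_middle by blast
  have a: "(1::real) < 12 / 11" "12 / 11 \<le> (2::real)" by auto
  obtain c3 where c3: "1 \<le> c3" "\<And>s t D u x. r0 \<le> s \<Longrightarrow> t < s \<Longrightarrow> open D \<Longrightarrow> D \<subseteq> U (12 / 11 * s) \<Longrightarrow> x \<in> D \<Longrightarrow>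
    u \<in> borel_measurable borel \<Longrightarrow> (\<And>z. t < dist z0 z \<Longrightarrow> u z = 0) \<Longrightarrow>
    A.Hr D u x \<le> ennreal c3 * Pd D x * (\<integral>\<^sup>+z. u z \<partial>m) \<and> Pd D x * (\<integral>\<^sup>+z. u z \<partial>m) \<le> ennreal c3 * A.Hr D u x"
    by (rule levy_landing[OF a]) blast
  define c where "c = 2 * c0 * c1 + c3 * c2"
  show ?thesis
  proof (rule that[of c])
    show "0 < c" using c0 c1 c2 c3 by (simp add: c_def add_pos_pos)
    fix r D and h :: "'a \<Rightarrow> ennreal" and w
    assume r: "r0 \<le> r" and D: "open D" "D \<subseteq> U r" and h[measurable]: "h \<in> borel_measurable borel" and hfin: "\<And>z. h z < top"
      and harm: "\<And>z. h z = A.Hr D h z" and h0: "\<And>z. z \<notin> D \<Longrightarrow> z \<notin> closed_ball z0 r \<Longrightarrow> h z = 0"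
      and w: "w \<in> D" "2 * r < dist z0 w" "dist z0 w < 4 * r"
    have rp: "0 < r" using r r0 by simp
    note v = vr_pos[OF rp] and \<Phi> = Phi_pos[OF rp]
    define I where "I = (\<integral>\<^sup>+z. indicator (ball z0 (2 * r)) z * h z \<partial>m)"
    show "h w \<le> ennreal (c / vr r) * (\<integral>\<^sup>+z. indicator (ball z0 (2 * r)) z * h z \<partial>m)"
      unfolding I_def[symmetric]
    proof (cases "I = top")
      case True
      then show "h w \<le> ennreal (c / vr r) * I" using \<open>0 < c\<close> v by (simp add: ennreal_mult_top)
    next
      case False
      then have Ifin: "I < top" by (simp add: top.not_eq_extremum)
      define \<delta> where "\<delta> = c0 / \<Phi> r"
      have \<delta>: "0 < \<delta>" using c0 \<Phi> by (simp add: \<delta>_def)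
      obtain f g where f: "f \<in> test_functions m \<D> (closed_ball z0 (5 / 4 * r)) (ball z0 (3 / 2 * r))"
        and gen: "generates C_zero X' f g" and g: "\<And>z. - g z \<le> c0 / \<Phi> r"
        using c0(2)[OF r] by blast
      have f01: "0 \<le> f z" "f z \<le> 1" for z using f by (auto simp: test_functions_def)
      have bm[measurable]: "ball z0 t \<in> sets borel" for t by simp
      have f1: "f z = 1" if "dist z0 z < 5 / 4 * r" for z using f closed_ball_lt[OF that] by (simp add: test_functions_def)
      have [measurable]: "f \<in> borel_measurable borel" using B.gen_bounded(1)[OF gen] by (rule bounded_borel_measurable)
      define \<epsilon> where "\<epsilon> n = 1 / real (Suc n)" for n :: nat
      have \<epsilon>: "0 < \<epsilon> n" for n by (simp add: \<epsilon>_def)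
      \<comment> \<open>On the ball the product of the rate with 1 - f + \<epsilon> is exactly
        2\<delta>. It meets the barrier condition and also cancels the factor 1 - f + \<epsilon> in
        the bound for the killed potential; \<epsilon> > 0 keeps the rate bounded.\<close>
      define \<psi> where "\<psi> n z = indicator (ball z0 (3 / 2 * r)) z * ennreal (2 * \<delta> / (1 - f z + \<epsilon> n))" for n z
      have \<psi>: "rate (\<psi> n)" for n
        unfolding rate_def
      proof (intro conjI exI[of _ "2 * \<delta> / \<epsilon> n"] allI)
        show "\<psi> n \<in> borel_measurable borel" unfolding \<psi>_def by measurable
        show "0 \<le> 2 * \<delta> / \<epsilon> n" using \<delta> \<epsilon>[of n] by simp
        fix z
        have "2 * \<delta> / (1 - f z + \<epsilon> n) \<le> 2 * \<delta> / \<epsilon> n" using \<delta> \<epsilon>[of n] f01[of z] by (intro divide_left_mono) auto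
        then show "\<psi> n z \<le> ennreal (2 * \<delta> / \<epsilon> n)" by (auto simp: \<psi>_def intro: ennreal_leI split: split_indicator)
      qed
      note \<psi>m[measurable] = rate_measurable[OF \<psi>]
      have \<psi>_f: "\<psi> n z * ennreal (1 - f z + \<epsilon> n) = ennreal (2 * \<delta>)" if "dist z0 z < 3 / 2 * r" for n z
      proof -
        have "0 < 1 - f z + \<epsilon> n" using \<epsilon>[of n] f01[of z] by linarith
        then show ?thesis using that \<delta> by (simp add: \<psi>_def ennreal_mult[symmetric])
      qed
      define M where "M = D \<inter> {z. 2 * r < dist z0 z \<and> dist z0 z < 4 * r}"
      have M: "open M" "M \<subseteq> D"
        unfolding M_def using D(1) by (auto intro!: open_Int open_Collect_conj open_Collect_less continuous_intros)
      have Mm[measurable]: "M \<in> sets borel" using M by auto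
      have Mfin: "emeasure m M < top"
      proof -
        have "emeasure m M \<le> emeasure m (ball z0 (4 * r))" by (intro emeasure_mono) (auto simp: M_def A.sets_m)
        then show ?thesis using vol_finite[of "4 * r"] by (rule le_less_trans)
      qed
      let ?\<kappa> = "ennreal (2 * c0 * c1 / vr r) * I"
      have killed: "AE z in m. z \<in> M \<longrightarrow> h z \<le> A.HK (\<psi> n) D h z + ?\<kappa>" for n
      proof (rule AE_le_by_integrals)
        fix S assume "S \<in> sets m" and SM: "S \<subseteq> M"
        then have S[measurable]: "S \<in> sets borel" by (simp add: A.sets_m)
        have S': "S \<subseteq> {y. 2 * r < dist z0 y \<and> dist z0 y < 4 * r}" using SM by (auto simp: M_def)
        let ?p = "indicator S :: 'a \<Rightarrow> ennreal"
        have "(\<integral>\<^sup>+x. ?p x * h x \<partial>m) = (\<integral>\<^sup>+x. ?p x * A.HK (\<psi> n) D h x + ?p x * A.GK (\<psi> n) D (\<lambda>z. \<psi> n z * h z) x \<partial>m)"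
        proof (intro nn_integral_cong)
          fix x
          have "A.Hr D h = h" using harm by auto
          then have "h x = A.HK (\<psi> n) D h x + A.GK (\<psi> n) D (\<lambda>z. \<psi> n z * h z) x"
            using A.HK_perturb[OF D(1) \<psi> h, of x n] by simp
          then show "?p x * h x = ?p x * A.HK (\<psi> n) D h x + ?p x * A.GK (\<psi> n) D (\<lambda>z. \<psi> n z * h z) x"
            by (metis distrib_left)
        qed
        also have "\<dots> = (\<integral>\<^sup>+x. ?p x * A.HK (\<psi> n) D h x \<partial>m) + (\<integral>\<^sup>+x. ?p x * A.GK (\<psi> n) D (\<lambda>z. \<psi> n z * h z) x \<partial>m)"
          by (rule nn_integral_add) measurable
        also have "(\<integral>\<^sup>+x. ?p x * A.GK (\<psi> n) D (\<lambda>z. \<psi> n z * h z) x \<partial>m) = (\<integral>\<^sup>+z. \<psi> n z * h z * B.GK (\<psi> n) D ?p z \<partial>m)"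
        proof (rule killed_duality[OF D(1) \<psi>])
          obtain b where b: "0 \<le> b" "\<And>y. B.Gr D (indicator (cball z0 (4 * r))) y \<le> ennreal b"
            by (rule dual_green_bounded[OF r D]) blast
          obtain \<kappa> where \<kappa>: "0 \<le> \<kappa>" "\<And>z. \<psi> n z \<le> ennreal \<kappa>" using \<psi>[of n] by (auto simp: rate_def)
          have "(\<integral>\<^sup>+z. \<psi> n z * h z * B.Gr D ?p z \<partial>m) \<le> (\<integral>\<^sup>+z. ennreal \<kappa> * ennreal b * (indicator (ball z0 (2 * r)) z * h z) \<partial>m)"
          proof (rule nn_integral_mono)
            fix z
            have "B.Gr D ?p z \<le> B.Gr D (indicator (cball z0 (4 * r))) z"
              using S' by (intro B.GK_mono[OF D(1)]) (auto split: split_indicator)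
            then have Gb: "B.Gr D ?p z \<le> ennreal b" using b(2)[of z] by (rule order_trans)
            have "\<psi> n z \<le> ennreal \<kappa> * indicator (ball z0 (2 * r)) z"
              using \<kappa>(2)[of z] rp by (cases "z \<in> ball z0 (3 / 2 * r)") (auto simp: \<psi>_def)
            then have "\<psi> n z * h z * B.Gr D ?p z \<le> ennreal \<kappa> * indicator (ball z0 (2 * r)) z * h z * ennreal b"
              using Gb by (intro mult_mono) auto
            then show "\<psi> n z * h z * B.Gr D ?p z \<le> ennreal \<kappa> * ennreal b * (indicator (ball z0 (2 * r)) z * h z)"
              by (simp add: ac_simps)
          qed
          also have "\<dots> = ennreal \<kappa> * ennreal b * I" unfolding I_def by (rule nn_integral_cmult) measurable
          also have "\<dots> < top" using Ifin by (simp add: ennreal_mult_less_top)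
          finally show "(\<integral>\<^sup>+z. \<psi> n z * h z * B.Gr D ?p z \<partial>m) < top" .
        qed measurable
        also have "\<dots> \<le> (\<integral>\<^sup>+z. ennreal (2 * c0 * c1 / vr r) * emeasure m S * (indicator (ball z0 (2 * r)) z * h z) \<partial>m)"
        proof (rule nn_integral_mono)
          fix z
          show "\<psi> n z * h z * B.GK (\<psi> n) D ?p z \<le> ennreal (2 * c0 * c1 / vr r) * emeasure m S * (indicator (ball z0 (2 * r)) z * h z)"
          proof (cases "z \<in> D \<and> dist z0 z < 3 / 2 * r")
            case True
            have "B.GK (\<psi> n) D ?p z \<le> ennreal (c1 * \<Phi> r / vr r) * emeasure m S * ennreal (1 - f z + \<epsilon> n)"
              using \<psi>_f \<epsilon>[of n] True
              by (intro c1(2)[OF r D S S' f gen g _ \<psi>]) (auto simp: \<delta>_def)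
            then have "\<psi> n z * h z * B.GK (\<psi> n) D ?p z \<le> \<psi> n z * h z * (ennreal (c1 * \<Phi> r / vr r) * emeasure m S * ennreal (1 - f z + \<epsilon> n))"
              by (rule mult_left_mono) simp
            also have "\<dots> = (ennreal (c1 * \<Phi> r / vr r) * (\<psi> n z * ennreal (1 - f z + \<epsilon> n))) * emeasure m S * h z" by (simp only: ac_simps)
            also have "ennreal (c1 * \<Phi> r / vr r) * (\<psi> n z * ennreal (1 - f z + \<epsilon> n)) = ennreal (2 * c0 * c1 / vr r)"
              using \<psi>_f[of z n] True c0 c1 \<Phi> v by (simp add: ennreal_mult[symmetric] \<delta>_def field_simps)
            finally show ?thesis using True rp by simp
          next
            case False
            then have "\<psi> n z = 0 \<or> B.GK (\<psi> n) D ?p z = 0" using B.GK_outside[OF D(1), of z] by (auto simp: \<psi>_def)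
            then show ?thesis by auto
          qed
        qed
        also have "\<dots> = ennreal (2 * c0 * c1 / vr r) * emeasure m S * I" unfolding I_def by (rule nn_integral_cmult) measurable
        also have "\<dots> = (\<integral>\<^sup>+x. ?\<kappa> * ?p x \<partial>m)" by (subst nn_integral_cmult_indicator) (auto simp: A.sets_m ac_simps)
        also have "(\<integral>\<^sup>+x. ?p x * A.HK (\<psi> n) D h x \<partial>m) + (\<integral>\<^sup>+x. ?\<kappa> * ?p x \<partial>m) = (\<integral>\<^sup>+x. ?p x * A.HK (\<psi> n) D h x + ?\<kappa> * ?p x \<partial>m)"
          by (rule nn_integral_add[symmetric]) measurable
        also have "\<dots> = (\<integral>\<^sup>+x. ?p x * (A.HK (\<psi> n) D h x + ?\<kappa>) \<partial>m)"
          by (intro nn_integral_cong) (simp add: distrib_left mult.commute)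
        finally show "(\<integral>\<^sup>+x. ?p x * h x \<partial>m) \<le> (\<integral>\<^sup>+x. ?p x * (A.HK (\<psi> n) D h x + ?\<kappa>) \<partial>m)"
          by (simp add: add_left_mono)
      qed (use Mfin hfin in \<open>auto simp: A.sets_m\<close>)
      \<comment> \<open>6/5 lies below 5/4, so what is removed from \<open>D\<close> is in the
        region where f = 1 and the rates blow up. It equals (12/11)(11/10), with 11r/10 strictly
        above the landing radius r, as \<open>levy_landing\<close> needs.\<close>
      define D' where "D' = D \<inter> U (6 / 5 * r)"
      have D': "open D'" "D' \<subseteq> D" "D' \<subseteq> U (12 / 11 * (11 / 10 * r))" using D by (auto simp: D'_def)
      let ?u = "\<lambda>z. indicator (- D) z * h z"
      have Dm[measurable]: "D \<in> sets borel" using D by auto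
      have u0: "?u z = 0" if "r < dist z0 z" for z
        using h0[of z] closed_ball_le[of z r] that by (auto split: split_indicator)
      have u_le: "?u z \<le> indicator (ball z0 (2 * r)) z * h z" for z
        using u0[of z] rp by (auto split: split_indicator simp: not_less)
      have bound: "h z \<le> ennreal (c / vr r) * I" if "z \<in> M" and le: "\<forall>n. z \<in> M \<longrightarrow> h z \<le> A.HK (\<psi> n) D h z + ?\<kappa>" for z
      proof -
        have zD: "z \<in> D'" using that(1) rp dist_U[of "6 / 5 * r" z] by (simp add: M_def D'_def)
        have "h z \<le> A.Hr D' ?u z + ?\<kappa>"
        proof (rule killing_limit[OF D(1) D'(1,2) open_ball _ \<psi> _ _ h harm hfin])
          show "D - D' \<subseteq> ball z0 (5 / 4 * r)" using closed_ball_le[of _ "6 / 5 * r"] rp by (fastforce simp: D'_def)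
          show "0 < 2 * \<delta>" using \<delta> by simp
          show "ennreal (2 * \<delta> * real n) \<le> \<psi> n y" if "y \<in> ball z0 (5 / 4 * r)" for n y
            using that f1[of y] rp \<delta> by (auto simp: \<psi>_def \<epsilon>_def intro!: ennreal_leI)
          show "h z \<le> A.HK (\<psi> n) D h z + ?\<kappa>" for n using le \<open>z \<in> M\<close> by blast
        qed
        also have "A.Hr D' ?u z \<le> ennreal c3 * Pd D' z * (\<integral>\<^sup>+y. ?u y \<partial>m)"
          using r rp zD D' u0 by (intro c3(2)[of "11 / 10 * r" r, THEN conjunct1]) auto
        also have "\<dots> \<le> ennreal c3 * ennreal (c2 / vr r) * I"
        proof (intro mult_mono order_refl)
          have "Pd D' z \<le> Pd D z" by (rule Pd_mono[OF D(1) D'(1,2)])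
          also have "\<dots> \<le> ennreal (c2 / vr r)" using that(1) by (intro c2(2)[OF r D]) (auto simp: M_def)
          finally show "Pd D' z \<le> ennreal (c2 / vr r)" .
          show "(\<integral>\<^sup>+y. ?u y \<partial>m) \<le> I" unfolding I_def by (intro nn_integral_mono u_le)
        qed auto
        also have "ennreal c3 * ennreal (c2 / vr r) * I + ?\<kappa> = (ennreal (c3 * c2 / vr r) + ennreal (2 * c0 * c1 / vr r)) * I"
          using c2 c3 v by (simp add: ennreal_mult[symmetric] distrib_right)
        also have "ennreal (c3 * c2 / vr r) + ennreal (2 * c0 * c1 / vr r) = ennreal (c / vr r)"
          using c0 c1 c2 c3 v by (subst ennreal_plus[symmetric]) (auto simp: c_def add_divide_distrib)
        finally show ?thesis by (simp add: add_right_mono)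
      qed
      show "h w \<le> ennreal (c / vr r) * I"
      proof (rule A.harmonic_le_AE[OF M(1) h])
        show "h z = A.Hr M h z" for z by (rule harmonic_restrict[OF D(1) M h harm])
        show "w \<in> M" "h w < top" using w hfin by (auto simp: M_def)
        have "AE z in m. \<forall>n. z \<in> M \<longrightarrow> h z \<le> A.HK (\<psi> n) D h z + ?\<kappa>" unfolding AE_all_countable using killed by blast
        then show "AE z in m. z \<in> M \<longrightarrow> h z \<le> ennreal (c / vr r) * I"
          by (rule eventually_mono) (use bound in blast)
      qed
    qed
  qed
qed

lemma vr_shrink4:
  obtains c where "1 \<le> c" "\<And>r s. 0 < r \<Longrightarrow> s \<le> 4 * r \<Longrightarrow> vr s \<le> c * vr r"
proof -
  obtain d where d: "1 \<le> d" "\<And>r s. 0 < s \<Longrightarrow> r \<le> 2 * s \<Longrightarrow> vr r \<le> d * vr s" using vr_shrink by blast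
  show ?thesis
  proof (rule that[of "d * d"])
    show "1 \<le> d * d" using d(1) mult_mono[of 1 d 1 d] by simp
    fix r s :: real assume r: "0 < r" "s \<le> 4 * r"
    have "vr s \<le> d * vr (2 * r)" using r by (intro d) auto
    also have "\<dots> \<le> d * (d * vr r)" using r d(1) by (intro mult_left_mono d) auto
    finally show "vr s \<le> d * d * vr r" by simp
  qed
qed

section \<open>The two inequalities\<close>

text \<open>On exit from the part of \<open>D\<close> beyond 3r the process is within 5r/2, where
  the landing density applies, or between 5r/2 and 3r, where h is bounded by
  \<open>harmonic_middle\<close>. A buffer between the two radii is needed because the density
  comparison fails up to the sphere.\<close>

lemma harmonic_upper:
  assumes a: "1 < a"
  obtains c where "0 < c" "\<And>r D h x. r0 \<le> r \<Longrightarrow> open D \<Longrightarrow> D \<subseteq> U r \<Longrightarrow> h \<in> borel_measurable borel \<Longrightarrow>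
    (\<And>z. h z < top) \<Longrightarrow> (\<And>z. h z = A.Hr D h z) \<Longrightarrow> (\<And>z. z \<notin> D \<Longrightarrow> z \<notin> closed_ball z0 r \<Longrightarrow> h z = 0) \<Longrightarrow>
    x \<in> D \<Longrightarrow> 8 * r \<le> dist z0 x \<Longrightarrow>
    h x \<le> ennreal c * Pd D x * (\<integral>\<^sup>+z. indicator (ball z0 (2 * a * r)) z * h z \<partial>m)"
proof -
  obtain c1 where c1: "0 < c1" "\<And>r D h w. r0 \<le> r \<Longrightarrow> open D \<Longrightarrow> D \<subseteq> U r \<Longrightarrow> h \<in> borel_measurable borel \<Longrightarrow>
    (\<And>z. h z < top) \<Longrightarrow> (\<And>z. h z = A.Hr D h z) \<Longrightarrow> (\<And>z. z \<notin> D \<Longrightarrow> z \<notin> closed_ball z0 r \<Longrightarrow> h z = 0) \<Longrightarrow>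
    w \<in> D \<Longrightarrow> 2 * r < dist z0 w \<Longrightarrow> dist z0 w < 4 * r \<Longrightarrow>
    h w \<le> ennreal (c1 / vr r) * (\<integral>\<^sup>+z. indicator (ball z0 (2 * r)) z * h z \<partial>m)"
    by (rule harmonic_middle) blast
  have k: "(1::real) < 12 / 11" "12 / 11 \<le> (2::real)" by auto
  obtain c2 where c2: "1 \<le> c2" "\<And>s t D u x. r0 \<le> s \<Longrightarrow> t < s \<Longrightarrow> open D \<Longrightarrow> D \<subseteq> U (12 / 11 * s) \<Longrightarrow> x \<in> D \<Longrightarrow>
    u \<in> borel_measurable borel \<Longrightarrow> (\<And>z. t < dist z0 z \<Longrightarrow> u z = 0) \<Longrightarrow>
    A.Hr D u x \<le> ennreal c2 * Pd D x * (\<integral>\<^sup>+z. u z \<partial>m) \<and> Pd D x * (\<integral>\<^sup>+z. u z \<partial>m) \<le> ennreal c2 * A.Hr D u x"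
    by (rule levy_landing[OF k]) blast
  obtain c3 where c3: "0 < c3" "\<And>s q D x. r0 \<le> s \<Longrightarrow> s < q \<Longrightarrow> q \<le> 2 * s \<Longrightarrow> open D \<Longrightarrow> D \<subseteq> U s \<Longrightarrow> 2 * q \<le> dist z0 x \<Longrightarrow>
    A.Hr D (indicator (closed_ball z0 s)) x \<le> ennreal (c3 * vr s) * Pd D x"
    by (rule landing_bound) blast
  obtain d where d: "1 \<le> d" "\<And>r s. 0 < r \<Longrightarrow> s \<le> 4 * r \<Longrightarrow> vr s \<le> d * vr r" using vr_shrink4 by blast
  define c where "c = c2 * (1 + c1 * d) + c1 * c3 * d"
  show ?thesis
  proof (rule that[of c])
    show "0 < c" using c1 c2 c3 d by (simp add: c_def add_pos_pos)
    fix r D and h :: "'a \<Rightarrow> ennreal" and x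
    assume r: "r0 \<le> r" and D: "open D" "D \<subseteq> U r" and h[measurable]: "h \<in> borel_measurable borel" and hfin: "\<And>z. h z < top"
      and harm: "\<And>z. h z = A.Hr D h z" and h0: "\<And>z. z \<notin> D \<Longrightarrow> z \<notin> closed_ball z0 r \<Longrightarrow> h z = 0"
      and x: "x \<in> D" "8 * r \<le> dist z0 x"
    have rp: "0 < r" using r r0 by simp
    note v = vr_pos[OF rp]
    define I where "I = (\<integral>\<^sup>+z. indicator (ball z0 (2 * a * r)) z * h z \<partial>m)"
    have bm[measurable]: "ball z0 t \<in> sets borel" for t by simp
    let ?M = "ennreal (c1 / vr r) * I"
    have mid: "h z \<le> ?M" if "2 * r < dist z0 z" "dist z0 z < 4 * r" for z
    proof (cases "z \<in> D")
      case True
      have "h z \<le> ennreal (c1 / vr r) * (\<integral>\<^sup>+z. indicator (ball z0 (2 * r)) z * h z \<partial>m)"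
        by (rule c1(2)[OF r D h hfin harm h0 True that])
      also have "\<dots> \<le> ?M"
        unfolding I_def using a rp
        by (intro mult_left_mono nn_integral_mono mult_right_mono) (auto split: split_indicator simp: less_le_trans)
      finally show ?thesis .
    next
      case False
      then have "h z = 0" using h0[of z] closed_ball_le[of z r] that rp by auto
      then show ?thesis by simp
    qed
    define D' where "D' = D \<inter> U (3 * r)"
    have D': "open D'" "D' \<subseteq> D" "D' \<subseteq> U (3 * r)" using D by (auto simp: D'_def)
    have xD: "x \<in> D'" using x rp dist_U[of "3 * r" x] by (simp add: D'_def)
    let ?u = "\<lambda>z. indicator {z. dist z0 z \<le> 5 / 2 * r} z * h z" and ?B = "indicator (closed_ball z0 (3 * r)) :: 'a \<Rightarrow> ennreal"
    have "h x = A.Hr D' h x" by (rule harmonic_restrict[OF D(1) D'(1,2) h harm])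
    also have "\<dots> \<le> A.Hr D' (\<lambda>z. ?u z + ?M * ?B z) x"
    proof (rule A.HK_mono[OF D'(1)])
      fix z assume z: "z \<notin> D'"
      show "h z \<le> ?u z + ?M * ?B z"
      proof (cases "dist z0 z \<le> 5 / 2 * r")
        case False
        show ?thesis
        proof (cases "z \<in> D")
          case True
          then have "z \<in> closed_ball z0 (3 * r)" using z by (simp add: D'_def)
          moreover from this have "dist z0 z \<le> 3 * r" by (rule closed_ball_le)
          ultimately show ?thesis using mid[of z] False rp by simp
        next
          case F: False
          then have "h z = 0" using h0[of z] closed_ball_le[of z r] False rp by auto
          then show ?thesis by simp
        qed
      qed simp
    qed
    also have "\<dots> = A.Hr D' ?u x + A.Hr D' (\<lambda>z. ?M * ?B z) x" by (rule A.HK_add) measurable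
    also have "A.Hr D' (\<lambda>z. ?M * ?B z) x = ?M * A.Hr D' ?B x" by (rule A.HK_cmult) measurable
    \<comment> \<open>The comparison radius 11r/4 lies above 5r/2, and (12/11)(11/4) = 3.\<close>
    also have "A.Hr D' ?u x \<le> ennreal c2 * Pd D' x * (\<integral>\<^sup>+z. ?u z \<partial>m)"
      using r rp r0 xD D' by (intro c2(2)[of "11 / 4 * r" "5 / 2 * r", THEN conjunct1]) auto
    \<comment> \<open>This is where |x| \<ge> 8r enters: s = 3r and q = 4r require 2q \<le>
      |x|.\<close>
    also have "A.Hr D' ?B x \<le> ennreal (c3 * vr (3 * r)) * Pd D' x"
      using r rp x D' by (intro c3(2)[of "3 * r" "4 * r"]) auto
    also have "Pd D' x \<le> Pd D x" by (rule Pd_mono[OF D(1) D'(1,2)])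
    also have "(\<integral>\<^sup>+z. ?u z \<partial>m) \<le> ennreal (1 + c1 * d) * I"
    proof -
      \<comment> \<open>Since a > 1, the points within 5r/2 that miss the ball of radius 2ar lie
        strictly between 2r and 4r, where the pointwise bound holds.\<close>
      have "(\<integral>\<^sup>+z. ?u z \<partial>m) \<le> (\<integral>\<^sup>+z. indicator (ball z0 (2 * a * r)) z * h z + ?M * indicator (ball z0 (4 * r)) z \<partial>m)"
      proof (rule nn_integral_mono)
        fix z
        have "2 * r < 2 * a * r" using a rp by simp
        then have "2 * r < dist z0 z" if "\<not> dist z0 z < 2 * a * r" using that by linarith
        then show "?u z \<le> indicator (ball z0 (2 * a * r)) z * h z + ?M * indicator (ball z0 (4 * r)) z"
          using mid[of z] rp by (cases "dist z0 z < 2 * a * r"; cases "dist z0 z \<le> 5 / 2 * r") auto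
      qed
      also have "\<dots> = I + (\<integral>\<^sup>+z. ?M * indicator (ball z0 (4 * r)) z \<partial>m)" unfolding I_def by (rule nn_integral_add) measurable
      also have "(\<integral>\<^sup>+z. ?M * indicator (ball z0 (4 * r)) z \<partial>m) = ?M * ennreal (vr (4 * r))"
        unfolding vol_eq[symmetric] by (rule nn_integral_cmult_indicator) (auto simp: A.sets_m)
      also have "\<dots> \<le> ennreal (c1 * d) * I"
      proof -
        have "c1 / vr r * vr (4 * r) \<le> c1 / vr r * (d * vr r)" using c1 v rp by (intro mult_left_mono d) auto
        then have "c1 / vr r * vr (4 * r) \<le> c1 * d" using v by simp
        then have "ennreal (c1 / vr r) * ennreal (vr (4 * r)) \<le> ennreal (c1 * d)"
          using c1 v by (subst ennreal_mult[symmetric]) (auto simp: vr_def intro: ennreal_leI)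
        then have "I * (ennreal (c1 / vr r) * ennreal (vr (4 * r))) \<le> I * ennreal (c1 * d)" by (rule mult_left_mono) simp
        then show ?thesis by (simp only: ac_simps)
      qed
      also have "I + ennreal (c1 * d) * I = ennreal (1 + c1 * d) * I"
        using c1 d by (simp add: distrib_right)
      finally show ?thesis by (simp add: add_left_mono)
    qed
    also have "ennreal (c3 * vr (3 * r)) \<le> ennreal (c3 * d * vr r)"
      using d(2)[OF rp, of "3 * r"] rp c3 by (intro ennreal_leI) (simp add: mult.assoc)
    also have "ennreal c2 * Pd D x * (ennreal (1 + c1 * d) * I) + ?M * (ennreal (c3 * d * vr r) * Pd D x) =
        (ennreal c2 * ennreal (1 + c1 * d) + ennreal (c1 / vr r) * ennreal (c3 * d * vr r)) * (Pd D x * I)"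
      by (simp only: algebra_simps)
    also have "ennreal c2 * ennreal (1 + c1 * d) + ennreal (c1 / vr r) * ennreal (c3 * d * vr r) = ennreal c"
    proof -
      have "ennreal c2 * ennreal (1 + c1 * d) = ennreal (c2 * (1 + c1 * d))"
        using c1 c2 d by (intro ennreal_mult[symmetric]) auto
      moreover have "ennreal (c1 / vr r) * ennreal (c3 * d * vr r) = ennreal (c1 * c3 * d)"
        using c1 c3 d v by (subst ennreal_mult[symmetric]) auto
      ultimately show ?thesis using c1 c2 c3 d by (simp add: c_def ennreal_plus[symmetric] del: ennreal_plus)
    qed
    finally show "h x \<le> ennreal c * Pd D x * (\<integral>\<^sup>+z. indicator (ball z0 (2 * a * r)) z * h z \<partial>m)"
      unfolding I_def[symmetric] by (simp add: mult_left_mono mult_right_mono add_mono mult.assoc)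
  qed
qed

text \<open>For the part \<open>D'\<close> of \<open>D\<close> beyond (a+2)r, the landing density
  bounds the mass of h on the ball of radius 2ar from below, as a < 2 leaves a gap. It remains to
  replace \<open>Pd D'\<close> by \<open>Pd D\<close>: the difference is the mean of
  \<open>Pd D\<close> at the exit from \<open>D'\<close>, and both its part within 2r and its part
  up to (a+2)r are at most a constant times \<open>Pd D' x\<close>.\<close>

lemma harmonic_lower:
  assumes a: "1 < a" "a < 2"
  obtains c where "0 < c" "\<And>r D h x. r0 \<le> r \<Longrightarrow> open D \<Longrightarrow> D \<subseteq> U r \<Longrightarrow> h \<in> borel_measurable borel \<Longrightarrow>
    (\<And>z. h z = A.Hr D h z) \<Longrightarrow> x \<in> D \<Longrightarrow> 8 * r \<le> dist z0 x \<Longrightarrow>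
    Pd D x * (\<integral>\<^sup>+z. indicator (ball z0 (2 * a * r)) z * h z \<partial>m) \<le> ennreal c * h x"
proof -
  \<comment> \<open>The comparison radius is the midpoint (3a+2)r/2 of 2ar and (a+2)r, and b is the
    ratio of (a+2)r to it.\<close>
  define b where "b = (2 * a + 4) / (3 * a + 2)"
  have b: "1 < b" "b \<le> 2" using a by (auto simp: b_def field_simps)
  obtain c1 where c1: "1 \<le> c1" "\<And>s t D u x. r0 \<le> s \<Longrightarrow> t < s \<Longrightarrow> open D \<Longrightarrow> D \<subseteq> U (b * s) \<Longrightarrow> x \<in> D \<Longrightarrow>
    u \<in> borel_measurable borel \<Longrightarrow> (\<And>z. t < dist z0 z \<Longrightarrow> u z = 0) \<Longrightarrow>
    A.Hr D u x \<le> ennreal c1 * Pd D x * (\<integral>\<^sup>+z. u z \<partial>m) \<and> Pd D x * (\<integral>\<^sup>+z. u z \<partial>m) \<le> ennreal c1 * A.Hr D u x"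
    by (rule levy_landing[OF b]) blast
  obtain c2 where c2: "0 < c2" "\<And>r D w. r0 \<le> r \<Longrightarrow> open D \<Longrightarrow> D \<subseteq> U r \<Longrightarrow> 2 * r < dist z0 w \<Longrightarrow> dist z0 w < 4 * r \<Longrightarrow>
    Pd D w \<le> ennreal (c2 / vr r)"
    using Pd_middle by blast
  obtain c3 where c3: "0 < c3" "\<And>s q D x. r0 \<le> s \<Longrightarrow> s < q \<Longrightarrow> q \<le> 2 * s \<Longrightarrow> open D \<Longrightarrow> D \<subseteq> U s \<Longrightarrow> 2 * q \<le> dist z0 x \<Longrightarrow>
    A.Hr D (indicator (closed_ball z0 s)) x \<le> ennreal (c3 * vr s) * Pd D x"
    by (rule landing_bound) blast
  obtain c4 where c4: "0 < c4" "\<And>r D. r0 \<le> r \<Longrightarrow> open D \<Longrightarrow> D \<subseteq> U r \<Longrightarrow>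
    (\<integral>\<^sup>+w. indicator {w. dist z0 w \<le> 2 * r} w * Pd D w \<partial>m) \<le> ennreal c4"
    using Pd_integral by blast
  obtain d where d: "1 \<le> d" "\<And>r s. 0 < r \<Longrightarrow> s \<le> 4 * r \<Longrightarrow> vr s \<le> d * vr r" using vr_shrink4 by blast
  define c where "c = 1 + c1 * c4 + c2 * c3 * d"
  have c: "0 < c" using c1 c2 c3 c4 d by (simp add: c_def add_pos_pos)
  show ?thesis
  proof (rule that[of "c * c1"])
    show "0 < c * c1" using c c1 by simp
    fix r D and h :: "'a \<Rightarrow> ennreal" and x
    assume r: "r0 \<le> r" and D: "open D" "D \<subseteq> U r" and h[measurable]: "h \<in> borel_measurable borel"
      and harm: "\<And>z. h z = A.Hr D h z" and x: "x \<in> D" "8 * r \<le> dist z0 x"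
    have rp: "0 < r" using r r0 by simp
    note v = vr_pos[OF rp]
    have bm[measurable]: "ball z0 t \<in> sets borel" for t by simp
    define s where "s = (3 * a + 2) / 2 * r"
    have bs: "b * s = (a + 2) * r" using a by (simp add: b_def s_def field_simps)
    have s: "r0 \<le> s" "2 * a * r < s" "2 * r < s"
    proof -
      have "1 * r < (3 * a + 2) / 2 * r" "2 * a * r < (3 * a + 2) / 2 * r" "2 * r < (3 * a + 2) / 2 * r"
        using a rp by (auto intro!: mult_strict_right_mono)
      then show "r0 \<le> s" "2 * a * r < s" "2 * r < s" using r by (auto simp: s_def)
    qed
    have q: "r0 \<le> (a + 2) * r" "(a + 2) * r < 4 * r" "4 * r \<le> 2 * ((a + 2) * r)"
    proof -
      have "1 * r < (a + 2) * r" "(a + 2) * r < 4 * r" "2 * r < (a + 2) * r" using a rp by (auto intro!: mult_strict_right_mono)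
      then show "r0 \<le> (a + 2) * r" "(a + 2) * r < 4 * r" "4 * r \<le> 2 * ((a + 2) * r)" using r by linarith+
    qed
    define D' where "D' = D \<inter> U ((a + 2) * r)"
    have D': "open D'" "D' \<subseteq> D" "D' \<subseteq> U ((a + 2) * r)" "D' \<subseteq> U (b * s)" using D by (auto simp: D'_def bs)
    have "(a + 2) * r < dist z0 x" using q(2) x(2) rp by linarith
    then have xD: "x \<in> D'" using x(1) dist_U[of "(a + 2) * r" x] by (simp add: D'_def)
    let ?u = "\<lambda>z. indicator {z. dist z0 z \<le> 2 * r} z * Pd D z" and ?B = "indicator (closed_ball z0 ((a + 2) * r)) :: 'a \<Rightarrow> ennreal"
    have [measurable]: "Pd D \<in> borel_measurable borel" unfolding Pd_def by measurable
    have "Pd D x = A.Gr D' J x + A.Hr D' (Pd D) x"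
      unfolding Pd_def by (rule A.GK_strong_markov[OF D(1) D'(1,2) A.rate0]) measurable
    also have "A.Gr D' J x = Pd D' x" by (simp add: Pd_def)
    also have "A.Hr D' (Pd D) x \<le> A.Hr D' (\<lambda>z. ?u z + ennreal (c2 / vr r) * ?B z) x"
    proof (rule A.HK_mono[OF D'(1)])
      fix z assume z: "z \<notin> D'"
      show "Pd D z \<le> ?u z + ennreal (c2 / vr r) * ?B z"
      proof (cases "z \<in> D \<and> 2 * r < dist z0 z")
        case True
        then have zB: "z \<in> closed_ball z0 ((a + 2) * r)" using z by (simp add: D'_def)
        then have "dist z0 z < 4 * r" using closed_ball_le[of z "(a + 2) * r"] q(2) by simp
        then have "Pd D z \<le> ennreal (c2 / vr r)" using True by (intro c2(2)[OF r D]) auto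
        then show ?thesis using zB by (simp add: add_increasing)
      next
        case False
        then show ?thesis using A.GK_outside[OF D(1), of z] by (auto simp: Pd_def)
      qed
    qed
    also have "\<dots> = A.Hr D' ?u x + A.Hr D' (\<lambda>z. ennreal (c2 / vr r) * ?B z) x" by (rule A.HK_add) measurable
    also have "A.Hr D' (\<lambda>z. ennreal (c2 / vr r) * ?B z) x = ennreal (c2 / vr r) * A.Hr D' ?B x" by (rule A.HK_cmult) measurable
    also have "A.Hr D' ?u x \<le> ennreal c1 * Pd D' x * (\<integral>\<^sup>+z. ?u z \<partial>m)"
      using s xD D' by (intro c1(2)[of s "2 * r", THEN conjunct1]) auto
    also have "(\<integral>\<^sup>+z. ?u z \<partial>m) \<le> ennreal c4" by (rule c4(2)[OF r D])
    also have "A.Hr D' ?B x \<le> ennreal (c3 * vr ((a + 2) * r)) * Pd D' x"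
      using q x D' by (intro c3(2)[of _ "4 * r"]) auto
    also have "ennreal (c3 * vr ((a + 2) * r)) \<le> ennreal (c3 * d * vr r)"
      using mult_left_mono[OF d(2)[OF rp less_imp_le[OF q(2)]], of c3] c3(1) by (intro ennreal_leI) (simp add: mult.assoc)
    also have "Pd D' x + (ennreal c1 * Pd D' x * ennreal c4 + ennreal (c2 / vr r) * (ennreal (c3 * d * vr r) * Pd D' x)) =
        (1 + (ennreal c1 * ennreal c4 + ennreal (c2 / vr r) * ennreal (c3 * d * vr r))) * Pd D' x"
      by (simp only: algebra_simps mult_1_left mult_1_right)
    also have "1 + (ennreal c1 * ennreal c4 + ennreal (c2 / vr r) * ennreal (c3 * d * vr r)) = ennreal c"
    proof -
      have "ennreal c1 * ennreal c4 = ennreal (c1 * c4)" using c1 c4 by (intro ennreal_mult[symmetric]) auto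
      moreover have "ennreal (c2 / vr r) * ennreal (c3 * d * vr r) = ennreal (c2 * c3 * d)"
        using c2 c3 d v by (subst ennreal_mult[symmetric]) auto
      ultimately show ?thesis using c1 c2 c3 c4 d
        by (simp add: c_def add.assoc)
    qed
    finally have P: "Pd D x \<le> ennreal c * Pd D' x" by (simp add: mult_left_mono mult_right_mono add_mono)
    let ?h = "\<lambda>z. indicator (ball z0 (2 * a * r)) z * h z"
    have "Pd D x * (\<integral>\<^sup>+z. ?h z \<partial>m) \<le> ennreal c * (Pd D' x * (\<integral>\<^sup>+z. ?h z \<partial>m))"
      using mult_right_mono[OF P, of "\<integral>\<^sup>+z. ?h z \<partial>m"] by (simp add: mult.assoc)
    also have "Pd D' x * (\<integral>\<^sup>+z. ?h z \<partial>m) \<le> ennreal c1 * A.Hr D' ?h x"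
      using s xD D' by (intro c1(2)[of s "2 * a * r", THEN conjunct2]) auto
    also have "A.Hr D' ?h x \<le> A.Hr D' h x" by (rule A.HK_mono[OF D'(1)]) (auto split: split_indicator)
    also have "A.Hr D' h x = h x" by (rule harmonic_restrict[OF D(1) D'(1,2) h harm, symmetric])
    finally show "Pd D x * (\<integral>\<^sup>+z. ?h z \<partial>m) \<le> ennreal (c * c1) * h x"
      using c c1 by (simp add: ennreal_mult mult_left_mono mult.assoc)
  qed
qed

lemma poisson_kernel_eq: "open D \<Longrightarrow> poisson_kernel m G j D x z0 = Pd D x"
  unfolding poisson_kernel_def Pd_def
  by (subst A.Gr_eq) (auto simp: A.G_outside mult.commute intro!: nn_integral_cong split: split_indicator)

end

section \<open>From the hypotheses to the two-sided estimate\<close>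

theorem theorem2p1:
  fixes m :: "'a::heine_borel measure"
    and X :: "('w, 'a) process" and X' :: "('v, 'a) process"
    and \<D> :: "('a \<Rightarrow> real) set"
    and j j' :: "'a \<Rightarrow> 'a \<Rightarrow> real"
    and G G' :: "'a set \<Rightarrow> 'a \<Rightarrow> 'a \<Rightarrow> ennreal"
    and \<Phi> :: "real \<Rightarrow> real" and z0 :: 'a and r0 :: real
  assumes "sets m = sets borel" and "sigma_finite_measure m" and "full_support m"
    and R0_infinite: "\<forall>x::'a. \<forall>r::real. - ball x (2 * r) \<noteq> {}"
    and "assumption_A m X X'"
    and "assumption_B m X X' \<D>"
    and "assumption_C m X X' j j'"
    and "green_functions m X X' G G'"
    and "conservative X" and "conservative X'"
    and "r0 > 0"
    and "assumption_V1 m z0"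
    and "assumption_V2 m z0 r0"
    and "assumption_Phi \<Phi>"
    and "assumption_B2a m X X' \<D> \<Phi> z0 r0"
    and "assumption_B2b m X X' \<D> j z0 r0"
    and "assumption_C2 m j j' \<Phi> z0 r0"
    and "assumption_D2 m G G' \<Phi> z0 r0"
  shows "\<forall>a. 1 < a \<and> a < 2 \<longrightarrow> (\<exists>C1>1. \<forall>r\<ge>r0. \<forall>D. \<forall>u :: 'a \<Rightarrow> real.
    open D \<and> D \<subseteq> - closed_ball z0 r \<and>
    u \<in> borel_measurable borel \<and> (\<forall>z. u z \<ge> 0) \<and>
    regular_harmonic X u D \<and>
    (\<forall>z \<in> - closed_ball z0 r \<inter> (- closure D \<union> regular_boundary X D). u z = 0) \<longrightarrow>
    (\<forall>x \<in> D \<inter> - closed_ball z0 (8 * r).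
       ennreal (inverse C1) * poisson_kernel m G j D x z0 * (\<integral>\<^sup>+z\<in>ball z0 (2 * a * r). ennreal (u z) \<partial>m)
         \<le> ennreal (u x) \<and>
       ennreal (u x)
         \<le> ennreal C1 * poisson_kernel m G j D x z0 * (\<integral>\<^sup>+z\<in>ball z0 (2 * a * r). ennreal (u z) \<partial>m)))"
proof (intro allI impI, goal_cases)
  case (1 a)
  then have a: "1 < a" "a < 2" by auto
  have "\<forall>x y. x \<noteq> y \<longrightarrow> j x y = j' y x \<and> j x y > 0"
    using assms(7) unfolding assumption_C_def by (elim conjE) assumption
  then have j: "x \<noteq> y \<Longrightarrow> j x y = j' y x" "x \<noteq> y \<Longrightarrow> 0 < j x y" for x y by blast+
  have jm: "case_prod j \<in> borel_measurable (borel \<Otimes>\<^sub>M borel)" "case_prod j' \<in> borel_measurable (borel \<Otimes>\<^sub>M borel)"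
    and jn: "0 \<le> j x y" "0 \<le> j' x y" and J: "levy_kernel X (\<lambda>x. density m (\<lambda>y. ennreal (j x y)))"
      "levy_kernel X' (\<lambda>x. density m (\<lambda>y. ennreal (j' x y)))" for x y
    using assms(7) unfolding assumption_C_def by blast+
  have \<D>: "\<D> \<subseteq> generator_domain C_zero X" "\<D> \<subseteq> generator_domain C_zero X'"
    "\<And>K D. compact K \<Longrightarrow> open D \<Longrightarrow> K \<subseteq> D \<Longrightarrow> test_functions m \<D> K D \<noteq> {}"
    using assms(6) unfolding assumption_B_def by blast+
  have X: "hunt_process X" "hunt_process X'" "feller X" "feller X'" and sf: "strong_feller X"
    and polar: "\<And>A. semipolar X A \<Longrightarrow> polar X A"
    using assms(5) unfolding assumption_A_def by blast+
  interpret A: jump_hunt X m j \<D> G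
  proof (intro jump_hunt.intro conservative_hunt.intro hunt.intro conservative_hunt_axioms.intro jump_hunt_axioms.intro)
    show "green_kernel m X D (G D)" if "open D" for D using assms(8) that by (simp add: green_functions_def)
  qed (fact X assms jm jn j J \<D>)+
  interpret B: jump_hunt X' m j' \<D> G'
  proof (intro jump_hunt.intro conservative_hunt.intro hunt.intro conservative_hunt_axioms.intro jump_hunt_axioms.intro)
    show "green_kernel m X' D (G' D)" if "open D" for D using assms(8) that by (simp add: green_functions_def)
    show "0 < j' x y" if "x \<noteq> y" for x y using j[of y x] that by simp
  qed (fact X assms jm jn j J \<D>)+
  interpret hunt_at_infinity X X' m j j' \<D> G G' \<Phi> z0 r0
  proof (intro_locales; (rule dual_hunt_axioms.intro hunt_at_infinity_axioms.intro)?)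
    show "G D x y = G' D y x" if "open D" for D x y using assms(8) that by (simp add: green_functions_def)
    show "- ball x (2 * r) \<noteq> {}" for x :: 'a and r :: real using R0_infinite by blast
  qed (fact assms j)+
  obtain c1 where c1: "0 < c1" "\<And>r D h x. r0 \<le> r \<Longrightarrow> open D \<Longrightarrow> D \<subseteq> U r \<Longrightarrow> h \<in> borel_measurable borel \<Longrightarrow>
    (\<And>z. h z < top) \<Longrightarrow> (\<And>z. h z = A.Hr D h z) \<Longrightarrow> (\<And>z. z \<notin> D \<Longrightarrow> z \<notin> closed_ball z0 r \<Longrightarrow> h z = 0) \<Longrightarrow>
    x \<in> D \<Longrightarrow> 8 * r \<le> dist z0 x \<Longrightarrow>
    h x \<le> ennreal c1 * Pd D x * (\<integral>\<^sup>+z. indicator (ball z0 (2 * a * r)) z * h z \<partial>m)"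
    by (rule harmonic_upper[OF a(1)]) blast
  obtain c2 where c2: "0 < c2" "\<And>r D h x. r0 \<le> r \<Longrightarrow> open D \<Longrightarrow> D \<subseteq> U r \<Longrightarrow> h \<in> borel_measurable borel \<Longrightarrow>
    (\<And>z. h z = A.Hr D h z) \<Longrightarrow> x \<in> D \<Longrightarrow> 8 * r \<le> dist z0 x \<Longrightarrow>
    Pd D x * (\<integral>\<^sup>+z. indicator (ball z0 (2 * a * r)) z * h z \<partial>m) \<le> ennreal c2 * h x"
    by (rule harmonic_lower[OF a]) blast
  define C where "C = 1 + c1 + c2"
  have C: "1 < C" "c1 \<le> C" "c2 \<le> C" using c1 c2 by (auto simp: C_def)
  show ?case
  proof (rule exI[of _ C], intro conjI allI impI ballI C(1); (elim conjE)?)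
    fix r D and u :: "'a \<Rightarrow> real" and x
    assume r: "r0 \<le> r" and x: "x \<in> D \<inter> - closed_ball z0 (8 * r)" and D: "open D" "D \<subseteq> - closed_ball z0 r"
      and um[measurable]: "u \<in> borel_measurable borel" and rh: "regular_harmonic X u D"
      and u0: "\<forall>z \<in> - closed_ball z0 r \<inter> (- closure D \<union> regular_boundary X D). u z = 0"
    define h where "h z = ennreal (u z)" for z
    have hm[measurable]: "h \<in> borel_measurable borel" unfolding h_def by measurable
    \<comment> \<open>The identity is extended to all points, as the estimates ask for it
      everywhere: off \<open>D\<close> the exit is at time 0.\<close>
    have harm: "h z = A.Hr D h z" for z
    proof (cases "z \<in> D")
      case True
      have "h z = (\<integral>\<^sup>+w. ext0 h (path X (exit_time X D w) w) \<partial>law X (Some z))"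
        using rh True by (auto simp: regular_harmonic_def h_def[abs_def])
      also have "\<dots> = A.Hr D h z"
        unfolding A.HK_def by (intro nn_integral_cong_AE eventually_mono[OF A.AE_exit_time[OF D(1) True]]) (simp add: A.exit_fun_def)
      finally show ?thesis .
    qed (simp add: A.HK_outside[OF D(1)])
    \<comment> \<open>\<open>u\<close> may be positive at irregular boundary points. The process does not hit them, so \<open>k\<close> is
      harmonic as well; the lower bound is for \<open>u\<close> itself.\<close>
    define k where "k z = indicator (D \<union> closed_ball z0 r) z * h z" for z
    have [measurable]: "D \<in> sets borel" using D by auto
    have km[measurable]: "k \<in> borel_measurable borel" unfolding k_def by measurable
    have k_harm: "k z = A.Hr D k z" for z
    proof (cases "z \<in> D")
      case True
      have "A.Hr D h z = A.Hr D k z"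
        unfolding A.HK_def
      proof (rule nn_integral_cong_AE)
        have regular: "AE w in law X (Some z). \<forall>y. path X (A.exit_at D w) w = Some y \<longrightarrow> y \<in> frontier D \<longrightarrow> y \<in> regular_boundary X D"
          by (rule A.AE_exit_regular[OF sf _ D(1) True]) (rule polar)
        show "AE w in law X (Some z). A.exit_fun (\<lambda>_. 0) D h w = A.exit_fun (\<lambda>_. 0) D k w"
          using regular A.AE_exit[OF D(1), of "Some z"]
        proof eventually_elim
          case (elim w)
          show ?case
          proof (cases "path X (A.exit_at D w) w")
            case (Some y)
            have "y \<notin> D" using elim Some by auto
            have "h y = k y"
            proof (cases "y \<in> closed_ball z0 r")
              case False
              have "y \<in> - closure D \<or> y \<in> regular_boundary X D"
                using elim(1) Some \<open>y \<notin> D\<close> D(1) by (auto simp: frontier_def interior_open)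
              then have "h y = 0" using u0 False by (auto simp: h_def)
              then show ?thesis by (simp add: k_def)
            qed (simp add: k_def)
            then show ?thesis using Some by (simp add: A.exit_fun_def)
          qed (simp add: A.exit_fun_def)
        qed
      qed
      then show ?thesis using harm[of z] True by (simp add: k_def)
    qed (simp add: A.HK_outside[OF D(1)])
    have x': "x \<in> D" "8 * r \<le> dist z0 x" using x U_dist[of x "8 * r"] by auto
    let ?I = "\<integral>\<^sup>+z\<in>ball z0 (2 * a * r). ennreal (u z) \<partial>m"
    have I: "?I = (\<integral>\<^sup>+z. indicator (ball z0 (2 * a * r)) z * h z \<partial>m)" by (simp add: h_def mult.commute)
    have "Pd D x * ?I \<le> ennreal c2 * h x" unfolding I by (rule c2(2)[OF r D hm harm x'])
    also have "\<dots> \<le> ennreal C * h x" using C by (intro mult_right_mono ennreal_leI) auto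
    finally have "ennreal (inverse C) * (Pd D x * ?I) \<le> ennreal (inverse C) * (ennreal C * h x)" by (rule mult_left_mono) simp
    also have "\<dots> = h x" using C by (simp add: mult.assoc[symmetric] ennreal_mult[symmetric])
    finally show "ennreal (inverse C) * poisson_kernel m G j D x z0 * ?I \<le> ennreal (u x)"
      by (simp add: poisson_kernel_eq[OF D(1)] mult.assoc h_def)
    have "h x = k x" using x' by (simp add: k_def)
    also have "\<dots> \<le> ennreal c1 * Pd D x * (\<integral>\<^sup>+z. indicator (ball z0 (2 * a * r)) z * k z \<partial>m)"
      by (rule c1(2)[OF r D km _ k_harm _ x']) (auto simp: k_def h_def split: split_indicator)
    also have "\<dots> \<le> ennreal C * Pd D x * ?I"
      unfolding I using C by (intro mult_mono nn_integral_mono ennreal_leI) (auto simp: k_def split: split_indicator)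
    finally show "ennreal (u x) \<le> ennreal C * poisson_kernel m G j D x z0 * ?I"
      by (simp add: poisson_kernel_eq[OF D(1)] h_def)
  qed
qed

end
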